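(* Let $d_L\geq4$. There is a constant $C_2$ depending only on $d_L$ such that for every $\epsilon>0$ there exist finite-dimensional Hilbert spaces $\mathcal{H}_{A_1},\mathcal{H}_{A_2},\mathcal{H}_{A_3}$ of dimensions $d_1,d_2,d_3$ carrying irreducible unitary representations $r_1,r_2,r_3$ of $U(d_L)$, and an isometry $V:\mathbb{C}^{d_L}\to\mathcal{H}_{A_1}\otimes\mathcal{H}_{A_2}\otimes\mathcal{H}_{A_3}$ with $VU=(r_1(U)\otimes r_2(U)\otimes r_3(U))V$ for all $U\in U(d_L)$, such that the code $\mathcal{E}(\cdot)=V(\cdot)V^\dagger$ has error $\epsilon_{\mathrm e}=\epsilon_{\mathrm e}(\mathcal{N}\circ\mathcal{E})\leq\epsilon$ and $$\max_i\ln d_i\leq d_L(d_L-1)\ln\!\left(\frac{1}{\epsilon_{\mathrm e}}\right)+C_2,$$ where $\mathcal{N}(\cdot)=\sum_{i=1}^3q_i|i\rangle\langle i|_C\otimes|\phi_i\rangle\langle\phi_i|_{A_i}\otimes\operatorname{tr}_{A_i}(\cdot)$ is the erasure of a single subsystem at a known location.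
   Context: Here $(q_1,q_2,q_3)$ is a probability distribution and $|\phi_i\rangle$ fixed states. Fidelity $F(\rho,\sigma)=\|\sqrt\rho\sqrt\sigma\|_1$; $|\hat\phi\rangle_{LR}=\sum_k|k\rangle|k\rangle/\sqrt{d_L}$ with $L=\mathbb{C}^{d_L}$, $R\cong L$. For a channel $\mathcal{M}$ from $L$ to $B$, $f_{\mathrm e}(\mathcal{M})=\max_{\mathcal{R}}F((\mathcal{R}\circ\mathcal{M}\otimes\mathrm{id}_R)(\hat\phi),\hat\phi)$ over channels $\mathcal{R}:B\to L$, and $\epsilon_{\mathrm e}(\mathcal{M})=\sqrt{1-f_{\mathrm e}^2(\mathcal{M})}$. *)

theory Defs
  imports "HOL-Analysis.Analysis" "Jordan_Normal_Form.Schur_Decomposition"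
begin

definition mtrace :: "complex mat \<Rightarrow> complex" where
  "mtrace A = (\<Sum>i<dim_row A. A $$ (i,i))"

definition unitary_mat :: "nat \<Rightarrow> complex mat \<Rightarrow> bool" where
  "unitary_mat n U \<longleftrightarrow> U \<in> carrier_mat n n \<and> mat_adjoint U * U = 1\<^sub>m n \<and> U * mat_adjoint U = 1\<^sub>m n"

definition unitary_group :: "nat \<Rightarrow> complex mat set" where
  "unitary_group n = {U. unitary_mat n U}"

definition isometry_mat :: "nat \<Rightarrow> nat \<Rightarrow> complex mat \<Rightarrow> bool" where
  "isometry_mat m n V \<longleftrightarrow> V \<in> carrier_mat m n \<and> mat_adjoint V * V = 1\<^sub>m n"

definition psd_mat :: "nat \<Rightarrow> complex mat \<Rightarrow> bool" where
  "psd_mat n A \<longleftrightarrow> A \<in> carrier_mat n n \<and> mat_adjoint A = A \<and>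
     (\<forall>v \<in> carrier_vec n. 0 \<le> Re (conjugate v \<bullet> (A *\<^sub>v v)))"

definition psd_sqrt :: "complex mat \<Rightarrow> complex mat" where
  "psd_sqrt A = (THE B. psd_mat (dim_row A) B \<and> B * B = A)"

definition trace_norm :: "complex mat \<Rightarrow> real" where
  "trace_norm A = Re (mtrace (psd_sqrt (mat_adjoint A * A)))"

definition fidelity :: "complex mat \<Rightarrow> complex mat \<Rightarrow> real" where
  "fidelity \<rho> \<sigma> = trace_norm (psd_sqrt \<rho> * psd_sqrt \<sigma>)"

definition kron :: "complex mat \<Rightarrow> complex mat \<Rightarrow> complex mat" where
  "kron A B = mat (dim_row A * dim_row B) (dim_col A * dim_col B)
     (\<lambda>(i,j). A $$ (i div dim_row B, j div dim_col B) * B $$ (i mod dim_row B, j mod dim_col B))"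

definition msum :: "nat \<Rightarrow> nat \<Rightarrow> nat \<Rightarrow> (nat \<Rightarrow> complex mat) \<Rightarrow> complex mat" where
  "msum n m k F = mat n m (\<lambda>(a,b). \<Sum>j<k. F j $$ (a,b))"

definition is_channel :: "nat \<Rightarrow> nat \<Rightarrow> (complex mat \<Rightarrow> complex mat) \<Rightarrow> bool" where
  "is_channel n m \<Phi> \<longleftrightarrow> (\<exists>k K. (\<forall>j<k. K j \<in> carrier_mat m n) \<and>
      msum n n k (\<lambda>j. mat_adjoint (K j) * K j) = 1\<^sub>m n \<and>
      (\<forall>\<rho> \<in> carrier_mat n n. \<Phi> \<rho> = msum m m k (\<lambda>j. K j * \<rho> * mat_adjoint (K j))))"

text \<open>\<open>(Phi \<otimes> id_k)(X)\<close> for a map Phi from n x n to m x m matrices, with the k-dimensional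
  reference system as the second tensor factor.\<close>
definition tensor_id :: "(complex mat \<Rightarrow> complex mat) \<Rightarrow> nat \<Rightarrow> nat \<Rightarrow> nat \<Rightarrow> complex mat \<Rightarrow> complex mat" where
  "tensor_id \<Phi> n m k X = mat (m*k) (m*k) (\<lambda>(p,q).
     \<Phi> (mat n n (\<lambda>(i,j). X $$ (i*k + p mod k, j*k + q mod k))) $$ (p div k, q div k))"

definition max_ent :: "nat \<Rightarrow> complex mat" where
  "max_ent d = mat (d*d) (d*d) (\<lambda>(p,q).
     if p div d = p mod d \<and> q div d = q mod d then 1 / of_nat d else 0)"

text \<open>Entanglement fidelity of a channel M from \<open>C^dL\<close> to \<open>C^dB\<close> (max over recovery channels,
  written as a supremum).\<close>
definition ent_fidelity :: "nat \<Rightarrow> nat \<Rightarrow> (complex mat \<Rightarrow> complex mat) \<Rightarrow> real" where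
  "ent_fidelity dL dB M = (SUP R \<in> {R. is_channel dB dL R}.
      fidelity (tensor_id (R \<circ> M) dL dL dL (max_ent dL)) (max_ent dL))"

definition ent_error :: "nat \<Rightarrow> nat \<Rightarrow> (complex mat \<Rightarrow> complex mat) \<Rightarrow> real" where
  "ent_error dL dB M = sqrt (1 - (ent_fidelity dL dB M)\<^sup>2)"

definition unitary_rep :: "nat \<Rightarrow> nat \<Rightarrow> (complex mat \<Rightarrow> complex mat) \<Rightarrow> bool" where
  "unitary_rep d n r \<longleftrightarrow>
     (\<forall>U \<in> unitary_group d. unitary_mat n (r U)) \<and>
     (\<forall>U \<in> unitary_group d. \<forall>W \<in> unitary_group d. r (U * W) = r U * r W) \<and>
     (\<forall>X U. (\<forall>k. X k \<in> unitary_group d) \<longrightarrow> U \<in> unitary_group d \<longrightarrow>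
        (\<forall>i<d. \<forall>j<d. (\<lambda>k. X k $$ (i,j)) \<longlonglongrightarrow> U $$ (i,j)) \<longrightarrow>
        (\<forall>i<n. \<forall>j<n. (\<lambda>k. r (X k) $$ (i,j)) \<longlonglongrightarrow> r U $$ (i,j)))"

definition irred_unitary_rep :: "nat \<Rightarrow> nat \<Rightarrow> (complex mat \<Rightarrow> complex mat) \<Rightarrow> bool" where
  "irred_unitary_rep d n r \<longleftrightarrow> unitary_rep d n r \<and> 0 < n \<and>
     (\<forall>W. W \<subseteq> carrier_vec n \<longrightarrow> 0\<^sub>v n \<in> W \<longrightarrow>
        (\<forall>v\<in>W. \<forall>w\<in>W. v + w \<in> W) \<longrightarrow> (\<forall>c. \<forall>v\<in>W. c \<cdot>\<^sub>v v \<in> W) \<longrightarrow>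
        (\<forall>U \<in> unitary_group d. \<forall>v\<in>W. r U *\<^sub>v v \<in> W) \<longrightarrow>
        W = {0\<^sub>v n} \<or> W = carrier_vec n)"

text \<open>Subsystems are indexed 0,1,2 (for A_1,A_2,A_3) with dimensions d 0, d 1, d 2;
  a basis index of \<open>A_1 \<otimes> A_2 \<otimes> A_3\<close> is (a0 * d 1 + a1) * d 2 + a2, consistent with
  kron (kron X0 X1) X2.\<close>
definition enc3 :: "(nat \<Rightarrow> nat) \<Rightarrow> (nat \<Rightarrow> nat) \<Rightarrow> nat" where
  "enc3 d a = (a 0 * d 1 + a 1) * d 2 + a 2"

definition dig3 :: "(nat \<Rightarrow> nat) \<Rightarrow> nat \<Rightarrow> nat \<Rightarrow> nat" where
  "dig3 d p i = (if i = 0 then p div (d 1 * d 2) else if i = 1 then (p div d 2) mod d 1 else p mod d 2)"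

definition setdig3 :: "(nat \<Rightarrow> nat) \<Rightarrow> nat \<Rightarrow> nat \<Rightarrow> nat \<Rightarrow> nat" where
  "setdig3 d i p k = enc3 d ((dig3 d p)(i := k))"

text \<open>\<open>|phi><phi|_{A_i} \<otimes> tr_{A_i}(X)\<close> (the other factors kept in place).\<close>
definition replace_sub :: "(nat \<Rightarrow> nat) \<Rightarrow> nat \<Rightarrow> complex vec \<Rightarrow> complex mat \<Rightarrow> complex mat" where
  "replace_sub d i \<phi> X = mat (d 0 * d 1 * d 2) (d 0 * d 1 * d 2) (\<lambda>(p,q).
     (\<phi> $ dig3 d p i * cnj (\<phi> $ dig3 d q i)) *
     (\<Sum>k<d i. X $$ (setdig3 d i p k, setdig3 d i q k)))"

text \<open>\<open>N(X) = \<Sum>_i q_i |i><i|_C \<otimes> |phi_i><phi_i|_{A_i} \<otimes> tr_{A_i}(X)\<close>, with C (dimension 3) as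
  first tensor factor.\<close>
definition erasure_noise :: "(nat \<Rightarrow> real) \<Rightarrow> (nat \<Rightarrow> nat) \<Rightarrow> (nat \<Rightarrow> complex vec) \<Rightarrow> complex mat \<Rightarrow> complex mat" where
  "erasure_noise q d \<phi> X = (let D = d 0 * d 1 * d 2 in
     mat (3 * D) (3 * D) (\<lambda>(p,p').
       if p div D = p' div D
       then complex_of_real (q (p div D)) * replace_sub d (p div D) (\<phi> (p div D)) X $$ (p mod D, p' mod D)
       else 0))"

definition unit_vector :: "nat \<Rightarrow> complex vec \<Rightarrow> bool" where
  "unit_vector n v \<longleftrightarrow> v \<in> carrier_vec n \<and> (\<Sum>k<n. (cmod (v $ k))\<^sup>2) = 1"

end

theory Submission
  imports Defs "Jordan_Normal_Form.Spectral_Radius" "HOL-Combinatorics.Multiset_Permutations"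
begin

text \<open>Let \<open>A_1 = A_2 = Sym^n\<close> and let \<open>A_3\<close> be the dual of \<open>Sym^(2n-1)\<close>. The code is spanned by the
  invariant tensors \<open>x_j (x \<sqdot> z)^(n-1) (y \<sqdot> z)^n\<close> plus \<open>\<omega>\<close> times the tensor with \<open>x\<close> and \<open>y\<close>
  exchanged. For \<open>|\<omega>| = 1\<close> and \<open>Re \<omega> = -(n-1)/n\<close> the state of \<open>A_3\<close> is exactly maximally mixed and
  independent of the encoded state, while the operators on \<open>L \<otimes> A_1\<close> and \<open>L \<otimes> A_2\<close> have norm at most
  \<open>1 + d_L (d_L + 1) / n\<close> times that of the maximally mixed state. Rescaled adjoints of these operators
  give a recovery with \<open>\<epsilon>_e\<^sup>2 \<le> d_L (d_L + 1) / n\<close>, and the dimensions grow like \<open>n^(d_L - 1)\<close>.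
  Since \<open>ln (1 / 0) = 0\<close> in the formal bound, one also needs \<open>\<epsilon>_e > 0\<close>: it follows from a nonzero
  off-diagonal entry of the operator on \<open>L \<otimes> A_1\<close> if \<open>q_1 > 0\<close>. If \<open>q_1 = 0\<close>, all information is put
  into \<open>A_1\<close>; then \<open>\<epsilon>_e = 0\<close> and the dimensions are at most \<open>d_L\<close>.\<close>

section \<open>Adjoints and diagonalization of Hermitian matrices\<close>

text \<open>Norm bounds alone decide the error: read the isometry as an operator T_i from L
  \<otimes> A_i to the two other subsystems. Its positive square has trace d_L on a space of
  dimension d_L d_i, so its norm is at least 1/d_i, with equality exactly when it is a multiple of
  the identity, that is when A_i is maximally mixed and uncorrelated with L. The excess over 1/d_i
  measures how far the erasure of A_i is from being correctable. Two tensors are used because each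
  alone gives a Gram matrix on A_3 that couples different logical states next to its scalar part.
  The cross terms contain the same coupling with a neighbouring binomial coefficient, so a
  superposition can cancel it. This fixes only the real part of the phase, and a unit \<omega> with
  that real part exists because the required ratio of the coefficients is below 1. The coupling on
  A_1 and A_2 then becomes almost a second difference of binomial coefficients, two orders in n
  below each of them; the norm of the coupling operator, of order n, takes back one of
  these.\<close>

lemma mat_mult_index:
  assumes "A \<in> carrier_mat m n" "B \<in> carrier_mat n k" "i < m" "j < k"
  shows "(A * B) $$ (i,j) = (\<Sum>l<n. A $$ (i,l) * B $$ (l,j))"
  using assms by (auto simp: scalar_prod_def lessThan_atLeast0)

lemma mult_mat_vec_index:
  assumes "A \<in> carrier_mat m n" "v \<in> carrier_vec n" "i < m"
  shows "(A *\<^sub>v v) $ i = (\<Sum>l<n. A $$ (i,l) * v $ l)"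
  using assms by (auto simp: scalar_prod_def lessThan_atLeast0)

lemma mat_adjoint_carrier [simp]: "A \<in> carrier_mat m n \<Longrightarrow> mat_adjoint A \<in> carrier_mat n m"
  unfolding mat_adjoint_def by auto

lemma dim_mat_adjoint [simp]: "dim_row (mat_adjoint A) = dim_col A" "dim_col (mat_adjoint A) = dim_row A"
  unfolding mat_adjoint_def by auto

lemma mat_adjoint_index [simp]:
  assumes "i < dim_col A" "j < dim_row A"
  shows "mat_adjoint (A :: complex mat) $$ (i,j) = cnj (A $$ (j,i))"
  using assms unfolding mat_adjoint_def by (auto simp: mat_of_rows_index)

lemma mat_adjoint_adjoint [simp]: "mat_adjoint (mat_adjoint A) = (A :: complex mat)"
  by (rule eq_matI) auto

lemma mat_adjoint_mult:
  assumes "A \<in> carrier_mat m n" "B \<in> carrier_mat n (k :: nat)"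
  shows "mat_adjoint (A * B :: complex mat) = mat_adjoint B * mat_adjoint A"
  using assms by (intro eq_matI) (auto simp: scalar_prod_def mult.commute)

lemma cnj_mult_self: "cnj z * z = complex_of_real ((cmod z)\<^sup>2)"
  by (subst mult.commute) (rule complex_norm_square[symmetric])

lemma quad_form_sum:
  assumes A: "A \<in> carrier_mat n n" and v: "v \<in> carrier_vec n"
  shows "conjugate v \<bullet> (A *\<^sub>v v) = (\<Sum>i<n. \<Sum>j<n. cnj (v $ i) * A $$ (i,j) * v $ j :: complex)"
proof -
  have "conjugate v \<bullet> (A *\<^sub>v v) = (\<Sum>i<n. cnj (v $ i) * (A *\<^sub>v v) $ i)"
    using carrier_matD[OF A] carrier_vecD[OF v]
    unfolding scalar_prod_def dim_mult_mat_vec atLeast0LessThan by (intro sum.cong) simp_all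
  also have "\<dots> = (\<Sum>i<n. \<Sum>j<n. cnj (v $ i) * A $$ (i,j) * v $ j)"
    by (intro sum.cong refl) (simp add: mult_mat_vec_index[OF A v] sum_distrib_left mult.assoc del: index_mult_mat_vec)
  finally show ?thesis .
qed

text \<open>Coordinate functions take the place of vectors here, so that positivity is checked and
  used by manipulating double sums.\<close>

lemma psd_matI:
  assumes "A \<in> carrier_mat n n"
    and "\<And>i j. i < n \<Longrightarrow> j < n \<Longrightarrow> A $$ (i,j) = cnj (A $$ (j,i))"
    and "\<And>v. 0 \<le> Re (\<Sum>i<n. \<Sum>j<n. cnj (v i) * A $$ (i,j) * v j)"
  shows "psd_mat n A"
proof -
  have "mat_adjoint A = A" using assms(1) assms(2)[symmetric] by (intro eq_matI) auto
  with assms(1) show ?thesis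
    unfolding psd_mat_def using quad_form_sum[OF assms(1)] assms(3) by simp
qed

lemma psd_matD:
  assumes "psd_mat n A"
  shows "A \<in> carrier_mat n n"
    and "\<And>i j. i < n \<Longrightarrow> j < n \<Longrightarrow> A $$ (i,j) = cnj (A $$ (j,i))"
    and "\<And>v. 0 \<le> Re (\<Sum>i<n. \<Sum>j<n. cnj (v i) * A $$ (i,j) * v j)"
proof -
  show A: "A \<in> carrier_mat n n" using assms unfolding psd_mat_def by auto
  show "A $$ (i,j) = cnj (A $$ (j,i))" if "i < n" "j < n" for i j
  proof -
    have "mat_adjoint A = A" using assms unfolding psd_mat_def by auto
    hence "A $$ (i,j) = mat_adjoint A $$ (i,j)" by simp
    with A that show ?thesis by simp
  qed
  show "0 \<le> Re (\<Sum>i<n. \<Sum>j<n. cnj (v i) * A $$ (i,j) * v j)" for v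
  proof -
    have "vec n v \<in> carrier_vec n" by simp
    with assms have "0 \<le> Re (conjugate (vec n v) \<bullet> (A *\<^sub>v vec n v))"
      unfolding psd_mat_def by blast
    also have "conjugate (vec n v) \<bullet> (A *\<^sub>v vec n v) = (\<Sum>i<n. \<Sum>j<n. cnj (v i) * A $$ (i,j) * v j)"
      by (subst quad_form_sum[OF A]) auto
    finally show ?thesis .
  qed
qed

lemma psd_mat_mult_adjoint:
  assumes "B \<in> carrier_mat m n"
  shows "psd_mat n (mat_adjoint B * B)"
proof (rule psd_matI)
  show "mat_adjoint B * B \<in> carrier_mat n n" using assms by auto
  have e: "(mat_adjoint B * B) $$ (i,j) = (\<Sum>l<m. cnj (B $$ (l,i)) * B $$ (l,j))"
    if "i < n" "j < n" for i j
    using that assms by (subst mat_mult_index[of _ n m _ n]) auto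
  show "(mat_adjoint B * B) $$ (i,j) = cnj ((mat_adjoint B * B) $$ (j,i))" if "i < n" "j < n" for i j
    using that by (simp add: e mult.commute)
  fix v
  have "(\<Sum>i<n. \<Sum>j<n. cnj (v i) * (mat_adjoint B * B) $$ (i,j) * v j)
      = (\<Sum>i<n. \<Sum>j<n. \<Sum>l<m. cnj (v i) * cnj (B $$ (l,i)) * B $$ (l,j) * v j)"
    by (simp add: e sum_distrib_left sum_distrib_right mult.assoc)
  also have "\<dots> = (\<Sum>l<m. \<Sum>i<n. \<Sum>j<n. cnj (v i) * cnj (B $$ (l,i)) * B $$ (l,j) * v j)"
    by (subst (2) sum.swap, subst (1) sum.swap, rule refl)
  also have "\<dots> = (\<Sum>l<m. cnj (\<Sum>i<n. B $$ (l,i) * v i) * (\<Sum>i<n. B $$ (l,i) * v i))"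
    by (simp add: sum_product ac_simps, subst sum.swap, simp add: ac_simps)
  also have "\<dots> = of_real (\<Sum>l<m. (cmod (\<Sum>i<n. B $$ (l,i) * v i))\<^sup>2)"
    by (simp only: cnj_mult_self of_real_sum)
  finally show "0 \<le> Re (\<Sum>i<n. \<Sum>j<n. cnj (v i) * (mat_adjoint B * B) $$ (i,j) * v j)"
    by (simp add: sum_nonneg)
qed

lemma conj_unitary_eqI:
  assumes "unitary_mat n W" "A \<in> carrier_mat n n" "A' = mat_adjoint W * A * W"
  shows "A = W * A' * mat_adjoint W"
proof -
  have W: "W \<in> carrier_mat n n" "mat_adjoint W \<in> carrier_mat n n" "W * mat_adjoint W = 1\<^sub>m n"
    using assms(1) unfolding unitary_mat_def by auto
  note assoc = assoc_mult_mat[of _ n n _ n _ n] mult_carrier_mat[of _ n n _ n]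
  have "W * (mat_adjoint W * A * W) * mat_adjoint W = (W * mat_adjoint W) * A * (W * mat_adjoint W)"
    using W(1,2) assms(2) by (simp add: assoc)
  also have "\<dots> = A" unfolding W(3) using assms(2) by simp
  finally show ?thesis unfolding assms(3) by simp
qed

text \<open>Complete v to a basis with v in front, orthogonalize, which leaves the first vector
  unchanged, and rescale. The scalar c is the normalization of v.\<close>

lemma unitary_first_column:
  assumes v: "v \<in> carrier_vec n" "v \<noteq> 0\<^sub>v n"
  obtains W c where "unitary_mat n W" "0 < n" "c \<noteq> 0" "col W 0 = (c :: complex) \<cdot>\<^sub>v v"
proof -
  interpret cof_vec_space n "TYPE(complex)" .
  define b where "b = basis_completion v"
  define ws where "ws = gram_schmidt n b"
  from basis_completion[OF v, folded b_def]
  have dist_b: "distinct b" and indep: "\<not> lin_dep (set b)" and b: "set b \<subseteq> carrier_vec n"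
    and hdb: "hd b = v" and len_b: "length b = n" by auto
  have n: "0 < n" using v by (cases n) auto
  from hdb len_b n obtain vs where bv: "b = v # vs" by (cases b) auto
  from gram_schmidt_result[OF b dist_b indep refl, folded ws_def]
  have ws: "set ws \<subseteq> carrier_vec n" "corthogonal ws" "length ws = n" by (auto simp: len_b)
  from gram_schmidt_hd[OF v(1), of vs, folded bv] have hdws: "hd ws = v" unfolding ws_def .
  \<comment> \<open>The squared norm is so far only a complex number; that it is real and positive
    is shown below, hence \<open>csqrt\<close>.\<close>
  define c where "c i = 1 / csqrt (ws ! i \<bullet>c ws ! i)" for i
  have wsn: "ws ! i \<in> carrier_vec n" if "i < n" for i using ws that by auto
  have nz: "ws ! i \<bullet>c ws ! i \<noteq> 0" if "i < n" for i
    using corthogonalD[OF ws(2)] that ws(3) by auto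
  define W where "W = mat n n (\<lambda>(i,j). c j * ws ! j $ i)"
  have W: "W \<in> carrier_mat n n" unfolding W_def by simp
  have WW: "mat_adjoint W * W = 1\<^sub>m n"
  proof (rule eq_matI)
    fix i j assume "i < dim_row (1\<^sub>m n :: complex mat)" "j < dim_col (1\<^sub>m n :: complex mat)"
    hence ij: "i < n" "j < n" by auto
    have sp: "ws ! j \<bullet>c ws ! i = (\<Sum>l<n. ws ! j $ l * cnj (ws ! i $ l))"
      using wsn[OF ij(1)] wsn[OF ij(2)] by (auto simp: scalar_prod_def lessThan_atLeast0)
    have "(mat_adjoint W * W) $$ (i,j) = (\<Sum>l<n. cnj (c i * ws ! i $ l) * (c j * ws ! j $ l))"
      using ij by (subst mat_mult_index[of _ n n _ n]) (auto simp: W_def)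
    also have "\<dots> = cnj (c i) * c j * (ws ! j \<bullet>c ws ! i)"
      unfolding sp sum_distrib_left by (simp add: ac_simps)
    also have "\<dots> = (if i = j then 1 else 0)"
    proof (cases "i = j")
      case True
      define s where "s = ws ! j \<bullet>c ws ! j"
      have "s = of_real (\<Sum>l<n. (cmod (ws ! j $ l))\<^sup>2)"
        unfolding s_def using sp[unfolded True] by (simp only: complex_norm_square[symmetric] of_real_sum)
      moreover have "(\<Sum>l<n. (cmod (ws ! j $ l))\<^sup>2) \<ge> 0" by (simp add: sum_nonneg)
      ultimately obtain t where t: "s = of_real t" "t \<ge> 0" by blast
      have "s \<noteq> 0" using nz ij s_def by auto
      hence "t > 0" using t by auto
      have "c j = of_real (1 / sqrt t)" unfolding c_def s_def[symmetric] t(1) 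
        using t(2) by (simp add: csqrt_of_real_nonneg)
      hence "cnj (c j) * c j * s = of_real (1 / sqrt t * (1 / sqrt t) * t)" unfolding t(1)
        by (simp only: complex_cnj_complex_of_real of_real_mult)
      also have "1 / sqrt t * (1 / sqrt t) * t = 1" using \<open>t > 0\<close> by (simp add: field_simps)
      finally show ?thesis using True s_def by simp
    next
      case False
      hence "ws ! j \<bullet>c ws ! i = 0" using corthogonalD[OF ws(2)] ij ws(3) by auto
      with False show ?thesis by simp
    qed
    finally show "(mat_adjoint W * W) $$ (i,j) = 1\<^sub>m n $$ (i,j)" using ij by simp
  qed (use W in auto)
  have "W * mat_adjoint W = 1\<^sub>m n"
    using mat_mult_left_right_inverse[OF mat_adjoint_carrier[OF W] W WW] .
  hence "unitary_mat n W" unfolding unitary_mat_def using W WW by auto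
  moreover have "ws ! 0 = v" using hdws ws(3) n by (cases ws) auto
  hence "col W 0 = c 0 \<cdot>\<^sub>v v" using v n unfolding W_def by (intro eq_vecI) auto
  moreover have "c 0 \<noteq> 0" unfolding c_def using nz[OF n] by simp
  ultimately show thesis using that n by blast
qed

lemma four_block_unitary:
  assumes "unitary_mat n U"
  shows "unitary_mat (1 + n) (four_block_mat (1\<^sub>m 1) (0\<^sub>m 1 n) (0\<^sub>m n 1) U)"
proof -
  let ?F = "four_block_mat (1\<^sub>m 1) (0\<^sub>m 1 n) (0\<^sub>m n 1)"
  have U: "U \<in> carrier_mat n n" "mat_adjoint U \<in> carrier_mat n n"
    "mat_adjoint U * U = 1\<^sub>m n" "U * mat_adjoint U = 1\<^sub>m n"
    using assms unfolding unitary_mat_def by auto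
  have F: "?F A * ?F B = ?F (A * B)" if "A \<in> carrier_mat n n" "B \<in> carrier_mat n n" for A B :: "complex mat"
    using that by (subst mult_four_block_mat[of _ 1 1 _ n _ n _ _ 1 _ n]) auto
  have one: "?F (1\<^sub>m n) = 1\<^sub>m (1 + n)" by (rule eq_matI) auto
  have adj: "mat_adjoint (?F U) = ?F (mat_adjoint U)" using U(1) by (intro eq_matI) auto
  show ?thesis unfolding unitary_mat_def adj F[OF U(1,2)] F[OF U(2,1)] U(3,4) one using U(1)
    by auto
qed

lemma unitary_mat_mult:
  assumes "unitary_mat n U" "unitary_mat n W"
  shows "unitary_mat n (U * W)"
proof -
  have U: "U \<in> carrier_mat n n" "mat_adjoint U \<in> carrier_mat n n"
    "mat_adjoint U * U = 1\<^sub>m n" "U * mat_adjoint U = 1\<^sub>m n"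
    using assms unfolding unitary_mat_def by auto
  have W: "W \<in> carrier_mat n n" "mat_adjoint W \<in> carrier_mat n n"
    "mat_adjoint W * W = 1\<^sub>m n" "W * mat_adjoint W = 1\<^sub>m n"
    using assms unfolding unitary_mat_def by auto
  have adj: "mat_adjoint (U * W) = mat_adjoint W * mat_adjoint U"
    by (rule mat_adjoint_mult[OF U(1) W(1)])
  note assoc = assoc_mult_mat[of _ n n _ n _ n] mult_carrier_mat[of _ n n _ n]
  have "mat_adjoint W * mat_adjoint U * (U * W) = mat_adjoint W * (mat_adjoint U * U) * W"
    using U(1,2) W(1,2) by (simp add: assoc)
  moreover have "U * W * (mat_adjoint W * mat_adjoint U) = U * (W * mat_adjoint W) * mat_adjoint U"
    using U(1,2) W(1,2) by (simp add: assoc)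
  ultimately show ?thesis unfolding unitary_mat_def adj using U W by auto
qed

text \<open>Deflation: conjugating by a unitary whose first column is an eigenvector splits off a
  block of size 1, and the induction hypothesis handles the remaining block.\<close>

theorem hermitian_diagonalization:
  assumes "A \<in> carrier_mat n n" "mat_adjoint A = A"
  shows "\<exists>U D. unitary_mat n U \<and> D \<in> carrier_mat n n \<and> diagonal_mat D \<and> A = U * D * mat_adjoint (U :: complex mat)"
  using assms
proof (induction n arbitrary: A)
  case 0
  thus ?case
    by (intro exI[of _ "1\<^sub>m 0"] exI[of _ "A"]) (auto simp: unitary_mat_def diagonal_mat_def)
next
  case (Suc n)
  let ?n = "Suc n"
  note A = Suc.prems(1)
  from spectrum_non_empty[OF A] obtain l v where "eigenvector A v l"
    unfolding spectrum_def eigenvalue_def by auto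
  hence v: "v \<in> carrier_vec ?n" "v \<noteq> 0\<^sub>v ?n" "A *\<^sub>v v = l \<cdot>\<^sub>v v" using A unfolding eigenvector_def by auto
  obtain W c where W: "unitary_mat ?n W" and c: "c \<noteq> 0" "col W 0 = c \<cdot>\<^sub>v v"
    using unitary_first_column[OF v(1,2)] by metis
  have Wc: "W \<in> carrier_mat ?n ?n" "mat_adjoint W \<in> carrier_mat ?n ?n" "mat_adjoint W * W = 1\<^sub>m ?n"
    using W unfolding unitary_mat_def by auto
  define A' where "A' = mat_adjoint W * A * W"
  have A'c: "A' \<in> carrier_mat ?n ?n" unfolding A'_def using A Wc by auto
  note assoc = assoc_mult_mat[of _ ?n ?n _ ?n _ ?n] mult_carrier_mat[of _ ?n ?n _ ?n]
  have "mat_adjoint A' = mat_adjoint W * mat_adjoint (mat_adjoint W * A)"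
    unfolding A'_def using A Wc by (intro mat_adjoint_mult) auto
  also have "mat_adjoint (mat_adjoint W * A) = A * W"
    using mat_adjoint_mult[OF Wc(2) A] Suc.prems(2) by simp
  also have "mat_adjoint W * (A * W) = A'" unfolding A'_def using A Wc by (simp add: assoc)
  finally have A'h: "mat_adjoint A' = A'" .
  have A'sym: "A' $$ (i,j) = cnj (A' $$ (j,i))" if "i < ?n" "j < ?n" for i j
    by (metis A'h A'c carrier_matD mat_adjoint_index that)
  have "A' = mat_adjoint W * (A * W)" unfolding A'_def using A Wc(1,2) by (simp add: assoc)
  hence "col A' 0 = mat_adjoint W *\<^sub>v (A *\<^sub>v col W 0)"
    using col_mult2[OF Wc(2) mult_carrier_mat[OF A Wc(1)]] col_mult2[OF A Wc(1)] by simp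
  also have "A *\<^sub>v col W 0 = l \<cdot>\<^sub>v col W 0"
    unfolding c(2) mult_mat_vec[OF A v(1)] v(3) by (simp add: smult_smult_assoc mult.commute[of c l])
  also have "mat_adjoint W *\<^sub>v (l \<cdot>\<^sub>v col W 0) = l \<cdot>\<^sub>v col (mat_adjoint W * W) 0"
    using mult_mat_vec[OF Wc(2) col_carrier_vec[OF _ Wc(1)]] col_mult2[OF Wc(2,1)] by simp
  finally have col0: "col A' 0 = l \<cdot>\<^sub>v col (1\<^sub>m ?n) 0" using Wc by simp
  have z1: "A' $$ (i,0) = 0" if "i < ?n" "i \<noteq> 0" for i
    using arg_cong[OF col0, of "\<lambda>v. v $ i"] that A'c by auto
  \<comment> \<open>Hermiticity transfers the zeros of the first column to the first row, so the
    matrix becomes block diagonal and not just block triangular.\<close>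
  have z2: "A' $$ (0,i) = 0" if "i < ?n" "i \<noteq> 0" for i
    using A'sym[of 0 i] z1 that by auto
  define A3 where "A3 = mat n n (\<lambda>(i,j). A' $$ (Suc i, Suc j))"
  have "A3 \<in> carrier_mat n n" "mat_adjoint A3 = A3"
    unfolding A3_def using A'sym[symmetric] by (auto intro!: eq_matI)
  from Suc.IH[OF this] obtain U D where UD: "unitary_mat n U" "D \<in> carrier_mat n n" "diagonal_mat D"
    "A3 = U * D * mat_adjoint U" by blast
  have U: "U \<in> carrier_mat n n" "mat_adjoint U \<in> carrier_mat n n" using UD unfolding unitary_mat_def by auto
  let ?F = "\<lambda>a. four_block_mat (a :: complex mat) (0\<^sub>m 1 n) (0\<^sub>m n 1)"
  define a0 where "a0 = A' $$ (0,0)"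
  let ?a = "mat 1 1 (\<lambda>_. a0)"
  have A'F: "A' = ?F ?a A3"
    using A'c z1 z2 unfolding A3_def a0_def by (intro eq_matI) auto
  have F: "?F a A * ?F b B = ?F (a * b) (A * B)" if "a \<in> carrier_mat 1 1" "b \<in> carrier_mat 1 1"
    "A \<in> carrier_mat n n" "B \<in> carrier_mat n n" for a b A B :: "complex mat"
    using that by (subst mult_four_block_mat[of _ 1 1 _ n _ n _ _ 1 _ n]) auto
  have adj: "mat_adjoint (?F (1\<^sub>m 1) U) = ?F (1\<^sub>m 1) (mat_adjoint U)" using U(1) by (intro eq_matI) auto
  let ?U = "?F (1\<^sub>m 1) U" and ?D = "?F ?a D"
  have c1: "?U \<in> carrier_mat ?n ?n" "?D \<in> carrier_mat ?n ?n" "mat_adjoint ?U \<in> carrier_mat ?n ?n"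
    using U UD(2) by auto
  have a: "?a \<in> carrier_mat 1 1" "1\<^sub>m 1 * ?a = ?a" "?a * 1\<^sub>m 1 = ?a" by auto
  have "?U * ?D = ?F ?a (U * D)"
    using F[OF one_carrier_mat a(1) U(1) UD(2)] a(2) by simp
  hence "?U * ?D * mat_adjoint ?U = A'"
    using F[OF a(1) one_carrier_mat mult_carrier_mat[OF U(1) UD(2)] U(2)] a(3)
    unfolding adj A'F UD(4) by simp
  hence "A = W * (?U * ?D * mat_adjoint ?U) * mat_adjoint W"
    using conj_unitary_eqI[OF W A A'_def] by simp
  also have "\<dots> = (W * ?U) * ?D * (mat_adjoint ?U * mat_adjoint W)"
    using c1 Wc(1,2) by (simp add: assoc del: four_block_carrier_mat)
  also have "mat_adjoint ?U * mat_adjoint W = mat_adjoint (W * ?U)"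
    using mat_adjoint_mult[OF Wc(1) c1(1)] by simp
  finally have "A = (W * ?U) * ?D * mat_adjoint (W * ?U)" .
  moreover have "unitary_mat ?n (W * ?U)"
    using unitary_mat_mult[OF W] four_block_unitary[OF UD(1)] by simp
  moreover have "diagonal_mat ?D" using UD(2,3) unfolding diagonal_mat_def by auto
  ultimately show ?case using c1(2) by blast
qed

section \<open>Square roots and fidelity\<close>

lemma mtrace_mult_comm:
  assumes "A \<in> carrier_mat m n" "B \<in> carrier_mat n m"
  shows "mtrace (A * B) = mtrace (B * A)"
proof -
  have "mtrace (A * B) = (\<Sum>i<m. \<Sum>l<n. A $$ (i,l) * B $$ (l,i))"
    unfolding mtrace_def using assms by (auto simp: mat_mult_index[of _ m n _ m] simp del: index_mult_mat(1) intro!: sum.cong)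
  also have "\<dots> = (\<Sum>l<n. \<Sum>i<m. B $$ (l,i) * A $$ (i,l))"
    by (subst sum.swap) (simp add: mult.commute)
  also have "\<dots> = mtrace (B * A)"
    unfolding mtrace_def using assms by (auto simp: mat_mult_index[of _ n m _ n] simp del: index_mult_mat(1) intro!: sum.cong)
  finally show ?thesis .
qed

lemma mtrace_adjoint_mult:
  assumes "X \<in> carrier_mat m n"
  shows "mtrace (mat_adjoint X * X) = of_real (\<Sum>i<n. \<Sum>l<m. (cmod (X $$ (l,i)))\<^sup>2)"
proof -
  have "mtrace (mat_adjoint X * X) = (\<Sum>i<n. \<Sum>l<m. cnj (X $$ (l,i)) * X $$ (l,i))"
    unfolding mtrace_def using assms
    by (auto simp: mat_mult_index[of _ n m _ n] simp del: index_mult_mat(1) intro!: sum.cong)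
  also have "\<dots> = of_real (\<Sum>i<n. \<Sum>l<m. (cmod (X $$ (l,i)))\<^sup>2)"
    by (simp only: cnj_mult_self of_real_sum)
  finally show ?thesis .
qed

lemma frobenius_eq_0D:
  assumes "X \<in> carrier_mat m n" "(\<Sum>i<n. \<Sum>l<m. (cmod (X $$ (l,i)))\<^sup>2) = 0"
  shows "X = 0\<^sub>m m n"
proof (rule eq_matI)
  fix l i assume "l < dim_row (0\<^sub>m m n :: complex mat)" "i < dim_col (0\<^sub>m m n :: complex mat)"
  hence li: "l < m" "i < n" by auto
  from assms(2) have "(\<Sum>l<m. (cmod (X $$ (l,i)))\<^sup>2) = 0"
    using li by (subst (asm) sum_nonneg_eq_0_iff) (auto intro: sum_nonneg)
  hence "(cmod (X $$ (l,i)))\<^sup>2 = 0" using li by (subst (asm) sum_nonneg_eq_0_iff) auto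
  thus "X $$ (l,i) = 0\<^sub>m m n $$ (l,i)" using li by simp
qed (use assms in auto)

lemma of_real_sqrt_mult_self: "0 \<le> a \<Longrightarrow> complex_of_real (sqrt a) * complex_of_real (sqrt a) = of_real a"
  by (simp flip: of_real_mult)

lemma psd_sqrt_exists:
  assumes "psd_mat n A"
  shows "\<exists>B. psd_mat n B \<and> B * B = A"
proof -
  have A: "A \<in> carrier_mat n n" "mat_adjoint A = A" using assms unfolding psd_mat_def by auto
  obtain U D where U: "unitary_mat n U" and D: "D \<in> carrier_mat n n" "diagonal_mat D"
    and eq: "A = U * D * mat_adjoint U"
    using hermitian_diagonalization[OF A] by blast
  have Uc: "U \<in> carrier_mat n n" "mat_adjoint U \<in> carrier_mat n n" "mat_adjoint U * U = 1\<^sub>m n"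
    using U unfolding unitary_mat_def by auto
  note assoc = assoc_mult_mat[of _ n n _ n _ n] mult_carrier_mat[of _ n n _ n]
  have Deq: "D = mat_adjoint U * A * U"
  proof -
    have "mat_adjoint U * (U * D * mat_adjoint U) * U = (mat_adjoint U * U) * D * (mat_adjoint U * U)"
      using Uc(1,2) D(1) by (simp add: assoc)
    thus ?thesis unfolding eq Uc(3) using D by simp
  qed
  define r where "r i = Re (D $$ (i,i))" for i
  have Dii: "D $$ (i,i) = of_real (r i) \<and> 0 \<le> r i" if "i < n" for i
  proof -
    have "D $$ (i,i) = (\<Sum>k<n. mat_adjoint U $$ (i,k) * (A * U) $$ (k,i))"
      unfolding Deq using that Uc A
      by (simp add: assoc mat_mult_index[of _ n n _ n] del: index_mult_mat(1))
    also have "\<dots> = (\<Sum>k<n. \<Sum>l<n. cnj (U $$ (k,i)) * A $$ (k,l) * U $$ (l,i))"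
      using that Uc A
      by (simp add: mat_mult_index[of _ n n _ n] sum_distrib_left mult.assoc del: index_mult_mat(1))
    finally have e: "D $$ (i,i) = (\<Sum>k<n. \<Sum>l<n. cnj (U $$ (k,i)) * A $$ (k,l) * U $$ (l,i))" .
    have "cnj (D $$ (i,i)) = D $$ (i,i)"
      unfolding e cnj_sum
      by (subst sum.swap) (auto simp: psd_matD(2)[OF assms, symmetric] intro!: sum.cong)
    hence "D $$ (i,i) = of_real (r i)" unfolding r_def by (simp add: complex_eq_iff)
    moreover have "0 \<le> r i" unfolding r_def e by (rule psd_matD(3)[OF assms])
    ultimately show ?thesis by blast
  qed
  \<comment> \<open>Fourth roots of the eigenvalues: the square root of A is then the adjoint of C
    times C for C = Q times the adjoint of U, and its positivity needs no further argument.\<close>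
  define Q where "Q = mat n n (\<lambda>(i,j). if i = j then of_real (sqrt (sqrt (r i))) else 0 :: complex)"
  have Q: "Q \<in> carrier_mat n n" "mat_adjoint Q = Q" unfolding Q_def by (auto intro!: eq_matI)
  have QQ: "Q * Q = mat n n (\<lambda>(i,j). if i = j then of_real (sqrt (r i)) else 0)"
  proof (rule eq_matI)
    fix i j assume "i < dim_row (mat n n (\<lambda>(i,j). if i = j then complex_of_real (sqrt (r i)) else 0))"
      "j < dim_col (mat n n (\<lambda>(i,j). if i = j then complex_of_real (sqrt (r i)) else 0))"
    hence ij: "i < n" "j < n" by auto
    have "(Q * Q) $$ (i,j) = (\<Sum>l<n. if l = i then (if i = j then of_real (sqrt (sqrt (r i))) * of_real (sqrt (sqrt (r i))) else 0) else 0)"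
      unfolding mat_mult_index[OF Q(1) Q(1) ij] using ij by (intro sum.cong) (auto simp: Q_def)
    also have "\<dots> = (if i = j then of_real (sqrt (r i)) else 0)" using ij Dii[of i] by (auto simp: of_real_sqrt_mult_self)
    finally show "(Q * Q) $$ (i,j) = mat n n (\<lambda>(i,j). if i = j then complex_of_real (sqrt (r i)) else 0) $$ (i,j)"
      using ij by simp
  qed (use Q in auto)
  have QQc: "Q * Q \<in> carrier_mat n n" using Q by auto
  have QQQQ: "Q * Q * (Q * Q) = D"
  proof (rule eq_matI)
    fix i j assume "i < dim_row D" "j < dim_col D"
    hence ij: "i < n" "j < n" using D by auto
    have "(Q * Q * (Q * Q)) $$ (i,j) = (\<Sum>l<n. if l = i then (if i = j then of_real (sqrt (r i)) * of_real (sqrt (r i)) else 0) else 0)"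
      unfolding mat_mult_index[OF QQc QQc ij] using ij unfolding QQ by (intro sum.cong) auto
    also have "\<dots> = D $$ (i,j)" using ij Dii[of i] D unfolding diagonal_mat_def by (auto simp: of_real_sqrt_mult_self)
    finally show "(Q * Q * (Q * Q)) $$ (i,j) = D $$ (i,j)" .
  qed (use Q D in auto)
  define C where "C = Q * mat_adjoint U"
  have C: "C \<in> carrier_mat n n" unfolding C_def using Q Uc by auto
  have Cadj: "mat_adjoint C = U * Q" unfolding C_def using mat_adjoint_mult[OF Q(1) Uc(2)] Q(2) by simp
  define B where "B = mat_adjoint C * C"
  have "psd_mat n B" unfolding B_def by (rule psd_mat_mult_adjoint[OF C])
  moreover have "B * B = U * (Q * Q) * (mat_adjoint U * U) * (Q * Q) * mat_adjoint U"
    unfolding B_def Cadj unfolding C_def using Uc(1,2) Q(1) by (simp add: assoc)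
  hence "B * B = U * (Q * Q * (Q * Q)) * mat_adjoint U"
    unfolding Uc(3) using Uc(1,2) Q(1) by (simp add: assoc)
  hence "B * B = A" unfolding QQQQ eq .
  ultimately show ?thesis by blast
qed

text \<open>For \<open>D = B - C\<close> one has \<open>BD + DC = 0\<close>, so \<open>tr(DBD) + tr(DCD) = 0\<close>, and both traces are
  nonnegative; hence \<open>BD = CD = 0\<close> and \<open>D\<^sup>2 = 0\<close>.\<close>
lemma psd_sqrt_unique_aux:
  assumes B: "psd_mat n B" and C: "psd_mat n C" and eq: "B * B = C * C"
  shows "B = C"
proof -
  have Bc: "B \<in> carrier_mat n n" "mat_adjoint B = B" using B unfolding psd_mat_def by auto
  have Cc: "C \<in> carrier_mat n n" "mat_adjoint C = C" using C unfolding psd_mat_def by auto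
  define D where "D = B - C"
  have D: "D \<in> carrier_mat n n" unfolding D_def using Bc Cc by auto
  have Dadj: "mat_adjoint D = D"
  proof (rule eq_matI)
    fix i j assume "i < dim_row D" "j < dim_col D"
    hence ij: "i < n" "j < n" using D by auto
    have "mat_adjoint D $$ (i,j) = mat_adjoint B $$ (i,j) - mat_adjoint C $$ (i,j)"
      unfolding D_def using ij Bc(1) Cc(1) by simp
    thus "mat_adjoint D $$ (i,j) = D $$ (i,j)" unfolding Bc(2) Cc(2) D_def using ij Bc Cc by simp
  qed (use D in auto)
  obtain S where S: "psd_mat n S" "S * S = B" using psd_sqrt_exists[OF B] by blast
  obtain T where T: "psd_mat n T" "T * T = C" using psd_sqrt_exists[OF C] by blast
  have Sc: "S \<in> carrier_mat n n" "mat_adjoint S = S" using S unfolding psd_mat_def by auto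
  have Tc: "T \<in> carrier_mat n n" "mat_adjoint T = T" using T unfolding psd_mat_def by auto
  note assoc = assoc_mult_mat[of _ n n _ n _ n] mult_carrier_mat[of _ n n _ n]
  have SD: "S * D \<in> carrier_mat n n" and TD: "T * D \<in> carrier_mat n n" using Sc Tc D by auto
  have e1: "mat_adjoint (S * D) * (S * D) = D * (B * D)"
    using mat_adjoint_mult[OF Sc(1) D] Sc D Dadj unfolding S(2)[symmetric] by (simp add: assoc)
  have e2: "mat_adjoint (T * D) * (T * D) = D * (C * D)"
    using mat_adjoint_mult[OF Tc(1) D] Tc D Dadj unfolding T(2)[symmetric] by (simp add: assoc)
  have "B * D = B * B - B * C" unfolding D_def by (rule mult_minus_distrib_mat) (use Bc Cc in auto)
  moreover have "D * C = B * C - C * C" unfolding D_def by (rule minus_mult_distrib_mat) (use Bc Cc in auto)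
  ultimately have sum0: "B * D + D * C = 0\<^sub>m n n" unfolding eq using Bc(1) Cc(1) by (intro eq_matI) auto
  have "mtrace (D * (C * D)) = mtrace (D * (D * C))"
    using mtrace_mult_comm[of D n n "C * D"] mtrace_mult_comm[of D n n "D * C"] D Cc(1) by (simp add: assoc)
  hence "mtrace (D * (B * D)) + mtrace (D * (C * D)) = mtrace (D * (B * D) + D * (D * C))"
    unfolding mtrace_def using D Cc(1) Bc(1) by (simp add: sum.distrib)
  also have "D * (B * D) + D * (D * C) = D * (B * D + D * C)"
    using D Cc(1) Bc(1) by (intro mult_add_distrib_mat[symmetric]) auto
  also have "mtrace \<dots> = 0" unfolding sum0 using D by (simp add: mtrace_def)
  finally have "(\<Sum>i<n. \<Sum>l<n. (cmod ((S * D) $$ (l,i)))\<^sup>2) + (\<Sum>i<n. \<Sum>l<n. (cmod ((T * D) $$ (l,i)))\<^sup>2) = 0"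
    unfolding e1[symmetric] e2[symmetric] mtrace_adjoint_mult[OF SD] mtrace_adjoint_mult[OF TD]
    unfolding of_real_add[symmetric] of_real_eq_0_iff .
  hence "(\<Sum>i<n. \<Sum>l<n. (cmod ((S * D) $$ (l,i)))\<^sup>2) = 0" "(\<Sum>i<n. \<Sum>l<n. (cmod ((T * D) $$ (l,i)))\<^sup>2) = 0"
    by (simp_all add: add_nonneg_eq_0_iff sum_nonneg del: index_mult_mat)
  from this[THEN frobenius_eq_0D[rotated]] have z: "S * D = 0\<^sub>m n n" "T * D = 0\<^sub>m n n" using SD TD by auto
  have "B * D = 0\<^sub>m n n" using z(1) Sc D unfolding S(2)[symmetric] by (simp add: assoc)
  moreover have "C * D = 0\<^sub>m n n" using z(2) Tc D unfolding T(2)[symmetric] by (simp add: assoc)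
  moreover have "D * D = B * D - C * D"
    by (subst D_def(1), rule minus_mult_distrib_mat) (use Bc Cc D in auto)
  ultimately have "mat_adjoint D * D = 0\<^sub>m n n" unfolding Dadj by simp
  hence "of_real (\<Sum>i<n. \<Sum>l<n. (cmod (D $$ (l,i)))\<^sup>2) = (0 :: complex)"
    unfolding mtrace_adjoint_mult[OF D, symmetric] by (simp add: mtrace_def)
  hence "D = 0\<^sub>m n n" using frobenius_eq_0D[OF D] unfolding of_real_eq_0_iff by blast
  thus "B = C" unfolding D_def using Bc(1) Cc(1)
    by (metis carrier_matD eq_matI index_minus_mat(1) index_zero_mat(1) right_minus_eq)
qed

lemma psd_sqrt_eqI:
  assumes "psd_mat n B" "B * B = A"
  shows "psd_sqrt A = B"
proof -
  have "dim_row A = n" using assms unfolding psd_mat_def by auto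
  thus ?thesis unfolding psd_sqrt_def using assms psd_sqrt_unique_aux by (intro the_equality) auto
qed

lemma psd_sqrt_properties:
  assumes "psd_mat n A"
  shows "psd_mat n (psd_sqrt A)" "psd_sqrt A * psd_sqrt A = A"
  using psd_sqrt_exists[OF assms] psd_sqrt_eqI by auto

text \<open>For the rank one projection P onto \<phi>, sandwiching gives P \<rho> P = z P with z the
  expectation of \<rho> in \<phi>. Since P is its own square root, the trace norm is the trace of
  sqrt z P.\<close>

lemma fidelity_pure:
  assumes rho: "psd_mat n \<rho>" and unit: "(\<Sum>i<n. (cmod (\<phi> i))\<^sup>2) = 1"
  shows "fidelity \<rho> (mat n n (\<lambda>(i,j). \<phi> i * cnj (\<phi> j)))
    = sqrt (Re (\<Sum>i<n. \<Sum>j<n. cnj (\<phi> i) * \<rho> $$ (i,j) * \<phi> j))"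
proof -
  define P where "P = mat n n (\<lambda>(i,j). \<phi> i * cnj (\<phi> j))"
  have P: "P \<in> carrier_mat n n" "mat_adjoint P = P" unfolding P_def by (auto intro!: eq_matI)
  have unit': "(\<Sum>i<n. cnj (\<phi> i) * \<phi> i) = 1"
  proof -
    have "(\<Sum>i<n. cnj (\<phi> i) * \<phi> i) = of_real (\<Sum>i<n. (cmod (\<phi> i))\<^sup>2)"
      by (simp only: cnj_mult_self of_real_sum)
    thus ?thesis using unit by simp
  qed
  have sand: "P * M * P = (\<Sum>i<n. \<Sum>j<n. cnj (\<phi> i) * M $$ (i,j) * \<phi> j) \<cdot>\<^sub>m P"
    if M: "M \<in> carrier_mat n n" for M
  proof (rule eq_matI)
    fix i j assume "i < dim_row ((\<Sum>i<n. \<Sum>j<n. cnj (\<phi> i) * M $$ (i,j) * \<phi> j) \<cdot>\<^sub>m P)"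
      "j < dim_col ((\<Sum>i<n. \<Sum>j<n. cnj (\<phi> i) * M $$ (i,j) * \<phi> j) \<cdot>\<^sub>m P)"
    hence ij: "i < n" "j < n" using P by auto
    have "(P * M * P) $$ (i,j) = (\<Sum>l<n. (\<Sum>k<n. P $$ (i,k) * M $$ (k,l)) * P $$ (l,j))"
      using ij P(1) M
      by (simp add: mat_mult_index[of "P * M" n n P n] mat_mult_index[of P n n M n]
          mult_carrier_mat[of _ n n _ n] del: index_mult_mat(1) assoc_mult_mat)
    also have "\<dots> = (\<Sum>l<n. \<Sum>k<n. \<phi> i * cnj (\<phi> j) * (cnj (\<phi> k) * M $$ (k,l) * \<phi> l))"
      unfolding sum_distrib_right using ij by (intro sum.cong refl) (simp add: P_def)
    also have "\<dots> = \<phi> i * cnj (\<phi> j) * (\<Sum>k<n. \<Sum>l<n. cnj (\<phi> k) * M $$ (k,l) * \<phi> l)"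
      by (subst sum.swap) (simp add: sum_distrib_left)
    finally show "(P * M * P) $$ (i,j) = ((\<Sum>i<n. \<Sum>j<n. cnj (\<phi> i) * M $$ (i,j) * \<phi> j) \<cdot>\<^sub>m P) $$ (i,j)"
      using ij by (simp add: P_def)
  qed (use P M in auto)
  have PP: "P * P = P"
  proof -
    have "P * 1\<^sub>m n * P = (\<Sum>i<n. \<Sum>j<n. cnj (\<phi> i) * 1\<^sub>m n $$ (i,j) * \<phi> j) \<cdot>\<^sub>m P"
      by (rule sand) auto
    also have "(\<Sum>i<n. \<Sum>j<n. cnj (\<phi> i) * 1\<^sub>m n $$ (i,j) * \<phi> j) = (\<Sum>i<n. cnj (\<phi> i) * \<phi> i)"
    proof (rule sum.cong[OF refl])
      fix i assume "i \<in> {..<n}"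
      hence "(\<Sum>j<n. cnj (\<phi> i) * 1\<^sub>m n $$ (i,j) * \<phi> j) = (\<Sum>j<n. if j = i then cnj (\<phi> i) * \<phi> i else 0)"
        by (intro sum.cong) auto
      thus "(\<Sum>j<n. cnj (\<phi> i) * 1\<^sub>m n $$ (i,j) * \<phi> j) = cnj (\<phi> i) * \<phi> i"
        using \<open>i \<in> {..<n}\<close> by simp
    qed
    finally show ?thesis using P unit' by (auto intro!: eq_matI)
  qed
  have Ppsd: "psd_mat n P" using psd_mat_mult_adjoint[OF P(1)] unfolding P(2) PP .
  have sqP: "psd_sqrt P = P" by (rule psd_sqrt_eqI[OF Ppsd PP])
  define S where "S = psd_sqrt \<rho>"
  have S: "S \<in> carrier_mat n n" "mat_adjoint S = S" "S * S = \<rho>"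
    using psd_sqrt_properties[OF rho] unfolding S_def psd_mat_def by auto
  have rc: "\<rho> \<in> carrier_mat n n" using rho unfolding psd_mat_def by auto
  define z where "z = (\<Sum>i<n. \<Sum>j<n. cnj (\<phi> i) * \<rho> $$ (i,j) * \<phi> j)"
  have z0: "0 \<le> Re z" unfolding z_def by (rule psd_matD(3)[OF rho])
  have "cnj z = z" unfolding z_def cnj_sum
    by (subst sum.swap) (auto simp: psd_matD(2)[OF rho, symmetric] intro!: sum.cong)
  hence zr: "z = of_real (Re z)" by (simp add: complex_eq_iff)
  have "mat_adjoint (S * P) * (S * P) = P * \<rho> * P"
    unfolding mat_adjoint_mult[OF S(1) P(1)] S(2) P(2) S(3)[symmetric]
    using S(1) P(1) by (simp add: assoc_mult_mat[of _ n n _ n _ n] mult_carrier_mat[of _ n n _ n])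
  also have "\<dots> = z \<cdot>\<^sub>m P" unfolding z_def by (rule sand[OF rc])
  finally have AA: "mat_adjoint (S * P) * (S * P) = z \<cdot>\<^sub>m P" .
  define s where "s = complex_of_real (sqrt (Re z))"
  have ss: "s * s = z" unfolding s_def using z0 by (subst (2) zr) (simp flip: of_real_mult)
  have sc: "s = of_real (sqrt (sqrt (Re z))) * of_real (sqrt (sqrt (Re z)))"
    unfolding s_def using z0 by (simp add: of_real_sqrt_mult_self)
  \<comment> \<open>Again a fourth root: W is self-adjoint with W W = s P, which exhibits s P as
    positive.\<close>
  define W where "W = complex_of_real (sqrt (sqrt (Re z))) \<cdot>\<^sub>m P"
  have W: "W \<in> carrier_mat n n" "mat_adjoint W = W" unfolding W_def P_def by (auto intro!: eq_matI)
  have smm: "(a \<cdot>\<^sub>m P) * (b \<cdot>\<^sub>m P) = (a * b) \<cdot>\<^sub>m P" for a b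
    using P(1) by (simp add: mult_smult_assoc_mat[of _ n n _ n] mult_smult_distrib[of _ n n _ n] PP)
      (auto intro!: eq_matI)
  have "W * W = s \<cdot>\<^sub>m P" unfolding W_def smm sc by simp
  hence "psd_mat n (s \<cdot>\<^sub>m P)" using psd_mat_mult_adjoint[OF W(1)] unfolding W(2) by simp
  hence "psd_sqrt (z \<cdot>\<^sub>m P) = s \<cdot>\<^sub>m P" by (rule psd_sqrt_eqI) (simp add: smm ss)
  moreover have "mtrace (s \<cdot>\<^sub>m P) = s * (\<Sum>i<n. cnj (\<phi> i) * \<phi> i)"
    unfolding mtrace_def sum_distrib_left P_def by (simp add: mult.commute)
  ultimately show ?thesis
    unfolding fidelity_def P_def[symmetric] sqP S_def[symmetric] trace_norm_def AA
    by (simp add: unit' s_def z_def[symmetric])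
qed

section \<open>Entanglement fidelity after erasure of a subsystem\<close>

lemma sum_lessThan_mult:
  "(\<Sum>x<m * n. f x) = (\<Sum>i<m. \<Sum>p<(n :: nat). f (i * n + p))"
proof -
  have block: "sum f {k..<k + n} = (\<Sum>p<n. f (k + p))" for k
    by (induction n) auto
  have "(\<Sum>x<m * n. f x) = (\<Sum>i<m. sum f {i * n..<i * n + n})"
    by (rule sum.nat_group[symmetric])
  thus ?thesis unfolding block .
qed

text \<open>An operator and its adjoint have the same norm. With \<xi> the image of u under the
  adjoint, S = |\<xi>|^2 is the inner product of u with the image of \<xi>, so S^2 \<le> |u|^2 t S
  by Cauchy-Schwarz, and one factor S cancels.\<close>

lemma adjoint_norm_bound:
  fixes T :: "'a \<Rightarrow> 'b \<Rightarrow> complex"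
  assumes fin: "finite A" "finite B" and t: "0 \<le> t"
    and bound: "\<And>\<xi>. (\<Sum>b\<in>B. (cmod (\<Sum>a\<in>A. T a b * \<xi> a))\<^sup>2) \<le> t * (\<Sum>a\<in>A. (cmod (\<xi> a))\<^sup>2)"
  shows "(\<Sum>a\<in>A. (cmod (\<Sum>b\<in>B. cnj (T a b) * u b))\<^sup>2) \<le> t * (\<Sum>b\<in>B. (cmod (u b))\<^sup>2)"
proof -
  define \<xi> where "\<xi> a = (\<Sum>b\<in>B. cnj (T a b) * u b)" for a
  define S where "S = (\<Sum>a\<in>A. (cmod (\<xi> a))\<^sup>2)"
  define v where "v b = (\<Sum>a\<in>A. T a b * \<xi> a)" for b
  have S0: "0 \<le> S" unfolding S_def by (simp add: sum_nonneg)
  have "complex_of_real S = (\<Sum>a\<in>A. cnj (\<xi> a) * \<xi> a)"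
    unfolding S_def of_real_sum cnj_mult_self ..
  also have "\<dots> = (\<Sum>a\<in>A. \<Sum>b\<in>B. cnj (u b) * (T a b * \<xi> a))"
  proof (intro sum.cong refl)
    fix a
    have "cnj (\<xi> a) = (\<Sum>b\<in>B. T a b * cnj (u b))" unfolding \<xi>_def by simp
    thus "cnj (\<xi> a) * \<xi> a = (\<Sum>b\<in>B. cnj (u b) * (T a b * \<xi> a))"
      by (simp add: sum_distrib_right sum_distrib_left ac_simps)
  qed
  also have "\<dots> = (\<Sum>b\<in>B. cnj (u b) * v b)"
    unfolding v_def by (subst sum.swap) (simp add: sum_distrib_left)
  finally have "S = cmod (\<Sum>b\<in>B. cnj (u b) * v b)" using S0 by (metis norm_of_real abs_of_nonneg)
  also have "\<dots> \<le> (\<Sum>b\<in>B. cmod (u b) * cmod (v b))"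
    by (rule order_trans[OF norm_sum]) (simp add: norm_mult)
  finally have "S\<^sup>2 \<le> (\<Sum>b\<in>B. cmod (u b) * cmod (v b))\<^sup>2" using S0 by (simp add: power_mono)
  also have "\<dots> \<le> (\<Sum>b\<in>B. (cmod (u b))\<^sup>2) * (\<Sum>b\<in>B. (cmod (v b))\<^sup>2)"
    by (rule Cauchy_Schwarz_ineq_sum)
  also have "\<dots> \<le> (\<Sum>b\<in>B. (cmod (u b))\<^sup>2) * (t * S)"
    unfolding v_def S_def by (intro mult_left_mono bound) (simp add: sum_nonneg)
  finally have "S * S \<le> (t * (\<Sum>b\<in>B. (cmod (u b))\<^sup>2)) * S" by (simp add: power2_eq_square ac_simps)
  hence "S \<le> t * (\<Sum>b\<in>B. (cmod (u b))\<^sup>2)"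
  proof (cases "S = 0")
    case True
    thus ?thesis using t by (simp add: sum_nonneg)
  next
    case False
    with S0 have "S > 0" by simp
    thus ?thesis using \<open>S * S \<le> _\<close> by (simp add: mult_le_cancel_right)
  qed
  thus ?thesis unfolding S_def \<xi>_def .
qed

section \<open>Fidelity with the maximally entangled state\<close>

lemma max_ent_altdef:
  "max_ent d = mat (d*d) (d*d) (\<lambda>(x,y). (if x div d = x mod d then of_real (1 / sqrt d) else 0)
     * cnj (if y div d = y mod d then of_real (1 / sqrt d) else 0))"
proof -
  have "complex_of_real (1 / sqrt d) * complex_of_real (1 / sqrt d) = 1 / of_nat d"
    by (simp flip: of_real_mult)
  thus ?thesis unfolding max_ent_def by (intro eq_matI) (auto split: if_splits)
qed

text \<open>The first matrix is the Choi state of the map with Kraus operators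
  \<open>sqrt (w s)\<close> times \<open>G s\<close>. The overlap of a vectorized operator with the
  maximally entangled vector is its trace, up to the normalization.\<close>

lemma gram_fidelity:
  fixes w :: "'s \<Rightarrow> real" and G :: "'s \<Rightarrow> nat \<Rightarrow> nat \<Rightarrow> complex"
  assumes d: "0 < d" and w: "\<And>s. s \<in> S \<Longrightarrow> 0 \<le> w s"
  shows "fidelity (mat (d*d) (d*d) (\<lambda>(x,y). (\<Sum>s\<in>S. of_real (w s) * G s (x div d) (x mod d)
      * cnj (G s (y div d) (y mod d))) / of_nat d)) (max_ent d)
    = sqrt ((\<Sum>s\<in>S. w s * (cmod (\<Sum>m<d. G s m m))\<^sup>2) / (real d)\<^sup>2)"
proof -
  define H where "H s x = G s (x div d) (x mod d)" for s x
  define \<rho> where "\<rho> = mat (d*d) (d*d) (\<lambda>(x,y). (\<Sum>s\<in>S. of_real (w s) * H s x * cnj (H s y)) / of_nat d)"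
  have quad: "(\<Sum>x<d*d. \<Sum>y<d*d. cnj (v x) * \<rho> $$ (x,y) * v y)
      = of_real ((\<Sum>s\<in>S. w s * (cmod (\<Sum>x<d*d. cnj (H s x) * v x))\<^sup>2) / d)" for v
  proof -
    have "(\<Sum>x<d*d. \<Sum>y<d*d. cnj (v x) * \<rho> $$ (x,y) * v y)
       = (\<Sum>x<d*d. \<Sum>y<d*d. \<Sum>s\<in>S. of_real (w s) * ((H s x * cnj (v x)) * (cnj (H s y) * v y)) / of_nat d)"
      by (intro sum.cong refl) (simp add: \<rho>_def sum_distrib_left sum_distrib_right sum_divide_distrib ac_simps)
    also have "\<dots> = (\<Sum>s\<in>S. \<Sum>x<d*d. \<Sum>y<d*d. of_real (w s) * ((H s x * cnj (v x)) * (cnj (H s y) * v y)) / of_nat d)"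
      by (subst (2) sum.swap, subst (1) sum.swap, rule refl)
    also have "\<dots> = (\<Sum>s\<in>S. of_real (w s) * (cnj (\<Sum>x<d*d. cnj (H s x) * v x) * (\<Sum>x<d*d. cnj (H s x) * v x)) / of_nat d)"
    proof (intro sum.cong refl)
      fix s
      have "cnj (\<Sum>x<d*d. cnj (H s x) * v x) * (\<Sum>x<d*d. cnj (H s x) * v x)
        = (\<Sum>x<d*d. \<Sum>y<d*d. (H s x * cnj (v x)) * (cnj (H s y) * v y))"
        by (simp only: cnj_sum complex_cnj_mult complex_cnj_cnj sum_product)
      thus "(\<Sum>x<d*d. \<Sum>y<d*d. of_real (w s) * ((H s x * cnj (v x)) * (cnj (H s y) * v y)) / of_nat d)
        = of_real (w s) * (cnj (\<Sum>x<d*d. cnj (H s x) * v x) * (\<Sum>x<d*d. cnj (H s x) * v x)) / of_nat d"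
        by (simp only: sum_distrib_left sum_divide_distrib)
    qed
    also have "\<dots> = of_real ((\<Sum>s\<in>S. w s * (cmod (\<Sum>x<d*d. cnj (H s x) * v x))\<^sup>2) / d)"
      unfolding cnj_mult_self by (simp add: sum_divide_distrib)
    finally show ?thesis .
  qed
  have psd: "psd_mat (d*d) \<rho>"
  proof (rule psd_matI)
    show "\<rho> $$ (i,j) = cnj (\<rho> $$ (j,i))" if "i < d*d" "j < d*d" for i j
      using that by (simp add: \<rho>_def ac_simps)
    show "0 \<le> Re (\<Sum>x<d*d. \<Sum>y<d*d. cnj (v x) * \<rho> $$ (x,y) * v y)" for v
      unfolding quad using w by (simp add: sum_nonneg)
  qed (simp add: \<rho>_def)
  define \<phi> where "\<phi> x = (if x div d = x mod d then complex_of_real (1 / sqrt d) else 0)" for x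
  have diag: "(\<Sum>x<d*d. if x div d = x mod d then f (x div d) else 0) = (\<Sum>m<d. f m)"
    for f :: "nat \<Rightarrow> 'x :: comm_monoid_add"
  proof -
    have "(\<Sum>x<d*d. if x div d = x mod d then f (x div d) else 0) = (\<Sum>m<d. \<Sum>l<d. if l = m then f m else 0)"
      unfolding sum_lessThan_mult by (intro sum.cong refl) auto
    thus ?thesis by simp
  qed
  have "(\<Sum>x<d*d. (cmod (\<phi> x))\<^sup>2) = (\<Sum>x<d*d. if x div d = x mod d then 1 / real d else 0)"
    unfolding \<phi>_def by (intro sum.cong refl) (simp add: power_divide norm_divide)
  also have "\<dots> = 1" using diag[of "\<lambda>_. 1 / real d"] d by simp
  finally have unit: "(\<Sum>x<d*d. (cmod (\<phi> x))\<^sup>2) = 1" .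
  have inner: "(cmod (\<Sum>x<d*d. cnj (H s x) * \<phi> x))\<^sup>2 = (cmod (\<Sum>m<d. G s m m))\<^sup>2 / d" for s
  proof -
    have "(\<Sum>x<d*d. cnj (H s x) * \<phi> x)
      = (\<Sum>x<d*d. if x div d = x mod d then cnj (G s (x div d) (x div d)) * of_real (1 / sqrt d) else 0)"
      unfolding H_def \<phi>_def by (intro sum.cong refl) auto
    also have "\<dots> = cnj (\<Sum>m<d. G s m m) * of_real (1 / sqrt d)"
      unfolding diag[of "\<lambda>m. cnj (G s m m) * of_real (1 / sqrt d)"] cnj_sum sum_distrib_right ..
    finally have "cmod (\<Sum>x<d*d. cnj (H s x) * \<phi> x) = cmod (\<Sum>m<d. G s m m) * (1 / sqrt d)"
      by (simp only: norm_mult complex_mod_cnj norm_of_real) simp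
    thus ?thesis by (simp add: power_divide)
  qed
  have "fidelity \<rho> (max_ent d) = sqrt (Re (\<Sum>x<d*d. \<Sum>y<d*d. cnj (\<phi> x) * \<rho> $$ (x,y) * \<phi> y))"
    unfolding max_ent_altdef using fidelity_pure[OF psd unit] unfolding \<phi>_def .
  also have "\<dots> = sqrt ((\<Sum>s\<in>S. w s * (cmod (\<Sum>m<d. G s m m))\<^sup>2) / (real d)\<^sup>2)"
    unfolding quad inner Re_complex_of_real by (simp add: power2_eq_square sum_divide_distrib)
  finally show ?thesis unfolding \<rho>_def H_def .
qed

section \<open>Indices of a threefold tensor product\<close>

locale three_digits =
  fixes d :: "nat \<Rightarrow> nat"
  assumes d_pos: "0 < d 0" "0 < d 1" "0 < d 2"
begin

definition dim3 :: nat where "dim3 = d 0 * d 1 * d 2"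

lemma dig3_less:
  assumes "i < 3" "p < dim3"
  shows "dig3 d p i < d i"
proof -
  have "p div (d 1 * d 2) < d 0" using assms(2) unfolding dim3_def
    by (simp add: less_mult_imp_div_less mult.assoc)
  moreover have "i = 0 \<or> i = 1 \<or> i = 2" using assms by auto
  ultimately show ?thesis using d_pos unfolding dig3_def by auto
qed

lemma enc3_dig3: "enc3 d (dig3 d p) = p"
proof -
  have "p div (d 1 * d 2) * d 1 + p div d 2 mod d 1 = p div d 2"
    by (metis add.commute div_mult2_eq mod_mult_div_eq mult.commute div_mult_mod_eq)
  thus ?thesis unfolding enc3_def dig3_def by simp
qed

lemma enc3_less:
  assumes "a 0 < d 0" "a 1 < d 1" "a 2 < d 2"
  shows "enc3 d a < dim3"
proof -
  have mixed: "x * n + y < m * n" if "x < m" "y < n" for x y m n :: nat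
  proof -
    have "x * n + y < Suc x * n" using that by simp
    also have "\<dots> \<le> m * n" using that by (intro mult_right_mono) auto
    finally show ?thesis .
  qed
  show ?thesis unfolding enc3_def dim3_def by (intro mixed assms)
qed

lemma dig3_enc3:
  assumes "a 0 < d 0" "a 1 < d 1" "a 2 < d 2" "i < 3"
  shows "dig3 d (enc3 d a) i = a i"
proof -
  have "enc3 d a div d 2 = a 0 * d 1 + a 1" using assms unfolding enc3_def by simp
  moreover have "enc3 d a div (d 1 * d 2) = enc3 d a div d 2 div d 1"
    by (metis mult.commute div_mult2_eq)
  moreover have "enc3 d a mod d 2 = a 2" using assms unfolding enc3_def by simp
  moreover have "i = 0 \<or> i = 1 \<or> i = 2" using assms(4) by auto
  ultimately show ?thesis using assms unfolding dig3_def by auto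
qed

lemma enc3_cong: "(\<And>i. i < 3 \<Longrightarrow> a i = b i) \<Longrightarrow> enc3 d a = enc3 d b"
  unfolding enc3_def by simp

lemma setdig3_less:
  assumes "i < 3" "p < dim3" "\<kappa> < d i"
  shows "setdig3 d i p \<kappa> < dim3"
  unfolding setdig3_def using assms dig3_less[of _ p] by (intro enc3_less) auto

lemma dig3_setdig3:
  assumes "i < 3" "p < dim3" "\<kappa> < d i" "i' < 3"
  shows "dig3 d (setdig3 d i p \<kappa>) i' = (if i' = i then \<kappa> else dig3 d p i')"
  unfolding setdig3_def using assms dig3_less[of _ p] by (subst dig3_enc3) auto

lemma setdig3_setdig3:
  assumes "i < 3" "p < dim3" "\<kappa> < d i"
  shows "setdig3 d i (setdig3 d i p \<kappa>) \<kappa>' = setdig3 d i p \<kappa>'"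
  unfolding setdig3_def[of d i _ \<kappa>'] using assms by (intro enc3_cong) (auto simp: dig3_setdig3)

lemma setdig3_dig3: "setdig3 d i p (dig3 d p i) = p"
  unfolding setdig3_def by (simp add: enc3_dig3)

text \<open>The indices with digit 0 in position i serve as the basis of the other two subsystems,
  so that no second index system is necessary after a partial trace.\<close>

definition rest :: "nat \<Rightarrow> nat set" where
  "rest i = {p. p < dim3 \<and> dig3 d p i = 0}"

lemma finite_rest [simp]: "finite (rest i)"
  unfolding rest_def by simp

lemma d_pos': "i < 3 \<Longrightarrow> 0 < d i"
  using d_pos by (auto simp: less_Suc_eq numeral_3_eq_3 numeral_2_eq_2)

lemma sum_rest:
  assumes "i < 3"
  shows "(\<Sum>p<dim3. F p) = (\<Sum>p\<in>rest i. \<Sum>\<kappa><d i. F (setdig3 d i p \<kappa>))"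
  unfolding sum.cartesian_product
  by (rule sum.reindex_bij_witness[of _ "\<lambda>(p,\<kappa>). setdig3 d i p \<kappa>" "\<lambda>p. (setdig3 d i p 0, dig3 d p i)"])
    (use assms d_pos'[OF assms] in \<open>auto simp: rest_def dig3_setdig3 setdig3_setdig3 setdig3_dig3
      setdig3_less dig3_less, metis setdig3_dig3\<close>)

end

section \<open>Kraus operators of the encoded, damaged and recovered channel\<close>

locale erasure_code = three_digits d for d :: "nat \<Rightarrow> nat" +
  fixes dL :: nat and q :: "nat \<Rightarrow> real" and \<phi> :: "nat \<Rightarrow> complex vec" and V :: "complex mat"
  assumes dL_pos: "0 < dL"
    and V_isometry: "isometry_mat dim3 dL V"
    and q_nonneg: "\<And>i. i < 3 \<Longrightarrow> 0 \<le> q i"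
    and q_sum: "q 0 + q 1 + q 2 = 1"
    and \<phi>_unit: "\<And>i. i < 3 \<Longrightarrow> unit_vector (d i) (\<phi> i)"
begin

definition noisy :: "complex mat \<Rightarrow> complex mat" where
  "noisy = erasure_noise q d \<phi> \<circ> (\<lambda>\<rho>. V * \<rho> * mat_adjoint V)"

text \<open>\<open>krk R i \<kappa>\<close> is, up to the factor \<open>sqrt (q i)\<close>, the Kraus operator of the encoded, damaged and
  recovered channel belonging to the Kraus operator \<open>R\<close> of the recovery and the outcome \<open>\<kappa>\<close> of
  tracing out \<open>A_i\<close>.\<close>
definition krk :: "complex mat \<Rightarrow> nat \<Rightarrow> nat \<Rightarrow> nat \<Rightarrow> nat \<Rightarrow> complex" where
  "krk R i \<kappa> m l = (\<Sum>p<dim3. R $$ (m, i * dim3 + p) * \<phi> i $ dig3 d p i * V $$ (setdig3 d i p \<kappa>, l))"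

lemma V_carrier: "V \<in> carrier_mat dim3 dL"
  using V_isometry unfolding isometry_mat_def by blast

lemma V_orthonormal:
  assumes "l < dL" "l' < dL"
  shows "(\<Sum>p<dim3. cnj (V $$ (p,l)) * V $$ (p,l')) = (if l = l' then 1 else 0)"
proof -
  have "(mat_adjoint V * V) $$ (l,l') = (\<Sum>p<dim3. cnj (V $$ (p,l)) * V $$ (p,l'))"
    using assms V_carrier by (subst mat_mult_index[of _ dL dim3 _ dL]) auto
  thus ?thesis using V_isometry assms unfolding isometry_mat_def by auto
qed

lemma V_norm: "(\<Sum>p<dim3. \<Sum>l<dL. (cmod (V $$ (p,l)))\<^sup>2) = dL"
proof -
  have "complex_of_real (\<Sum>l<dL. \<Sum>p<dim3. (cmod (V $$ (p,l)))\<^sup>2) = (\<Sum>l<dL. 1)"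
    unfolding of_real_sum cnj_mult_self[symmetric] using V_orthonormal by simp
  also have "\<dots> = of_real (real dL)" by simp
  finally show ?thesis unfolding of_real_eq_iff by (subst sum.swap)
qed

lemma \<phi>_norm: "i < 3 \<Longrightarrow> (\<Sum>k<d i. (cmod (\<phi> i $ k))\<^sup>2) = 1"
  using \<phi>_unit unfolding unit_vector_def by blast

text \<open>The state put in place of the erased subsystem contributes only its squared norm 1 if
  the remaining factor ignores digit i. This is how \<open>\<phi>\<close> drops out of the fidelity
  estimates.\<close>

lemma sum_unit_rest:
  assumes i: "i < 3" and inv: "\<And>p \<kappa>. p < dim3 \<Longrightarrow> \<kappa> < d i \<Longrightarrow> Z (setdig3 d i p \<kappa>) = Z p"
  shows "(\<Sum>p<dim3. of_real ((cmod (\<phi> i $ dig3 d p i))\<^sup>2) * Z p) = (\<Sum>p\<in>rest i. Z p :: complex)"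
proof -
  have "(\<Sum>p<dim3. of_real ((cmod (\<phi> i $ dig3 d p i))\<^sup>2) * Z p)
    = (\<Sum>p\<in>rest i. \<Sum>\<kappa><d i. of_real ((cmod (\<phi> i $ \<kappa>))\<^sup>2) * Z p)"
    unfolding sum_rest[OF i] using i inv by (intro sum.cong refl) (auto simp: rest_def dig3_setdig3)
  also have "\<dots> = (\<Sum>p\<in>rest i. of_real (\<Sum>\<kappa><d i. (cmod (\<phi> i $ \<kappa>))\<^sup>2) * Z p)"
    by (simp add: sum_distrib_right)
  also have "\<dots> = (\<Sum>p\<in>rest i. Z p)" unfolding \<phi>_norm[OF i] by simp
  finally show ?thesis .
qed

text \<open>The factor 1 / dL is included because these matrices are the blocks of
  \<open>max_ent\<close>, one for each pair of basis states of the reference.\<close>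

definition matrix_unit :: "nat \<Rightarrow> nat \<Rightarrow> complex mat" where
  "matrix_unit a b = mat dL dL (\<lambda>(i,j). if i = a \<and> j = b then 1 / of_nat dL else 0)"

lemma encoded_matrix_unit:
  assumes "a < dL" "b < dL" "p < dim3" "p' < dim3"
  shows "(V * matrix_unit a b * mat_adjoint V) $$ (p,p') = V $$ (p,a) * cnj (V $$ (p',b)) / of_nat dL"
proof -
  have E: "matrix_unit a b \<in> carrier_mat dL dL" unfolding matrix_unit_def by simp
  have 1: "(V * matrix_unit a b) $$ (p,j) = (if j = b then V $$ (p,a) / of_nat dL else 0)" if "j < dL" for j
  proof -
    have "(V * matrix_unit a b) $$ (p,j) = (\<Sum>i<dL. if i = a then (if j = b then V $$ (p,a) / of_nat dL else 0) else 0)"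
      unfolding mat_mult_index[OF V_carrier E assms(3) that]
      using that by (intro sum.cong refl) (auto simp: matrix_unit_def)
    thus ?thesis using assms(1) by simp
  qed
  have "(V * matrix_unit a b * mat_adjoint V) $$ (p,p')
    = (\<Sum>j<dL. (V * matrix_unit a b) $$ (p,j) * mat_adjoint V $$ (j,p'))"
    using assms V_carrier E by (intro mat_mult_index) auto
  also have "\<dots> = (\<Sum>j<dL. if j = b then V $$ (p,a) * cnj (V $$ (p',b)) / of_nat dL else 0)"
    using assms V_carrier by (intro sum.cong refl) (auto simp: 1)
  finally show ?thesis using assms by simp
qed

lemma noisy_matrix_unit:
  assumes "a < dL" "b < dL" "p < dim3" "p' < dim3" "i < 3" "i' < 3"
  shows "noisy (matrix_unit a b) $$ (i * dim3 + p, i' * dim3 + p') =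
    (if i = i' then of_real (q i) * (\<phi> i $ dig3 d p i * cnj (\<phi> i $ dig3 d p' i)) *
      (\<Sum>\<kappa><d i. V $$ (setdig3 d i p \<kappa>, a) * cnj (V $$ (setdig3 d i p' \<kappa>, b))) / of_nat dL else 0)"
proof -
  have "j * dim3 + x < 3 * dim3" if "j < 3" "x < dim3" for j x
  proof -
    have "j * dim3 + x < Suc j * dim3" using that by simp
    also have "\<dots> \<le> 3 * dim3" using that by (intro mult_right_mono) auto
    finally show ?thesis .
  qed
  hence "noisy (matrix_unit a b) $$ (i * dim3 + p, i' * dim3 + p') =
    (if i = i' then of_real (q i) * replace_sub d i (\<phi> i) (V * matrix_unit a b * mat_adjoint V) $$ (p, p') else 0)"
    unfolding noisy_def erasure_noise_def o_def Let_def dim3_def[symmetric]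
    using assms by (subst index_mat) auto
  moreover have "replace_sub d i (\<phi> i) (V * matrix_unit a b * mat_adjoint V) $$ (p, p')
    = (\<phi> i $ dig3 d p i * cnj (\<phi> i $ dig3 d p' i)) *
      (\<Sum>\<kappa><d i. V $$ (setdig3 d i p \<kappa>, a) * cnj (V $$ (setdig3 d i p' \<kappa>, b))) / of_nat dL"
    unfolding replace_sub_def dim3_def[symmetric]
    using assms by (simp add: encoded_matrix_unit setdig3_less sum_divide_distrib[symmetric] del: index_mult_mat)
  ultimately show ?thesis by (simp only: mult.assoc times_divide_eq_right)
qed

lemma recovered_matrix_unit:
  assumes "a < dL" "b < dL" "m < dL" "m' < dL"
    and K: "\<And>j. j < k \<Longrightarrow> R j \<in> carrier_mat dL (3 * dim3)"
    and \<Phi>: "\<And>\<rho>. \<rho> \<in> carrier_mat (3 * dim3) (3 * dim3) \<Longrightarrow> \<Phi> \<rho> = msum dL dL k (\<lambda>j. R j * \<rho> * mat_adjoint (R j))"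
  shows "(\<Phi> \<circ> noisy) (matrix_unit a b) $$ (m,m') = (\<Sum>j<k. \<Sum>i<3. \<Sum>\<kappa><d i.
     of_real (q i) * krk (R j) i \<kappa> m a * cnj (krk (R j) i \<kappa> m' b)) / of_nat dL"
proof -
  define N where "N = noisy (matrix_unit a b)"
  have N: "N \<in> carrier_mat (3 * dim3) (3 * dim3)"
    unfolding N_def noisy_def erasure_noise_def o_def Let_def dim3_def[symmetric] by simp
  have "(R j * N * mat_adjoint (R j)) $$ (m,m') = (\<Sum>i<3. \<Sum>\<kappa><d i.
     of_real (q i) * krk (R j) i \<kappa> m a * cnj (krk (R j) i \<kappa> m' b)) / of_nat dL" if "j < k" for j
  proof -
    note Kj = K[OF that]
    have "(R j * N * mat_adjoint (R j)) $$ (m,m')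
      = (\<Sum>y<3*dim3. (R j * N) $$ (m,y) * cnj (R j $$ (m',y)))"
      using assms Kj N by (subst mat_mult_index[of _ dL "3*dim3" _ dL]) auto
    also have "\<dots> = (\<Sum>y<3*dim3. \<Sum>x<3*dim3. R j $$ (m,x) * N $$ (x,y) * cnj (R j $$ (m',y)))"
      using assms Kj N by (intro sum.cong refl) (simp add: mat_mult_index[OF Kj N] sum_distrib_right del: index_mult_mat)
    also have "\<dots> = (\<Sum>i'<3. \<Sum>p'<dim3. \<Sum>i<3. \<Sum>p<dim3.
        R j $$ (m,i*dim3+p) * N $$ (i*dim3+p,i'*dim3+p') * cnj (R j $$ (m',i'*dim3+p')))"
      unfolding sum_lessThan_mult ..
    also have "\<dots> = (\<Sum>i'<3. \<Sum>i<3. \<Sum>p'<dim3. \<Sum>p<dim3.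
        R j $$ (m,i*dim3+p) * N $$ (i*dim3+p,i'*dim3+p') * cnj (R j $$ (m',i'*dim3+p')))"
      by (rule sum.cong[OF refl], rule sum.swap)
    also have "\<dots> = (\<Sum>i'<3. \<Sum>i<3. if i = i' then (\<Sum>\<kappa><d i.
       of_real (q i) * krk (R j) i \<kappa> m a * cnj (krk (R j) i \<kappa> m' b)) / of_nat dL else 0)"
    proof (intro sum.cong refl)
      fix i' i :: nat assume ii: "i' \<in> {..<3}" "i \<in> {..<3}"
      show "(\<Sum>p'<dim3. \<Sum>p<dim3. R j $$ (m,i*dim3+p) * N $$ (i*dim3+p,i'*dim3+p') * cnj (R j $$ (m',i'*dim3+p')))
        = (if i = i' then (\<Sum>\<kappa><d i.
       of_real (q i) * krk (R j) i \<kappa> m a * cnj (krk (R j) i \<kappa> m' b)) / of_nat dL else 0)"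
      proof (cases "i = i'")
        case False
        thus ?thesis using ii assms unfolding N_def by (auto simp: noisy_matrix_unit)
      next
        case True
        let ?x = "\<lambda>p. R j $$ (m,i*dim3+p) * \<phi> i $ dig3 d p i"
        let ?y = "\<lambda>p'. cnj (R j $$ (m',i*dim3+p') * \<phi> i $ dig3 d p' i)"
        have "(\<Sum>p'<dim3. \<Sum>p<dim3. R j $$ (m,i*dim3+p) * N $$ (i*dim3+p,i'*dim3+p') * cnj (R j $$ (m',i'*dim3+p')))
          = (\<Sum>p'<dim3. \<Sum>p<dim3. \<Sum>\<kappa><d i. of_real (q i) * ((?x p * V $$ (setdig3 d i p \<kappa>, a)) *
               (?y p' * cnj (V $$ (setdig3 d i p' \<kappa>, b)))) / of_nat dL)"
        proof (intro sum.cong refl)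
          fix p' p assume "p' \<in> {..<dim3}" "p \<in> {..<dim3}"
          hence "N $$ (i*dim3+p,i'*dim3+p') = of_real (q i) * (\<phi> i $ dig3 d p i * cnj (\<phi> i $ dig3 d p' i)) *
            (\<Sum>\<kappa><d i. V $$ (setdig3 d i p \<kappa>, a) * cnj (V $$ (setdig3 d i p' \<kappa>, b))) / of_nat dL"
            using noisy_matrix_unit[of a b p p' i i'] ii assms True unfolding N_def by auto
          thus "R j $$ (m,i*dim3+p) * N $$ (i*dim3+p,i'*dim3+p') * cnj (R j $$ (m',i'*dim3+p'))
            = (\<Sum>\<kappa><d i. of_real (q i) * ((?x p * V $$ (setdig3 d i p \<kappa>, a)) *
               (?y p' * cnj (V $$ (setdig3 d i p' \<kappa>, b)))) / of_nat dL)"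
            unfolding True
            by (simp only: sum_distrib_left sum_distrib_right sum_divide_distrib complex_cnj_mult
                times_divide_eq_right times_divide_eq_left ac_simps)
        qed
        also have "\<dots> = (\<Sum>\<kappa><d i. \<Sum>p'<dim3. \<Sum>p<dim3. of_real (q i) * ((?x p * V $$ (setdig3 d i p \<kappa>, a)) *
               (?y p' * cnj (V $$ (setdig3 d i p' \<kappa>, b)))) / of_nat dL)"
          by (subst (2) sum.swap, subst (1) sum.swap, rule refl)
        also have "\<dots> = (\<Sum>\<kappa><d i. of_real (q i) * krk (R j) i \<kappa> m a * cnj (krk (R j) i \<kappa> m' b)) / of_nat dL"
          unfolding krk_def cnj_sum complex_cnj_mult
          by (simp add: sum_product sum_distrib_left sum_distrib_right sum_divide_distrib mult.assoc)
        finally show ?thesis using True by simp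
      qed
    qed
    also have "\<dots> = (\<Sum>i<3. \<Sum>\<kappa><d i.
       of_real (q i) * krk (R j) i \<kappa> m a * cnj (krk (R j) i \<kappa> m' b)) / of_nat dL"
      by (simp add: sum_divide_distrib)
    finally show ?thesis .
  qed
  thus ?thesis using \<Phi>[OF N] assms unfolding o_def N_def[symmetric] msum_def by (simp add: sum_divide_distrib)
qed

text \<open>This is the square of the fidelity reached by the recovery with Kraus operators R, as
  \<open>fidelity_eq_fid\<close> shows.\<close>

definition fid :: "nat \<Rightarrow> (nat \<Rightarrow> complex mat) \<Rightarrow> real" where
  "fid k R = (\<Sum>j<k. \<Sum>i<3. \<Sum>\<kappa><d i. q i * (cmod (\<Sum>m<dL. krk (R j) i \<kappa> m m))\<^sup>2) / (real dL)\<^sup>2"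

lemma sum_Kraus_index:
  "(\<Sum>j<(k :: nat). \<Sum>i<3. \<Sum>\<kappa><d i. f j i \<kappa>)
    = (\<Sum>s\<in>(SIGMA j:{..<k}. SIGMA i:{..<3}. {..<d i}). f (fst s) (fst (snd s)) (snd (snd s)))"
proof -
  have "(\<Sum>i<3. \<Sum>\<kappa><d i. f j i \<kappa>) = (\<Sum>s\<in>(SIGMA i:{..<3}. {..<d i}). f j (fst s) (snd s))" for j
    by (subst sum.Sigma) (auto simp: case_prod_unfold)
  thus ?thesis by (simp only:) (subst sum.Sigma, auto simp: case_prod_unfold)
qed

text \<open>\<open>tensor_id\<close> acts on \<open>max_ent\<close> block by block, and the blocks
  are matrix units. The output is therefore the Choi state built from all \<open>krk\<close>, to
  which \<open>gram_fidelity\<close> applies.\<close>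

lemma fidelity_eq_fid:
  assumes K: "\<And>j. j < k \<Longrightarrow> R j \<in> carrier_mat dL (3 * dim3)"
    and \<Phi>: "\<And>\<rho>. \<rho> \<in> carrier_mat (3 * dim3) (3 * dim3) \<Longrightarrow> \<Phi> \<rho> = msum dL dL k (\<lambda>j. R j * \<rho> * mat_adjoint (R j))"
  shows "fidelity (tensor_id (\<Phi> \<circ> noisy) dL dL dL (max_ent dL)) (max_ent dL) = sqrt (fid k R)"
proof -
  let ?S = "SIGMA j:{..<k}. SIGMA i:{..<3}. {..<d i}"
  let ?w = "\<lambda>s. q (fst (snd s))"
  let ?G = "\<lambda>s. krk (R (fst s)) (fst (snd s)) (snd (snd s))"
  have "tensor_id (\<Phi> \<circ> noisy) dL dL dL (max_ent dL) = mat (dL*dL) (dL*dL) (\<lambda>(x,y).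
    (\<Sum>s\<in>?S. of_real (?w s) * ?G s (x div dL) (x mod dL) * cnj (?G s (y div dL) (y mod dL))) / of_nat dL)"
  proof (rule eq_matI)
    fix x y assume "x < dim_row (mat (dL*dL) (dL*dL) (\<lambda>(x,y).
      (\<Sum>s\<in>?S. of_real (?w s) * ?G s (x div dL) (x mod dL) * cnj (?G s (y div dL) (y mod dL))) / of_nat dL))"
      "y < dim_col (mat (dL*dL) (dL*dL) (\<lambda>(x,y).
      (\<Sum>s\<in>?S. of_real (?w s) * ?G s (x div dL) (x mod dL) * cnj (?G s (y div dL) (y mod dL))) / of_nat dL))"
    hence xy: "x < dL * dL" "y < dL * dL" by auto
    have lt: "i * dL + z mod dL < dL * dL" if "i < dL" for i z
    proof -
      have "i * dL + z mod dL < Suc i * dL" using dL_pos by simp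
      also have "\<dots> \<le> dL * dL" using that by (intro mult_right_mono) auto
      finally show ?thesis .
    qed
    have "mat dL dL (\<lambda>(i,j). max_ent dL $$ (i*dL + x mod dL, j*dL + y mod dL)) = matrix_unit (x mod dL) (y mod dL)"
      unfolding matrix_unit_def max_ent_def using dL_pos by (intro eq_matI) (auto simp: lt)
    hence "tensor_id (\<Phi> \<circ> noisy) dL dL dL (max_ent dL) $$ (x,y)
      = (\<Phi> \<circ> noisy) (matrix_unit (x mod dL) (y mod dL)) $$ (x div dL, y div dL)"
      unfolding tensor_id_def using xy by simp
    also have "\<dots> = (\<Sum>j<k. \<Sum>i<3. \<Sum>\<kappa><d i. of_real (q i) * krk (R j) i \<kappa> (x div dL) (x mod dL)
        * cnj (krk (R j) i \<kappa> (y div dL) (y mod dL))) / of_nat dL"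
      using xy dL_pos by (intro recovered_matrix_unit K \<Phi>) (auto simp: less_mult_imp_div_less)
    finally show "tensor_id (\<Phi> \<circ> noisy) dL dL dL (max_ent dL) $$ (x,y) = mat (dL*dL) (dL*dL) (\<lambda>(x,y).
      (\<Sum>s\<in>?S. of_real (?w s) * ?G s (x div dL) (x mod dL) * cnj (?G s (y div dL) (y mod dL))) / of_nat dL) $$ (x,y)"
      using xy unfolding sum_Kraus_index by simp
  qed (auto simp: tensor_id_def)
  thus ?thesis
    using gram_fidelity[OF dL_pos, of ?S ?w ?G] q_nonneg unfolding fid_def sum_Kraus_index by auto
qed

lemma Kraus_orthonormal:
  assumes K: "\<And>j. j < k \<Longrightarrow> R j \<in> carrier_mat dL n"
    and one: "msum n n k (\<lambda>j. mat_adjoint (R j) * R j) = 1\<^sub>m n" and xy: "x < n" "y < n"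
  shows "(\<Sum>j<k. \<Sum>m<dL. cnj (R j $$ (m,x)) * R j $$ (m,y)) = (if x = y then 1 else 0)"
proof -
  have "(\<Sum>j<k. \<Sum>m<dL. cnj (R j $$ (m,x)) * R j $$ (m,y)) = msum n n k (\<lambda>j. mat_adjoint (R j) * R j) $$ (x,y)"
    unfolding msum_def using xy K
    by (auto intro!: sum.cong simp: mat_mult_index[of _ n dL _ n] carrier_matD[OF K] simp del: index_mult_mat(1))
  thus ?thesis unfolding one using xy by simp
qed

lemma block_index_less: "i < 3 \<Longrightarrow> p < dim3 \<Longrightarrow> i * dim3 + p < 3 * dim3"
proof -
  assume "i < 3" "p < dim3"
  hence "i * dim3 + p < Suc i * dim3" by simp
  also have "\<dots> \<le> 3 * dim3" using \<open>i < 3\<close> by (intro mult_right_mono) auto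
  finally show ?thesis .
qed

text \<open>Completeness of the Kraus operators R removes the recovery from the left side. What
  remains is an entry of the operator on L \<otimes> A_i that records the correlation of the lost
  subsystem with the encoded state, a quantity which no recovery can change.\<close>

lemma krk_gram:
  assumes K: "\<And>j. j < k \<Longrightarrow> R j \<in> carrier_mat dL (3 * dim3)"
    and one: "msum (3 * dim3) (3 * dim3) k (\<lambda>j. mat_adjoint (R j) * R j) = 1\<^sub>m (3 * dim3)"
    and i: "i < 3" "\<kappa> < d i" "\<kappa>' < d i"
  shows "(\<Sum>j<k. \<Sum>m<dL. cnj (krk (R j) i \<kappa>' m l') * krk (R j) i \<kappa> m l)
    = (\<Sum>p\<in>rest i. cnj (V $$ (setdig3 d i p \<kappa>', l')) * V $$ (setdig3 d i p \<kappa>, l))"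
proof -
  let ?b = "\<lambda>\<kappa> l p. \<phi> i $ dig3 d p i * V $$ (setdig3 d i p \<kappa>, l)"
  have "(\<Sum>j<k. \<Sum>m<dL. cnj (krk (R j) i \<kappa>' m l') * krk (R j) i \<kappa> m l)
    = (\<Sum>j<k. \<Sum>m<dL. \<Sum>p<dim3. \<Sum>p'<dim3. (cnj (?b \<kappa>' l' p) * ?b \<kappa> l p') * (cnj (R j $$ (m,i*dim3+p)) * R j $$ (m,i*dim3+p')))"
    unfolding krk_def cnj_sum sum_product by (intro sum.cong refl) simp
  also have "\<dots> = (\<Sum>j<k. \<Sum>p<dim3. \<Sum>p'<dim3. \<Sum>m<dL. (cnj (?b \<kappa>' l' p) * ?b \<kappa> l p') * (cnj (R j $$ (m,i*dim3+p)) * R j $$ (m,i*dim3+p')))"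
    by (subst (2) sum.swap, subst (3) sum.swap, rule refl)
  also have "\<dots> = (\<Sum>p<dim3. \<Sum>p'<dim3. \<Sum>j<k. \<Sum>m<dL. (cnj (?b \<kappa>' l' p) * ?b \<kappa> l p') * (cnj (R j $$ (m,i*dim3+p)) * R j $$ (m,i*dim3+p')))"
    by (subst (1) sum.swap, subst (2) sum.swap, rule refl)
  also have "\<dots> = (\<Sum>p<dim3. \<Sum>p'<dim3. (cnj (?b \<kappa>' l' p) * ?b \<kappa> l p') * (if p = p' then 1 else 0))"
    unfolding sum_distrib_left[symmetric] using i
    by (intro sum.cong refl) (auto simp: Kraus_orthonormal[OF K one] block_index_less)
  also have "\<dots> = (\<Sum>p<dim3. cnj (?b \<kappa>' l' p) * ?b \<kappa> l p)"
    by (intro sum.cong refl) (simp add: if_distrib cong: if_cong)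
  also have "\<dots> = (\<Sum>p<dim3. of_real ((cmod (\<phi> i $ dig3 d p i))\<^sup>2) * (cnj (V $$ (setdig3 d i p \<kappa>', l')) * V $$ (setdig3 d i p \<kappa>, l)))"
    by (intro sum.cong refl) (simp only: cnj_mult_self[symmetric] complex_cnj_mult ac_simps)
  also have "\<dots> = (\<Sum>p\<in>rest i. cnj (V $$ (setdig3 d i p \<kappa>', l')) * V $$ (setdig3 d i p \<kappa>, l))"
    using i by (intro sum_unit_rest) (auto simp: setdig3_setdig3)
  finally show ?thesis .
qed

text \<open>Trace preservation of the whole channel, applied to the identity on L and expressed by
  Hilbert-Schmidt norms.\<close>

lemma krk_norm:
  assumes K: "\<And>j. j < k \<Longrightarrow> R j \<in> carrier_mat dL (3 * dim3)"
    and one: "msum (3 * dim3) (3 * dim3) k (\<lambda>j. mat_adjoint (R j) * R j) = 1\<^sub>m (3 * dim3)"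
  shows "(\<Sum>j<k. \<Sum>i<3. \<Sum>\<kappa><d i. q i * (\<Sum>m<dL. \<Sum>l<dL. (cmod (krk (R j) i \<kappa> m l))\<^sup>2)) = dL"
proof -
  have 1: "(\<Sum>j<k. \<Sum>m<dL. (cmod (krk (R j) i \<kappa> m l))\<^sup>2) = (\<Sum>p\<in>rest i. (cmod (V $$ (setdig3 d i p \<kappa>, l)))\<^sup>2)"
    if "i < 3" "\<kappa> < d i" for i \<kappa> l
    using krk_gram[OF K one that that(2), of l l] unfolding cnj_mult_self of_real_sum[symmetric] of_real_eq_iff by simp
  have "(\<Sum>j<k. \<Sum>i<3. \<Sum>\<kappa><d i. q i * (\<Sum>m<dL. \<Sum>l<dL. (cmod (krk (R j) i \<kappa> m l))\<^sup>2))
     = (\<Sum>i<3. \<Sum>\<kappa><d i. q i * (\<Sum>j<k. \<Sum>m<dL. \<Sum>l<dL. (cmod (krk (R j) i \<kappa> m l))\<^sup>2))"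
    by (subst sum.swap, subst (2) sum.swap) (simp add: sum_distrib_left)
  also have "\<dots> = (\<Sum>i<3. \<Sum>\<kappa><d i. q i * (\<Sum>l<dL. \<Sum>j<k. \<Sum>m<dL. (cmod (krk (R j) i \<kappa> m l))\<^sup>2))"
    by (subst (4) sum.swap, subst (3) sum.swap, rule refl)
  also have "\<dots> = (\<Sum>i<3. q i * (\<Sum>\<kappa><d i. \<Sum>l<dL. \<Sum>p\<in>rest i. (cmod (V $$ (setdig3 d i p \<kappa>, l)))\<^sup>2))"
  proof (intro sum.cong refl)
    fix i :: nat assume "i \<in> {..<3}"
    hence "(\<Sum>\<kappa><d i. \<Sum>l<dL. \<Sum>j<k. \<Sum>m<dL. (cmod (krk (R j) i \<kappa> m l))\<^sup>2)
      = (\<Sum>\<kappa><d i. \<Sum>l<dL. \<Sum>p\<in>rest i. (cmod (V $$ (setdig3 d i p \<kappa>, l)))\<^sup>2)"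
      by (intro sum.cong refl 1) auto
    thus "(\<Sum>\<kappa><d i. q i * (\<Sum>l<dL. \<Sum>j<k. \<Sum>m<dL. (cmod (krk (R j) i \<kappa> m l))\<^sup>2))
      = q i * (\<Sum>\<kappa><d i. \<Sum>l<dL. \<Sum>p\<in>rest i. (cmod (V $$ (setdig3 d i p \<kappa>, l)))\<^sup>2)"
      by (simp only: sum_distrib_left[symmetric])
  qed
  also have "\<dots> = (\<Sum>i<3. q i * dL)"
  proof (intro sum.cong refl arg_cong2[of _ _ _ _ "(*)"])
    fix i :: nat assume "i \<in> {..<3}"
    hence i: "i < 3" by simp
    have "(\<Sum>\<kappa><d i. \<Sum>l<dL. \<Sum>p\<in>rest i. (cmod (V $$ (setdig3 d i p \<kappa>, l)))\<^sup>2)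
      = (\<Sum>p\<in>rest i. \<Sum>\<kappa><d i. \<Sum>l<dL. (cmod (V $$ (setdig3 d i p \<kappa>, l)))\<^sup>2)"
      by (subst (2) sum.swap, subst (1) sum.swap, rule refl)
    also have "\<dots> = dL"
      using sum_rest[OF i, of "\<lambda>p. \<Sum>l<dL. (cmod (V $$ (p, l)))\<^sup>2"] V_norm by simp
    finally show "(\<Sum>\<kappa><d i. \<Sum>l<dL. \<Sum>p\<in>rest i. (cmod (V $$ (setdig3 d i p \<kappa>, l)))\<^sup>2) = dL" .
  qed
  also have "\<dots> = (q 0 + q 1 + q 2) * dL" by (simp add: numeral_3_eq_3 numeral_2_eq_2 algebra_simps)
  finally show ?thesis unfolding q_sum by simp
qed

text \<open>The fidelity of a recovery is limited by the off-diagonal parts of its Kraus operators, and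
  these must reproduce the dependence of the state of \<open>A_i\<close> on the encoded state.\<close>
lemma fid_le:
  assumes K: "\<And>j. j < k \<Longrightarrow> R j \<in> carrier_mat dL (3 * dim3)"
    and one: "msum (3 * dim3) (3 * dim3) k (\<lambda>j. mat_adjoint (R j) * R j) = 1\<^sub>m (3 * dim3)"
    and i: "i < 3" "\<kappa> < d i" "\<kappa>' < d i" and l: "l < dL" "l' < dL" "l \<noteq> l'"
  shows "fid k R \<le> 1 - (q i * cmod (\<Sum>p\<in>rest i. cnj (V $$ (setdig3 d i p \<kappa>', l')) * V $$ (setdig3 d i p \<kappa>, l)))\<^sup>2 / (4 * (real dL)\<^sup>2)"
proof -
  \<comment> \<open>The weight of the Kraus matrix entries selected by \<open>A\<close>; all entries
    together weigh dL.\<close>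
  define W where "W A = (\<Sum>j<k. \<Sum>i<3. \<Sum>\<kappa><d i. q i * (\<Sum>m<dL. \<Sum>l<dL. if A m l then (cmod (krk (R j) i \<kappa> m l))\<^sup>2 else 0))"
    for A :: "nat \<Rightarrow> nat \<Rightarrow> bool"
  define off where "off = W (\<lambda>m l. m \<noteq> l)"
  have W_all: "W (\<lambda>_ _. True) = dL" unfolding W_def using krk_norm[OF K one] by simp
  have "W (\<lambda>m l. m = l) + off = W (\<lambda>_ _. True)"
    unfolding W_def off_def sum.distrib[symmetric] distrib_left[symmetric]
    by (intro sum.cong refl arg_cong2[of _ _ _ _ "(*)"]) auto
  hence split: "W (\<lambda>m l. m = l) = dL - off" using W_all by simp
  \<comment> \<open>The fidelity sees only traces, hence only diagonal entries, and Cauchy-Schwarz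
    bounds it by their share of the weight. Off-diagonal weight is therefore lost fidelity.\<close>
  have "fid k R \<le> W (\<lambda>m l. m = l) / dL"
  proof -
    have "(cmod (\<Sum>m<dL. krk (R j) i \<kappa> m m))\<^sup>2 \<le> dL * (\<Sum>m<dL. \<Sum>l<dL. if m = l then (cmod (krk (R j) i \<kappa> m l))\<^sup>2 else 0)"
      for j i \<kappa>
    proof -
      have "(cmod (\<Sum>m<dL. krk (R j) i \<kappa> m m))\<^sup>2 \<le> (\<Sum>m<dL. 1 * cmod (krk (R j) i \<kappa> m m))\<^sup>2"
        by (intro power_mono) (auto simp: norm_sum)
      also have "\<dots> \<le> (\<Sum>m<dL. 1\<^sup>2) * (\<Sum>m<dL. (cmod (krk (R j) i \<kappa> m m))\<^sup>2)"
        by (rule Cauchy_Schwarz_ineq_sum)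
      finally show ?thesis by simp
    qed
    hence "(\<Sum>j<k. \<Sum>i<3. \<Sum>\<kappa><d i. q i * (cmod (\<Sum>m<dL. krk (R j) i \<kappa> m m))\<^sup>2) \<le> dL * W (\<lambda>m l. m = l)"
      unfolding W_def sum_distrib_left by (intro sum_mono) (simp add: q_nonneg mult.left_commute[of "real dL"] mult_left_mono sum_distrib_left[symmetric])
    thus ?thesis unfolding fid_def using dL_pos by (simp add: power2_eq_square divide_simps mult.commute)
  qed
  hence fid: "fid k R \<le> 1 - off / dL" unfolding split using dL_pos by (simp add: diff_divide_distrib)
  define nr where "nr \<kappa> l S = (\<Sum>(j,m)\<in>S. (cmod (krk (R j) i \<kappa> m l))\<^sup>2)" for \<kappa> l S
  have nr_le: "q i * nr \<kappa> l S \<le> W A" if "S \<subseteq> {..<k} \<times> {..<dL}" "\<And>j m. (j,m) \<in> S \<Longrightarrow> A m l" "\<kappa> < d i" "l < dL" for \<kappa> l S A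
  proof -
    have "nr \<kappa> l S = (\<Sum>(j,m)\<in>S. if A m l then (cmod (krk (R j) i \<kappa> m l))\<^sup>2 else 0)"
      unfolding nr_def using that(2) by (intro sum.cong) auto
    also have "\<dots> \<le> (\<Sum>(j,m)\<in>{..<k} \<times> {..<dL}. if A m l then (cmod (krk (R j) i \<kappa> m l))\<^sup>2 else 0)"
      using that(1) by (intro sum_mono2) auto
    also have "\<dots> = (\<Sum>j<k. \<Sum>m<dL. if A m l then (cmod (krk (R j) i \<kappa> m l))\<^sup>2 else 0)"
      by (simp add: sum.cartesian_product)
    finally have "q i * nr \<kappa> l S \<le> q i * \<dots>" using q_nonneg i by (intro mult_left_mono) auto
    also have "\<dots> = (\<Sum>j<k. q i * (\<Sum>m<dL. if A m l then (cmod (krk (R j) i \<kappa> m l))\<^sup>2 else 0))"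
      by (rule sum_distrib_left)
    also have "\<dots> \<le> W A"
      unfolding W_def
    proof (intro sum_mono)
      fix j assume "j \<in> {..<k}"
      have "q i * (\<Sum>m<dL. if A m l then (cmod (krk (R j) i \<kappa> m l))\<^sup>2 else 0)
        \<le> q i * (\<Sum>m<dL. \<Sum>l<dL. if A m l then (cmod (krk (R j) i \<kappa> m l))\<^sup>2 else 0)"
        using that(4) q_nonneg[OF i(1)]
        by (intro mult_left_mono sum_mono member_le_sum[of l _ "\<lambda>l. if A _ l then (cmod (krk (R j) i \<kappa> _ l))\<^sup>2 else 0"]) auto
      also have "\<dots> \<le> (\<Sum>\<kappa><d i. q i * (\<Sum>m<dL. \<Sum>l<dL. if A m l then (cmod (krk (R j) i \<kappa> m l))\<^sup>2 else 0))"
        using that(3) q_nonneg[OF i(1)]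
        by (intro member_le_sum[of \<kappa> _ "\<lambda>\<kappa>. q i * (\<Sum>m<dL. \<Sum>l<dL. if A m l then (cmod (krk (R j) i \<kappa> m l))\<^sup>2 else 0)"])
          (auto intro!: mult_nonneg_nonneg sum_nonneg)
      also have "\<dots> \<le> (\<Sum>i<3. \<Sum>\<kappa><d i. q i * (\<Sum>m<dL. \<Sum>l<dL. if A m l then (cmod (krk (R j) i \<kappa> m l))\<^sup>2 else 0))"
        using i(1) q_nonneg
        by (intro member_le_sum[of i _ "\<lambda>i. \<Sum>\<kappa><d i. q i * (\<Sum>m<dL. \<Sum>l<dL. if A m l then (cmod (krk (R j) i \<kappa> m l))\<^sup>2 else 0)"])
          (auto intro!: mult_nonneg_nonneg sum_nonneg)
      finally show "(q i * (\<Sum>m<dL. if A m l then (cmod (krk (R j) i \<kappa> m l))\<^sup>2 else 0))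
        \<le> (\<Sum>i<3. \<Sum>\<kappa><d i. q i * (\<Sum>m<dL. \<Sum>l<dL. if A m l then (cmod (krk (R j) i \<kappa> m l))\<^sup>2 else 0))" .
    qed
    finally show ?thesis .
  qed
  have off0: "0 \<le> off" unfolding off_def W_def using q_nonneg by (auto intro!: sum_nonneg mult_nonneg_nonneg)
  define part where "part S = q i * (\<Sum>(j,m)\<in>S. cmod (krk (R j) i \<kappa>' m l') * cmod (krk (R j) i \<kappa> m l))" for S
  have nr0: "0 \<le> q i * nr \<kappa> l S" for \<kappa> l S
    unfolding nr_def using q_nonneg i by (auto intro!: sum_nonneg mult_nonneg_nonneg)
  have part: "(part S)\<^sup>2 \<le> dL * off" if S: "S \<subseteq> {..<k} \<times> {..<dL}" and
    "(\<forall>(j,m)\<in>S. m \<noteq> l) \<or> (\<forall>(j,m)\<in>S. m \<noteq> l')" for S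
  proof -
    have "(part S)\<^sup>2 \<le> (q i)\<^sup>2 * (nr \<kappa>' l' S * nr \<kappa> l S)"
      unfolding part_def power_mult_distrib nr_def case_prod_unfold
      by (intro mult_left_mono Cauchy_Schwarz_ineq_sum) auto
    also have "\<dots> = (q i * nr \<kappa>' l' S) * (q i * nr \<kappa> l S)" by (simp add: power2_eq_square ac_simps)
    also have "\<dots> \<le> dL * off"
    proof (cases "\<forall>(j,m)\<in>S. m \<noteq> l")
      case True
      have "q i * nr \<kappa>' l' S \<le> W (\<lambda>_ _. True)" "q i * nr \<kappa> l S \<le> off"
        unfolding off_def using True i l by (auto intro!: nr_le[OF S])
      thus ?thesis unfolding W_all using nr0 off0 by (intro mult_mono) auto
    next
      case False
      with that(2) have "\<forall>(j,m)\<in>S. m \<noteq> l'" by blast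
      hence "q i * nr \<kappa>' l' S \<le> off" "q i * nr \<kappa> l S \<le> W (\<lambda>_ _. True)"
        unfolding off_def using i l by (auto intro!: nr_le[OF S])
      hence "(q i * nr \<kappa>' l' S) * (q i * nr \<kappa> l S) \<le> off * dL"
        unfolding W_all using nr0 off0 by (intro mult_mono) auto
      thus ?thesis by (simp add: mult.commute)
    qed
    finally show ?thesis .
  qed
  define x where "x = q i * cmod (\<Sum>p\<in>rest i. cnj (V $$ (setdig3 d i p \<kappa>', l')) * V $$ (setdig3 d i p \<kappa>, l))"
  \<comment> \<open>No m equals both l and l'. On S1 the entry (m,l) is off-diagonal, on S2 the
    entry (m,l') is, so each part of the sum has one factor whose weight is at most
    \<open>off\<close>. Adding the two parts costs the factor 4.\<close>
  define S1 where "S1 = {s \<in> {..<k} \<times> {..<dL}. snd s \<noteq> l}"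
  define S2 where "S2 = {s \<in> {..<k} \<times> {..<dL}. snd s = l}"
  have x0: "0 \<le> x" unfolding x_def using q_nonneg i by auto
  have "x = q i * cmod (\<Sum>j<k. \<Sum>m<dL. cnj (krk (R j) i \<kappa>' m l') * krk (R j) i \<kappa> m l)"
    unfolding x_def using krk_gram[OF K one i, where l = l and l' = l'] by simp
  also have "\<dots> = q i * cmod (\<Sum>(j,m)\<in>{..<k} \<times> {..<dL}. cnj (krk (R j) i \<kappa>' m l') * krk (R j) i \<kappa> m l)"
    unfolding sum.cartesian_product ..
  also have "\<dots> \<le> part ({..<k} \<times> {..<dL})"
    unfolding part_def using q_nonneg[OF i(1)]
    by (intro mult_left_mono order_trans[OF norm_sum])
      (simp_all only: norm_mult case_prod_unfold complex_mod_cnj order_refl)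
  also have "{..<k} \<times> {..<dL} = S1 \<union> S2" unfolding S1_def S2_def by auto
  also have "part (S1 \<union> S2) = part S1 + part S2"
    unfolding part_def distrib_left[symmetric]
    by (subst sum.union_disjoint) (auto simp: S1_def S2_def)
  finally have "x\<^sup>2 \<le> (part S1 + part S2)\<^sup>2" using x0 by (simp add: power_mono)
  also have "\<dots> \<le> 2 * (part S1)\<^sup>2 + 2 * (part S2)\<^sup>2"
    using sum_squares_bound[of "part S1" "part S2"] by (simp add: power2_sum)
  also have "\<dots> \<le> 4 * (dL * off)"
  proof -
    have "(part S1)\<^sup>2 \<le> dL * off" by (rule part) (auto simp: S1_def)
    moreover have "(part S2)\<^sup>2 \<le> dL * off" 
      by (rule part, force simp: S2_def, rule disjI2) (use l in \<open>auto simp: S2_def\<close>)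
    ultimately show ?thesis by simp
  qed
  finally have "x\<^sup>2 / (4 * (real dL)\<^sup>2) \<le> off / dL"
    using dL_pos by (simp add: divide_simps power2_eq_square ac_simps)
  thus ?thesis using fid unfolding x_def by linarith
qed

end

section \<open>The recovery channel\<close>

context erasure_code
begin

lemma is_channelE:
  assumes "is_channel (3 * dim3) dL \<Phi>"
  obtains k R where "\<And>j. j < k \<Longrightarrow> R j \<in> carrier_mat dL (3 * dim3)"
    "msum (3 * dim3) (3 * dim3) k (\<lambda>j. mat_adjoint (R j) * R j) = 1\<^sub>m (3 * dim3)"
    "fidelity (tensor_id (\<Phi> \<circ> noisy) dL dL dL (max_ent dL)) (max_ent dL) = sqrt (fid k R)"
proof -
  from assms obtain k R where K: "\<And>j. j < k \<Longrightarrow> R j \<in> carrier_mat dL (3 * dim3)"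
    "msum (3 * dim3) (3 * dim3) k (\<lambda>j. mat_adjoint (R j) * R j) = 1\<^sub>m (3 * dim3)"
    "\<And>\<rho>. \<rho> \<in> carrier_mat (3 * dim3) (3 * dim3) \<Longrightarrow> \<Phi> \<rho> = msum dL dL k (\<lambda>j. R j * \<rho> * mat_adjoint (R j))"
    unfolding is_channel_def by blast
  show thesis using that[OF K(1,2) fidelity_eq_fid[OF K(1,3)]] K(1) by blast
qed

text \<open>The recovery applies the adjoint of \<open>T_i\<close>, rescaled to a contraction, where \<open>T_i\<close> maps
  \<open>L \<otimes> A_i\<close> to the two remaining subsystems; a further block of Kraus operators, indexed after the
  first \<open>3 * dm\<close>, restores trace preservation.\<close>
lemma recovery_exists:
  assumes t: "\<And>i. i < 3 \<Longrightarrow> 0 < t i"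
    and bound: "\<And>i \<xi>. i < 3 \<Longrightarrow> (\<Sum>p\<in>rest i. (cmod (\<Sum>\<kappa><d i. \<Sum>l<dL. V $$ (setdig3 d i p \<kappa>, l) * \<xi> \<kappa> l))\<^sup>2)
      \<le> t i * (\<Sum>\<kappa><d i. \<Sum>l<dL. (cmod (\<xi> \<kappa> l))\<^sup>2)"
  shows "\<exists>\<Phi>. is_channel (3 * dim3) dL \<Phi> \<and> (\<Sum>i<3. q i / (t i * d i)) \<le>
    (fidelity (tensor_id (\<Phi> \<circ> noisy) dL dL dL (max_ent dL)) (max_ent dL))\<^sup>2"
proof -
  define N where "N = 3 * dim3"
  \<comment> \<open>A common bound for the three dimensions lets the Kraus operators be numbered by
    i * dm + \<alpha>; those with \<alpha> \<ge> d i are zero.\<close>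
  define dm where "dm = d 0 + d 1 + d 2"
  have dm: "d i \<le> dm" if "i < 3" for i
    using that unfolding dm_def by (auto simp: numeral_3_eq_3 less_Suc_eq numeral_2_eq_2)
  have dim3_pos: "0 < dim3" unfolding dim3_def using d_pos by simp
  \<comment> \<open>The \<alpha> component of the adjoint of T_i, preceded by projecting the
    replaced slot onto \<open>\<phi> i\<close>. In \<open>K\<close> it is restricted to the block of
    the flag value i, since the location of the erasure is known.\<close>
  define A where "A i \<alpha> p l = cnj (\<phi> i $ dig3 d p i) * cnj (V $$ (setdig3 d i p \<alpha>, l)) / of_real (sqrt (t i))"
    for i \<alpha> p l
  define K where "K i \<alpha> = mat dL N (\<lambda>(l,x). if \<alpha> < d i \<and> x div dim3 = i then A i \<alpha> (x mod dim3) l else 0)" for i \<alpha>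
  have Kc: "K i \<alpha> \<in> carrier_mat dL N" for i \<alpha> unfolding K_def by simp
  have K_index: "K i \<alpha> $$ (l, i' * dim3 + p) = (if \<alpha> < d i \<and> i' = i then A i \<alpha> p l else 0)"
    if "l < dL" "i' < 3" "p < dim3" for i \<alpha> l i' p
    using that block_index_less[of i' p] unfolding K_def N_def by simp
  have contraction: "(\<Sum>i<3. \<Sum>\<alpha><d i. \<Sum>l<dL. (cmod (\<Sum>x<N. K i \<alpha> $$ (l,x) * v x))\<^sup>2) \<le> (\<Sum>x<N. (cmod (v x))\<^sup>2)" for v
  proof -
    have "(\<Sum>\<alpha><d i. \<Sum>l<dL. (cmod (\<Sum>x<N. K i \<alpha> $$ (l,x) * v x))\<^sup>2) \<le> (\<Sum>p<dim3. (cmod (v (i * dim3 + p)))\<^sup>2)"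
      if i: "i < 3" for i
    proof -
      define u where "u p = (\<Sum>\<kappa><d i. cnj (\<phi> i $ \<kappa>) * v (i * dim3 + setdig3 d i p \<kappa>))" for p
      define T where "T = (\<lambda>(\<kappa>,l) p. V $$ (setdig3 d i p \<kappa>, l))"
      have e: "(\<Sum>x<N. K i \<alpha> $$ (l,x) * v x) = (\<Sum>p\<in>rest i. cnj (T (\<alpha>,l) p) * u p) / of_real (sqrt (t i))"
        if "\<alpha> < d i" "l < dL" for \<alpha> l
      proof -
        have "(\<Sum>x<N. K i \<alpha> $$ (l,x) * v x) = (\<Sum>i'<3. \<Sum>p<dim3. if i' = i then A i \<alpha> p l * v (i * dim3 + p) else 0)"
          unfolding N_def sum_lessThan_mult using that by (intro sum.cong refl) (auto simp: K_index)
        also have "\<dots> = (\<Sum>i'<3. if i' = i then \<Sum>p<dim3. A i \<alpha> p l * v (i * dim3 + p) else 0)"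
          by (intro sum.cong refl) simp
        also have "\<dots> = (\<Sum>p<dim3. A i \<alpha> p l * v (i * dim3 + p))" using i by simp
        also have "\<dots> = (\<Sum>p\<in>rest i. \<Sum>\<kappa><d i. A i \<alpha> (setdig3 d i p \<kappa>) l * v (i * dim3 + setdig3 d i p \<kappa>))"
          by (rule sum_rest[OF i])
        also have "\<dots> = (\<Sum>p\<in>rest i. cnj (T (\<alpha>,l) p) * u p / of_real (sqrt (t i)))"
        proof (intro sum.cong refl)
          fix p assume "p \<in> rest i"
          hence "(\<Sum>\<kappa><d i. A i \<alpha> (setdig3 d i p \<kappa>) l * v (i * dim3 + setdig3 d i p \<kappa>))
            = (\<Sum>\<kappa><d i. cnj (V $$ (setdig3 d i p \<alpha>, l)) * (cnj (\<phi> i $ \<kappa>) * v (i * dim3 + setdig3 d i p \<kappa>)) / of_real (sqrt (t i)))"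
            using i that by (intro sum.cong refl) (auto simp: A_def rest_def dig3_setdig3 setdig3_setdig3)
          thus "(\<Sum>\<kappa><d i. A i \<alpha> (setdig3 d i p \<kappa>) l * v (i * dim3 + setdig3 d i p \<kappa>)) = cnj (T (\<alpha>,l) p) * u p / of_real (sqrt (t i))"
            unfolding u_def T_def by (simp only: sum_distrib_left sum_divide_distrib case_prod_conv)
        qed
        finally show ?thesis by (simp only: sum_divide_distrib)
      qed
      have "(\<Sum>\<alpha><d i. \<Sum>l<dL. (cmod (\<Sum>x<N. K i \<alpha> $$ (l,x) * v x))\<^sup>2)
        = (\<Sum>\<alpha><d i. \<Sum>l<dL. (cmod (\<Sum>p\<in>rest i. cnj (T (\<alpha>,l) p) * u p))\<^sup>2 / t i)"
        using t[OF i] by (intro sum.cong refl) (auto simp: e norm_divide power_divide)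
      also have "\<dots> = (\<Sum>a\<in>{..<d i} \<times> {..<dL}. (cmod (\<Sum>p\<in>rest i. cnj (T a p) * u p))\<^sup>2) / t i"
        unfolding sum.cartesian_product sum_divide_distrib by (simp add: case_prod_unfold)
      also have "(\<Sum>a\<in>{..<d i} \<times> {..<dL}. (cmod (\<Sum>p\<in>rest i. cnj (T a p) * u p))\<^sup>2) \<le> t i * (\<Sum>p\<in>rest i. (cmod (u p))\<^sup>2)"
      proof (rule adjoint_norm_bound)
        fix \<xi> :: "nat \<times> nat \<Rightarrow> complex"
        show "(\<Sum>p\<in>rest i. (cmod (\<Sum>a\<in>{..<d i} \<times> {..<dL}. T a p * \<xi> a))\<^sup>2) \<le> t i * (\<Sum>a\<in>{..<d i} \<times> {..<dL}. (cmod (\<xi> a))\<^sup>2)"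
          using bound[OF i, of "curry \<xi>"] unfolding T_def sum.cartesian_product
          by (simp add: case_prod_unfold)
      qed (use t[OF i] in auto)
      hence "(\<Sum>a\<in>{..<d i} \<times> {..<dL}. (cmod (\<Sum>p\<in>rest i. cnj (T a p) * u p))\<^sup>2) / t i \<le> (\<Sum>p\<in>rest i. (cmod (u p))\<^sup>2)"
        using t[OF i] by (simp add: divide_simps mult.commute)
      also have "\<dots> \<le> (\<Sum>p\<in>rest i. \<Sum>\<kappa><d i. (cmod (v (i * dim3 + setdig3 d i p \<kappa>)))\<^sup>2)"
      proof (intro sum_mono)
        fix p
        have "(cmod (u p))\<^sup>2 \<le> (\<Sum>\<kappa><d i. cmod (\<phi> i $ \<kappa>) * cmod (v (i * dim3 + setdig3 d i p \<kappa>)))\<^sup>2"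
          unfolding u_def by (intro power_mono order_trans[OF norm_sum]) (auto simp: norm_mult)
        also have "\<dots> \<le> (\<Sum>\<kappa><d i. (cmod (\<phi> i $ \<kappa>))\<^sup>2) * (\<Sum>\<kappa><d i. (cmod (v (i * dim3 + setdig3 d i p \<kappa>)))\<^sup>2)"
          by (rule Cauchy_Schwarz_ineq_sum)
        finally show "(cmod (u p))\<^sup>2 \<le> (\<Sum>\<kappa><d i. (cmod (v (i * dim3 + setdig3 d i p \<kappa>)))\<^sup>2)"
          unfolding \<phi>_norm[OF i] by simp
      qed
      also have "\<dots> = (\<Sum>p<dim3. (cmod (v (i * dim3 + p)))\<^sup>2)"
        by (rule sum_rest[OF i, symmetric])
      finally show ?thesis .
    qed
    thus ?thesis unfolding N_def sum_lessThan_mult by (intro sum_mono) auto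
  qed
  define M where "M = mat N N (\<lambda>(x,y). \<Sum>i<3. \<Sum>\<alpha><dm. \<Sum>l<dL. cnj (K i \<alpha> $$ (l,x)) * K i \<alpha> $$ (l,y))"
  \<comment> \<open>The defect in the completeness relation; it is positive because the first family
    is a contraction.\<close>
  define C where "C = 1\<^sub>m N - M"
  have Cc: "C \<in> carrier_mat N N" unfolding C_def M_def by (intro minus_carrier_mat) simp
  have K0: "K i \<alpha> $$ (l,x) = 0" if "d i \<le> \<alpha>" "l < dL" "x < N" for i \<alpha> l x
    using that unfolding K_def by simp
  have M_eq: "M $$ (x,y) = (\<Sum>i<3. \<Sum>\<alpha><d i. \<Sum>l<dL. cnj (K i \<alpha> $$ (l,x)) * K i \<alpha> $$ (l,y))"
    if "x < N" "y < N" for x y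
  proof -
    have "(\<Sum>\<alpha><dm. \<Sum>l<dL. cnj (K i \<alpha> $$ (l,x)) * K i \<alpha> $$ (l,y)) = (\<Sum>\<alpha><d i. \<Sum>l<dL. cnj (K i \<alpha> $$ (l,x)) * K i \<alpha> $$ (l,y))"
      if "i < 3" for i
      using dm[OF that] \<open>x < N\<close> \<open>y < N\<close> by (intro sum.mono_neutral_right) (auto simp: K0)
    thus ?thesis using that unfolding M_def by simp
  qed
  have C_psd: "psd_mat N C"
  proof (rule psd_matI[OF Cc])
    show "C $$ (x,y) = cnj (C $$ (y,x))" if "x < N" "y < N" for x y
      using that unfolding C_def M_def by (simp add: mult.commute)
    fix v
    have "(\<Sum>x<N. \<Sum>y<N. cnj (v x) * C $$ (x,y) * v y)
      = (\<Sum>x<N. \<Sum>y<N. (if y = x then cnj (v x) * v x else 0)) - (\<Sum>x<N. \<Sum>y<N. cnj (v x) * M $$ (x,y) * v y)"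
      unfolding sum_subtractf[symmetric] by (intro sum.cong refl) (auto simp: C_def M_def algebra_simps)
    also have "(\<Sum>x<N. \<Sum>y<N. (if y = x then cnj (v x) * v x else 0)) = of_real (\<Sum>x<N. (cmod (v x))\<^sup>2)"
      unfolding of_real_sum cnj_mult_self[symmetric] by simp
    also have "(\<Sum>x<N. \<Sum>y<N. cnj (v x) * M $$ (x,y) * v y)
      = (\<Sum>x<N. \<Sum>y<N. \<Sum>i<3. \<Sum>\<alpha><d i. \<Sum>l<dL. cnj (K i \<alpha> $$ (l,x) * v x) * (K i \<alpha> $$ (l,y) * v y))"
      by (intro sum.cong refl) (simp add: M_eq sum_distrib_left sum_distrib_right ac_simps)
    also have "\<dots> = (\<Sum>x<N. \<Sum>i<3. \<Sum>\<alpha><d i. \<Sum>l<dL. \<Sum>y<N. cnj (K i \<alpha> $$ (l,x) * v x) * (K i \<alpha> $$ (l,y) * v y))"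
      by (subst (2) sum.swap, subst (3) sum.swap, subst (4) sum.swap, rule refl)
    also have "\<dots> = (\<Sum>i<3. \<Sum>\<alpha><d i. \<Sum>l<dL. \<Sum>x<N. \<Sum>y<N. cnj (K i \<alpha> $$ (l,x) * v x) * (K i \<alpha> $$ (l,y) * v y))"
      by (subst (1) sum.swap, subst (2) sum.swap, subst (3) sum.swap, rule refl)
    also have "\<dots> = (\<Sum>i<3. \<Sum>\<alpha><d i. \<Sum>l<dL. of_real ((cmod (\<Sum>x<N. K i \<alpha> $$ (l,x) * v x))\<^sup>2))"
      unfolding cnj_mult_self[symmetric] cnj_sum sum_product ..
    finally show "0 \<le> Re (\<Sum>x<N. \<Sum>y<N. cnj (v x) * C $$ (x,y) * v y)"
      using contraction[of v] by simp
  qed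
  define B where "B = psd_sqrt C"
  have B: "B \<in> carrier_mat N N" "B * B = C" "\<And>x y. x < N \<Longrightarrow> y < N \<Longrightarrow> B $$ (x,y) = cnj (B $$ (y,x))"
    using psd_sqrt_properties[OF C_psd] psd_matD(1,2) unfolding B_def by blast+
  \<comment> \<open>Row s of the square root of C, followed by preparation of the basis state 0.
    Summed over s these operators contribute B B = C to the completeness relation; their part of the
    fidelity is nonnegative and is discarded.\<close>
  define L where "L s = mat dL N (\<lambda>(l,x). if l = 0 then B $$ (s,x) else 0)" for s
  define R where "R j = (if j < 3 * dm then K (j div dm) (j mod dm) else L (j - 3 * dm))" for j
  have Rc: "R j \<in> carrier_mat dL N" for j unfolding R_def L_def using Kc by auto
  have dm_pos: "0 < dm" unfolding dm_def using d_pos by simp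
  have gram: "(mat_adjoint X * X) $$ (x,y) = (\<Sum>l<dL. cnj (X $$ (l,x)) * X $$ (l,y))"
    if "X \<in> carrier_mat dL N" "x < N" "y < N" for X x y
    using that by (subst mat_mult_index[of _ N dL _ N]) auto
  have one: "msum N N (3 * dm + N) (\<lambda>j. mat_adjoint (R j) * R j) = 1\<^sub>m N"
  proof (rule eq_matI)
    fix x y assume "x < dim_row (1\<^sub>m N :: complex mat)" "y < dim_col (1\<^sub>m N :: complex mat)"
    hence xy: "x < N" "y < N" by auto
    have "msum N N (3 * dm + N) (\<lambda>j. mat_adjoint (R j) * R j) $$ (x,y)
      = (\<Sum>j<3 * dm + N. \<Sum>l<dL. cnj (R j $$ (l,x)) * R j $$ (l,y))"
      unfolding msum_def using xy by (simp add: gram[OF Rc] del: index_mult_mat)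
    also have "\<dots> = (\<Sum>j<3 * dm. \<Sum>l<dL. cnj (R j $$ (l,x)) * R j $$ (l,y))
       + (\<Sum>s<N. \<Sum>l<dL. cnj (R (3 * dm + s) $$ (l,x)) * R (3 * dm + s) $$ (l,y))"
    proof -
      have "(\<Sum>j<a + b. f j) = (\<Sum>j<a. f j) + (\<Sum>s<b. f (a + s))" for a b and f :: "nat \<Rightarrow> complex"
        by (induction b) (simp_all add: add.assoc)
      thus ?thesis .
    qed
    also have "(\<Sum>j<3 * dm. \<Sum>l<dL. cnj (R j $$ (l,x)) * R j $$ (l,y)) = M $$ (x,y)"
    proof -
      have "(\<Sum>j<3 * dm. \<Sum>l<dL. cnj (R j $$ (l,x)) * R j $$ (l,y))
        = (\<Sum>i<3. \<Sum>\<alpha><dm. \<Sum>l<dL. cnj (R (i*dm+\<alpha>) $$ (l,x)) * R (i*dm+\<alpha>) $$ (l,y))"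
        by (rule sum_lessThan_mult)
      also have "\<dots> = M $$ (x,y)"
      proof -
        have "R (i*dm+\<alpha>) = K i \<alpha>" if "i < 3" "\<alpha> < dm" for i \<alpha>
        proof -
          have "i*dm+\<alpha> < Suc i * dm" using that by simp
          also have "\<dots> \<le> 3 * dm" using that by (intro mult_right_mono) auto
          finally show ?thesis using that unfolding R_def by simp
        qed
        thus ?thesis using xy unfolding M_def by simp
      qed
      finally show ?thesis .
    qed
    also have "(\<Sum>s<N. \<Sum>l<dL. cnj (R (3 * dm + s) $$ (l,x)) * R (3 * dm + s) $$ (l,y)) = C $$ (x,y)"
    proof -
      have "(\<Sum>s<N. \<Sum>l<dL. cnj (R (3 * dm + s) $$ (l,x)) * R (3 * dm + s) $$ (l,y))
        = (\<Sum>s<N. \<Sum>l<dL. if l = 0 then B $$ (x,s) * B $$ (s,y) else 0)"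
        unfolding R_def L_def using xy by (intro sum.cong refl) (auto simp: B(3)[symmetric])
      also have "\<dots> = (\<Sum>s<N. B $$ (x,s) * B $$ (s,y))" using dL_pos by simp
      also have "\<dots> = C $$ (x,y)" unfolding B(2)[symmetric] using mat_mult_index[OF B(1) B(1) xy] by simp
      finally show ?thesis .
    qed
    also have "M $$ (x,y) + C $$ (x,y) = 1\<^sub>m N $$ (x,y)" unfolding C_def using xy by (simp add: M_def)
    finally show "msum N N (3 * dm + N) (\<lambda>j. mat_adjoint (R j) * R j) $$ (x,y) = 1\<^sub>m N $$ (x,y)" .
  qed (auto simp: msum_def)
  define \<Phi> where "\<Phi> \<rho> = msum dL dL (3 * dm + N) (\<lambda>j. R j * \<rho> * mat_adjoint (R j))" for \<rho>
  have ch: "is_channel (3 * dim3) dL \<Phi>"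
    unfolding is_channel_def N_def[symmetric]
    by (intro exI[of _ "3 * dm + N"] exI[of _ R]) (use Rc one in \<open>auto simp: \<Phi>_def\<close>)
  have f: "fidelity (tensor_id (\<Phi> \<circ> noisy) dL dL dL (max_ent dL)) (max_ent dL) = sqrt (fid (3 * dm + N) R)"
    by (rule fidelity_eq_fid) (use Rc in \<open>auto simp: \<Phi>_def N_def\<close>)
  \<comment> \<open>The weight of the basis state \<kappa> of A_i, summed over logical states. The
    traced-out state \<kappa> together with the recovery operator of the same index yields the trace
    w / sqrt t.\<close>
  define w where "w i \<kappa> = (\<Sum>p\<in>rest i. \<Sum>m<dL. (cmod (V $$ (setdig3 d i p \<kappa>, m)))\<^sup>2)" for i \<kappa>
  have tr: "(\<Sum>m<dL. krk (K i \<kappa>) i \<kappa> m m) = of_real (w i \<kappa> / sqrt (t i))" if i: "i < 3" and \<kappa>: "\<kappa> < d i" for i \<kappa>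
  proof -
    have "(\<Sum>m<dL. krk (K i \<kappa>) i \<kappa> m m) = (\<Sum>m<dL. \<Sum>p<dim3. of_real ((cmod (\<phi> i $ dig3 d p i))\<^sup>2) *
      of_real ((cmod (V $$ (setdig3 d i p \<kappa>, m)))\<^sup>2 / sqrt (t i)))"
    proof (unfold krk_def, intro sum.cong refl)
      fix m p assume "m \<in> {..<dL}" "p \<in> {..<dim3}"
      hence "K i \<kappa> $$ (m, i * dim3 + p) = A i \<kappa> p m" using i \<kappa> by (simp add: K_index)
      thus "K i \<kappa> $$ (m, i * dim3 + p) * \<phi> i $ dig3 d p i * V $$ (setdig3 d i p \<kappa>, m)
        = of_real ((cmod (\<phi> i $ dig3 d p i))\<^sup>2) * of_real ((cmod (V $$ (setdig3 d i p \<kappa>, m)))\<^sup>2 / sqrt (t i))"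
        unfolding A_def by (simp add: cnj_mult_self[symmetric] del: of_real_power)
    qed
    also have "\<dots> = (\<Sum>m<dL. \<Sum>p\<in>rest i. of_real ((cmod (V $$ (setdig3 d i p \<kappa>, m)))\<^sup>2 / sqrt (t i)))"
      using i \<kappa> by (intro sum.cong refl sum_unit_rest) (auto simp: setdig3_setdig3)
    also have "\<dots> = of_real (w i \<kappa> / sqrt (t i))"
      unfolding w_def by (subst sum.swap) (simp add: sum_divide_distrib)
    finally show ?thesis .
  qed
  have w_sum: "(\<Sum>\<kappa><d i. w i \<kappa>) = dL" if i: "i < 3" for i
  proof -
    have "(\<Sum>\<kappa><d i. w i \<kappa>) = (\<Sum>p\<in>rest i. \<Sum>\<kappa><d i. \<Sum>m<dL. (cmod (V $$ (setdig3 d i p \<kappa>, m)))\<^sup>2)"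
      unfolding w_def by (rule sum.swap)
    thus ?thesis using sum_rest[OF i, of "\<lambda>p. \<Sum>l<dL. (cmod (V $$ (p, l)))\<^sup>2"] V_norm by simp
  qed
  \<comment> \<open>Only the recovery operator whose index agrees with the traced-out state is kept.
    The d i weights sum to dL, so their squares sum to at least dL^2 / d i.\<close>
  have "(\<Sum>i<3. q i / (t i * d i)) * (real dL)\<^sup>2 \<le> (\<Sum>i<3. \<Sum>\<kappa><d i. q i * (w i \<kappa> / sqrt (t i))\<^sup>2)"
    unfolding sum_distrib_right
  proof (intro sum_mono)
    fix i :: nat assume "i \<in> {..<3}"
    hence i: "i < 3" by simp
    have "(real dL)\<^sup>2 = (\<Sum>\<kappa><d i. 1 * w i \<kappa>)\<^sup>2" using w_sum[OF i] by simp
    also have "\<dots> \<le> (\<Sum>\<kappa><d i. 1\<^sup>2) * (\<Sum>\<kappa><d i. (w i \<kappa>)\<^sup>2)" by (rule Cauchy_Schwarz_ineq_sum)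
    finally have "(real dL)\<^sup>2 / d i \<le> (\<Sum>\<kappa><d i. (w i \<kappa>)\<^sup>2)" using d_pos'[OF i] by (simp add: divide_simps mult.commute)
    hence "q i / t i * ((real dL)\<^sup>2 / d i) \<le> q i / t i * (\<Sum>\<kappa><d i. (w i \<kappa>)\<^sup>2)"
      using t[OF i] q_nonneg[OF i] by (intro mult_left_mono) auto
    also have "\<dots> = (\<Sum>\<kappa><d i. q i * (w i \<kappa> / sqrt (t i))\<^sup>2)"
      using t[OF i] by (simp add: sum_distrib_left power_divide)
    finally show "q i / (t i * d i) * (real dL)\<^sup>2 \<le> (\<Sum>\<kappa><d i. q i * (w i \<kappa> / sqrt (t i))\<^sup>2)" by simp
  qed
  also have "\<dots> = (\<Sum>i<3. \<Sum>\<kappa><d i. q i * (cmod (\<Sum>m<dL. krk (K i \<kappa>) i \<kappa> m m))\<^sup>2)"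
    by (intro sum.cong refl) (simp only: tr lessThan_iff norm_of_real power2_abs)
  also have "\<dots> \<le> fid (3 * dm + N) R * (real dL)\<^sup>2"
  proof -
    let ?g = "\<lambda>j i \<kappa>. q i * (cmod (\<Sum>m<dL. krk (R j) i \<kappa> m m))\<^sup>2"
    have g0: "0 \<le> ?g j i \<kappa>" if "i < 3" for j i \<kappa> using q_nonneg[OF that] by simp
    have "(\<Sum>i<3. \<Sum>\<kappa><d i. q i * (cmod (\<Sum>m<dL. krk (K i \<kappa>) i \<kappa> m m))\<^sup>2) \<le> (\<Sum>i<3. \<Sum>\<kappa><d i. \<Sum>j<3 * dm + N. ?g j i \<kappa>)"
    proof (intro sum_mono)
      fix i \<kappa> assume "i \<in> {..<3}" "\<kappa> \<in> {..<d i}"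
      hence i: "i < 3" "\<kappa> < dm" using dm[of i] by auto
      have "i*dm+\<kappa> < Suc i * dm" using i by simp
      also have "\<dots> \<le> 3 * dm" using i by (intro mult_right_mono) auto
      finally have lt: "i*dm+\<kappa> < 3 * dm" .
      hence "R (i*dm+\<kappa>) = K i \<kappa>" using i unfolding R_def by simp
      hence "q i * (cmod (\<Sum>m<dL. krk (K i \<kappa>) i \<kappa> m m))\<^sup>2 = ?g (i*dm+\<kappa>) i \<kappa>" by simp
      also have "\<dots> \<le> (\<Sum>j<3 * dm + N. ?g j i \<kappa>)"
        using lt by (intro member_le_sum[of _ _ "\<lambda>j. ?g j i \<kappa>"] g0 i) auto
      finally show "q i * (cmod (\<Sum>m<dL. krk (K i \<kappa>) i \<kappa> m m))\<^sup>2 \<le> (\<Sum>j<3 * dm + N. ?g j i \<kappa>)" .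
    qed
    also have "\<dots> = (\<Sum>j<3 * dm + N. \<Sum>i<3. \<Sum>\<kappa><d i. ?g j i \<kappa>)"
      by (subst (2) sum.swap, subst (1) sum.swap, rule refl)
    finally show ?thesis unfolding fid_def using dL_pos by simp
  qed
  finally have "(\<Sum>i<3. q i / (t i * d i)) \<le> fid (3 * dm + N) R" using dL_pos by simp
  moreover have "0 \<le> fid (3 * dm + N) R"
    unfolding fid_def using q_nonneg by (auto intro!: sum_nonneg divide_nonneg_nonneg mult_nonneg_nonneg)
  ultimately show ?thesis using ch f by auto
qed

section \<open>Two-sided bounds on the error\<close>

lemma channel_fidelity_le:
  assumes "is_channel (3 * dim3) dL \<Phi>" "i < 3" "\<kappa> < d i" "\<kappa>' < d i" "l < dL" "l' < dL" "l \<noteq> l'"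
  shows "fidelity (tensor_id (\<Phi> \<circ> noisy) dL dL dL (max_ent dL)) (max_ent dL)
    \<le> sqrt (1 - (q i * cmod (\<Sum>p\<in>rest i. cnj (V $$ (setdig3 d i p \<kappa>', l')) * V $$ (setdig3 d i p \<kappa>, l)))\<^sup>2 / (4 * (real dL)\<^sup>2))"
proof -
  obtain k R where R: "\<And>j. j < k \<Longrightarrow> R j \<in> carrier_mat dL (3 * dim3)"
    "msum (3 * dim3) (3 * dim3) k (\<lambda>j. mat_adjoint (R j) * R j) = 1\<^sub>m (3 * dim3)"
    and f: "fidelity (tensor_id (\<Phi> \<circ> noisy) dL dL dL (max_ent dL)) (max_ent dL) = sqrt (fid k R)"
    using is_channelE[OF assms(1)] by blast
  show ?thesis unfolding f real_sqrt_le_iff by (rule fid_le[OF R assms(2-)])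
qed

lemma ent_error_eq: "ent_error dL (3 * (d 0 * d 1 * d 2)) (erasure_noise q d \<phi> \<circ> (\<lambda>\<rho>. V * \<rho> * mat_adjoint V))
  = sqrt (1 - (SUP R \<in> {R. is_channel (3 * dim3) dL R}. fidelity (tensor_id (R \<circ> noisy) dL dL dL (max_ent dL)) (max_ent dL))\<^sup>2)"
  unfolding ent_error_def ent_fidelity_def dim3_def noisy_def ..

text \<open>The supremum over recoveries is controlled only if its set is nonempty and bounded
  above: the constructed recovery gives the former, the uniform bound on all channels the latter.
  The same two facts, squared and subtracted from 1, are the two conclusions.\<close>

lemma ent_error_bounds:
  assumes t: "\<And>i. i < 3 \<Longrightarrow> 0 < t i"
    and bound: "\<And>i \<xi>. i < 3 \<Longrightarrow> (\<Sum>p\<in>rest i. (cmod (\<Sum>\<kappa><d i. \<Sum>l<dL. V $$ (setdig3 d i p \<kappa>, l) * \<xi> \<kappa> l))\<^sup>2)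
      \<le> t i * (\<Sum>\<kappa><d i. \<Sum>l<dL. (cmod (\<xi> \<kappa> l))\<^sup>2)"
    and i: "i < 3" "\<kappa> < d i" "\<kappa>' < d i" and l: "l < dL" "l' < dL" "l \<noteq> l'"
  defines "err \<equiv> ent_error dL (3 * (d 0 * d 1 * d 2)) (erasure_noise q d \<phi> \<circ> (\<lambda>\<rho>. V * \<rho> * mat_adjoint V))"
  shows "err \<le> sqrt (1 - (\<Sum>i<3. q i / (t i * d i)))"
    and "q i * cmod (\<Sum>p\<in>rest i. cnj (V $$ (setdig3 d i p \<kappa>', l')) * V $$ (setdig3 d i p \<kappa>, l)) / (2 * dL) \<le> err"
proof -
  let ?f = "\<lambda>R. fidelity (tensor_id (R \<circ> noisy) dL dL dL (max_ent dL)) (max_ent dL)"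
  let ?S = "{R. is_channel (3 * dim3) dL R}"
  define x where "x = q i * cmod (\<Sum>p\<in>rest i. cnj (V $$ (setdig3 d i p \<kappa>', l')) * V $$ (setdig3 d i p \<kappa>, l))"
  define F where "F = (SUP R \<in> ?S. ?f R)"
  have err: "err = sqrt (1 - F\<^sup>2)" unfolding err_def F_def by (rule ent_error_eq)
  have le: "?f R \<le> sqrt (1 - x\<^sup>2 / (4 * (real dL)\<^sup>2))" if "R \<in> ?S" for R
    unfolding x_def using channel_fidelity_le[OF _ i l] that by blast
  obtain \<Phi> where \<Phi>: "\<Phi> \<in> ?S" "(\<Sum>i<3. q i / (t i * d i)) \<le> (?f \<Phi>)\<^sup>2"
    using recovery_exists[OF t bound] by blast
  have "bdd_above (?f ` ?S)" using le by (auto intro!: bdd_aboveI)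
  hence "?f \<Phi> \<le> F" unfolding F_def using \<Phi>(1) by (intro cSUP_upper) auto
  moreover have "0 \<le> ?f \<Phi>"
  proof -
    obtain k R where "?f \<Phi> = sqrt (fid k R)" using is_channelE \<Phi>(1) by blast
    moreover have "0 \<le> fid k R"
      unfolding fid_def using q_nonneg by (auto intro!: sum_nonneg divide_nonneg_nonneg mult_nonneg_nonneg)
    ultimately show ?thesis by simp
  qed
  ultimately have F: "0 \<le> F" "(?f \<Phi>)\<^sup>2 \<le> F\<^sup>2" by (auto intro: power_mono)
  thus "err \<le> sqrt (1 - (\<Sum>i<3. q i / (t i * d i)))" unfolding err using \<Phi>(2) by simp
  have "F \<le> sqrt (1 - x\<^sup>2 / (4 * (real dL)\<^sup>2))" unfolding F_def using \<Phi>(1) le by (intro cSUP_least) auto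
  moreover from this F(1) have "0 \<le> 1 - x\<^sup>2 / (4 * (real dL)\<^sup>2)" by (meson order_trans real_sqrt_ge_0_iff)
  ultimately have "F\<^sup>2 \<le> 1 - x\<^sup>2 / (4 * (real dL)\<^sup>2)" using F(1) by (metis power_mono real_sqrt_pow2)
  hence "(x / (2 * dL))\<^sup>2 \<le> 1 - F\<^sup>2" by (simp add: power_divide power_mult_distrib)
  moreover have "0 \<le> x / (2 * dL)" unfolding x_def using q_nonneg i by simp
  ultimately show "x / (2 * dL) \<le> err" unfolding err by (simp add: real_le_rsqrt)
qed

end

section \<open>Symmetric powers of unitaries\<close>

text \<open>Multisets index the monomial basis of the n-th symmetric power, words the product basis
  of the n-th tensor power. A multiset stands for the orbit of its words under permutation of
  positions.\<close>

definition types :: "nat \<Rightarrow> nat \<Rightarrow> nat multiset set" where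
  "types d n = {\<alpha>. size \<alpha> = n \<and> set_mset \<alpha> \<subseteq> {..<d}}"

definition words :: "nat \<Rightarrow> nat \<Rightarrow> nat list set" where
  "words d n = {w. length w = n \<and> set w \<subseteq> {..<d}}"

abbreviation "perms \<equiv> permutations_of_multiset"

text \<open>A matrix entry of the tensor power of U. Taking U as a function makes transposition and
  conjugation plain abstractions.\<close>

definition wprod :: "(nat \<Rightarrow> nat \<Rightarrow> complex) \<Rightarrow> nat list \<Rightarrow> nat list \<Rightarrow> complex" where
  "wprod U w u = prod_list (map2 U w u)"

text \<open>A matrix entry of the symmetric power of U in the orthonormal basis of orbit sums; an
  orbit sum has norm \<open>sqrt (card (perms \<alpha>))\<close>.\<close>

definition symk :: "(nat \<Rightarrow> nat \<Rightarrow> complex) \<Rightarrow> nat multiset \<Rightarrow> nat multiset \<Rightarrow> complex" where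
  "symk U \<alpha>' \<alpha> = (\<Sum>w\<in>perms \<alpha>'. \<Sum>u\<in>perms \<alpha>. wprod U w u) / of_real (sqrt (card (perms \<alpha>') * card (perms \<alpha>)))"

lemma mem_perms: "w \<in> perms \<alpha> \<longleftrightarrow> mset w = \<alpha>"
  by (auto simp: permutations_of_multiset_def)

lemma card_perms_pos [simp]: "0 < card (perms \<alpha>)"
  by (simp add: card_gt_0_iff)

lemma finite_words [simp]: "finite (words d n)"
  using finite_lists_length_eq[of "{..<d}" n] unfolding words_def by (simp add: conj_commute)

lemma types_eq_image_words: "types d n = mset ` words d n"
proof
  show "types d n \<subseteq> mset ` words d n"
  proof
    fix \<alpha> assume "\<alpha> \<in> types d n"
    moreover obtain w where "mset w = \<alpha>" using ex_mset by blast
    ultimately show "\<alpha> \<in> mset ` words d n" unfolding types_def words_def by (auto intro!: image_eqI[of _ _ w])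
  qed
qed (auto simp: types_def words_def)

lemma finite_types [simp]: "finite (types d n)"
  unfolding types_eq_image_words by simp

lemma mset_in_types: "w \<in> words d n \<Longrightarrow> mset w \<in> types d n"
  unfolding types_eq_image_words by simp

lemma perms_subset_words: "\<alpha> \<in> types d n \<Longrightarrow> perms \<alpha> \<subseteq> words d n"
  by (auto simp: types_def words_def mem_perms subset_iff)

lemma sum_words_by_type: "(\<Sum>w\<in>words d n. f w) = (\<Sum>\<alpha>\<in>types d n. \<Sum>w\<in>perms \<alpha>. f w)"
proof -
  have "(\<Sum>\<alpha>\<in>types d n. \<Sum>w\<in>perms \<alpha>. f w) = (\<Sum>\<alpha>\<in>mset ` words d n. \<Sum>w\<in>{w \<in> words d n. mset w = \<alpha>}. f w)"
    unfolding types_eq_image_words[symmetric]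
  proof (intro sum.cong refl)
    fix \<alpha> assume "\<alpha> \<in> types d n"
    thus "perms \<alpha> = {w \<in> words d n. mset w = \<alpha>}"
      using perms_subset_words by (auto simp: mem_perms)
  qed
  thus ?thesis using sum.image_gen[of "words d n" f mset] by simp
qed

lemma words_0 [simp]: "words d 0 = {[]}"
  unfolding words_def by auto

lemma sum_words_Suc: "(\<Sum>w\<in>words d (Suc n). f w) = (\<Sum>i<d. \<Sum>w\<in>words d n. f (i # w))"
  unfolding sum.cartesian_product
  by (rule sum.reindex_bij_witness[of _ "\<lambda>(i,w). i # w" "\<lambda>w. (hd w, tl w)"])
    (auto simp: words_def length_Suc_conv)

lemma sum_words_append: "(\<Sum>w\<in>words d (m + n). f w) = (\<Sum>a\<in>words d m. \<Sum>b\<in>words d n. f (a @ b))"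
  by (induction m arbitrary: f) (simp_all add: sum_words_Suc)

lemma wprod_Cons [simp]: "wprod U (i # w) (j # u) = U i j * wprod U w u"
  and wprod_Nil [simp]: "wprod U [] u = 1"
  unfolding wprod_def by simp_all

lemma wprod_append: "length a = length c \<Longrightarrow> wprod U (a @ b) (c @ e) = wprod U a c * wprod U b e"
  unfolding wprod_def by simp

lemma words_induct2 [consumes 2, case_names Nil Cons]:
  assumes "w \<in> words d n" "u \<in> words d n" "P 0 [] []"
    "\<And>n i j w u. i < d \<Longrightarrow> j < d \<Longrightarrow> w \<in> words d n \<Longrightarrow> u \<in> words d n \<Longrightarrow> P n w u \<Longrightarrow> P (Suc n) (i # w) (j # u)"
  shows "P n w u"
  using assms(1,2)
proof (induction n arbitrary: w u)
  case 0
  thus ?case using assms(3) by simp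
next
  case (Suc n)
  then obtain i w' j u' where "w = i # w'" "u = j # u'" by (auto simp: words_def length_Suc_conv)
  thus ?case using Suc assms(4) by (auto simp: words_def)
qed

lemma wprod_cong:
  assumes "w \<in> words d n" "u \<in> words d n" "\<And>i j. i < d \<Longrightarrow> j < d \<Longrightarrow> U i j = W i j"
  shows "wprod U w u = wprod W w u"
  using assms(1,2) by (induction rule: words_induct2) (simp_all add: assms(3))

lemma wprod_mult:
  assumes "w \<in> words d n" "v \<in> words d n"
  shows "wprod (\<lambda>i j. \<Sum>k<d. U i k * W k j) w v = (\<Sum>u\<in>words d n. wprod U w u * wprod W u v)"
  using assms
proof (induction rule: words_induct2)
  case (Cons n i j w v)
  thus ?case by (simp add: sum_words_Suc sum_product ac_simps)
qed simp

lemma wprod_one: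
  assumes "w \<in> words d n" "u \<in> words d n"
  shows "wprod (\<lambda>i j. if i = j then f i else 0) w u = (if w = u then prod_list (map f w) else 0)"
  using assms by (induction rule: words_induct2) auto

lemma wprod_cnj: "wprod (\<lambda>i j. cnj (U i j)) w u = cnj (wprod U w u)"
  unfolding wprod_def by (induction w u rule: list_induct2') auto

lemma wprod_transpose: "wprod (\<lambda>i j. U j i) w u = wprod U u w"
  unfolding wprod_def by (induction w u rule: list_induct2') auto

lemma wprod_permute:
  assumes "length w = length u" "p permutes {..<length u}"
  shows "wprod U (permute_list p w) (permute_list p u) = wprod U w u"
proof -
  have len: "length (zip w u) = length u" using assms(1) by simp
  have "zip (permute_list p w) (permute_list p u) = permute_list p (zip w u)"
    using permute_list_zip[OF assms(2) _ assms(1)] assms(1) by simp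
  hence "wprod U (permute_list p w) (permute_list p u) = prod_mset (image_mset (\<lambda>(x,y). U x y) (mset (permute_list p (zip w u))))"
    unfolding wprod_def by (simp only: prod_mset_prod_list flip: mset_map)
  also have "mset (permute_list p (zip w u)) = mset (zip w u)"
    by (rule mset_permute_list) (use assms(2) in \<open>simp only: len\<close>)
  finally show ?thesis unfolding wprod_def by (simp only: prod_mset_prod_list flip: mset_map)
qed

text \<open>A permutation of positions taking u' to u, applied to both words at once, leaves each
  product unchanged and merely rearranges \<open>perms \<alpha>\<close>.\<close>

lemma sum_wprod_symmetric:
  assumes u: "mset u = mset u'" and \<alpha>: "size \<alpha> = length u"
  shows "(\<Sum>w\<in>perms \<alpha>. wprod U w u) = (\<Sum>w\<in>perms \<alpha>. wprod U w u')"
proof -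
  obtain p where p: "p permutes {..<length u'}" "permute_list p u' = u"
    using mset_eq_permutation[OF u] by blast
  have len: "length u = length u'" using u by (metis size_mset)
  have ip: "inv_into UNIV p permutes {..<length u'}" using p(1) by (rule permutes_inv)
  have id: "permute_list p (permute_list (inv_into UNIV p) w) = w" "permute_list (inv_into UNIV p) (permute_list p w) = w"
    if "length w = length u'" for w :: "nat list"
    using that p(1) ip permute_list_compose[of p w "inv_into UNIV p"] permute_list_compose[of "inv_into UNIV p" w p]
    by (simp_all add: permutes_inv_o)
  have "(\<Sum>w\<in>perms \<alpha>. wprod U w u') = (\<Sum>w\<in>perms \<alpha>. wprod U w u)"
  proof (rule sum.reindex_bij_witness[of _ "permute_list (inv_into UNIV p)" "permute_list p"])
    fix w assume w: "w \<in> perms \<alpha>"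
    hence lw: "length w = length u'" using \<alpha> len by (metis mem_perms size_mset)
    show "permute_list (inv_into UNIV p) (permute_list p w) = w" "permute_list p (permute_list (inv_into UNIV p) w) = w"
      using id lw by auto
    show "permute_list p w \<in> perms \<alpha>" "permute_list (inv_into UNIV p) w \<in> perms \<alpha>"
      using w lw p(1) ip by (auto simp: mem_perms)
    show "wprod U (permute_list p w) u = wprod U w u'"
      unfolding p(2)[symmetric] using lw p(1) by (rule wprod_permute)
  qed
  thus ?thesis by simp
qed

lemma symk_transpose: "symk (\<lambda>i j. U j i) \<alpha>' \<alpha> = symk U \<alpha> \<alpha>'"
  unfolding symk_def wprod_transpose[of U] by (subst sum.swap) (simp only: mult.commute)

lemma symk_cnj: "symk (\<lambda>i j. cnj (U i j)) \<alpha>' \<alpha> = cnj (symk U \<alpha>' \<alpha>)"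
  unfolding symk_def wprod_cnj by simp

lemma symk_cong:
  assumes "\<alpha>' \<in> types d n" "\<alpha> \<in> types d n" "\<And>i j. i < d \<Longrightarrow> j < d \<Longrightarrow> U i j = W i j"
  shows "symk U \<alpha>' \<alpha> = symk W \<alpha>' \<alpha>"
  unfolding symk_def
  by (intro arg_cong2[of _ _ _ _ "(/)"] sum.cong refl wprod_cong[of _ d n] assms(3))
    (use perms_subset_words[OF assms(1)] perms_subset_words[OF assms(2)] in auto)

text \<open>By symmetry the inner sum is the same for every word in the orbit of u, so the double
  sum in \<open>symk\<close> is a multiple of a single one.\<close>

lemma sum_wprod_eq_symk:
  assumes "size \<alpha> = length u"
  shows "(\<Sum>w\<in>perms \<alpha>. wprod U w u) = of_real (sqrt (card (perms \<alpha>) / card (perms (mset u)))) * symk U \<alpha> (mset u)"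
proof -
  let ?a = "real (card (perms \<alpha>))" and ?b = "real (card (perms (mset u)))"
  have pos: "0 < ?a" "0 < ?b" by (simp_all only: of_nat_0_less_iff card_perms_pos)
  have "(\<Sum>w\<in>perms \<alpha>. \<Sum>v\<in>perms (mset u). wprod U w v) = (\<Sum>v\<in>perms (mset u). \<Sum>w\<in>perms \<alpha>. wprod U w u)"
  proof (subst sum.swap, rule sum.cong[OF refl])
    fix v assume "v \<in> perms (mset u)"
    thus "(\<Sum>w\<in>perms \<alpha>. wprod U w v) = (\<Sum>w\<in>perms \<alpha>. wprod U w u)"
      using assms by (intro sum_wprod_symmetric) (auto simp: mem_perms dest: arg_cong[of _ _ size])
  qed
  also have "\<dots> = of_real ?b * (\<Sum>w\<in>perms \<alpha>. wprod U w u)" by simp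
  finally have "of_real (sqrt (?a / ?b)) * symk U \<alpha> (mset u) = of_real (sqrt (?a / ?b) * ?b / sqrt (?a * ?b)) * (\<Sum>w\<in>perms \<alpha>. wprod U w u)"
    unfolding symk_def by simp
  also have "sqrt (?a / ?b) * ?b / sqrt (?a * ?b) = 1"
    using pos by (simp add: real_sqrt_divide real_sqrt_mult field_simps)
  finally show ?thesis by simp
qed

text \<open>Insert all intermediate words and group them by type. Each factor depends on the
  intermediate word only through its type, and the number of words of that type cancels against the
  normalizations.\<close>

lemma symk_mult:
  assumes "\<alpha>' \<in> types d n" "\<alpha>'' \<in> types d n"
  shows "symk (\<lambda>i j. \<Sum>k<d. U i k * W k j) \<alpha>' \<alpha>'' = (\<Sum>\<alpha>\<in>types d n. symk U \<alpha>' \<alpha> * symk W \<alpha> \<alpha>'')"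
proof -
  let ?c = "\<lambda>\<alpha>. real (card (perms \<alpha>))"
  have pos: "0 < ?c \<alpha>" for \<alpha> :: "nat multiset" by (simp only: of_nat_0_less_iff card_perms_pos)
  have "(\<Sum>w\<in>perms \<alpha>'. \<Sum>v\<in>perms \<alpha>''. wprod (\<lambda>i j. \<Sum>k<d. U i k * W k j) w v)
    = (\<Sum>w\<in>perms \<alpha>'. \<Sum>v\<in>perms \<alpha>''. \<Sum>u\<in>words d n. wprod U w u * wprod W u v)"
    using perms_subset_words[OF assms(1)] perms_subset_words[OF assms(2)]
    by (intro sum.cong refl wprod_mult) auto
  also have "\<dots> = (\<Sum>u\<in>words d n. (\<Sum>w\<in>perms \<alpha>'. wprod U w u) * (\<Sum>v\<in>perms \<alpha>''. wprod W u v))"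
    unfolding sum_product by (subst (2) sum.swap, subst (1) sum.swap, rule refl)
  also have "\<dots> = (\<Sum>u\<in>words d n. of_real (sqrt (?c \<alpha>' * ?c \<alpha>'')) * (symk U \<alpha>' (mset u) * symk W (mset u) \<alpha>'') / of_real (?c (mset u)))"
  proof (rule sum.cong[OF refl])
    fix u assume "u \<in> words d n"
    hence sz: "size \<alpha>' = length u" "size \<alpha>'' = length u" using assms by (auto simp: types_def words_def)
    have "(\<Sum>v\<in>perms \<alpha>''. wprod W u v) = of_real (sqrt (?c \<alpha>'' / ?c (mset u))) * symk W (mset u) \<alpha>''"
      using sum_wprod_eq_symk[OF sz(2), of "\<lambda>i j. W j i"]
      unfolding wprod_transpose[of W] symk_transpose[of W] .
    moreover have "sqrt (?c \<alpha>' / ?c (mset u)) * sqrt (?c \<alpha>'' / ?c (mset u)) = sqrt (?c \<alpha>' * ?c \<alpha>'') / ?c (mset u)"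
      by (simp add: real_sqrt_divide real_sqrt_mult)
    hence "complex_of_real (sqrt (?c \<alpha>' / ?c (mset u))) * of_real (sqrt (?c \<alpha>'' / ?c (mset u))) = of_real (sqrt (?c \<alpha>' * ?c \<alpha>'')) / of_real (?c (mset u))"
      by (metis of_real_mult of_real_divide)
    ultimately show "(\<Sum>w\<in>perms \<alpha>'. wprod U w u) * (\<Sum>v\<in>perms \<alpha>''. wprod W u v)
      = of_real (sqrt (?c \<alpha>' * ?c \<alpha>'')) * (symk U \<alpha>' (mset u) * symk W (mset u) \<alpha>'') / of_real (?c (mset u))"
      unfolding sum_wprod_eq_symk[OF sz(1)] by (simp add: divide_simps) (simp add: ac_simps)
  qed
  also have "\<dots> = (\<Sum>\<alpha>\<in>types d n. of_real (sqrt (?c \<alpha>' * ?c \<alpha>'')) * (symk U \<alpha>' \<alpha> * symk W \<alpha> \<alpha>''))"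
    unfolding sum_words_by_type
  proof (rule sum.cong[OF refl])
    fix \<alpha> assume "\<alpha> \<in> types d n"
    have "(\<Sum>u\<in>perms \<alpha>. of_real (sqrt (?c \<alpha>' * ?c \<alpha>'')) * (symk U \<alpha>' (mset u) * symk W (mset u) \<alpha>'') / of_real (?c (mset u)))
      = (\<Sum>u\<in>perms \<alpha>. of_real (sqrt (?c \<alpha>' * ?c \<alpha>'')) * (symk U \<alpha>' \<alpha> * symk W \<alpha> \<alpha>'') / of_real (?c \<alpha>))"
      by (intro sum.cong refl) (simp add: mem_perms)
    thus "(\<Sum>u\<in>perms \<alpha>. of_real (sqrt (?c \<alpha>' * ?c \<alpha>'')) * (symk U \<alpha>' (mset u) * symk W (mset u) \<alpha>'') / of_real (?c (mset u)))
      = of_real (sqrt (?c \<alpha>' * ?c \<alpha>'')) * (symk U \<alpha>' \<alpha> * symk W \<alpha> \<alpha>'')"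
      using pos[of \<alpha>] by simp
  qed
  finally show ?thesis unfolding symk_def[of "\<lambda>i j. \<Sum>k<d. U i k * W k j"]
    unfolding sum_distrib_left[symmetric] using pos by simp
qed

text \<open>The torus acts on the basis vector \<alpha> through the monomial of \<alpha>: the types
  are the weights, and distinct basis vectors have distinct weights.\<close>

lemma symk_diagonal:
  assumes "\<alpha>' \<in> types d n" "\<alpha> \<in> types d n"
  shows "symk (\<lambda>i j. if i = j then f i else 0) \<alpha>' \<alpha> = (if \<alpha>' = \<alpha> then prod_mset (image_mset f \<alpha>) else 0)"
proof -
  have "(\<Sum>w\<in>perms \<alpha>'. \<Sum>u\<in>perms \<alpha>. wprod (\<lambda>i j. if i = j then f i else 0) w u)
    = (\<Sum>w\<in>perms \<alpha>'. \<Sum>u\<in>perms \<alpha>. if u = w then prod_mset (image_mset f \<alpha>) else 0)"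
  proof (intro sum.cong refl)
    fix w u assume wu: "w \<in> perms \<alpha>'" "u \<in> perms \<alpha>"
    have "prod_list (map f u) = prod_mset (image_mset f \<alpha>)"
      using wu(2) by (simp add: mem_perms flip: prod_mset_prod_list)
    thus "wprod (\<lambda>i j. if i = j then f i else 0) w u = (if u = w then prod_mset (image_mset f \<alpha>) else 0)"
      using wu perms_subset_words[OF assms(1)] perms_subset_words[OF assms(2)]
      by (subst wprod_one[of _ d n]) auto
  qed
  also have "\<dots> = (\<Sum>w\<in>perms \<alpha>'. if \<alpha>' = \<alpha> then prod_mset (image_mset f \<alpha>) else 0)"
    by (intro sum.cong refl) (auto simp: mem_perms)
  also have "\<dots> = (if \<alpha>' = \<alpha> then of_nat (card (perms \<alpha>)) * prod_mset (image_mset f \<alpha>) else 0)"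
    by simp
  finally show ?thesis unfolding symk_def by auto
qed

lemma tendsto_wprod:
  assumes "w \<in> words d n" "u \<in> words d n"
    and "\<And>i j. i < d \<Longrightarrow> j < d \<Longrightarrow> (\<lambda>k. X k i j) \<longlonglongrightarrow> U i j"
  shows "(\<lambda>k. wprod (X k) w u) \<longlonglongrightarrow> wprod U w u"
  using assms(1,2)
  by (induction rule: words_induct2) (auto intro!: tendsto_mult assms(3))

lemma tendsto_symk:
  assumes "\<alpha>' \<in> types d n" "\<alpha> \<in> types d n"
    and "\<And>i j. i < d \<Longrightarrow> j < d \<Longrightarrow> (\<lambda>k. X k i j) \<longlonglongrightarrow> U i j"
  shows "(\<lambda>k. symk (X k) \<alpha>' \<alpha>) \<longlonglongrightarrow> symk U \<alpha>' \<alpha>"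
  unfolding symk_def
  by (intro tendsto_divide tendsto_sum tendsto_const tendsto_wprod[of _ d n] assms(3))
    (use perms_subset_words[OF assms(1)] perms_subset_words[OF assms(2)] in \<open>auto simp: less_imp_neq[OF card_perms_pos, symmetric]\<close>)

section \<open>Matrix form of the symmetric power\<close>

definition num_types :: "nat \<Rightarrow> nat \<Rightarrow> nat" where
  "num_types d n = card (types d n)"

text \<open>An arbitrary enumeration of the basis; only its bijectivity is ever used.\<close>

definition type_at :: "nat \<Rightarrow> nat \<Rightarrow> nat \<Rightarrow> nat multiset" where
  "type_at d n = (SOME e. bij_betw e {..<num_types d n} (types d n))"

lemma type_at_bij: "bij_betw (type_at d n) {..<num_types d n} (types d n)"
proof -
  have "\<exists>e. bij_betw e {..<num_types d n} (types d n)"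
    unfolding num_types_def using ex_bij_betw_nat_finite[of "types d n"] by (simp add: atLeast0LessThan)
  thus ?thesis unfolding type_at_def by (rule someI_ex)
qed

lemma type_at_mem: "p < num_types d n \<Longrightarrow> type_at d n p \<in> types d n"
  using type_at_bij bij_betwE by blast

lemma type_at_inject: "p < num_types d n \<Longrightarrow> p' < num_types d n \<Longrightarrow> type_at d n p = type_at d n p' \<longleftrightarrow> p = p'"
  using type_at_bij[of d n] unfolding bij_betw_def inj_on_def by auto

lemma type_at_surj: "\<alpha> \<in> types d n \<Longrightarrow> \<exists>p<num_types d n. type_at d n p = \<alpha>"
  using type_at_bij[of d n] unfolding bij_betw_def by force

lemma sum_type_at: "(\<Sum>p<num_types d n. f (type_at d n p)) = (\<Sum>\<alpha>\<in>types d n. f \<alpha>)"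
  by (rule sum.reindex_bij_betw[OF type_at_bij])

lemma replicate_mset_in_types: "0 < d \<Longrightarrow> replicate_mset n 0 \<in> types d n"
  unfolding types_def by (auto split: if_splits)

lemma num_types_pos: "0 < d \<Longrightarrow> 0 < num_types d n"
  unfolding num_types_def card_gt_0_iff using replicate_mset_in_types by auto

definition sym_rep :: "nat \<Rightarrow> nat \<Rightarrow> complex mat \<Rightarrow> complex mat" where
  "sym_rep d n U = mat (num_types d n) (num_types d n)
     (\<lambda>(p,q). symk (\<lambda>i j. U $$ (i,j)) (type_at d n p) (type_at d n q))"

lemma sym_rep_carrier [simp]: "sym_rep d n U \<in> carrier_mat (num_types d n) (num_types d n)"
  unfolding sym_rep_def by simp

lemma sym_rep_index [simp]: "p < num_types d n \<Longrightarrow> q < num_types d n \<Longrightarrow>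
    sym_rep d n U $$ (p,q) = symk (\<lambda>i j. U $$ (i,j)) (type_at d n p) (type_at d n q)"
  unfolding sym_rep_def by simp

lemma sym_rep_mult:
  assumes "U \<in> carrier_mat d d" "W \<in> carrier_mat d d"
  shows "sym_rep d n (U * W) = sym_rep d n U * sym_rep d n W"
proof (rule eq_matI)
  fix p q assume "p < dim_row (sym_rep d n U * sym_rep d n W)" "q < dim_col (sym_rep d n U * sym_rep d n W)"
  hence pq: "p < num_types d n" "q < num_types d n" by (auto simp: sym_rep_def)
  have "sym_rep d n (U * W) $$ (p,q) = symk (\<lambda>i j. \<Sum>k<d. U $$ (i,k) * W $$ (k,j)) (type_at d n p) (type_at d n q)"
    using pq type_at_mem mat_mult_index[OF assms] by (simp, intro symk_cong[of _ d n]) auto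
  also have "\<dots> = (\<Sum>\<alpha>\<in>types d n. symk (\<lambda>i j. U $$ (i,j)) (type_at d n p) \<alpha> * symk (\<lambda>i j. W $$ (i,j)) \<alpha> (type_at d n q))"
    using pq type_at_mem by (intro symk_mult) auto
  also have "\<dots> = (sym_rep d n U * sym_rep d n W) $$ (p,q)"
    using pq by (subst mat_mult_index[OF sym_rep_carrier sym_rep_carrier]) (simp_all flip: sum_type_at)
  finally show "sym_rep d n (U * W) $$ (p,q) = (sym_rep d n U * sym_rep d n W) $$ (p,q)" .
qed (auto simp: sym_rep_def)

lemma sym_rep_adjoint:
  assumes "U \<in> carrier_mat d d"
  shows "sym_rep d n (mat_adjoint U) = mat_adjoint (sym_rep d n U)"
proof (rule eq_matI)
  fix p q assume "p < dim_row (mat_adjoint (sym_rep d n U))" "q < dim_col (mat_adjoint (sym_rep d n U))"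
  hence pq: "p < num_types d n" "q < num_types d n" by (auto simp: sym_rep_def)
  have "sym_rep d n (mat_adjoint U) $$ (p,q) = symk (\<lambda>i j. cnj (U $$ (j,i))) (type_at d n p) (type_at d n q)"
    using pq type_at_mem assms by (simp, intro symk_cong[of _ d n]) auto
  also have "\<dots> = symk (\<lambda>i j. cnj (U $$ (i,j))) (type_at d n q) (type_at d n p)"
    by (rule symk_transpose)
  also have "\<dots> = cnj (symk (\<lambda>i j. U $$ (i,j)) (type_at d n q) (type_at d n p))"
    by (rule symk_cnj)
  finally show "sym_rep d n (mat_adjoint U) $$ (p,q) = mat_adjoint (sym_rep d n U) $$ (p,q)"
    using pq carrier_matD[OF sym_rep_carrier] by simp
qed (auto simp: sym_rep_def)

lemma sym_rep_diagonal:
  assumes "p < num_types d n" "q < num_types d n"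
  shows "sym_rep d n (mat d d (\<lambda>(i,j). if i = j then f i else 0)) $$ (p,q)
    = (if p = q then prod_mset (image_mset f (type_at d n q)) else 0)"
proof -
  have "symk (\<lambda>i j. mat d d (\<lambda>(i,j). if i = j then f i else 0) $$ (i,j)) (type_at d n p) (type_at d n q)
    = symk (\<lambda>i j. if i = j then f i else 0) (type_at d n p) (type_at d n q)"
    using assms type_at_mem by (intro symk_cong[of _ d n]) auto
  also have "\<dots> = (if p = q then prod_mset (image_mset f (type_at d n q)) else 0)"
    using assms type_at_mem by (subst symk_diagonal[of _ d n]) (auto simp: type_at_inject)
  finally show ?thesis using assms by simp
qed

lemma sym_rep_one: "sym_rep d n (1\<^sub>m d) = 1\<^sub>m (num_types d n)"
proof (rule eq_matI)
  fix p q assume "p < dim_row (1\<^sub>m (num_types d n) :: complex mat)" "q < dim_col (1\<^sub>m (num_types d n) :: complex mat)"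
  hence pq: "p < num_types d n" "q < num_types d n" by auto
  have "1\<^sub>m d = mat d d (\<lambda>(i,j). if i = j then 1 else 0 :: complex)" by (rule eq_matI) auto
  thus "sym_rep d n (1\<^sub>m d) $$ (p,q) = 1\<^sub>m (num_types d n) $$ (p,q)"
    using sym_rep_diagonal[OF pq, of "\<lambda>_. 1"] pq by simp
qed (auto simp: sym_rep_def)

lemma unitary_rep_sym_rep: "unitary_rep d (num_types d n) (sym_rep d n)"
  unfolding unitary_rep_def
proof (intro conjI ballI allI impI)
  fix U assume "U \<in> unitary_group d"
  hence U: "U \<in> carrier_mat d d" "mat_adjoint U * U = 1\<^sub>m d" "U * mat_adjoint U = 1\<^sub>m d"
    unfolding unitary_group_def unitary_mat_def by auto
  show "unitary_mat (num_types d n) (sym_rep d n U)"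
    unfolding unitary_mat_def sym_rep_adjoint[OF U(1), symmetric]
      sym_rep_mult[OF U(1) mat_adjoint_carrier[OF U(1)], symmetric]
      sym_rep_mult[OF mat_adjoint_carrier[OF U(1)] U(1), symmetric] U(2,3) sym_rep_one by simp
next
  fix U W assume "U \<in> unitary_group d" "W \<in> unitary_group d"
  thus "sym_rep d n (U * W) = sym_rep d n U * sym_rep d n W"
    unfolding unitary_group_def unitary_mat_def by (auto intro!: sym_rep_mult)
next
  fix X :: "nat \<Rightarrow> complex mat" and U :: "complex mat" and p q :: nat
  assume "\<forall>i<d. \<forall>j<d. (\<lambda>k. X k $$ (i,j)) \<longlonglongrightarrow> U $$ (i,j)" and pq: "p < num_types d n" "q < num_types d n"
  thus "(\<lambda>k. sym_rep d n (X k) $$ (p,q)) \<longlonglongrightarrow> sym_rep d n U $$ (p,q)"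
    using type_at_mem by (simp, intro tendsto_symk[of _ d n]) auto
qed

section \<open>Irreducibility of the symmetric power\<close>

lemma torus_unitary:
  assumes "\<And>i. i < d \<Longrightarrow> cmod (f i) = 1"
  shows "mat d d (\<lambda>(i,j). if i = j then f i else 0) \<in> unitary_group d"
proof -
  let ?T = "\<lambda>f. mat d d (\<lambda>(i,j). if i = j then f i else 0 :: complex)"
  have TT: "?T f * ?T g = 1\<^sub>m d" if "\<And>i. i < d \<Longrightarrow> f i * g i = 1" for f g
  proof (rule eq_matI)
    fix i j assume "i < dim_row (1\<^sub>m d :: complex mat)" "j < dim_col (1\<^sub>m d :: complex mat)"
    hence ij: "i < d" "j < d" by auto
    have "(?T f * ?T g) $$ (i,j) = (\<Sum>l<d. ?T f $$ (i,l) * ?T g $$ (l,j))"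
      using ij by (intro mat_mult_index) auto
    also have "\<dots> = (\<Sum>l<d. if l = i then (if i = j then f i * g i else 0) else 0)"
      using ij by (intro sum.cong refl) auto
    finally show "(?T f * ?T g) $$ (i,j) = 1\<^sub>m d $$ (i,j)" using ij that by simp
  qed auto
  have adj: "mat_adjoint (?T f) = ?T (\<lambda>i. cnj (f i))" by (rule eq_matI) auto
  have "cnj (f i) * f i = 1" if "i < d" for i using assms[OF that] by (simp add: cnj_mult_self)
  thus ?thesis unfolding unitary_group_def unitary_mat_def mem_Collect_eq adj
    by (auto intro!: TT simp: mult.commute)
qed

text \<open>The reflection \<open>1 - (2/d) J\<close>, with \<open>J\<close> the all-ones matrix, is a unitary without zero
  entries, so its symmetric power connects the highest weight vector to every weight vector.\<close>
definition householder :: "nat \<Rightarrow> complex mat" where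
  "householder d = mat d d (\<lambda>(i,j). (if i = j then 1 else 0) - 2 / of_nat d)"

lemma householder_unitary: "0 < d \<Longrightarrow> householder d \<in> unitary_group d"
proof -
  assume d: "0 < d"
  have H: "householder d \<in> carrier_mat d d" unfolding householder_def by simp
  have adj: "mat_adjoint (householder d) = householder d"
    unfolding householder_def by (rule eq_matI) auto
  have "householder d * householder d = 1\<^sub>m d"
  proof (rule eq_matI)
    fix i j assume "i < dim_row (1\<^sub>m d :: complex mat)" "j < dim_col (1\<^sub>m d :: complex mat)"
    hence ij: "i < d" "j < d" by auto
    define c where "c = 2 / complex_of_nat d"
    have "(householder d * householder d) $$ (i,j)
      = (\<Sum>l<d. ((if i = l then 1 else 0) - c) * ((if l = j then 1 else 0) - c))"
      unfolding mat_mult_index[OF H H ij] using ij by (simp add: householder_def c_def)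
    also have "\<dots> = (\<Sum>l<d. (if l = i then (if i = j then 1 else 0) else 0) - (if l = i then c else 0) - (if l = j then c else 0) + c * c)"
      by (intro sum.cong refl) (auto simp: algebra_simps)
    also have "\<dots> = (if i = j then 1 else 0) - c - c + of_nat d * (c * c)"
      using ij by (simp add: sum.distrib sum_subtractf)
    also have "of_nat d * (c * c) = 2 * c" unfolding c_def using d by simp
    finally show "(householder d * householder d) $$ (i,j) = 1\<^sub>m d $$ (i,j)" using ij by simp
  qed (auto simp: householder_def)
  thus ?thesis unfolding unitary_group_def unitary_mat_def mem_Collect_eq adj using H by auto
qed

text \<open>The diagonal entries 1 - 2/d would vanish at d = 2.\<close>

lemma householder_nonzero: "3 \<le> d \<Longrightarrow> i < d \<Longrightarrow> j < d \<Longrightarrow> householder d $$ (i,j) \<noteq> 0"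
proof -
  assume d: "3 \<le> d" and ij: "i < d" "j < d"
  hence "complex_of_nat d \<noteq> complex_of_nat 2" by (simp only: of_nat_eq_iff)
  thus ?thesis using d ij unfolding householder_def by (auto simp: divide_simps)
qed

text \<open>The type consisting only of 0 has a single word, so all terms of the double sum equal
  the same monomial in the first row of U and nothing can cancel.\<close>

lemma symk_highest_weight_nonzero:
  assumes d: "0 < d" and \<alpha>: "\<alpha> \<in> types d n" and nz: "\<And>j. j < d \<Longrightarrow> U 0 j \<noteq> 0"
  shows "symk U (replicate_mset n 0) \<alpha> \<noteq> 0"
proof -
  have "perms (replicate_mset n 0) = {replicate n (0 :: nat)}"
  proof -
    have "mset w = replicate_mset n 0 \<longleftrightarrow> w = replicate n 0" for w :: "nat list"
    proof
      assume *: "mset w = replicate_mset n 0"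
      have "length w = n" using arg_cong[OF *, of size] by simp
      moreover have "\<forall>x\<in>set w. x = 0" using arg_cong[OF *, of set_mset] by (auto split: if_splits)
      ultimately show "w = replicate n 0" by (metis replicate_eqI)
    qed simp
    thus ?thesis by - (rule Set.set_eqI, simp only: mem_perms singleton_iff)
  qed
  moreover have "wprod U (replicate n 0) u = prod_mset (image_mset (U 0) \<alpha>)" if "u \<in> perms \<alpha>" for u
  proof -
    have "length u = n" "mset u = \<alpha>" using that \<alpha> by (auto simp: mem_perms types_def)
    hence "wprod U (replicate n 0) u = prod_list (map (U 0) u)"
      unfolding wprod_def by (induction u arbitrary: n \<alpha>) auto
    thus ?thesis using \<open>mset u = \<alpha>\<close> by (simp flip: prod_mset_prod_list)
  qed
  ultimately have "(\<Sum>w\<in>perms (replicate_mset n 0). \<Sum>u\<in>perms \<alpha>. wprod U w u)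
     = of_nat (card (perms \<alpha>)) * prod_mset (image_mset (U 0) \<alpha>)" by simp
  moreover have "prod_mset (image_mset (U 0) \<alpha>) \<noteq> 0"
    using \<alpha> nz by (auto simp: types_def prod_mset_zero_iff)
  ultimately show ?thesis unfolding symk_def by (simp add: less_imp_neq[OF card_perms_pos, symmetric])
qed

text \<open>The unit of angle is chosen so that all multiples up to n lie in [0,1], inside the
  interval where the cosine is injective. One such z thus separates all multiplicities that can
  occur.\<close>

lemma cis_power_separates:
  assumes "a \<le> n" "b \<le> n" "a \<noteq> b"
  shows "cis (1 / (real n + 1)) ^ a \<noteq> cis (1 / (real n + 1)) ^ b"
proof
  assume "cis (1 / (real n + 1)) ^ a = cis (1 / (real n + 1)) ^ b"
  hence "Re (cis (real a * (1 / (real n + 1)))) = Re (cis (real b * (1 / (real n + 1))))"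
    unfolding Complex.DeMoivre by (simp only:)
  hence "cos (real a / (real n + 1)) = cos (real b / (real n + 1))" by simp
  moreover have "0 \<le> real x / (real n + 1)" "real x / (real n + 1) \<le> pi" if "x \<le> n" for x
  proof -
    have "real x / (real n + 1) \<le> 1" using that by simp
    thus "real x / (real n + 1) \<le> pi" using pi_gt3 by linarith
  qed simp
  ultimately have "real a / (real n + 1) = real b / (real n + 1)"
    using assms cos_inj_pi[of "real a / (real n + 1)" "real b / (real n + 1)"] by blast
  thus False using assms(3) by (simp add: field_simps)
qed

text \<open>A nonzero invariant subspace contains a weight vector, because torus elements separate
  the weights and allow the other components to be removed one by one. The reflection carries this
  vector to the highest weight and from there to every weight.\<close>

theorem irred_sym_rep:
  assumes d: "3 \<le> d"
  shows "irred_unitary_rep d (num_types d n) (sym_rep d n)"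
  unfolding irred_unitary_rep_def
proof (intro conjI allI impI)
  let ?D = "num_types d n"
  show "unitary_rep d ?D (sym_rep d n)" by (rule unitary_rep_sym_rep)
  show "0 < ?D" using d by (intro num_types_pos) auto
  fix W :: "complex vec set"
  assume sub: "W \<subseteq> carrier_vec ?D" and zero: "0\<^sub>v ?D \<in> W" and add: "\<forall>v\<in>W. \<forall>w\<in>W. v + w \<in> W"
    and smult: "\<forall>c. \<forall>v\<in>W. c \<cdot>\<^sub>v v \<in> W" and inv: "\<forall>U\<in>unitary_group d. \<forall>v\<in>W. sym_rep d n U *\<^sub>v v \<in> W"
  have unit: "unit_vec ?D p \<in> W" if "v \<in> W" "p < ?D" "v $ p \<noteq> 0" for v :: "complex vec" and p
    using that
  proof (induction "card {q. q < ?D \<and> v $ q \<noteq> 0}" arbitrary: v rule: less_induct)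
    case less
    note v = less.prems(1) and p = less.prems(2,3)
    have vc: "v \<in> carrier_vec ?D" using v sub by auto
    show ?case
    proof (cases "\<exists>q<?D. q \<noteq> p \<and> v $ q \<noteq> 0")
      case False
      hence "unit_vec ?D p = (1 / v $ p) \<cdot>\<^sub>v v" using vc p by (intro eq_vecI) auto
      thus ?thesis using smult v by simp
    next
      case True
      then obtain q where q: "q < ?D" "q \<noteq> p" "v $ q \<noteq> 0" by blast
      let ?t = "type_at d n"
      have tp: "?t p \<in> types d n" "?t q \<in> types d n" using p q type_at_mem by auto
      have "?t p \<noteq> ?t q" using p q type_at_inject by auto
      then obtain i where i: "count (?t p) i \<noteq> count (?t q) i" by (meson multiset_eqI)
      have le: "count (?t p) i \<le> n" "count (?t q) i \<le> n"
        using tp count_le_size[of "?t p" i] count_le_size[of "?t q" i] unfolding types_def by auto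
      define z where "z = cis (1 / (real n + 1))"
      \<comment> \<open>The torus element rotates only the coordinate i, whose multiplicity
        distinguishes the types at p and q.\<close>
      define f where "f j = (if j = i then z else 1)" for j
      define T where "T = mat d d (\<lambda>(a,b). if a = b then f a else 0)"
      have T: "T \<in> unitary_group d" unfolding T_def by (rule torus_unitary) (simp add: f_def z_def)
      have char: "prod_mset (image_mset f \<alpha>) = z ^ count \<alpha> i" for \<alpha>
        by (induction \<alpha>) (auto simp: f_def)
      have Tv: "(sym_rep d n T *\<^sub>v v) $ x = z ^ count (?t x) i * v $ x" if "x < ?D" for x
      proof -
        have "(sym_rep d n T *\<^sub>v v) $ x = (\<Sum>y<?D. if y = x then z ^ count (?t x) i * v $ x else 0)"
          unfolding mult_mat_vec_index[OF sym_rep_carrier vc that] T_def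
          using that by (intro sum.cong refl) (auto simp: sym_rep_diagonal char simp del: sym_rep_index)
        thus ?thesis using that by simp
      qed
      \<comment> \<open>Subtracting the eigenvalue at q annihilates the component q and keeps the
        component p, so the support shrinks strictly without losing p.\<close>
      define v' where "v' = sym_rep d n T *\<^sub>v v + (- (z ^ count (?t q) i)) \<cdot>\<^sub>v v"
      have v': "v' \<in> W" unfolding v'_def using inv T v smult add by blast
      have v'x: "v' $ x = (z ^ count (?t x) i - z ^ count (?t q) i) * v $ x" if "x < ?D" for x
        unfolding v'_def using that vc carrier_matD[OF sym_rep_carrier, of d n T]
        by (simp add: Tv algebra_simps del: index_mult_mat_vec)
      have "z ^ count (?t p) i \<noteq> z ^ count (?t q) i"
        unfolding z_def using le i by (rule cis_power_separates)
      hence "v' $ p \<noteq> 0" unfolding v'x[OF p(1)] using p(2) by simp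
      moreover have "card {x. x < ?D \<and> v' $ x \<noteq> 0} < card {x. x < ?D \<and> v $ x \<noteq> 0}"
      proof (rule psubset_card_mono)
        have "{x. x < ?D \<and> v' $ x \<noteq> 0} \<subseteq> {x. x < ?D \<and> v $ x \<noteq> 0}" by (auto simp: v'x)
        moreover have "q \<in> {x. x < ?D \<and> v $ x \<noteq> 0}" using q by simp
        moreover have "q \<notin> {x. x < ?D \<and> v' $ x \<noteq> 0}" using v'x[OF q(1)] by simp
        ultimately show "{x. x < ?D \<and> v' $ x \<noteq> 0} \<subset> {x. x < ?D \<and> v $ x \<noteq> 0}" by blast
      qed simp
      ultimately show ?thesis using less.hyps[OF _ v' p(1)] by blast
    qed
  qed
  show "W = {0\<^sub>v ?D} \<or> W = carrier_vec ?D"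
  proof (cases "W = {0\<^sub>v ?D}")
    case False
    then obtain v where v: "v \<in> W" "v \<noteq> 0\<^sub>v ?D" using zero by blast
    hence vc: "v \<in> carrier_vec ?D" using sub by auto
    hence "\<exists>p<?D. v $ p \<noteq> 0" using v(2) by (metis carrier_vecD eq_vecI index_zero_vec)
    then obtain p where p: "p < ?D" "v $ p \<noteq> 0" by blast
    have d0: "0 < d" using d by simp
    obtain p0 where p0: "p0 < ?D" "type_at d n p0 = replicate_mset n 0"
      using type_at_surj[OF replicate_mset_in_types[OF d0]] by blast
    let ?H = "sym_rep d n (householder d)"
    have H: "householder d \<in> unitary_group d" by (rule householder_unitary[OF d0])
    have col: "(?H *\<^sub>v unit_vec ?D y) $ x = ?H $$ (x,y)" if "x < ?D" "y < ?D" for x y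
    proof -
      have "(?H *\<^sub>v unit_vec ?D y) $ x = (\<Sum>l<?D. if l = y then ?H $$ (x,y) else 0)"
        unfolding mult_mat_vec_index[OF sym_rep_carrier unit_vec_carrier that(1)]
        using that by (intro sum.cong refl) auto
      thus ?thesis using that by simp
    qed
    have Hsym: "symk (\<lambda>i j. householder d $$ (i,j)) \<alpha> \<beta> = symk (\<lambda>i j. householder d $$ (i,j)) \<beta> \<alpha>"
      if "\<alpha> \<in> types d n" "\<beta> \<in> types d n" for \<alpha> \<beta>
    proof -
      have "symk (\<lambda>i j. householder d $$ (i,j)) \<alpha> \<beta> = symk (\<lambda>i j. householder d $$ (j,i)) \<alpha> \<beta>"
        using that by (intro symk_cong[of _ d n]) (auto simp: householder_def)
      also have "\<dots> = symk (\<lambda>i j. householder d $$ (i,j)) \<beta> \<alpha>" by (rule symk_transpose)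
      finally show ?thesis .
    qed
    have nz: "?H $$ (p0,x) \<noteq> 0" "?H $$ (x,p0) \<noteq> 0" if "x < ?D" for x
    proof -
      have "symk (\<lambda>i j. householder d $$ (i,j)) (type_at d n p0) (type_at d n x) \<noteq> 0"
        unfolding p0(2) using d d0 type_at_mem[OF that]
        by (intro symk_highest_weight_nonzero[of d]) (auto simp: householder_nonzero)
      moreover have "symk (\<lambda>i j. householder d $$ (i,j)) (type_at d n x) (type_at d n p0)
        = symk (\<lambda>i j. householder d $$ (i,j)) (type_at d n p0) (type_at d n x)"
        by (intro Hsym type_at_mem that p0)
      ultimately show "?H $$ (p0,x) \<noteq> 0" "?H $$ (x,p0) \<noteq> 0"
        using that p0(1) by simp_all
    qed
    \<comment> \<open>The reflection is applied twice, first to reach p0, then to reach an arbitrary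
      weight. Each time the image has many components, from which \<open>unit\<close> extracts the
      wanted one.\<close>
    have "unit_vec ?D p \<in> W" by (rule unit[OF v(1) p])
    hence "?H *\<^sub>v unit_vec ?D p \<in> W" using inv H by blast
    hence "unit_vec ?D p0 \<in> W" using unit[OF _ p0(1)] col[OF p0(1) p(1)] nz(1)[OF p(1)] by simp
    hence "?H *\<^sub>v unit_vec ?D p0 \<in> W" using inv H by blast
    hence units: "unit_vec ?D x \<in> W" if "x < ?D" for x
      using unit[OF _ that] col[OF that p0(1)] nz(2)[OF that] by simp
    have "x \<in> W" if x: "x \<in> carrier_vec ?D" for x :: "complex vec"
    proof -
      have "m \<le> ?D \<Longrightarrow> vec ?D (\<lambda>i. if i < m then x $ i else 0) \<in> W" for m
      proof (induction m)
        case 0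
        have "vec ?D (\<lambda>i. if i < 0 then x $ i else 0) = 0\<^sub>v ?D" by (intro eq_vecI) auto
        thus ?case using zero by (simp only:)
      next
        case (Suc m)
        have "vec ?D (\<lambda>i. if i < Suc m then x $ i else 0) = vec ?D (\<lambda>i. if i < m then x $ i else 0) + x $ m \<cdot>\<^sub>v unit_vec ?D m"
          by (intro eq_vecI) (auto simp: less_Suc_eq unit_vec_def)
        thus ?case using Suc add smult units[of m] by auto
      qed
      from this[of ?D] have "vec ?D (\<lambda>i. if i < ?D then x $ i else 0) \<in> W" by simp
      moreover have "vec ?D (\<lambda>i. if i < ?D then x $ i else 0) = x" using x by (intro eq_vecI) auto
      ultimately show "x \<in> W" by simp
    qed
    hence "W = carrier_vec ?D" using sub by blast
    thus ?thesis ..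
  qed simp
qed

section \<open>Conjugate representations\<close>

lemma conj_unitary_group: "U \<in> unitary_group d \<Longrightarrow> map_mat cnj U \<in> unitary_group d"
proof -
  assume "U \<in> unitary_group d"
  hence U: "U \<in> carrier_mat d d" "mat_adjoint U * U = 1\<^sub>m d" "U * mat_adjoint U = 1\<^sub>m d"
    unfolding unitary_group_def unitary_mat_def by auto
  have adj: "mat_adjoint (map_mat cnj U) = map_mat cnj (mat_adjoint U)" by (rule eq_matI) auto
  have mult: "map_mat cnj A * map_mat cnj B = map_mat cnj (A * B)" if "A \<in> carrier_mat d d" "B \<in> carrier_mat d d" for A B
    using that by (intro eq_matI) (auto simp: scalar_prod_def)
  have one: "map_mat cnj (1\<^sub>m d) = 1\<^sub>m d" by (rule eq_matI) auto
  show ?thesis unfolding unitary_group_def unitary_mat_def mem_Collect_eq adj using U one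
    by (simp add: mult[OF U(1) mat_adjoint_carrier[OF U(1)]] mult[OF mat_adjoint_carrier[OF U(1)] U(1)])
qed

text \<open>Entrywise conjugation is a continuous involutive automorphism of the unitary group, so
  composing with it leaves the set of operators and hence the invariant subspaces unchanged. It
  provides the dual representation for A_3.\<close>

lemma irred_conj_rep:
  assumes "irred_unitary_rep d n r"
  shows "irred_unitary_rep d n (\<lambda>U. r (map_mat cnj U))"
proof -
  have rep: "unitary_rep d n r" using assms unfolding irred_unitary_rep_def by blast
  have "unitary_rep d n (\<lambda>U. r (map_mat cnj U))"
    unfolding unitary_rep_def
  proof (intro conjI ballI allI impI)
    fix U assume "U \<in> unitary_group d"
    thus "unitary_mat n (r (map_mat cnj U))" using rep conj_unitary_group unfolding unitary_rep_def by blast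
  next
    fix U W assume UW: "U \<in> unitary_group d" "W \<in> unitary_group d"
    hence c: "U \<in> carrier_mat d d" "W \<in> carrier_mat d d" unfolding unitary_group_def unitary_mat_def by auto
    have "map_mat cnj (U * W) = map_mat cnj U * map_mat cnj W"
      using c by (intro eq_matI) (auto simp: scalar_prod_def)
    thus "r (map_mat cnj (U * W)) = r (map_mat cnj U) * r (map_mat cnj W)"
      using rep UW conj_unitary_group unfolding unitary_rep_def by simp
  next
    fix X :: "nat \<Rightarrow> complex mat" and U :: "complex mat" and i j :: nat
    assume X: "\<forall>k. X k \<in> unitary_group d" and U: "U \<in> unitary_group d"
      and lim: "\<forall>i<d. \<forall>j<d. (\<lambda>k. X k $$ (i,j)) \<longlonglongrightarrow> U $$ (i,j)" and ij: "i < n" "j < n"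
    have c: "X k \<in> carrier_mat d d" "U \<in> carrier_mat d d" for k
      using X U unfolding unitary_group_def unitary_mat_def by auto
    have "(\<lambda>k. map_mat cnj (X k) $$ (i,j)) \<longlonglongrightarrow> map_mat cnj U $$ (i,j)" if "i < d" "j < d" for i j
    proof -
      have "(\<lambda>k. cnj (X k $$ (i,j))) \<longlonglongrightarrow> cnj (U $$ (i,j))" using lim that by (intro tendsto_cnj) auto
      moreover have "map_mat cnj (X k) $$ (i,j) = cnj (X k $$ (i,j))" for k
        using carrier_matD[OF c(1)] that by simp
      moreover have "map_mat cnj U $$ (i,j) = cnj (U $$ (i,j))" using c(2) that by simp
      ultimately show ?thesis by simp
    qed
    thus "(\<lambda>k. r (map_mat cnj (X k)) $$ (i,j)) \<longlonglongrightarrow> r (map_mat cnj U) $$ (i,j)"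
      using rep X U ij conj_unitary_group unfolding unitary_rep_def by simp
  qed
  moreover have iff: "(\<forall>U\<in>unitary_group d. \<forall>v\<in>W. r (map_mat cnj U) *\<^sub>v v \<in> W)
    \<longleftrightarrow> (\<forall>U\<in>unitary_group d. \<forall>v\<in>W. r U *\<^sub>v v \<in> W)" for W
  proof -
    have id: "map_mat cnj (map_mat cnj U) = U" for U by (rule eq_matI) auto
    show ?thesis
    proof (intro iffI ballI)
      fix U v assume *: "\<forall>U\<in>unitary_group d. \<forall>v\<in>W. r (map_mat cnj U) *\<^sub>v v \<in> W" "U \<in> unitary_group d" "v \<in> W"
      show "r U *\<^sub>v v \<in> W" using bspec[OF bspec[OF *(1) conj_unitary_group[OF *(2)]] *(3)] unfolding id .
    next
      fix U v assume *: "\<forall>U\<in>unitary_group d. \<forall>v\<in>W. r U *\<^sub>v v \<in> W" "U \<in> unitary_group d" "v \<in> W"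
      show "r (map_mat cnj U) *\<^sub>v v \<in> W" by (rule bspec[OF bspec[OF *(1) conj_unitary_group[OF *(2)]] *(3)])
    qed
  qed
  ultimately show ?thesis unfolding irred_unitary_rep_def iff
    by (intro conjI[OF _ assms[unfolded irred_unitary_rep_def, THEN conjunct2]])
qed

section \<open>Invariant amplitudes and their Gram matrices\<close>

text \<open>This is \<alpha>!, the product of the factorials of the multiplicities, obtained by
  dividing n! by the multinomial coefficient.\<close>

definition fct :: "nat multiset \<Rightarrow> real" where
  "fct \<alpha> = fact (size \<alpha>) / card (perms \<alpha>)"

lemma fct_pos [simp]: "0 < fct \<alpha>"
  unfolding fct_def by (intro divide_pos_pos) (simp_all only: fact_gt_zero of_nat_0_less_iff card_perms_pos)

lemma fct_nonzero [simp]: "fct \<alpha> \<noteq> 0"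
  using fct_pos[of \<alpha>] by linarith

lemma fct_empty [simp]: "fct {#} = 1"
  unfolding fct_def by simp

lemma fct_add [simp]: "fct (add_mset x \<alpha>) = (count \<alpha> x + 1) * fct \<alpha>"
proof -
  have pos: "0 < real (card (perms \<alpha>))" "0 < real (card (perms (add_mset x \<alpha>)))"
    by (simp_all only: of_nat_0_less_iff card_perms_pos)
  have "real (card (perms \<alpha>)) = real (card (perms (add_mset x \<alpha>)) * (count \<alpha> x + 1)) / real (size \<alpha> + 1)"
    using real_card_permutations_of_multiset_remove[of x "add_mset x \<alpha>"] by simp
  hence "(real (size \<alpha>) + 1) / card (perms (add_mset x \<alpha>)) = (real (count \<alpha> x) + 1) / card (perms \<alpha>)"
    using pos by (simp add: divide_simps) (simp add: algebra_simps)
  hence "fact (size \<alpha>) * ((real (size \<alpha>) + 1) / card (perms (add_mset x \<alpha>)))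
    = fact (size \<alpha>) * ((real (count \<alpha> x) + 1) / card (perms \<alpha>))" by simp
  thus ?thesis unfolding fct_def by (simp add: algebra_simps)
qed

lemma abs_fct [simp]: "\<bar>fct \<alpha>\<bar> = fct \<alpha>"
  using fct_pos[of \<alpha>] by linarith

section \<open>Weighted sums over multisets\<close>

lemma add_mset_in_types [simp]: "j < d \<Longrightarrow> add_mset j \<sigma> \<in> types d (Suc n) \<longleftrightarrow> \<sigma> \<in> types d n"
  unfolding types_def by auto

lemma types_0 [simp]: "types d 0 = {{#}}"
  unfolding types_def by auto

lemma union_in_types [intro]: "\<alpha> \<in> types d a \<Longrightarrow> \<beta> \<in> types d b \<Longrightarrow> \<alpha> + \<beta> \<in> types d (a + b)"
  unfolding types_def by auto

lemma sum_count_types: "\<alpha> \<in> types d n \<Longrightarrow> (\<Sum>j<d. count \<alpha> j) = n"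
proof -
  assume "\<alpha> \<in> types d n"
  hence "size \<alpha> = n" "set_mset \<alpha> \<subseteq> {..<d}" unfolding types_def by auto
  thus ?thesis unfolding size_multiset_overloaded_eq
    by (metis (no_types, lifting) finite_lessThan not_in_iff sum.mono_neutral_left DiffD2)
qed

lemma sum_count_types_real: "\<alpha> \<in> types d n \<Longrightarrow> (\<Sum>j<d. real (count \<alpha> j)) = n"
  using sum_count_types[of \<alpha> d n] by (simp flip: of_nat_sum)

text \<open>Differentiation by x_j in the generating function: the multiplicity of j kills the types
  without j, and otherwise cancels the factor by which \<alpha>! exceeds \<sigma>!. The recursions
  for weighted sums below rest on this step.\<close>

lemma sum_types_shift:
  fixes F :: "nat multiset \<Rightarrow> real"
  assumes j: "j < d"
  shows "(\<Sum>\<alpha>\<in>types d (Suc n). count \<alpha> j * F \<alpha> / fct \<alpha>) = (\<Sum>\<sigma>\<in>types d n. F (add_mset j \<sigma>) / fct \<sigma> :: real)"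
proof -
  have "(\<Sum>\<alpha>\<in>types d (Suc n). count \<alpha> j * F \<alpha> / fct \<alpha>)
    = (\<Sum>\<alpha>\<in>add_mset j ` types d n. count \<alpha> j * F \<alpha> / fct \<alpha>)"
  proof (rule sum.mono_neutral_right)
    show "\<forall>\<alpha>\<in>types d (Suc n) - add_mset j ` types d n. count \<alpha> j * F \<alpha> / fct \<alpha> = 0"
    proof
      fix \<alpha> assume \<alpha>: "\<alpha> \<in> types d (Suc n) - add_mset j ` types d n"
      have "j \<notin># \<alpha>"
      proof
        assume "j \<in># \<alpha>"
        then obtain \<sigma> where "\<alpha> = add_mset j \<sigma>" by (metis insert_DiffM)
        thus False using \<alpha> j by auto
      qed
      thus "count \<alpha> j * F \<alpha> / fct \<alpha> = 0" by (simp add: not_in_iff)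
    qed
  qed (use j in auto)
  also have "\<dots> = (\<Sum>\<sigma>\<in>types d n. F (add_mset j \<sigma>) / fct \<sigma>)"
    by (subst sum.reindex) (auto simp: inj_on_def divide_simps)
  finally show ?thesis .
qed

lemma Suc_times_binomial_comp: "Suc k * (n choose Suc k) = (n - k) * (n choose k)"
  using binomial_absorption[of k n] binomial_absorb_comp[of n k] by simp

text \<open>Write m + 1 as the sum of the multiplicities of \<beta> and move one letter j from
  \<beta> to \<sigma>. This replaces \<sigma>! by (\<sigma>_j + 1) \<sigma>!, and since these
  factors sum to p + d, the recursion is that of the binomial coefficient.\<close>

lemma multinomial_sum:
  assumes "\<sigma> \<in> types d p" "0 < d"
  shows "(\<Sum>\<beta>\<in>types d m. fct (\<sigma> + \<beta>) / fct \<beta>) = fct \<sigma> * ((p + d + m - 1) choose m)"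
  using assms(1)
proof (induction m arbitrary: \<sigma> p)
  case (Suc m)
  have "Suc m * (\<Sum>\<beta>\<in>types d (Suc m). fct (\<sigma> + \<beta>) / fct \<beta>)
    = (\<Sum>\<beta>\<in>types d (Suc m). (\<Sum>j<d. real (count \<beta> j)) * fct (\<sigma> + \<beta>) / fct \<beta>)"
    unfolding sum_distrib_left by (intro sum.cong refl) (simp add: sum_count_types_real del: of_nat_Suc)
  also have "\<dots> = (\<Sum>j<d. \<Sum>\<beta>\<in>types d (Suc m). count \<beta> j * fct (\<sigma> + \<beta>) / fct \<beta>)"
    by (subst sum.swap) (simp add: sum_distrib_right sum_divide_distrib)
  also have "\<dots> = (\<Sum>j<d. \<Sum>\<beta>\<in>types d m. fct (add_mset j \<sigma> + \<beta>) / fct \<beta>)"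
  proof (rule sum.cong[OF refl])
    fix j assume "j \<in> {..<d}"
    thus "(\<Sum>\<beta>\<in>types d (Suc m). count \<beta> j * fct (\<sigma> + \<beta>) / fct \<beta>) = (\<Sum>\<beta>\<in>types d m. fct (add_mset j \<sigma> + \<beta>) / fct \<beta>)"
      using sum_types_shift[where n = m and j = j and d = d and F = "\<lambda>\<beta>. fct (\<sigma> + \<beta>)"] by simp
  qed
  also have "\<dots> = (\<Sum>j<d. fct (add_mset j \<sigma>) * ((Suc p + d + m - 1) choose m))"
    using Suc.prems by (intro sum.cong refl Suc.IH) auto
  also have "\<dots> = (\<Sum>j<d. real (count \<sigma> j) + 1) * (fct \<sigma> * ((p + d + m) choose m))"
    unfolding sum_distrib_right by (intro sum.cong refl) simp
  also have "(\<Sum>j<d. real (count \<sigma> j) + 1) = p + d"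
    using sum_count_types_real[OF Suc.prems] by (simp add: sum.distrib)
  also have "real (p + d) * (fct \<sigma> * ((p + d + m) choose m)) = fct \<sigma> * real ((p + d) * ((p + d + m) choose m))"
    by simp
  also have "(p + d) * ((p + d + m) choose m) = Suc m * ((p + d + m) choose Suc m)"
    unfolding Suc_times_binomial_comp by simp
  finally have "real (Suc m) * (\<Sum>\<beta>\<in>types d (Suc m). fct (\<sigma> + \<beta>) / fct \<beta>)
    = real (Suc m) * (fct \<sigma> * ((p + d + m) choose Suc m))" by (simp only: of_nat_mult mult_ac)
  thus ?case unfolding mult_cancel_left by simp
qed simp

lemma card_types:
  assumes "0 < d"
  shows "num_types d n = (d + n - 1) choose n"
proof -
  have "real (num_types d n) = (\<Sum>\<beta>\<in>types d n. fct ({#} + \<beta>) / fct \<beta>)"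
    unfolding num_types_def by simp
  also have "\<dots> = (d + n - 1) choose n"
    using multinomial_sum[of "{#}" d 0 n] assms by simp
  finally show ?thesis by simp
qed

text \<open>With s the sum of the variables, both sides are the coefficient of x^\<eta> in (s^a /
  a!) (s^b / b!). The proof removes one letter of \<alpha> at a time.\<close>

lemma vandermonde_types:
  assumes "\<eta> \<in> types d (a + b)"
  shows "(\<Sum>\<alpha>\<in>types d a. \<Sum>\<beta>\<in>types d b. (if \<alpha> + \<beta> = \<eta> then 1 else 0) / (fct \<alpha> * fct \<beta>)) = ((a + b) choose a) / fct \<eta>"
  using assms
proof (induction a arbitrary: \<eta>)
  case 0
  have "(\<Sum>\<beta>\<in>types d b. (if \<beta> = \<eta> then 1 else 0) / fct \<beta>) = (\<Sum>\<beta>\<in>types d b. if \<beta> = \<eta> then 1 / fct \<eta> else 0)"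
    by (intro sum.cong) auto
  thus ?case using 0 by simp
next
  case (Suc a)
  let ?F = "\<lambda>\<eta> \<alpha>. \<Sum>\<beta>\<in>types d b. (if \<alpha> + \<beta> = \<eta> then 1 else 0) / fct \<beta>"
  have F: "(\<Sum>\<alpha>\<in>types d n. \<Sum>\<beta>\<in>types d b. (if \<alpha> + \<beta> = \<eta> then 1 else 0) / (fct \<alpha> * fct \<beta>))
    = (\<Sum>\<alpha>\<in>types d n. ?F \<eta> \<alpha> / fct \<alpha>)" for n \<eta>
    by (simp add: sum_divide_distrib mult.commute)
  have "Suc a * (\<Sum>\<alpha>\<in>types d (Suc a). ?F \<eta> \<alpha> / fct \<alpha>)
    = (\<Sum>\<alpha>\<in>types d (Suc a). (\<Sum>j<d. real (count \<alpha> j)) * ?F \<eta> \<alpha> / fct \<alpha>)"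
    unfolding sum_distrib_left[of "real (Suc a)"]
    by (intro sum.cong refl) (simp add: sum_count_types_real del: of_nat_Suc)
  also have "\<dots> = (\<Sum>j<d. \<Sum>\<alpha>\<in>types d (Suc a). count \<alpha> j * ?F \<eta> \<alpha> / fct \<alpha>)"
    by (subst sum.swap) (simp add: sum_distrib_right[of _ _ "?F _ _"] sum_divide_distrib[of _ "{..<d}"])
  also have "\<dots> = (\<Sum>j<d. \<Sum>\<sigma>\<in>types d a. ?F \<eta> (add_mset j \<sigma>) / fct \<sigma>)"
    by (rule sum.cong[OF refl], rule sum_types_shift) simp
  also have "\<dots> = (\<Sum>j<d. count \<eta> j * (((a + b) choose a) / fct \<eta>))"
  proof (intro sum.cong refl)
    fix j assume "j \<in> {..<d}"
    show "(\<Sum>\<sigma>\<in>types d a. ?F \<eta> (add_mset j \<sigma>) / fct \<sigma>) = count \<eta> j * (((a + b) choose a) / fct \<eta>)"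
    proof (cases "j \<in># \<eta>")
      case True
      then obtain \<eta>' where \<eta>: "\<eta> = add_mset j \<eta>'" by (metis insert_DiffM)
      hence "\<eta>' \<in> types d (a + b)" using Suc.prems \<open>j \<in> {..<d}\<close> by simp
      hence "(\<Sum>\<sigma>\<in>types d a. ?F \<eta>' \<sigma> / fct \<sigma>) = ((a + b) choose a) / fct \<eta>'"
        using Suc.IH[of \<eta>'] unfolding F by simp
      moreover have "fct \<eta> = (count \<eta>' j + 1) * fct \<eta>'" "count \<eta> j = count \<eta>' j + 1" unfolding \<eta> by simp_all
      ultimately show ?thesis unfolding \<eta> by (simp add: divide_simps)
    next
      case False
      hence "add_mset j \<sigma> + \<beta> \<noteq> \<eta>" for \<sigma> \<beta> by auto
      thus ?thesis using False by (simp add: not_in_iff)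
    qed
  qed
  also have "\<dots> = real (Suc (a + b)) * (((a + b) choose a) / fct \<eta>)"
    unfolding sum_distrib_right[symmetric] using sum_count_types_real[OF Suc.prems] by (simp add: algebra_simps)
  also have "\<dots> = real (Suc (a + b) * ((a + b) choose a)) / fct \<eta>"
    by (simp only: of_nat_mult times_divide_eq_right)
  also have "Suc (a + b) * ((a + b) choose a) = Suc a * (Suc (a + b) choose Suc a)"
    using binomial_absorption[of a "Suc (a + b)"] by simp
  finally have "real (Suc a) * (\<Sum>\<alpha>\<in>types d (Suc a). ?F \<eta> \<alpha> / fct \<alpha>)
    = real (Suc a) * ((Suc (a + b) choose Suc a) / fct \<eta>)" by (simp only: of_nat_mult times_divide_eq_right)
  thus ?case unfolding F mult_cancel_left by simp
qed

section \<open>Gram matrices of the two tensors on L \<otimes> A_1\<close>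

text \<open>Up to a constant, \<open>amp \<alpha> \<beta> \<gamma> j\<close> is the amplitude of \<open>\<alpha> \<otimes> \<beta> \<otimes> \<gamma>\<close>, in the orthonormal bases
  \<open>x\<^sup>\<alpha> / sqrt (\<alpha>!)\<close>, in the invariant tensor \<open>x_j (x \<sqdot> z)\<^sup>n\<^sup>-\<^sup>1 (y \<sqdot> z)\<^sup>m\<close>.\<close>
definition amp :: "nat multiset \<Rightarrow> nat multiset \<Rightarrow> nat multiset \<Rightarrow> nat \<Rightarrow> real" where
  "amp \<alpha> \<beta> \<gamma> j = (if add_mset j \<gamma> = \<alpha> + \<beta> then count \<alpha> j * sqrt (fct \<gamma> / (fct \<alpha> * fct \<beta>)) else 0)"

lemma sqrt_frac: "0 < a \<Longrightarrow> 0 < b \<Longrightarrow> 0 < c \<Longrightarrow> 0 < e \<Longrightarrow>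
  sqrt (a / (b * c)) * sqrt (a / (e * c)) = a / (c * sqrt (b * e))"
  by (simp add: real_sqrt_divide real_sqrt_mult field_simps)

text \<open>The shared \<beta> and \<gamma> occur under both roots, so only the root over \<alpha>
  and \<alpha>' survives. The suffixes 1 and 2, here and in the Gram lemmas, refer to the first
  tensor and to the one with A_1 and A_2 exchanged.\<close>

lemma amp_mult_11: "amp \<alpha> \<beta> \<gamma> j * amp \<alpha>' \<beta> \<gamma> j' = (if add_mset j \<gamma> = \<alpha> + \<beta> \<and> add_mset j' \<gamma> = \<alpha>' + \<beta>
    then count \<alpha> j * count \<alpha>' j' * (fct \<gamma> / (fct \<beta> * sqrt (fct \<alpha> * fct \<alpha>'))) else 0)"
  unfolding amp_def sqrt_frac[OF fct_pos fct_pos fct_pos fct_pos, symmetric] by simp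

lemma amp_mult_12: "amp \<alpha> \<beta> \<gamma> j * amp \<beta> \<alpha>' \<gamma> j' = (if add_mset j \<gamma> = \<alpha> + \<beta> \<and> add_mset j' \<gamma> = \<alpha>' + \<beta>
    then count \<alpha> j * count \<beta> j' * (fct \<gamma> / (fct \<beta> * sqrt (fct \<alpha> * fct \<alpha>'))) else 0)"
  unfolding amp_def sqrt_frac[OF fct_pos fct_pos fct_pos fct_pos, symmetric]
  by (simp add: add.commute mult.commute)

lemma amp_mult_22: "amp \<beta> \<alpha> \<gamma> j * amp \<beta> \<alpha>' \<gamma> j' = (if add_mset j \<gamma> = \<alpha> + \<beta> \<and> add_mset j' \<gamma> = \<alpha>' + \<beta>
    then count \<beta> j * count \<beta> j' * (fct \<gamma> / (fct \<beta> * sqrt (fct \<alpha> * fct \<alpha>'))) else 0)"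
  unfolding amp_def sqrt_frac[OF fct_pos fct_pos fct_pos fct_pos, symmetric]
  by (simp add: add.commute mult.commute)

text \<open>The binomial coefficient in \<open>multinomial_sum\<close>.\<close>
definition hdim :: "nat \<Rightarrow> nat \<Rightarrow> nat \<Rightarrow> real" where
  "hdim d p m = ((p + d + m - 1) choose m)"

text \<open>Gram matrix of the lowering map that sends \<alpha> \<otimes> j to
  \<open>sqrt (count \<alpha> j)\<close> times \<alpha> with one j removed. The condition that both
  removals agree is written additively to avoid truncated subtraction of multisets.\<close>

definition linked :: "nat multiset \<Rightarrow> nat \<Rightarrow> nat multiset \<Rightarrow> nat \<Rightarrow> real" where
  "linked \<alpha> j \<alpha>' j' = (if add_mset j' \<alpha> = add_mset j \<alpha>' then sqrt (count \<alpha> j * count \<alpha>' j') else 0)"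

lemma linked_cases:
  assumes "add_mset j' \<alpha> = add_mset j \<alpha>'" "0 < count \<alpha> j"
  obtains \<sigma> where "\<alpha> = add_mset j \<sigma>" "\<alpha>' = add_mset j' \<sigma>"
proof -
  have "j \<in># \<alpha>" using assms(2) by simp
  then obtain \<sigma> where "\<alpha> = add_mset j \<sigma>" by (metis insert_DiffM)
  moreover from this have "\<alpha>' = add_mset j' \<sigma>" using assms(1) by (simp add: add_mset_commute)
  ultimately show thesis using that by blast
qed

lemma sum_types_delta: "(\<Sum>\<gamma>\<in>types d k. if \<gamma> = \<delta> \<and> P \<gamma> then f \<gamma> else 0) = (if \<delta> \<in> types d k \<and> P \<delta> then f \<delta> else (0 :: real))"
proof -
  have "(\<Sum>\<gamma>\<in>types d k. if \<gamma> = \<delta> \<and> P \<gamma> then f \<gamma> else 0) = (\<Sum>\<gamma>\<in>types d k. if \<gamma> = \<delta> then if P \<delta> then f \<delta> else 0 else 0)"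
    by (intro sum.cong) auto
  thus ?thesis by auto
qed

lemma linked_fct:
  assumes "add_mset j' \<alpha> = add_mset j \<alpha>'"
  shows "count \<alpha> j * fct \<alpha>' / sqrt (fct \<alpha> * fct \<alpha>') = sqrt (count \<alpha> j * count \<alpha>' j')"
proof (cases "count \<alpha> j = 0")
  case False
  then obtain \<sigma> where s: "\<alpha> = add_mset j \<sigma>" "\<alpha>' = add_mset j' \<sigma>" using linked_cases[OF assms] by blast
  define a b where "a = real (count \<alpha> j)" and "b = real (count \<alpha>' j')"
  have ab: "0 < a" "0 < b" unfolding a_def b_def s by simp_all
  have e: "fct \<alpha> = a * fct \<sigma>" "fct \<alpha>' = b * fct \<sigma>" unfolding a_def b_def s by simp_all
  have "a * fct \<sigma> * (b * fct \<sigma>) = (a * b) * (fct \<sigma>)\<^sup>2" by (simp add: power2_eq_square)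
  hence "sqrt (fct \<alpha> * fct \<alpha>') = sqrt (a * b) * fct \<sigma>"
    unfolding e by (simp add: real_sqrt_mult less_imp_le[OF fct_pos])
  hence "a * fct \<alpha>' / sqrt (fct \<alpha> * fct \<alpha>') = (a * b) / sqrt (a * b)" unfolding e(2) by simp
  also have "\<dots> = sqrt (a * b)" using ab by (intro real_div_sqrt) simp
  finally show ?thesis unfolding a_def b_def by simp
qed simp

text \<open>The matching conditions force \<gamma> = \<sigma> + \<beta>, where \<sigma> is \<alpha>
  without j and also \<alpha>' without j'. What is left is a \<open>multinomial_sum\<close> over
  \<beta>. If one of the letters is absent, both sides vanish.\<close>

lemma gram_11:
  assumes \<alpha>: "\<alpha> \<in> types d (Suc n)" "\<alpha>' \<in> types d (Suc n)" and j: "j < d" "j' < d"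
  shows "(\<Sum>\<beta>\<in>types d m. \<Sum>\<gamma>\<in>types d (n + m). amp \<alpha> \<beta> \<gamma> j * amp \<alpha>' \<beta> \<gamma> j') = hdim d n m * linked \<alpha> j \<alpha>' j'"
proof (cases "count \<alpha> j = 0 \<or> count \<alpha>' j' = 0")
  case True
  thus ?thesis by (auto simp: amp_mult_11 linked_def)
next
  case False
  hence "j \<in># \<alpha>" "j' \<in># \<alpha>'" by auto
  then obtain \<sigma> \<sigma>' where s: "\<alpha> = add_mset j \<sigma>" "\<alpha>' = add_mset j' \<sigma>'" by (metis insert_DiffM)
  hence \<sigma>: "\<sigma> \<in> types d n" "\<sigma>' \<in> types d n" using \<alpha> j by auto
  have link: "add_mset j' \<alpha> = add_mset j \<alpha>' \<longleftrightarrow> \<sigma> = \<sigma>'" unfolding s by (simp add: add_mset_commute)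
  define c where "c = count \<alpha> j * count \<alpha>' j' / sqrt (fct \<alpha> * fct \<alpha>')"
  have "(\<Sum>\<beta>\<in>types d m. \<Sum>\<gamma>\<in>types d (n + m). amp \<alpha> \<beta> \<gamma> j * amp \<alpha>' \<beta> \<gamma> j')
    = (\<Sum>\<beta>\<in>types d m. \<Sum>\<gamma>\<in>types d (n + m). if \<gamma> = \<sigma> + \<beta> \<and> \<gamma> = \<sigma>' + \<beta> then c * (fct \<gamma> / fct \<beta>) else 0)"
  proof (intro sum.cong refl)
    fix \<beta> \<gamma>
    have "add_mset j \<gamma> = \<alpha> + \<beta> \<longleftrightarrow> \<gamma> = \<sigma> + \<beta>" "add_mset j' \<gamma> = \<alpha>' + \<beta> \<longleftrightarrow> \<gamma> = \<sigma>' + \<beta>"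
      unfolding s by simp_all
    thus "amp \<alpha> \<beta> \<gamma> j * amp \<alpha>' \<beta> \<gamma> j' = (if \<gamma> = \<sigma> + \<beta> \<and> \<gamma> = \<sigma>' + \<beta> then c * (fct \<gamma> / fct \<beta>) else 0)"
      unfolding amp_mult_11 by (simp only: c_def times_divide_eq_right times_divide_eq_left divide_divide_eq_left mult_ac)
  qed
  also have "\<dots> = (\<Sum>\<beta>\<in>types d m. if \<sigma> = \<sigma>' then c * (fct (\<sigma> + \<beta>) / fct \<beta>) else 0)"
    using \<sigma> by (intro sum.cong refl) (auto simp: sum_types_delta)
  also have "\<dots> = (if \<sigma> = \<sigma>' then c * (fct \<sigma> * hdim d n m) else 0)"
    using multinomial_sum[OF \<sigma>(1), of m] j
    by (cases "\<sigma> = \<sigma>'") (auto simp: hdim_def simp del: times_divide_eq_right simp flip: sum_distrib_left)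
  also have "\<dots> = hdim d n m * linked \<alpha> j \<alpha>' j'"
  proof (cases "\<sigma> = \<sigma>'")
    case True
    have "c * fct \<sigma> = count \<alpha> j * fct \<alpha>' / sqrt (fct \<alpha> * fct \<alpha>')" unfolding c_def s True by (simp add: algebra_simps)
    also have "\<dots> = sqrt (count \<alpha> j * count \<alpha>' j')" using linked_fct link True by blast
    finally show ?thesis using True link by (simp add: linked_def)
  qed (use link in \<open>simp add: linked_def\<close>)
  finally show ?thesis .
qed

lemma shift_condition:
  "(add_mset j \<gamma> = \<alpha> + add_mset j' \<beta> \<and> add_mset j' \<gamma> = \<alpha>' + add_mset j' \<beta>)
    \<longleftrightarrow> (\<gamma> = \<alpha>' + \<beta> \<and> add_mset j' \<alpha> = add_mset j \<alpha>')"
proof -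
  have "add_mset j (\<alpha>' + \<beta>) = \<alpha> + add_mset j' \<beta> \<longleftrightarrow> add_mset j \<alpha>' + \<beta> = add_mset j' \<alpha> + \<beta>" by simp
  also have "\<dots> \<longleftrightarrow> add_mset j' \<alpha> = add_mset j \<alpha>'" unfolding add_right_cancel by auto
  finally show ?thesis by auto
qed

text \<open>The second factor counts letters of \<beta>, so j' is first taken off \<beta> by
  \<open>sum_types_shift\<close>. The remaining conditions again determine \<gamma> and link
  \<alpha> with \<alpha>'.\<close>

lemma gram_12:
  assumes \<alpha>: "\<alpha> \<in> types d n" "\<alpha>' \<in> types d n" and j: "j < d" "j' < d"
  shows "(\<Sum>\<beta>\<in>types d (Suc m). \<Sum>\<gamma>\<in>types d (n + m). amp \<alpha> \<beta> \<gamma> j * amp \<beta> \<alpha>' \<gamma> j') = hdim d n m * linked \<alpha> j \<alpha>' j'"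
proof -
  define c where "c = count \<alpha> j / sqrt (fct \<alpha> * fct \<alpha>')"
  define F where "F \<beta> = (\<Sum>\<gamma>\<in>types d (n + m). if add_mset j \<gamma> = \<alpha> + \<beta> \<and> add_mset j' \<gamma> = \<alpha>' + \<beta> then c * fct \<gamma> else 0)" for \<beta>
  have "(\<Sum>\<beta>\<in>types d (Suc m). \<Sum>\<gamma>\<in>types d (n + m). amp \<alpha> \<beta> \<gamma> j * amp \<beta> \<alpha>' \<gamma> j')
    = (\<Sum>\<beta>\<in>types d (Suc m). count \<beta> j' * F \<beta> / fct \<beta>)"
    unfolding amp_mult_12 F_def sum_distrib_left sum_divide_distrib by (intro sum.cong refl) (auto simp: c_def mult_ac)
  also have "\<dots> = (\<Sum>\<beta>\<in>types d m. F (add_mset j' \<beta>) / fct \<beta>)"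
    by (rule sum_types_shift[OF j(2)])
  also have "\<dots> = (\<Sum>\<beta>\<in>types d m. (\<Sum>\<gamma>\<in>types d (n + m). if \<gamma> = \<alpha>' + \<beta> \<and> add_mset j' \<alpha> = add_mset j \<alpha>' then c * fct \<gamma> else 0) / fct \<beta>)"
    unfolding F_def shift_condition ..
  also have "\<dots> = (\<Sum>\<beta>\<in>types d m. (if add_mset j' \<alpha> = add_mset j \<alpha>' then c else 0) * (fct (\<alpha>' + \<beta>) / fct \<beta>))"
    using \<alpha> by (intro sum.cong refl) (auto simp: sum_types_delta)
  also have "\<dots> = (if add_mset j' \<alpha> = add_mset j \<alpha>' then c else 0) * (fct \<alpha>' * hdim d n m)"
    unfolding sum_distrib_left[symmetric] using multinomial_sum[OF \<alpha>(2), of m] j by (simp add: hdim_def)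
  also have "\<dots> = hdim d n m * linked \<alpha> j \<alpha>' j'"
    using linked_fct[of j' \<alpha> j \<alpha>'] by (auto simp: c_def linked_def)
  finally show ?thesis .
qed

lemma linked_fct_add:
  assumes "add_mset j' \<alpha> = add_mset j \<alpha>'"
  shows "fct (add_mset j \<alpha>') / sqrt (fct \<alpha> * fct \<alpha>') = (if j = j' then 1 else 0) + sqrt (count \<alpha> j * count \<alpha>' j')"
proof (cases "j = j'")
  case True
  hence "\<alpha> = \<alpha>'" using assms by simp
  thus ?thesis using True by (simp add: real_sqrt_mult)
next
  case False
  have "count (add_mset j' \<alpha>) j = count (add_mset j \<alpha>') j" using assms by simp
  hence c: "count \<alpha> j = count \<alpha>' j + 1" using False by simp
  hence "fct (add_mset j \<alpha>') = count \<alpha> j * fct \<alpha>'" by simp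
  thus ?thesis using linked_fct[OF assms] False by simp
qed

text \<open>Both factors count letters of \<beta>. Taking off j' leaves
  \<open>count (add_mset j' \<beta>) j\<close>, a Kronecker delta plus
  \<open>count \<beta> j\<close>, and the latter is shifted once more. This delta and the one in
  \<open>linked_fct_add\<close> together form the scalar part.\<close>

lemma gram_22:
  assumes \<alpha>: "\<alpha> \<in> types d n" "\<alpha>' \<in> types d n" and j: "j < d" "j' < d"
  shows "(\<Sum>\<beta>\<in>types d (Suc (Suc m)). \<Sum>\<gamma>\<in>types d (n + Suc m). amp \<beta> \<alpha> \<gamma> j * amp \<beta> \<alpha>' \<gamma> j')
    = (if \<alpha> = \<alpha>' \<and> j = j' then hdim d n (Suc m) + hdim d (Suc n) m else 0) + hdim d (Suc n) m * linked \<alpha> j \<alpha>' j'"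
proof -
  define c where "c = 1 / sqrt (fct \<alpha> * fct \<alpha>')"
  define L where "L = (if add_mset j' \<alpha> = add_mset j \<alpha>' then 1 else 0 :: real)"
  define F where "F \<beta> = (\<Sum>\<gamma>\<in>types d (n + Suc m). if add_mset j \<gamma> = \<alpha> + \<beta> \<and> add_mset j' \<gamma> = \<alpha>' + \<beta> then c * count \<beta> j * fct \<gamma> else 0)" for \<beta>
  have "(\<Sum>\<beta>\<in>types d (Suc (Suc m)). \<Sum>\<gamma>\<in>types d (n + Suc m). amp \<beta> \<alpha> \<gamma> j * amp \<beta> \<alpha>' \<gamma> j')
    = (\<Sum>\<beta>\<in>types d (Suc (Suc m)). count \<beta> j' * F \<beta> / fct \<beta>)"
    unfolding amp_mult_22 F_def sum_distrib_left sum_divide_distrib by (intro sum.cong refl) (auto simp: c_def mult_ac)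
  also have "\<dots> = (\<Sum>\<beta>\<in>types d (Suc m). F (add_mset j' \<beta>) / fct \<beta>)"
    by (rule sum_types_shift[OF j(2)])
  also have "\<dots> = (\<Sum>\<beta>\<in>types d (Suc m). (\<Sum>\<gamma>\<in>types d (n + Suc m). if \<gamma> = \<alpha>' + \<beta> \<and> add_mset j' \<alpha> = add_mset j \<alpha>' then c * count (add_mset j' \<beta>) j * fct \<gamma> else 0) / fct \<beta>)"
    unfolding F_def shift_condition ..
  also have "\<dots> = (\<Sum>\<beta>\<in>types d (Suc m). c * L * ((if j = j' then 1 else 0) * (fct (\<alpha>' + \<beta>) / fct \<beta>) + count \<beta> j * fct (\<alpha>' + \<beta>) / fct \<beta>))"
  proof (rule sum.cong[OF refl])
    fix \<beta> assume "\<beta> \<in> types d (Suc m)"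
    hence "\<alpha>' + \<beta> \<in> types d (n + Suc m)" using \<alpha> by blast
    thus "(\<Sum>\<gamma>\<in>types d (n + Suc m). if \<gamma> = \<alpha>' + \<beta> \<and> add_mset j' \<alpha> = add_mset j \<alpha>' then c * count (add_mset j' \<beta>) j * fct \<gamma> else 0) / fct \<beta>
      = c * L * ((if j = j' then 1 else 0) * (fct (\<alpha>' + \<beta>) / fct \<beta>) + count \<beta> j * fct (\<alpha>' + \<beta>) / fct \<beta>)"
      unfolding sum_types_delta L_def by (auto simp: algebra_simps add_divide_distrib)
  qed
  also have "\<dots> = c * L * ((if j = j' then 1 else 0) * (\<Sum>\<beta>\<in>types d (Suc m). fct (\<alpha>' + \<beta>) / fct \<beta>) + (\<Sum>\<beta>\<in>types d (Suc m). count \<beta> j * fct (\<alpha>' + \<beta>) / fct \<beta>))"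
    unfolding sum_distrib_left[symmetric] sum.distrib ..
  also have "(\<Sum>\<beta>\<in>types d (Suc m). count \<beta> j * fct (\<alpha>' + \<beta>) / fct \<beta>) = (\<Sum>\<beta>\<in>types d m. fct (add_mset j \<alpha>' + \<beta>) / fct \<beta>)"
    using sum_types_shift[OF j(1), where n = m and F = "\<lambda>\<beta>. fct (\<alpha>' + \<beta>)"] by simp
  also have "\<dots> = fct (add_mset j \<alpha>') * hdim d (Suc n) m"
    using multinomial_sum[of "add_mset j \<alpha>'" d "Suc n" m] \<alpha> j unfolding hdim_def by simp
  also have "(\<Sum>\<beta>\<in>types d (Suc m). fct (\<alpha>' + \<beta>) / fct \<beta>) = fct \<alpha>' * hdim d n (Suc m)"
    using multinomial_sum[OF \<alpha>(2), of "Suc m"] j unfolding hdim_def by simp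
  also have "c * L * ((if j = j' then 1 else 0) * (fct \<alpha>' * hdim d n (Suc m)) + fct (add_mset j \<alpha>') * hdim d (Suc n) m)
    = (if \<alpha> = \<alpha>' \<and> j = j' then hdim d n (Suc m) + hdim d (Suc n) m else 0) + hdim d (Suc n) m * linked \<alpha> j \<alpha>' j'"
  proof (cases "add_mset j' \<alpha> = add_mset j \<alpha>'")
    case False
    thus ?thesis by (auto simp: L_def linked_def)
  next
    case True
    have "c * fct (add_mset j \<alpha>') = (if j = j' then 1 else 0) + linked \<alpha> j \<alpha>' j'"
      using linked_fct_add[OF True] True unfolding c_def linked_def by simp
    moreover have "j = j' \<Longrightarrow> \<alpha> = \<alpha>'" using True by simp
    moreover have "j = j' \<Longrightarrow> c * fct \<alpha>' = 1" using True unfolding c_def by (simp add: real_sqrt_mult less_imp_le[OF fct_pos])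
    moreover have "c * L * ((if j = j' then 1 else 0) * (fct \<alpha>' * hdim d n (Suc m)) + fct (add_mset j \<alpha>') * hdim d (Suc n) m)
      = (if j = j' then 1 else 0) * (c * fct \<alpha>') * hdim d n (Suc m) + (c * fct (add_mset j \<alpha>')) * hdim d (Suc n) m"
      unfolding L_def using True by (simp add: algebra_simps)
    ultimately show ?thesis by (cases "j = j'") (simp_all only: simp_thms if_True if_False, simp_all add: algebra_simps)
  qed
  finally show ?thesis .
qed

section \<open>The relative phase\<close>

definition vand :: "nat \<Rightarrow> nat \<Rightarrow> nat \<Rightarrow> nat multiset \<Rightarrow> real" where
  "vand d a b \<eta> = (\<Sum>\<alpha>\<in>types d a. \<Sum>\<beta>\<in>types d b. (if \<alpha> + \<beta> = \<eta> then 1 else 0) / (fct \<alpha> * fct \<beta>))"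

lemma vand_shift_left:
  fixes f :: "nat multiset \<Rightarrow> nat multiset \<Rightarrow> real"
  assumes "j < d"
  shows "(\<Sum>\<alpha>\<in>types d (Suc a). \<Sum>\<beta>\<in>types d b. (if \<alpha> + \<beta> = \<eta> then count \<alpha> j * f \<alpha> \<beta> else 0) / (fct \<alpha> * fct \<beta>))
    = (\<Sum>\<alpha>\<in>types d a. \<Sum>\<beta>\<in>types d b. (if add_mset j (\<alpha> + \<beta>) = \<eta> then f (add_mset j \<alpha>) \<beta> else 0) / (fct \<alpha> * fct \<beta>))"
proof -
  define F where "F \<alpha> = (\<Sum>\<beta>\<in>types d b. (if \<alpha> + \<beta> = \<eta> then f \<alpha> \<beta> else 0) / fct \<beta>)" for \<alpha>
  have "(\<Sum>\<alpha>\<in>types d (Suc a). \<Sum>\<beta>\<in>types d b. (if \<alpha> + \<beta> = \<eta> then count \<alpha> j * f \<alpha> \<beta> else 0) / (fct \<alpha> * fct \<beta>))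
    = (\<Sum>\<alpha>\<in>types d (Suc a). count \<alpha> j * F \<alpha> / fct \<alpha>)"
    unfolding F_def sum_distrib_left sum_divide_distrib by (intro sum.cong refl) (auto simp: mult_ac)
  also have "\<dots> = (\<Sum>\<alpha>\<in>types d a. F (add_mset j \<alpha>) / fct \<alpha>)"
    by (rule sum_types_shift[OF assms])
  also have "\<dots> = (\<Sum>\<alpha>\<in>types d a. \<Sum>\<beta>\<in>types d b. (if add_mset j (\<alpha> + \<beta>) = \<eta> then f (add_mset j \<alpha>) \<beta> else 0) / (fct \<alpha> * fct \<beta>))"
    unfolding F_def sum_divide_distrib by (intro sum.cong refl) (auto simp: mult_ac)
  finally show ?thesis .
qed

lemma vand_shift_right:
  fixes f :: "nat multiset \<Rightarrow> nat multiset \<Rightarrow> real"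
  assumes "j < d"
  shows "(\<Sum>\<alpha>\<in>types d a. \<Sum>\<beta>\<in>types d (Suc b). (if \<alpha> + \<beta> = \<eta> then count \<beta> j * f \<alpha> \<beta> else 0) / (fct \<alpha> * fct \<beta>))
    = (\<Sum>\<alpha>\<in>types d a. \<Sum>\<beta>\<in>types d b. (if add_mset j (\<alpha> + \<beta>) = \<eta> then f \<alpha> (add_mset j \<beta>) else 0) / (fct \<alpha> * fct \<beta>))"
  using vand_shift_left[OF assms, where a = b and b = a and f = "\<lambda>\<beta> \<alpha>. f \<alpha> \<beta>" and \<eta> = \<eta>]
  by (subst (1 2) sum.swap) (simp add: add.commute mult.commute)

lemma vand_add_mset: "(\<Sum>\<alpha>\<in>types d a. \<Sum>\<beta>\<in>types d b. (if add_mset j (\<alpha> + \<beta>) = \<gamma> then 1 else 0) / (fct \<alpha> * fct \<beta>))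
    = (if j \<in># \<gamma> then vand d a b (\<gamma> - {#j#}) else 0)"
proof (cases "j \<in># \<gamma>")
  case True
  then obtain \<gamma>' where "\<gamma> = add_mset j \<gamma>'" by (metis insert_DiffM)
  thus ?thesis by (simp add: vand_def)
next
  case False
  hence "add_mset j (\<alpha> + \<beta>) \<noteq> \<gamma>" for \<alpha> \<beta> by auto
  thus ?thesis using False by simp
qed

lemma sqrt_frac': "0 < b \<Longrightarrow> sqrt (a / b) * sqrt (e / b) = sqrt (a * e) / b"
  by (simp add: real_sqrt_mult real_sqrt_divide)

lemma amp_mult_3: "amp \<alpha> \<beta> \<gamma> j * amp \<alpha> \<beta> \<gamma>' j' = sqrt (fct \<gamma> * fct \<gamma>') * (if add_mset j \<gamma> = add_mset j' \<gamma>' then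
    (if \<alpha> + \<beta> = add_mset j \<gamma> then real (count \<alpha> j) * count \<alpha> j' else 0) / (fct \<alpha> * fct \<beta>) else 0)"
proof -
  have "sqrt (fct \<gamma> / (fct \<alpha> * fct \<beta>)) * sqrt (fct \<gamma>' / (fct \<alpha> * fct \<beta>)) = sqrt (fct \<gamma> * fct \<gamma>') / (fct \<alpha> * fct \<beta>)"
    by (intro sqrt_frac' mult_pos_pos) simp_all
  note key = this
  have "(x * sqrt (fct \<gamma> / (fct \<alpha> * fct \<beta>))) * (y * sqrt (fct \<gamma>' / (fct \<alpha> * fct \<beta>)))
    = sqrt (fct \<gamma> * fct \<gamma>') * ((x * y) / (fct \<alpha> * fct \<beta>))" for x y
  proof -
    have r: "(x * a) * (y * b) = (a * b) * (x * y)" for a b :: real by simp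
    show ?thesis unfolding r key by simp
  qed
  thus ?thesis unfolding amp_def by simp
qed

lemma amp_mult_3': "amp \<alpha> \<beta> \<gamma> j * amp \<beta> \<alpha> \<gamma>' j' = sqrt (fct \<gamma> * fct \<gamma>') * (if add_mset j \<gamma> = add_mset j' \<gamma>' then
    (if \<alpha> + \<beta> = add_mset j \<gamma> then real (count \<alpha> j) * count \<beta> j' else 0) / (fct \<alpha> * fct \<beta>) else 0)"
proof -
  have "sqrt (fct \<gamma> / (fct \<alpha> * fct \<beta>)) * sqrt (fct \<gamma>' / (fct \<beta> * fct \<alpha>)) = sqrt (fct \<gamma> * fct \<gamma>') / (fct \<alpha> * fct \<beta>)"
    unfolding mult.commute[of "fct \<beta>"] by (intro sqrt_frac' mult_pos_pos) simp_all
  note key = this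
  have "(x * sqrt (fct \<gamma> / (fct \<alpha> * fct \<beta>))) * (y * sqrt (fct \<gamma>' / (fct \<beta> * fct \<alpha>)))
    = sqrt (fct \<gamma> * fct \<gamma>') * ((x * y) / (fct \<alpha> * fct \<beta>))" for x y
  proof -
    have r: "(x * a) * (y * b) = (a * b) * (x * y)" for a b :: real by simp
    show ?thesis unfolding r key by simp
  qed
  thus ?thesis unfolding amp_def by (simp add: add.commute[of \<beta>])
qed

text \<open>Both removed letters come from \<alpha>. After j is removed, the multiplicity of j' is a
  Kronecker delta plus that in the remainder: the delta gives the desired scalar part, the other
  term is the coupling that has to be cancelled.\<close>

lemma gram_3_same:
  assumes j: "j < d" "j' < d"
  shows "(\<Sum>\<alpha>\<in>types d (Suc (Suc a)). \<Sum>\<beta>\<in>types d b. (if \<alpha> + \<beta> = add_mset j \<gamma> then real (count \<alpha> j) * count \<alpha> j' else 0) / (fct \<alpha> * fct \<beta>))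
    = (if j = j' then vand d (Suc a) b \<gamma> else 0) + (if j' \<in># \<gamma> then vand d a b (\<gamma> - {#j'#}) else 0)"
proof -
  have "(\<Sum>\<alpha>\<in>types d (Suc (Suc a)). \<Sum>\<beta>\<in>types d b. (if \<alpha> + \<beta> = add_mset j \<gamma> then real (count \<alpha> j) * count \<alpha> j' else 0) / (fct \<alpha> * fct \<beta>))
    = (\<Sum>\<alpha>\<in>types d (Suc a). \<Sum>\<beta>\<in>types d b. (if \<alpha> + \<beta> = \<gamma> then real (count (add_mset j \<alpha>) j') else 0) / (fct \<alpha> * fct \<beta>))"
    by (subst vand_shift_left[OF j(1)]) simp
  also have "\<dots> = (\<Sum>\<alpha>\<in>types d (Suc a). \<Sum>\<beta>\<in>types d b. (if j = j' then 1 else 0) * ((if \<alpha> + \<beta> = \<gamma> then 1 else 0) / (fct \<alpha> * fct \<beta>))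
       + (if \<alpha> + \<beta> = \<gamma> then real (count \<alpha> j') * 1 else 0) / (fct \<alpha> * fct \<beta>))"
    by (intro sum.cong refl) (auto simp: add_divide_distrib)
  also have "\<dots> = (if j = j' then 1 else 0) * vand d (Suc a) b \<gamma>
    + (\<Sum>\<alpha>\<in>types d (Suc a). \<Sum>\<beta>\<in>types d b. (if \<alpha> + \<beta> = \<gamma> then real (count \<alpha> j') * 1 else 0) / (fct \<alpha> * fct \<beta>))"
    unfolding sum.distrib vand_def sum_distrib_left ..
  also have "(\<Sum>\<alpha>\<in>types d (Suc a). \<Sum>\<beta>\<in>types d b. (if \<alpha> + \<beta> = \<gamma> then real (count \<alpha> j') * 1 else 0) / (fct \<alpha> * fct \<beta>))
    = (if j' \<in># \<gamma> then vand d a b (\<gamma> - {#j'#}) else 0)"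
    unfolding vand_shift_left[OF j(2)] vand_add_mset ..
  finally show ?thesis by simp
qed

text \<open>The letters now come from different factors, so no delta arises. Only the coupling
  appears, with the degrees distributed differently.\<close>

lemma gram_3_mixed:
  assumes j: "j < d" "j' < d"
  shows "(\<Sum>\<alpha>\<in>types d (Suc a). \<Sum>\<beta>\<in>types d (Suc b). (if \<alpha> + \<beta> = add_mset j \<gamma> then real (count \<alpha> j) * count \<beta> j' else 0) / (fct \<alpha> * fct \<beta>))
    = (if j' \<in># \<gamma> then vand d a b (\<gamma> - {#j'#}) else 0)"
proof -
  have "(\<Sum>\<alpha>\<in>types d (Suc a). \<Sum>\<beta>\<in>types d (Suc b). (if \<alpha> + \<beta> = add_mset j \<gamma> then real (count \<alpha> j) * count \<beta> j' else 0) / (fct \<alpha> * fct \<beta>))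
    = (\<Sum>\<alpha>\<in>types d a. \<Sum>\<beta>\<in>types d (Suc b). (if \<alpha> + \<beta> = \<gamma> then real (count \<beta> j') * 1 else 0) / (fct \<alpha> * fct \<beta>))"
    by (subst vand_shift_left[OF j(1)]) (simp cong: if_cong)
  thus ?thesis unfolding vand_shift_right[OF j(2)] vand_add_mset .
qed

definition code_amp :: "complex \<Rightarrow> nat multiset \<Rightarrow> nat multiset \<Rightarrow> nat multiset \<Rightarrow> nat \<Rightarrow> complex" where
  "code_amp \<omega> \<alpha> \<beta> \<gamma> j = of_real (amp \<alpha> \<beta> \<gamma> j) + \<omega> * of_real (amp \<beta> \<alpha> \<gamma> j)"

lemma code_amp_mult:
  assumes "cmod \<omega> = 1"
  shows "code_amp \<omega> \<alpha> \<beta> \<gamma> j * cnj (code_amp \<omega> \<alpha>' \<beta>' \<gamma>' j') =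
    of_real (amp \<alpha> \<beta> \<gamma> j * amp \<alpha>' \<beta>' \<gamma>' j' + amp \<beta> \<alpha> \<gamma> j * amp \<beta>' \<alpha>' \<gamma>' j')
    + cnj \<omega> * of_real (amp \<alpha> \<beta> \<gamma> j * amp \<beta>' \<alpha>' \<gamma>' j') + \<omega> * of_real (amp \<beta> \<alpha> \<gamma> j * amp \<alpha>' \<beta>' \<gamma>' j')"
proof -
  have "cnj \<omega> * \<omega> = 1" using assms by (simp add: cnj_mult_self)
  hence *: "\<omega> * (cnj \<omega> * z) = z" for z by (metis mult.assoc mult.commute mult_1)
  show ?thesis unfolding code_amp_def by (simp add: algebra_simps *)
qed

lemma add_cnj_mult: "cnj \<omega> * of_real r + \<omega> * of_real r = of_real (2 * Re \<omega> * r)"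
  by (simp add: complex_eq_iff)

text \<open>Here \<open>n = t + 2\<close> is the degree of the symmetric powers on \<open>A_1\<close> and \<open>A_2\<close>.\<close>
locale phase =
  fixes t :: nat and \<omega> :: complex
  assumes \<omega>_unit: "cmod \<omega> = 1" and \<omega>_Re: "Re \<omega> = - (real t + 1) / (real t + 2)"
begin

lemma phase_cnj: "phase t (cnj \<omega>)"
  using \<omega>_unit \<omega>_Re by unfold_locales simp_all

text \<open>This is where the value of \<open>Re \<omega>\<close> comes from: it makes the state of \<open>A_3\<close> independent of the
  encoded state.\<close>
lemma gram_3:
  assumes j: "j < d" "j' < d" and \<gamma>: "\<gamma> \<in> types d (2 * t + 3)" "\<gamma>' \<in> types d (2 * t + 3)"
  shows "(\<Sum>\<alpha>\<in>types d (t + 2). \<Sum>\<beta>\<in>types d (t + 2). code_amp \<omega> \<alpha> \<beta> \<gamma> j * cnj (code_amp \<omega> \<alpha> \<beta> \<gamma>' j'))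
    = (if \<gamma> = \<gamma>' \<and> j = j' then 2 * of_nat ((2 * t + 3) choose (t + 1)) else 0)"
proof -
  let ?T = "types d (Suc (Suc t))"
  define s where "s = sqrt (fct \<gamma> * fct \<gamma>')"
  define e where "e = (if add_mset j \<gamma> = add_mset j' \<gamma>' then 1 else 0 :: real)"
  define v where "v a b = (if j' \<in># \<gamma> then vand d a b (\<gamma> - {#j'#}) else 0)" for a b
  have S: "(\<Sum>\<alpha>\<in>?T. \<Sum>\<beta>\<in>?T. amp \<alpha> \<beta> \<gamma> j * amp \<alpha> \<beta> \<gamma>' j') = s * e * ((if j = j' then vand d (Suc t) (Suc (Suc t)) \<gamma> else 0) + v t (Suc (Suc t)))"
    unfolding gram_3_same[OF j, symmetric] v_def sum_distrib_left amp_mult_3 s_def e_def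
    by (intro sum.cong refl) auto
  have S': "(\<Sum>\<alpha>\<in>?T. \<Sum>\<beta>\<in>?T. amp \<beta> \<alpha> \<gamma> j * amp \<beta> \<alpha> \<gamma>' j') = s * e * ((if j = j' then vand d (Suc t) (Suc (Suc t)) \<gamma> else 0) + v t (Suc (Suc t)))"
    unfolding S[symmetric] by (rule sum.swap)
  have M: "(\<Sum>\<alpha>\<in>?T. \<Sum>\<beta>\<in>?T. amp \<alpha> \<beta> \<gamma> j * amp \<beta> \<alpha> \<gamma>' j') = s * e * v (Suc t) (Suc t)"
    unfolding gram_3_mixed[OF j, symmetric] v_def sum_distrib_left amp_mult_3' s_def e_def
    by (intro sum.cong refl) auto
  have M': "(\<Sum>\<alpha>\<in>?T. \<Sum>\<beta>\<in>?T. amp \<beta> \<alpha> \<gamma> j * amp \<alpha> \<beta> \<gamma>' j') = s * e * v (Suc t) (Suc t)"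
    unfolding M[symmetric] by (rule sum.swap)
  \<comment> \<open>Both couplings are 1 / \<tau>! times a binomial coefficient of 2t + 2, with
    lower index t from equal tensors and t + 1 from mixed ones. Their ratio (t + 1) / (t + 2) is -Re
    \<omega>.\<close>
  have cancel: "2 * v t (Suc (Suc t)) + 2 * Re \<omega> * v (Suc t) (Suc t) = 0"
  proof (cases "j' \<in># \<gamma>")
    case True
    then obtain \<tau> where "\<gamma> = add_mset j' \<tau>" by (metis insert_DiffM)
    moreover from this have "\<tau> \<in> types d (2 * t + 2)" using \<gamma>(1) j(2) by (simp add: numeral_3_eq_3)
    hence "\<tau> \<in> types d (t + Suc (Suc t))" "\<tau> \<in> types d (Suc t + Suc t)" by (simp_all add: mult_2)
    ultimately have v: "v t (Suc (Suc t)) = ((2 * t + 2) choose t) / fct \<tau>" "v (Suc t) (Suc t) = ((2 * t + 2) choose Suc t) / fct \<tau>"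
      unfolding v_def vand_def by (simp_all add: vandermonde_types mult_2)
    have "Suc t * ((2 * t + 2) choose Suc t) = (t + 2) * ((2 * t + 2) choose t)"
      using Suc_times_binomial_comp[of t "2 * t + 2"] by simp
    hence "real (Suc t * ((2 * t + 2) choose Suc t)) = real ((t + 2) * ((2 * t + 2) choose t))" by (simp only:)
    moreover define P Q where "P = real ((2 * t + 2) choose t)" and "Q = real ((2 * t + 2) choose Suc t)"
    ultimately have "(real t + 1) * Q = (real t + 2) * P" by (simp add: algebra_simps)
    hence "P = (real t + 1) / (real t + 2) * Q" by (simp add: field_simps)
    moreover define x where "x = (real t + 1) / (real t + 2)"
    ultimately have "2 * (P / fct \<tau>) + 2 * (- x) * (Q / fct \<tau>) = 0" by simp
    hence "2 * (P / fct \<tau>) + 2 * (- (real t + 1) / (real t + 2)) * (Q / fct \<tau>) = 0"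
      unfolding x_def minus_divide_left .
    thus ?thesis unfolding v \<omega>_Re P_def Q_def .
  qed (simp add: v_def)
  have "(\<Sum>\<alpha>\<in>types d (t + 2). \<Sum>\<beta>\<in>types d (t + 2). code_amp \<omega> \<alpha> \<beta> \<gamma> j * cnj (code_amp \<omega> \<alpha> \<beta> \<gamma>' j'))
    = of_real ((\<Sum>\<alpha>\<in>?T. \<Sum>\<beta>\<in>?T. amp \<alpha> \<beta> \<gamma> j * amp \<alpha> \<beta> \<gamma>' j') + (\<Sum>\<alpha>\<in>?T. \<Sum>\<beta>\<in>?T. amp \<beta> \<alpha> \<gamma> j * amp \<beta> \<alpha> \<gamma>' j'))
    + cnj \<omega> * of_real (\<Sum>\<alpha>\<in>?T. \<Sum>\<beta>\<in>?T. amp \<alpha> \<beta> \<gamma> j * amp \<beta> \<alpha> \<gamma>' j')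
    + \<omega> * of_real (\<Sum>\<alpha>\<in>?T. \<Sum>\<beta>\<in>?T. amp \<beta> \<alpha> \<gamma> j * amp \<alpha> \<beta> \<gamma>' j')"
    unfolding code_amp_mult[OF \<omega>_unit] by (simp add: sum.distrib sum_distrib_left)
  also have "\<dots> = of_real (2 * (s * e * ((if j = j' then vand d (Suc t) (Suc (Suc t)) \<gamma> else 0) + v t (Suc (Suc t))))
    + 2 * Re \<omega> * (s * e * v (Suc t) (Suc t)))"
    unfolding S S' M M' of_real_add[of _ "2 * Re \<omega> * _"] add_cnj_mult[symmetric] by (simp add: add.assoc)
  also have "2 * (s * e * ((if j = j' then vand d (Suc t) (Suc (Suc t)) \<gamma> else 0) + v t (Suc (Suc t))))
    + 2 * Re \<omega> * (s * e * v (Suc t) (Suc t))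
    = s * e * (2 * (if j = j' then vand d (Suc t) (Suc (Suc t)) \<gamma> else 0)) + s * e * (2 * v t (Suc (Suc t)) + 2 * Re \<omega> * v (Suc t) (Suc t))"
    by (simp only: algebra_simps)
  also have "\<dots> = s * e * (2 * (if j = j' then vand d (Suc t) (Suc (Suc t)) \<gamma> else 0))" unfolding cancel by simp
  also have "\<dots> = (if \<gamma> = \<gamma>' \<and> j = j' then 2 * ((2 * t + 3) choose (t + 1)) else 0)"
  proof -
    have idx: "Suc t + Suc (Suc t) = 2 * t + 3" by simp
    have "vand d (Suc t) (Suc (Suc t)) \<gamma> = ((2 * t + 3) choose (t + 1)) / fct \<gamma>"
      unfolding vand_def using vandermonde_types[of \<gamma> d "Suc t" "Suc (Suc t)"] \<gamma>(1) unfolding idx by simp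
    thus ?thesis by (auto simp: e_def s_def)
  qed
  finally show ?thesis by simp
qed

lemma linked_commute: "linked \<alpha>' j' \<alpha> j = linked \<alpha> j \<alpha>' j'"
  unfolding linked_def by (auto simp: mult.commute)

text \<open>With M = 2t + 2 + d, the \<open>hdim\<close> values in the Gram matrix are the binomial
  coefficients of M with lower indices t, t + 1 and t + 2. This is the middle one, and the others
  are rational multiples of it.\<close>

definition binom_mid :: "nat \<Rightarrow> real" where
  "binom_mid d = ((2 * t + 2 + d) choose (t + 1))"

definition gram_diag :: "nat \<Rightarrow> real" where
  "gram_diag d = hdim d (t + 2) (t + 1) + hdim d (t + 3) t"

definition gram_link :: "nat \<Rightarrow> real" where
  "gram_link d = hdim d (t + 1) (t + 2) + 2 * Re \<omega> * hdim d (t + 2) (t + 1) + hdim d (t + 3) t"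

text \<open>Of the four products only that of the exchanged tensor with itself has a scalar part.
  The two mixed sums are equal, so the phase enters through 2 Re \<omega> alone.\<close>

lemma gram_1:
  assumes j: "j < d" "j' < d" and \<alpha>: "\<alpha> \<in> types d (t + 2)" "\<alpha>' \<in> types d (t + 2)"
  shows "(\<Sum>\<beta>\<in>types d (t + 2). \<Sum>\<gamma>\<in>types d (2 * t + 3). code_amp \<omega> \<alpha> \<beta> \<gamma> j * cnj (code_amp \<omega> \<alpha>' \<beta> \<gamma> j'))
    = of_real ((if \<alpha> = \<alpha>' \<and> j = j' then gram_diag d else 0) + gram_link d * linked \<alpha> j \<alpha>' j')"
proof -
  let ?T = "types d (t + 2)" and ?K = "types d (2 * t + 3)"
  let ?l = "linked \<alpha> j \<alpha>' j'"
  have 11: "(\<Sum>\<beta>\<in>?T. \<Sum>\<gamma>\<in>?K. amp \<alpha> \<beta> \<gamma> j * amp \<alpha>' \<beta> \<gamma> j') = hdim d (t + 1) (t + 2) * ?l"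
    using gram_11[of \<alpha> d "t + 1" \<alpha>' j j' "t + 2"] \<alpha> j by (simp add: mult_2 numeral_3_eq_3)
  have 12: "(\<Sum>\<beta>\<in>?T. \<Sum>\<gamma>\<in>?K. amp \<alpha> \<beta> \<gamma> j * amp \<beta> \<alpha>' \<gamma> j') = hdim d (t + 2) (t + 1) * ?l"
    using gram_12[of \<alpha> d "t + 2" \<alpha>' j j' "t + 1"] \<alpha> j by (simp add: mult_2 numeral_3_eq_3)
  have 21: "(\<Sum>\<beta>\<in>?T. \<Sum>\<gamma>\<in>?K. amp \<beta> \<alpha> \<gamma> j * amp \<alpha>' \<beta> \<gamma> j') = hdim d (t + 2) (t + 1) * ?l"
    using gram_12[of \<alpha>' d "t + 2" \<alpha> j' j "t + 1"] \<alpha> j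
    by (simp add: mult_2 numeral_3_eq_3 linked_commute mult.commute[of "amp _ \<alpha> _ j"])
  have 22: "(\<Sum>\<beta>\<in>?T. \<Sum>\<gamma>\<in>?K. amp \<beta> \<alpha> \<gamma> j * amp \<beta> \<alpha>' \<gamma> j')
    = (if \<alpha> = \<alpha>' \<and> j = j' then gram_diag d else 0) + hdim d (t + 3) t * ?l"
    using gram_22[of \<alpha> d "t + 2" \<alpha>' j j' t] \<alpha> j unfolding gram_diag_def by (simp add: mult_2 numeral_3_eq_3)
  have "(\<Sum>\<beta>\<in>?T. \<Sum>\<gamma>\<in>?K. code_amp \<omega> \<alpha> \<beta> \<gamma> j * cnj (code_amp \<omega> \<alpha>' \<beta> \<gamma> j'))
    = of_real ((\<Sum>\<beta>\<in>?T. \<Sum>\<gamma>\<in>?K. amp \<alpha> \<beta> \<gamma> j * amp \<alpha>' \<beta> \<gamma> j') + (\<Sum>\<beta>\<in>?T. \<Sum>\<gamma>\<in>?K. amp \<beta> \<alpha> \<gamma> j * amp \<beta> \<alpha>' \<gamma> j'))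
    + cnj \<omega> * of_real (\<Sum>\<beta>\<in>?T. \<Sum>\<gamma>\<in>?K. amp \<alpha> \<beta> \<gamma> j * amp \<beta> \<alpha>' \<gamma> j')
    + \<omega> * of_real (\<Sum>\<beta>\<in>?T. \<Sum>\<gamma>\<in>?K. amp \<beta> \<alpha> \<gamma> j * amp \<alpha>' \<beta> \<gamma> j')"
    unfolding code_amp_mult[OF \<omega>_unit] by (simp add: sum.distrib sum_distrib_left)
  also have "\<dots> = of_real (hdim d (t + 1) (t + 2) * ?l + ((if \<alpha> = \<alpha>' \<and> j = j' then gram_diag d else 0) + hdim d (t + 3) t * ?l)
    + 2 * Re \<omega> * (hdim d (t + 2) (t + 1) * ?l))"
    unfolding 11 12 21 22 of_real_add[of _ "2 * Re \<omega> * _"] add_cnj_mult[symmetric] by (simp only: add.assoc)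
  finally show ?thesis unfolding gram_link_def by (simp only: algebra_simps)
qed

lemma gram_diag_ge: "binom_mid d \<le> gram_diag d"
proof -
  have "t + 2 + d + (t + 1) - 1 = 2 * t + 2 + d" by simp
  hence "hdim d (t + 2) (t + 1) = binom_mid d" unfolding binom_mid_def hdim_def by (simp only:)
  moreover have "0 \<le> hdim d (t + 3) t" unfolding hdim_def by simp
  ultimately show ?thesis unfolding gram_diag_def by simp
qed

lemma binom_mid_pos: "0 < binom_mid d"
  unfolding binom_mid_def by (simp only: of_nat_0_less_iff zero_less_binomial_iff)

text \<open>The three neighbouring coefficients carry the weights 1, 2 Re \<omega> and 1 with Re
  \<omega> close to -1. As in a second difference the leading parts cancel, and the result is below
  \<open>binom_mid\<close> by a factor of order d^2 / t^2.\<close>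

lemma gram_link_eq: "gram_link d = binom_mid d * (real d * (real d + 1)) / ((real t + 2) * (real t + 2 + real d))"
proof -
  let ?M = "2 * t + 2 + d"
  have idx: "t + 1 + d + (t + 2) - 1 = ?M" "t + 2 + d + (t + 1) - 1 = ?M" "t + 3 + d + t - 1 = ?M" by simp_all
  have idx2: "t + 2 = Suc (t + 1)" by simp
  define A B C where "A = real (?M choose Suc (t + 1))" and "B = real (?M choose (t + 1))" and "C = real (?M choose t)"
  have "Suc (t + 1) * (?M choose Suc (t + 1)) = (t + 1 + d) * (?M choose (t + 1))"
    using Suc_times_binomial_comp[of "t + 1" ?M] by simp
  hence "real (Suc (t + 1) * (?M choose Suc (t + 1))) = real ((t + 1 + d) * (?M choose (t + 1)))" by (simp only:)
  hence "(real t + 2) * A = (real t + 1 + real d) * B" unfolding A_def[symmetric] B_def[symmetric] of_nat_mult by (simp add: algebra_simps)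
  hence 1: "A = (real t + 1 + real d) / (real t + 2) * B" by (simp add: field_simps)
  have "Suc t * (?M choose Suc t) = (t + 2 + d) * (?M choose t)"
    using Suc_times_binomial_comp[of t ?M] by simp
  hence "real (Suc t * (?M choose (t + 1))) = real ((t + 2 + d) * (?M choose t))" by (simp only: Suc_eq_plus1)
  hence "(real t + 1) * B = (real t + 2 + real d) * C" unfolding C_def[symmetric] B_def[symmetric] of_nat_mult by (simp add: algebra_simps)
  hence 2: "C = (real t + 1) / (real t + 2 + real d) * B" by (simp add: field_simps)
  have B: "B = binom_mid d" unfolding B_def binom_mid_def ..
  have "hdim d (t + 1) (t + 2) = A" "hdim d (t + 2) (t + 1) = B" "hdim d (t + 3) t = C"
    unfolding hdim_def idx A_def B_def C_def by (simp_all only: idx2)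
  hence "gram_link d = A + 2 * Re \<omega> * B + C" unfolding gram_link_def by simp
  also have "\<dots> = ((real t + 1 + real d) / (real t + 2) + 2 * Re \<omega> + (real t + 1) / (real t + 2 + real d)) * B"
    unfolding 1 2 by (simp only: algebra_simps)
  also have "(real t + 1 + real d) / (real t + 2) + 2 * Re \<omega> + (real t + 1) / (real t + 2 + real d)
    = real d * (real d + 1) / ((real t + 2) * (real t + 2 + real d))"
    unfolding \<omega>_Re by (simp add: divide_simps add_eq_0_iff) (simp add: algebra_simps)
  finally show ?thesis unfolding B by simp
qed

lemma gram_link_nonneg: "0 \<le> gram_link d"
  unfolding gram_link_eq using binom_mid_pos[of d] by simp

text \<open>Strict positivity of the coupling is what later makes the error nonzero.\<close>

lemma gram_link_pos: "0 < d \<Longrightarrow> 0 < gram_link d"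
  unfolding gram_link_eq using binom_mid_pos[of d] by (intro divide_pos_pos mult_pos_pos) auto

text \<open>The numerator is the norm bound on L \<otimes> A_1, as the form of \<open>linked\<close>
  is at most t + 1 + d. This factor uses up one of the two orders by which the coupling is small and
  leaves an excess of order 1 / t.\<close>

lemma gram_ratio: "(gram_diag d + gram_link d * (real t + 1 + real d)) / gram_diag d \<le> 1 + real d * (real d + 1) / (real t + 2)"
proof -
  have pos: "0 < gram_diag d" using gram_diag_ge[of d] binom_mid_pos[of d] by linarith
  have "gram_link d * (real t + 1 + real d) \<le> binom_mid d * (real d * (real d + 1) / (real t + 2))"
  proof -
    have "(real t + 1 + real d) / (real t + 2 + real d) \<le> 1" by simp
    hence "binom_mid d * (real d * (real d + 1)) / (real t + 2) * ((real t + 1 + real d) / (real t + 2 + real d))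
      \<le> binom_mid d * (real d * (real d + 1)) / (real t + 2) * 1"
      using binom_mid_pos[of d] by (intro mult_left_mono) auto
    thus ?thesis unfolding gram_link_eq by simp
  qed
  also have "\<dots> \<le> gram_diag d * (real d * (real d + 1) / (real t + 2))"
    using gram_diag_ge by (intro mult_right_mono) auto
  finally have "gram_link d * (real t + 1 + real d) / gram_diag d \<le> real d * (real d + 1) / (real t + 2)"
    unfolding pos_divide_le_eq[OF pos] by (simp only: mult.commute)
  thus ?thesis unfolding add_divide_distrib using pos by simp
qed

text \<open>Cauchy-Schwarz applied to the vectors \<open>(sqrt (\<sigma>_j + 1))_j\<close> of squared length \<open>|\<sigma>| + d\<close>.\<close>
lemma linked_form_le:
  assumes d: "0 < d"
  shows "Re (\<Sum>(\<alpha>,j)\<in>types d (Suc n) \<times> {..<d}. \<Sum>(\<alpha>',j')\<in>types d (Suc n) \<times> {..<d}.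
      of_real (linked \<alpha> j \<alpha>' j') * (\<xi> \<alpha> j * cnj (\<xi> \<alpha>' j'))) \<le> (real n + real d) * (\<Sum>\<alpha>\<in>types d (Suc n). \<Sum>j<d. (cmod (\<xi> \<alpha> j))\<^sup>2)"
proof -
  let ?I = "types d (Suc n) \<times> {..<d}"
  \<comment> \<open>\<open>g \<sigma>\<close> collects the terms lowered to \<sigma>. Through it the
    form of \<open>linked\<close> becomes a sum of squares, one for each type of size n.\<close>
  define g where "g \<sigma> = (\<lambda>(\<alpha>,j). if \<alpha> = add_mset j \<sigma> then complex_of_real (sqrt (count \<alpha> j)) * \<xi> \<alpha> j else 0)" for \<sigma>
  have "of_real (linked \<alpha> j \<alpha>' j') * (\<xi> \<alpha> j * cnj (\<xi> \<alpha>' j')) = (\<Sum>\<sigma>\<in>types d n. g \<sigma> (\<alpha>,j) * cnj (g \<sigma> (\<alpha>',j')))"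
    if "(\<alpha>,j) \<in> ?I" "(\<alpha>',j') \<in> ?I" for \<alpha> j \<alpha>' j'
  proof (cases "\<exists>\<sigma>. \<alpha> = add_mset j \<sigma> \<and> \<alpha>' = add_mset j' \<sigma>")
    case True
    then obtain \<sigma>0 where s: "\<alpha> = add_mset j \<sigma>0" "\<alpha>' = add_mset j' \<sigma>0" by blast
    hence mem: "\<sigma>0 \<in> types d n" using that by auto
    have "(\<Sum>\<sigma>\<in>types d n. g \<sigma> (\<alpha>,j) * cnj (g \<sigma> (\<alpha>',j')))
      = (\<Sum>\<sigma>\<in>types d n. if \<sigma> = \<sigma>0 then of_real (sqrt (count \<alpha> j) * sqrt (count \<alpha>' j')) * (\<xi> \<alpha> j * cnj (\<xi> \<alpha>' j')) else 0)"
      unfolding g_def s by (intro sum.cong refl) (auto simp: mult_ac)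
    also have "\<dots> = of_real (sqrt (count \<alpha> j) * sqrt (count \<alpha>' j')) * (\<xi> \<alpha> j * cnj (\<xi> \<alpha>' j'))"
      using mem by simp
    moreover have "linked \<alpha> j \<alpha>' j' = sqrt (count \<alpha> j) * sqrt (count \<alpha>' j')"
      unfolding linked_def s add_mset_commute[of j' j] by (simp only: if_True refl of_nat_mult real_sqrt_mult)
    ultimately show ?thesis by simp
  next
    case False
    have "g \<sigma> (\<alpha>,j) * cnj (g \<sigma> (\<alpha>',j')) = 0" for \<sigma> using False unfolding g_def by auto
    moreover have "linked \<alpha> j \<alpha>' j' = 0"
    proof (rule ccontr)
      assume "linked \<alpha> j \<alpha>' j' \<noteq> 0"
      hence "add_mset j' \<alpha> = add_mset j \<alpha>'" "0 < count \<alpha> j" unfolding linked_def by (auto split: if_splits)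
      from linked_cases[OF this] obtain \<sigma> where "\<alpha> = add_mset j \<sigma>" "\<alpha>' = add_mset j' \<sigma>" .
      thus False using False by blast
    qed
    ultimately show ?thesis by simp
  qed
  hence "(\<Sum>(\<alpha>,j)\<in>?I. \<Sum>(\<alpha>',j')\<in>?I. of_real (linked \<alpha> j \<alpha>' j') * (\<xi> \<alpha> j * cnj (\<xi> \<alpha>' j')))
    = (\<Sum>x\<in>?I. \<Sum>y\<in>?I. \<Sum>\<sigma>\<in>types d n. g \<sigma> x * cnj (g \<sigma> y))"
    unfolding case_prod_unfold by (intro sum.cong refl) auto
  also have "\<dots> = (\<Sum>\<sigma>\<in>types d n. \<Sum>x\<in>?I. \<Sum>y\<in>?I. g \<sigma> x * cnj (g \<sigma> y))"
    by (subst (2) sum.swap, subst (1) sum.swap, rule refl)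
  also have "\<dots> = (\<Sum>\<sigma>\<in>types d n. of_real ((cmod (\<Sum>x\<in>?I. g \<sigma> x))\<^sup>2))"
    unfolding complex_norm_square cnj_sum sum_product ..
  finally have "Re (\<Sum>(\<alpha>,j)\<in>?I. \<Sum>(\<alpha>',j')\<in>?I. of_real (linked \<alpha> j \<alpha>' j') * (\<xi> \<alpha> j * cnj (\<xi> \<alpha>' j')))
    = (\<Sum>\<sigma>\<in>types d n. (cmod (\<Sum>x\<in>?I. g \<sigma> x))\<^sup>2)" by simp
  also have "\<dots> \<le> (\<Sum>\<sigma>\<in>types d n. (real n + real d) * (\<Sum>j<d. (cmod (\<xi> (add_mset j \<sigma>) j))\<^sup>2))"
  proof (rule sum_mono)
    fix \<sigma> assume \<sigma>: "\<sigma> \<in> types d n"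
    have "(\<Sum>x\<in>?I. g \<sigma> x) = (\<Sum>j<d. \<Sum>\<alpha>\<in>types d (Suc n). if \<alpha> = add_mset j \<sigma> then complex_of_real (sqrt (count \<sigma> j + 1)) * \<xi> (add_mset j \<sigma>) j else 0)"
      unfolding g_def sum.cartesian_product[symmetric] by (subst sum.swap) (intro sum.cong refl, auto)
    also have "\<dots> = (\<Sum>j<d. complex_of_real (sqrt (count \<sigma> j + 1)) * \<xi> (add_mset j \<sigma>) j)"
      using \<sigma> by (intro sum.cong refl) simp
    finally have "(cmod (\<Sum>x\<in>?I. g \<sigma> x))\<^sup>2 \<le> (\<Sum>j<d. sqrt (count \<sigma> j + 1) * cmod (\<xi> (add_mset j \<sigma>) j))\<^sup>2"
      by (simp only:, intro power_mono order_trans[OF norm_sum]) (auto simp: norm_mult)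
    also have "\<dots> \<le> (\<Sum>j<d. (sqrt (count \<sigma> j + 1))\<^sup>2) * (\<Sum>j<d. (cmod (\<xi> (add_mset j \<sigma>) j))\<^sup>2)"
      by (rule Cauchy_Schwarz_ineq_sum)
    also have "(\<Sum>j<d. (sqrt (count \<sigma> j + 1))\<^sup>2) = real n + real d"
      using sum_count_types_real[OF \<sigma>] by (simp add: sum.distrib)
    finally show "(cmod (\<Sum>x\<in>?I. g \<sigma> x))\<^sup>2 \<le> (real n + real d) * (\<Sum>j<d. (cmod (\<xi> (add_mset j \<sigma>) j))\<^sup>2)" .
  qed
  also have "\<dots> = (real n + real d) * (\<Sum>j<d. \<Sum>\<sigma>\<in>types d n. (cmod (\<xi> (add_mset j \<sigma>) j))\<^sup>2)"
    unfolding sum_distrib_left[symmetric] by (subst sum.swap) (rule refl)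
  also have "\<dots> \<le> (real n + real d) * (\<Sum>j<d. \<Sum>\<alpha>\<in>types d (Suc n). (cmod (\<xi> \<alpha> j))\<^sup>2)"
  proof (intro mult_left_mono sum_mono)
    fix j assume "j \<in> {..<d}"
    have "(\<Sum>\<sigma>\<in>types d n. (cmod (\<xi> (add_mset j \<sigma>) j))\<^sup>2) = (\<Sum>\<alpha>\<in>add_mset j ` types d n. (cmod (\<xi> \<alpha> j))\<^sup>2)"
      by (subst sum.reindex) (auto simp: inj_on_def)
    also have "\<dots> \<le> (\<Sum>\<alpha>\<in>types d (Suc n). (cmod (\<xi> \<alpha> j))\<^sup>2)"
      using \<open>j \<in> {..<d}\<close> by (intro sum_mono2) auto
    finally show "(\<Sum>\<sigma>\<in>types d n. (cmod (\<xi> (add_mset j \<sigma>) j))\<^sup>2) \<le> (\<Sum>\<alpha>\<in>types d (Suc n). (cmod (\<xi> \<alpha> j))\<^sup>2)" .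
  qed simp
  also have "(\<Sum>j<d. \<Sum>\<alpha>\<in>types d (Suc n). (cmod (\<xi> \<alpha> j))\<^sup>2) = (\<Sum>\<alpha>\<in>types d (Suc n). \<Sum>j<d. (cmod (\<xi> \<alpha> j))\<^sup>2)"
    by (rule sum.swap)
  finally show ?thesis .
qed

end

section \<open>Covariance\<close>

lemma sum_words_if:
  assumes "\<alpha> \<in> types d n"
  shows "(\<Sum>w\<in>words d n. if mset w = \<alpha> then f w else 0) = (\<Sum>w\<in>perms \<alpha>. f w)"
proof -
  have "perms \<alpha> = {w \<in> words d n. mset w = \<alpha>}"
    using perms_subset_words[OF assms] by (auto simp: mem_perms)
  thus ?thesis by (simp add: sum.inter_filter)
qed

lemma sum_product3:
  fixes f :: "'a \<Rightarrow> 'd :: comm_semiring_0"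
  shows "(\<Sum>x\<in>X. f x) * (\<Sum>y\<in>Y. g y) * (\<Sum>z\<in>Z. h z) = (\<Sum>x\<in>X. \<Sum>y\<in>Y. \<Sum>z\<in>Z. f x * g y * h z)"
proof -
  have "(\<Sum>x\<in>X. f x) * (\<Sum>y\<in>Y. g y) * (\<Sum>z\<in>Z. h z) = (\<Sum>x\<in>X. f x * ((\<Sum>y\<in>Y. g y) * (\<Sum>z\<in>Z. h z)))"
    unfolding mult.assoc by (rule sum_distrib_right)
  also have "(\<Sum>y\<in>Y. g y) * (\<Sum>z\<in>Z. h z) = (\<Sum>y\<in>Y. \<Sum>z\<in>Z. g y * h z)" by (rule sum_product)
  finally show ?thesis by (simp only: sum_distrib_left mult.assoc)
qed

lemma sum_swap_3_1: "(\<Sum>a\<in>A. \<Sum>b\<in>B. \<Sum>c\<in>C. \<Sum>p\<in>P. f a b c p) = (\<Sum>p\<in>P. \<Sum>a\<in>A. \<Sum>b\<in>B. \<Sum>c\<in>C. f a b c p)"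
proof -
  have "(\<Sum>c\<in>C. \<Sum>p\<in>P. f a b c p) = (\<Sum>p\<in>P. \<Sum>c\<in>C. f a b c p)" for a b by (rule sum.swap)
  moreover have "(\<Sum>b\<in>B. \<Sum>p\<in>P. \<Sum>c\<in>C. f a b c p) = (\<Sum>p\<in>P. \<Sum>b\<in>B. \<Sum>c\<in>C. f a b c p)" for a by (rule sum.swap)
  moreover have "(\<Sum>a\<in>A. \<Sum>p\<in>P. \<Sum>b\<in>B. \<Sum>c\<in>C. f a b c p) = (\<Sum>p\<in>P. \<Sum>a\<in>A. \<Sum>b\<in>B. \<Sum>c\<in>C. f a b c p)" by (rule sum.swap)
  ultimately show ?thesis by (simp only:)
qed

lemma sum_swap_3_2:
  "(\<Sum>a\<in>A. \<Sum>b\<in>B. \<Sum>c\<in>C. \<Sum>p\<in>P. \<Sum>q\<in>Q. f a b c p q) = (\<Sum>p\<in>P. \<Sum>q\<in>Q. \<Sum>a\<in>A. \<Sum>b\<in>B. \<Sum>c\<in>C. f a b c p q)"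
  by (rule trans[OF sum_swap_3_1 sum.cong[OF refl sum_swap_3_1]])

lemma sum_if_const: "(\<Sum>x\<in>X. if P then f x else 0) = (if P then \<Sum>x\<in>X. f x else 0)"
  by simp

text \<open>The part of the conversion from factorial weights to counts of words that does not
  depend on the types.\<close>

definition word_const :: "nat \<Rightarrow> nat \<Rightarrow> real" where
  "word_const a b = (real a + 1) / sqrt (fact (Suc a) * fact b / fact (a + b))"

lemma perms_fct: "real (card (perms \<alpha>)) = fact (size \<alpha>) / fct \<alpha>"
  unfolding fct_def by simp

text \<open>On words the invariant tensor is a Kronecker delta: the third word is the first one
  without its leading letter j, followed by the second. The conditions are nested and not conjoined,
  so that the sums can be collapsed one at a time.\<close>

lemma amp_words:
  assumes \<alpha>: "\<alpha> \<in> types d (Suc a)" "\<beta> \<in> types d b" "\<gamma> \<in> types d (a + b)" and j: "j < d"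
  shows "amp \<alpha> \<beta> \<gamma> j = word_const a b * (\<Sum>p\<in>words d a. \<Sum>q\<in>words d b.
      if mset (j # p) = \<alpha> then if mset q = \<beta> then if mset (p @ q) = \<gamma> then 1 else 0 else 0 else 0)
      / sqrt (card (perms \<alpha>) * card (perms \<beta>) * card (perms \<gamma>))"
proof (cases "j \<in># \<alpha>")
  case False
  hence "mset (j # p) \<noteq> \<alpha>" for p by auto
  thus ?thesis using False by (simp add: amp_def not_in_iff)
next
  case True
  then obtain \<sigma> where s: "\<alpha> = add_mset j \<sigma>" by (metis insert_DiffM)
  hence \<sigma>: "\<sigma> \<in> types d a" using \<alpha> j by simp
  have "(\<Sum>p\<in>words d a. \<Sum>q\<in>words d b. if mset (j # p) = \<alpha> then if mset q = \<beta> then if mset (p @ q) = \<gamma> then 1 else 0 else 0 else 0)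
    = (\<Sum>p\<in>words d a. if mset p = \<sigma> then \<Sum>q\<in>words d b. if mset q = \<beta> then if \<sigma> + \<beta> = \<gamma> then 1 else 0 else 0 else 0 :: real)"
    unfolding s by (intro sum.cong refl) (auto intro!: sum.cong)
  also have "\<dots> = real (card (perms \<sigma>)) * card (perms \<beta>) * (if \<sigma> + \<beta> = \<gamma> then 1 else 0)"
    unfolding sum_words_if[OF \<sigma>] sum_words_if[OF \<alpha>(2)] by simp
  finally have count: "(\<Sum>p\<in>words d a. \<Sum>q\<in>words d b. if mset (j # p) = \<alpha> then if mset q = \<beta> then if mset (p @ q) = \<gamma> then 1 else 0 else 0 else 0)
    = real (card (perms \<sigma>)) * card (perms \<beta>) * (if \<sigma> + \<beta> = \<gamma> then 1 else 0)" .
  have iff: "add_mset j \<gamma> = \<alpha> + \<beta> \<longleftrightarrow> \<sigma> + \<beta> = \<gamma>" unfolding s by auto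
  define c where "c = real (count \<alpha> j)"
  have c: "0 < c" "fct \<alpha> = c * fct \<sigma>" unfolding c_def s by simp_all
  define A B K where "A = (fact (Suc a) :: real)" and "B = (fact b :: real)" and "K = (fact (a + b) :: real)"
  have ABK: "0 < A" "0 < B" "0 < K" unfolding A_def B_def K_def by simp_all
  define f s where "f = fct \<alpha> * fct \<beta> * fct \<gamma>" and "s = sqrt (A * B / K)"
  have f: "0 < f" and s0: "0 < s" and ss: "s * s = A * B / K"
    unfolding f_def s_def using ABK by simp_all
  have sizes: "size \<alpha> = Suc a" "size \<beta> = b" "size \<gamma> = a + b" "size \<sigma> = a"
    using \<alpha> \<sigma> unfolding types_def by auto
  have "real (card (perms \<alpha>) * card (perms \<beta>) * card (perms \<gamma>)) = A * B * K / f"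
    unfolding of_nat_mult perms_fct sizes A_def B_def K_def f_def by simp
  also have "\<dots> = (A * B / K) * K\<^sup>2 / f" using ABK by (simp add: power2_eq_square)
  finally have "sqrt (card (perms \<alpha>) * card (perms \<beta>) * card (perms \<gamma>)) = sqrt ((A * B / K) * K\<^sup>2 / f)"
    by (simp only:)
  also have "\<dots> = s * K / sqrt f"
    unfolding s_def using ABK by (simp only: real_sqrt_divide real_sqrt_mult real_sqrt_abs abs_of_pos)
  finally have root: "sqrt (card (perms \<alpha>) * card (perms \<beta>) * card (perms \<gamma>)) = s * K / sqrt f" .
  have "word_const a b * (real (card (perms \<sigma>)) * card (perms \<beta>)) / (s * K / sqrt f)
    = (((real a + 1) * fact a) * B) / (s * s * K) * (sqrt f / (fct \<sigma> * fct \<beta>))"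
    unfolding word_const_def perms_fct sizes A_def[symmetric] B_def[symmetric] K_def[symmetric] s_def[symmetric]
    by (simp add: mult_ac)
  also have "(real a + 1) * fact a = A" unfolding A_def by simp
  also have "A * B / (s * s * K) = 1" unfolding ss using ABK by simp
  also have "1 * (sqrt f / (fct \<sigma> * fct \<beta>)) = c * (sqrt f / (fct \<alpha> * fct \<beta>))"
    unfolding c(2) using c(1) by simp
  also have "sqrt f / (fct \<alpha> * fct \<beta>) = sqrt (fct \<gamma> / (fct \<alpha> * fct \<beta>))"
  proof -
    have "fct \<gamma> / (fct \<alpha> * fct \<beta>) = f / (fct \<alpha> * fct \<beta>)\<^sup>2" unfolding f_def by (simp add: power2_eq_square)
    thus ?thesis by (simp only: real_sqrt_divide real_sqrt_abs) (simp add: abs_mult)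
  qed
  finally show ?thesis unfolding count root amp_def iff c_def by simp
qed

lemma symk_div_sqrt:
  assumes "u \<in> words d n" "\<alpha>' \<in> types d n"
  shows "symk U \<alpha>' (mset u) / of_real (sqrt (card (perms (mset u)))) = (\<Sum>w\<in>perms \<alpha>'. wprod U w u) / of_real (sqrt (card (perms \<alpha>')))"
proof -
  let ?a = "real (card (perms \<alpha>'))" and ?b = "real (card (perms (mset u)))"
  have pos: "0 < ?a" "0 < ?b" by (simp_all only: of_nat_0_less_iff card_perms_pos)
  have "size \<alpha>' = length u" using assms by (auto simp: types_def words_def)
  from sum_wprod_eq_symk[OF this, of U]
  have "(\<Sum>w\<in>perms \<alpha>'. wprod U w u) / of_real (sqrt ?a) = of_real (sqrt (?a / ?b) / sqrt ?a) * symk U \<alpha>' (mset u)" by simp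
  also have "sqrt (?a / ?b) / sqrt ?a = 1 / sqrt ?b" using pos by (simp add: real_sqrt_divide)
  finally show ?thesis by simp
qed

text \<open>Each letter of p and q is transformed once by U and once by its conjugate, and
  orthonormality of the rows of U contracts these pairs to a delta. Only the leading letter stays
  unpaired, which gives the action on the logical index. Both sides are brought to the same sum over
  words.\<close>

lemma amp_covariant:
  assumes U: "\<And>i i'. i < d \<Longrightarrow> i' < d \<Longrightarrow> (\<Sum>k<d. U i k * cnj (U i' k)) = (if i = i' then 1 else 0)"
    and \<alpha>': "\<alpha>' \<in> types d (Suc a)" and \<beta>': "\<beta>' \<in> types d b" and \<gamma>': "\<gamma>' \<in> types d (a + b)" and j: "j < d"
  shows "(\<Sum>l<d. of_real (amp \<alpha>' \<beta>' \<gamma>' l) * U l j) = (\<Sum>\<alpha>\<in>types d (Suc a). \<Sum>\<beta>\<in>types d b. \<Sum>\<gamma>\<in>types d (a + b).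
     symk U \<alpha>' \<alpha> * symk U \<beta>' \<beta> * cnj (symk U \<gamma>' \<gamma>) * of_real (amp \<alpha> \<beta> \<gamma> j))"
proof -
  define C where "C = complex_of_real (word_const a b)"
  define n where "n \<alpha> = complex_of_real (sqrt (card (perms \<alpha>)))" for \<alpha> :: "nat multiset"
  have nn: "complex_of_real (sqrt (card (perms \<alpha>) * card (perms \<beta>) * card (perms \<gamma>))) = n \<alpha> * n \<beta> * n \<gamma>" for \<alpha> \<beta> \<gamma> :: "nat multiset"
    unfolding n_def of_nat_mult real_sqrt_mult of_real_mult ..
  \<comment> \<open>The tensor on words with its logical slot already contracted with column j of
    U.\<close>
  define T where "T w1 w2 w3 = U (hd w1) j * (if tl w1 @ w2 = w3 then 1 else 0)" for w1 w2 w3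
  have amp: "of_real (amp \<alpha> \<beta> \<gamma> l) = C * (\<Sum>p\<in>words d a. \<Sum>q\<in>words d b.
      if mset (l # p) = \<alpha> then if mset q = \<beta> then if mset (p @ q) = \<gamma> then 1 else 0 else 0 else 0) / (n \<alpha> * n \<beta> * n \<gamma>)"
    if "\<alpha> \<in> types d (Suc a)" "\<beta> \<in> types d b" "\<gamma> \<in> types d (a + b)" "l < d" for \<alpha> \<beta> \<gamma> l
  proof -
    have "complex_of_real (\<Sum>p\<in>words d a. \<Sum>q\<in>words d b. if mset (l # p) = \<alpha> then if mset q = \<beta> then if mset (p @ q) = \<gamma> then 1 else 0 else 0 else 0)
      = (\<Sum>p\<in>words d a. \<Sum>q\<in>words d b. if mset (l # p) = \<alpha> then if mset q = \<beta> then if mset (p @ q) = \<gamma> then 1 else 0 else 0 else 0)"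
      unfolding of_real_sum by (intro sum.cong refl) auto
    thus ?thesis unfolding amp_words[OF that] C_def by (simp only: of_real_mult of_real_divide nn)
  qed
  let ?N = "n \<alpha>' * n \<beta>' * n \<gamma>'"
  have "(\<Sum>l<d. of_real (amp \<alpha>' \<beta>' \<gamma>' l) * U l j)
    = C * (\<Sum>l<d. \<Sum>p\<in>words d a. \<Sum>q\<in>words d b. if mset (l # p) = \<alpha>' then if mset q = \<beta>' then if mset (p @ q) = \<gamma>' then U l j else 0 else 0 else 0) / ?N"
    unfolding sum_distrib_left[of C "\<lambda>l. \<Sum>p\<in>words d a. _ l p"] sum_divide_distrib[of _ "{..<d}"]
  proof (rule sum.cong[OF refl])
    fix l assume "l \<in> {..<d}"
    hence a: "of_real (amp \<alpha>' \<beta>' \<gamma>' l) = C * (\<Sum>p\<in>words d a. \<Sum>q\<in>words d b.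
      if mset (l # p) = \<alpha>' then if mset q = \<beta>' then if mset (p @ q) = \<gamma>' then 1 else 0 else 0 else 0) / ?N"
      by (intro amp \<alpha>' \<beta>' \<gamma>') simp
    have e: "(\<Sum>p\<in>words d a. \<Sum>q\<in>words d b. if mset (l # p) = \<alpha>' then if mset q = \<beta>' then if mset (p @ q) = \<gamma>' then 1 else 0 else 0 else 0) * U l j
      = (\<Sum>p\<in>words d a. \<Sum>q\<in>words d b. if mset (l # p) = \<alpha>' then if mset q = \<beta>' then if mset (p @ q) = \<gamma>' then U l j else 0 else 0 else 0)"
      unfolding sum_distrib_right by (intro sum.cong refl) auto
    show "of_real (amp \<alpha>' \<beta>' \<gamma>' l) * U l j = C * (\<Sum>p\<in>words d a. \<Sum>q\<in>words d b.
      if mset (l # p) = \<alpha>' then if mset q = \<beta>' then if mset (p @ q) = \<gamma>' then U l j else 0 else 0 else 0) / ?N"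
      unfolding a e[symmetric] by (simp only: mult.assoc times_divide_eq_left)
  qed
  also have "(\<Sum>l<d. \<Sum>p\<in>words d a. \<Sum>q\<in>words d b. if mset (l # p) = \<alpha>' then if mset q = \<beta>' then if mset (p @ q) = \<gamma>' then U l j else 0 else 0 else 0)
    = (\<Sum>w1\<in>words d (Suc a). \<Sum>w2\<in>words d b. if mset w1 = \<alpha>' then if mset w2 = \<beta>' then if mset (tl w1 @ w2) = \<gamma>' then U (hd w1) j else 0 else 0 else 0)"
    unfolding sum_words_Suc list.sel ..
  also have "\<dots> = (\<Sum>w1\<in>words d (Suc a). if mset w1 = \<alpha>' then \<Sum>w2\<in>words d b. if mset w2 = \<beta>' then if mset (tl w1 @ w2) = \<gamma>' then U (hd w1) j else 0 else 0 else 0)"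
    by (intro sum.cong refl) auto
  also have "\<dots> = (\<Sum>w1\<in>perms \<alpha>'. \<Sum>w2\<in>perms \<beta>'. if mset (tl w1 @ w2) = \<gamma>' then U (hd w1) j else 0)"
    unfolding sum_words_if[OF \<alpha>'] sum_words_if[OF \<beta>'] ..
  also have "\<dots> = (\<Sum>w1\<in>perms \<alpha>'. \<Sum>w2\<in>perms \<beta>'. \<Sum>w3\<in>perms \<gamma>'. T w1 w2 w3)"
    unfolding T_def by (intro sum.cong refl) (auto simp: mem_perms simp flip: sum_distrib_left)
  finally have lhs: "(\<Sum>l<d. of_real (amp \<alpha>' \<beta>' \<gamma>' l) * U l j) = C * (\<Sum>w1\<in>perms \<alpha>'. \<Sum>w2\<in>perms \<beta>'. \<Sum>w3\<in>perms \<gamma>'. T w1 w2 w3) / ?N" .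
  \<comment> \<open>The two inner words are concatenated to one word u of length a + b; summing over
    u multiplies U by its adjoint.\<close>
  have contract: "(\<Sum>p\<in>words d a. \<Sum>q\<in>words d b. wprod U w1 (j # p) * wprod U w2 q * cnj (wprod U w3 (p @ q))) = T w1 w2 w3"
    if "w1 \<in> words d (Suc a)" "w2 \<in> words d b" "w3 \<in> words d (a + b)" for w1 w2 w3
  proof -
    from that(1) have "w1 \<noteq> []" by (auto simp: words_def)
    then obtain i w where w1: "w1 = i # w" by (meson neq_Nil_conv)
    have w: "w \<in> words d a" "length w = a" "w @ w2 \<in> words d (a + b)" using that unfolding w1 by (auto simp: words_def)
    have "(\<Sum>p\<in>words d a. \<Sum>q\<in>words d b. wprod U w1 (j # p) * wprod U w2 q * cnj (wprod U w3 (p @ q)))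
      = (\<Sum>p\<in>words d a. \<Sum>q\<in>words d b. U i j * (wprod U (w @ w2) (p @ q) * wprod (\<lambda>k l. cnj (U l k)) (p @ q) w3))"
      unfolding w1 using w
      by (intro sum.cong refl) (simp add: wprod_append words_def wprod_transpose[of "\<lambda>k l. cnj (U k l)"] wprod_cnj)
    also have "\<dots> = U i j * (\<Sum>u\<in>words d (a + b). wprod U (w @ w2) u * wprod (\<lambda>k l. cnj (U l k)) u w3)"
      unfolding sum_words_append sum_distrib_left ..
    also have "(\<Sum>u\<in>words d (a + b). wprod U (w @ w2) u * wprod (\<lambda>k l. cnj (U l k)) u w3)
      = wprod (\<lambda>i i'. \<Sum>k<d. U i k * cnj (U i' k)) (w @ w2) w3"
      using wprod_mult[OF w(3) that(3), of U "\<lambda>k l. cnj (U l k)"] by simp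
    also have "\<dots> = wprod (\<lambda>i i'. if i = i' then 1 else 0) (w @ w2) w3"
      by (rule wprod_cong[OF w(3) that(3) U])
    also have "\<dots> = (if w @ w2 = w3 then 1 else 0)"
      unfolding wprod_one[OF w(3) that(3)] by (simp add: map_replicate_const prod_list_replicate)
    finally show ?thesis unfolding T_def w1 by simp
  qed
  let ?f1 = "\<lambda>\<alpha>. symk U \<alpha>' \<alpha> / n \<alpha>" and ?f2 = "\<lambda>\<alpha>. symk U \<beta>' \<alpha> / n \<alpha>" and ?f3 = "\<lambda>\<alpha>. cnj (symk U \<gamma>' \<alpha> / n \<alpha>)"
  have "(\<Sum>\<alpha>\<in>types d (Suc a). \<Sum>\<beta>\<in>types d b. \<Sum>\<gamma>\<in>types d (a + b). symk U \<alpha>' \<alpha> * symk U \<beta>' \<beta> * cnj (symk U \<gamma>' \<gamma>) * of_real (amp \<alpha> \<beta> \<gamma> j))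
    = (\<Sum>\<alpha>\<in>types d (Suc a). \<Sum>\<beta>\<in>types d b. \<Sum>\<gamma>\<in>types d (a + b). \<Sum>p\<in>words d a. \<Sum>q\<in>words d b.
       if mset (j # p) = \<alpha> then if mset q = \<beta> then if mset (p @ q) = \<gamma> then C * (?f1 \<alpha> * ?f2 \<beta> * ?f3 \<gamma>) else 0 else 0 else 0)"
  proof (intro sum.cong refl)
    fix \<alpha> \<beta> \<gamma> assume "\<alpha> \<in> types d (Suc a)" "\<beta> \<in> types d b" "\<gamma> \<in> types d (a + b)"
    note a = amp[OF this j]
    have "cnj (n \<gamma>) = n \<gamma>" unfolding n_def by simp
    hence "symk U \<alpha>' \<alpha> * symk U \<beta>' \<beta> * cnj (symk U \<gamma>' \<gamma>) * of_real (amp \<alpha> \<beta> \<gamma> j)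
      = (C * (?f1 \<alpha> * ?f2 \<beta> * ?f3 \<gamma>)) * (\<Sum>p\<in>words d a. \<Sum>q\<in>words d b.
       if mset (j # p) = \<alpha> then if mset q = \<beta> then if mset (p @ q) = \<gamma> then 1 else 0 else 0 else 0)"
      unfolding a by simp
    also have "\<dots> = (\<Sum>p\<in>words d a. \<Sum>q\<in>words d b.
       if mset (j # p) = \<alpha> then if mset q = \<beta> then if mset (p @ q) = \<gamma> then C * (?f1 \<alpha> * ?f2 \<beta> * ?f3 \<gamma>) else 0 else 0 else 0)"
      unfolding sum_distrib_left by (intro sum.cong refl) auto
    finally show "symk U \<alpha>' \<alpha> * symk U \<beta>' \<beta> * cnj (symk U \<gamma>' \<gamma>) * of_real (amp \<alpha> \<beta> \<gamma> j) = \<dots>" .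
  qed
  also have "\<dots> = (\<Sum>p\<in>words d a. \<Sum>q\<in>words d b. \<Sum>\<alpha>\<in>types d (Suc a). \<Sum>\<beta>\<in>types d b. \<Sum>\<gamma>\<in>types d (a + b).
       if mset (j # p) = \<alpha> then if mset q = \<beta> then if mset (p @ q) = \<gamma> then C * (?f1 \<alpha> * ?f2 \<beta> * ?f3 \<gamma>) else 0 else 0 else 0)"
    by (rule sum_swap_3_2)
  also have "\<dots> = (\<Sum>p\<in>words d a. \<Sum>q\<in>words d b. C * (?f1 (mset (j # p)) * ?f2 (mset q) * ?f3 (mset (p @ q))))"
  proof (intro sum.cong refl)
    fix p q assume pq: "p \<in> words d a" "q \<in> words d b"
    have mem: "mset (j # p) \<in> types d (Suc a)" "mset q \<in> types d b" "mset (p @ q) \<in> types d (a + b)"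
      using pq j by (auto intro!: mset_in_types simp: words_def simp del: mset.simps mset_append)
    show "(\<Sum>\<alpha>\<in>types d (Suc a). \<Sum>\<beta>\<in>types d b. \<Sum>\<gamma>\<in>types d (a + b).
       if mset (j # p) = \<alpha> then if mset q = \<beta> then if mset (p @ q) = \<gamma> then C * (?f1 \<alpha> * ?f2 \<beta> * ?f3 \<gamma>) else 0 else 0 else 0)
      = C * (?f1 (mset (j # p)) * ?f2 (mset q) * ?f3 (mset (p @ q)))"
      by (simp only: sum_if_const sum.delta' finite_types mem if_True)
  qed
  also have "\<dots> = (\<Sum>p\<in>words d a. \<Sum>q\<in>words d b. C / ?N * ((\<Sum>w1\<in>perms \<alpha>'. wprod U w1 (j # p)) * (\<Sum>w2\<in>perms \<beta>'. wprod U w2 q)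
       * cnj (\<Sum>w3\<in>perms \<gamma>'. wprod U w3 (p @ q))))"
  proof (intro sum.cong refl)
    fix p q assume pq: "p \<in> words d a" "q \<in> words d b"
    have mem: "j # p \<in> words d (Suc a)" "q \<in> words d b" "p @ q \<in> words d (a + b)"
      using pq j by (auto simp: words_def)
    have "?f1 (mset (j # p)) = (\<Sum>w1\<in>perms \<alpha>'. wprod U w1 (j # p)) / n \<alpha>'" "?f2 (mset q) = (\<Sum>w2\<in>perms \<beta>'. wprod U w2 q) / n \<beta>'"
      "?f3 (mset (p @ q)) = cnj (\<Sum>w3\<in>perms \<gamma>'. wprod U w3 (p @ q)) / n \<gamma>'"
      unfolding n_def symk_div_sqrt[OF mem(1) \<alpha>'] symk_div_sqrt[OF mem(2) \<beta>'] symk_div_sqrt[OF mem(3) \<gamma>'] by simp_all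
    thus "C * (?f1 (mset (j # p)) * ?f2 (mset q) * ?f3 (mset (p @ q))) = C / ?N * ((\<Sum>w1\<in>perms \<alpha>'. wprod U w1 (j # p)) * (\<Sum>w2\<in>perms \<beta>'. wprod U w2 q)
       * cnj (\<Sum>w3\<in>perms \<gamma>'. wprod U w3 (p @ q)))" by (simp only:) simp
  qed
  also have "\<dots> = C / ?N * (\<Sum>p\<in>words d a. \<Sum>q\<in>words d b. \<Sum>w1\<in>perms \<alpha>'. \<Sum>w2\<in>perms \<beta>'. \<Sum>w3\<in>perms \<gamma>'.
      wprod U w1 (j # p) * wprod U w2 q * cnj (wprod U w3 (p @ q)))"
    unfolding cnj_sum sum_product3 by (simp only: sum_distrib_left)
  also have "(\<Sum>p\<in>words d a. \<Sum>q\<in>words d b. \<Sum>w1\<in>perms \<alpha>'. \<Sum>w2\<in>perms \<beta>'. \<Sum>w3\<in>perms \<gamma>'.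
      wprod U w1 (j # p) * wprod U w2 q * cnj (wprod U w3 (p @ q)))
    = (\<Sum>w1\<in>perms \<alpha>'. \<Sum>w2\<in>perms \<beta>'. \<Sum>w3\<in>perms \<gamma>'. \<Sum>p\<in>words d a. \<Sum>q\<in>words d b.
      wprod U w1 (j # p) * wprod U w2 q * cnj (wprod U w3 (p @ q)))"
    by (rule sum_swap_3_2[symmetric])
  also have "\<dots> = (\<Sum>w1\<in>perms \<alpha>'. \<Sum>w2\<in>perms \<beta>'. \<Sum>w3\<in>perms \<gamma>'. T w1 w2 w3)"
    using perms_subset_words[OF \<alpha>'] perms_subset_words[OF \<beta>'] perms_subset_words[OF \<gamma>']
    by (intro sum.cong refl contract) auto
  finally show ?thesis unfolding lhs by simp
qed

section \<open>Codes on symmetric powers\<close>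

context three_digits
begin

lemma sum_dig3: "(\<Sum>p<dim3. F (dig3 d p 0) (dig3 d p 1) (dig3 d p 2)) = (\<Sum>a<d 0. \<Sum>b<d 1. \<Sum>c<d 2. F a b c)"
proof -
  have "dig3 d ((a * d 1 + b) * d 2 + c) i = (if i = 0 then a else if i = 1 then b else c)"
    if "a < d 0" "b < d 1" "c < d 2" "i < 3" for a b c i
    using dig3_enc3[of "\<lambda>i. if i = 0 then a else if i = 1 then b else c" i] that unfolding enc3_def by simp
  thus ?thesis unfolding dim3_def sum_lessThan_mult by simp
qed

lemma sum_rest_dig3:
  shows "(\<Sum>p\<in>rest 0. F (dig3 d p 1) (dig3 d p 2)) = (\<Sum>b<d 1. \<Sum>c<d 2. F b c)"
    and "(\<Sum>p\<in>rest 1. F (dig3 d p 0) (dig3 d p 2)) = (\<Sum>a<d 0. \<Sum>c<d 2. F a c)"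
    and "(\<Sum>p\<in>rest 2. F (dig3 d p 0) (dig3 d p 1)) = (\<Sum>a<d 0. \<Sum>b<d 1. F a b)"
proof -
  have r: "(\<Sum>p\<in>rest i. G p) = (\<Sum>p<dim3. if dig3 d p i = 0 then G p else 0)" for i and G :: "nat \<Rightarrow> 'a"
  proof -
    have "rest i = {p \<in> {..<dim3}. dig3 d p i = 0}" unfolding rest_def by auto
    thus ?thesis by (simp only: sum.inter_filter[OF finite_lessThan])
  qed
  have z: "(\<Sum>a<n. if a = 0 then f a else 0) = (f 0 :: 'a)" if "0 < n" for n :: nat and f
    using that by simp
  show "(\<Sum>p\<in>rest 0. F (dig3 d p 1) (dig3 d p 2)) = (\<Sum>b<d 1. \<Sum>c<d 2. F b c)"
    unfolding r sum_dig3[of "\<lambda>a b c. if a = 0 then F b c else 0"] by (simp only: sum_if_const z d_pos)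
  show "(\<Sum>p\<in>rest 1. F (dig3 d p 0) (dig3 d p 2)) = (\<Sum>a<d 0. \<Sum>c<d 2. F a c)"
    unfolding r sum_dig3[of "\<lambda>a b c. if b = 0 then F a c else 0"] by (simp only: sum_if_const z d_pos)
  show "(\<Sum>p\<in>rest 2. F (dig3 d p 0) (dig3 d p 1)) = (\<Sum>a<d 0. \<Sum>b<d 1. F a b)"
    unfolding r sum_dig3[of "\<lambda>a b c. if c = 0 then F a b else 0"] by (simp only: z d_pos)
qed

lemma kron3_index:
  assumes "A \<in> carrier_mat (d 0) (d 0)" "B \<in> carrier_mat (d 1) (d 1)" "C \<in> carrier_mat (d 2) (d 2)"
    and "p < dim3" "p' < dim3"
  shows "kron (kron A B) C $$ (p,p') = A $$ (dig3 d p 0, dig3 d p' 0) * B $$ (dig3 d p 1, dig3 d p' 1) * C $$ (dig3 d p 2, dig3 d p' 2)"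
proof -
  have "x div d 2 < d 0 * d 1" if "x < dim3" for x
    using that unfolding dim3_def by (simp add: less_mult_imp_div_less)
  moreover have "x div (d 1 * d 2) = x div d 2 div d 1" for x
    by (metis div_mult2_eq mult.commute)
  ultimately show ?thesis using assms unfolding kron_def dig3_def dim3_def by simp
qed

end

text \<open>Shared by the main code and by the one for \<open>q 0 = 0\<close>, which differ only in
  the degrees \<open>ns\<close> and the amplitudes \<open>v\<close>. The third factor will carry the
  conjugate representation.\<close>

locale type_code =
  fixes dL :: nat and ns :: "nat \<Rightarrow> nat" and v :: "nat multiset \<Rightarrow> nat multiset \<Rightarrow> nat multiset \<Rightarrow> nat \<Rightarrow> complex"
  assumes dL_pos: "0 < dL"
begin

definition dims :: "nat \<Rightarrow> nat" where "dims i = num_types dL (ns i)"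

sublocale three_digits dims
  by unfold_locales (simp_all add: dims_def num_types_pos[OF dL_pos])

abbreviation ty :: "nat \<Rightarrow> nat \<Rightarrow> nat multiset" where "ty i \<equiv> type_at dL (ns i)"

abbreviation T :: "nat \<Rightarrow> nat multiset set" where "T i \<equiv> types dL (ns i)"

definition V :: "complex mat" where
  "V = mat dim3 dL (\<lambda>(p,l). v (ty 0 (dig3 dims p 0)) (ty 1 (dig3 dims p 1)) (ty 2 (dig3 dims p 2)) l)"

lemma V_index: "p < dim3 \<Longrightarrow> l < dL \<Longrightarrow> V $$ (p,l) = v (ty 0 (dig3 dims p 0)) (ty 1 (dig3 dims p 1)) (ty 2 (dig3 dims p 2)) l"
  unfolding V_def by simp

lemma sum_ty: "(\<Sum>a<dims i. f (ty i a)) = (\<Sum>\<alpha>\<in>T i. f \<alpha>)"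
  unfolding dims_def by (rule sum_type_at)

lemma isometry:
  assumes "\<And>l l'. l < dL \<Longrightarrow> l' < dL \<Longrightarrow> (\<Sum>\<alpha>\<in>T 0. \<Sum>\<beta>\<in>T 1. \<Sum>\<gamma>\<in>T 2. cnj (v \<alpha> \<beta> \<gamma> l) * v \<alpha> \<beta> \<gamma> l') = (if l = l' then 1 else 0)"
  shows "isometry_mat dim3 dL V"
proof -
  have Vc: "V \<in> carrier_mat dim3 dL" unfolding V_def by simp
  have "mat_adjoint V * V = 1\<^sub>m dL"
  proof (rule eq_matI)
    fix l l' assume "l < dim_row (1\<^sub>m dL :: complex mat)" "l' < dim_col (1\<^sub>m dL :: complex mat)"
    hence l: "l < dL" "l' < dL" by auto
    have "(mat_adjoint V * V) $$ (l,l') = (\<Sum>p<dim3. cnj (V $$ (p,l)) * V $$ (p,l'))"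
      using l Vc by (subst mat_mult_index[of _ dL dim3 _ dL]) auto
    also have "\<dots> = (\<Sum>p<dim3. cnj (v (ty 0 (dig3 dims p 0)) (ty 1 (dig3 dims p 1)) (ty 2 (dig3 dims p 2)) l)
       * v (ty 0 (dig3 dims p 0)) (ty 1 (dig3 dims p 1)) (ty 2 (dig3 dims p 2)) l')"
      using l by (intro sum.cong refl) (simp add: V_index)
    also have "\<dots> = (\<Sum>\<alpha>\<in>T 0. \<Sum>\<beta>\<in>T 1. \<Sum>\<gamma>\<in>T 2. cnj (v \<alpha> \<beta> \<gamma> l) * v \<alpha> \<beta> \<gamma> l')"
      unfolding sum_dig3[of "\<lambda>a b c. cnj (v (ty 0 a) (ty 1 b) (ty 2 c) l) * v (ty 0 a) (ty 1 b) (ty 2 c) l'"]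
      unfolding sum_ty[symmetric] ..
    finally show "(mat_adjoint V * V) $$ (l,l') = 1\<^sub>m dL $$ (l,l')" using l assms by simp
  qed (use Vc in auto)
  thus ?thesis unfolding isometry_mat_def using Vc by blast
qed

lemma covariant:
  assumes U: "U \<in> unitary_group dL"
    and kernel: "\<And>\<alpha>' \<beta>' \<gamma>' j. \<alpha>' \<in> T 0 \<Longrightarrow> \<beta>' \<in> T 1 \<Longrightarrow> \<gamma>' \<in> T 2 \<Longrightarrow> j < dL \<Longrightarrow>
      (\<Sum>l<dL. v \<alpha>' \<beta>' \<gamma>' l * U $$ (l,j)) = (\<Sum>\<alpha>\<in>T 0. \<Sum>\<beta>\<in>T 1. \<Sum>\<gamma>\<in>T 2.
       symk (\<lambda>i j. U $$ (i,j)) \<alpha>' \<alpha> * symk (\<lambda>i j. U $$ (i,j)) \<beta>' \<beta> * cnj (symk (\<lambda>i j. U $$ (i,j)) \<gamma>' \<gamma>) * v \<alpha> \<beta> \<gamma> j)"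
  shows "V * U = kron (kron (sym_rep dL (ns 0) U) (sym_rep dL (ns 1) U)) (sym_rep dL (ns 2) (map_mat cnj U)) * V"
proof -
  let ?K = "kron (kron (sym_rep dL (ns 0) U) (sym_rep dL (ns 1) U)) (sym_rep dL (ns 2) (map_mat cnj U))"
  let ?s = "symk (\<lambda>i j. U $$ (i,j))"
  have Uc: "U \<in> carrier_mat dL dL" using U unfolding unitary_group_def unitary_mat_def by auto
  have Vc: "V \<in> carrier_mat dim3 dL" unfolding V_def by simp
  have carr: "sym_rep dL (ns i) W \<in> carrier_mat (dims i) (dims i)" for i W
    unfolding dims_def by simp
  have Kc: "?K \<in> carrier_mat dim3 dim3"
    using carrier_matD[OF carr] unfolding kron_def dim3_def by auto
  show ?thesis
  proof (rule eq_matI)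
    fix p j assume "p < dim_row (?K * V)" "j < dim_col (?K * V)"
    hence p: "p < dim3" and j: "j < dL" using Kc Vc by auto
    have dg: "dig3 dims p i < dims i" if "i < 3" for i using dig3_less[OF that p] .
    have tyT: "ty i (dig3 dims p i) \<in> T i" if "i < 3" for i
      using dg[OF that] unfolding dims_def by (rule type_at_mem)
    define \<alpha>' \<beta>' \<gamma>' where "\<alpha>' = ty 0 (dig3 dims p 0)" and "\<beta>' = ty 1 (dig3 dims p 1)" and "\<gamma>' = ty 2 (dig3 dims p 2)"
    have mem: "\<alpha>' \<in> T 0" "\<beta>' \<in> T 1" "\<gamma>' \<in> T 2" unfolding \<alpha>'_def \<beta>'_def \<gamma>'_def by (auto intro: tyT)
    have K: "?K $$ (p,p') = ?s \<alpha>' (ty 0 (dig3 dims p' 0)) * ?s \<beta>' (ty 1 (dig3 dims p' 1)) * cnj (?s \<gamma>' (ty 2 (dig3 dims p' 2)))"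
      if "p' < dim3" for p'
    proof -
      have dg': "dig3 dims p' i < dims i" if "i < 3" for i using dig3_less[OF that \<open>p' < dim3\<close>] .
      have tyT': "ty i (dig3 dims p' i) \<in> T i" if "i < 3" for i
        using dg'[OF that] unfolding dims_def by (rule type_at_mem)
      have s: "sym_rep dL (ns i) W $$ (dig3 dims p i, dig3 dims p' i) = symk (\<lambda>i j. W $$ (i,j)) (ty i (dig3 dims p i)) (ty i (dig3 dims p' i))"
        if "i < 3" for i W
        using dg[OF that] dg'[OF that] unfolding dims_def by (rule sym_rep_index)
      have "symk (\<lambda>i j. map_mat cnj U $$ (i,j)) \<gamma>' (ty 2 (dig3 dims p' 2)) = symk (\<lambda>i j. cnj (U $$ (i,j))) \<gamma>' (ty 2 (dig3 dims p' 2))"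
        using Uc mem tyT'[of 2] by (intro symk_cong[of _ dL "ns 2"]) auto
      hence c: "symk (\<lambda>i j. map_mat cnj U $$ (i,j)) \<gamma>' (ty 2 (dig3 dims p' 2)) = cnj (?s \<gamma>' (ty 2 (dig3 dims p' 2)))"
        unfolding symk_cnj .
      show ?thesis unfolding kron3_index[OF carr carr carr p that] \<alpha>'_def \<beta>'_def
        using s[of 0 U] s[of 1 U] s[of 2 "map_mat cnj U"] c unfolding \<gamma>'_def by simp
    qed
    have "(?K * V) $$ (p,j) = (\<Sum>p'<dim3. ?K $$ (p,p') * V $$ (p',j))"
      by (rule mat_mult_index[OF Kc Vc p j])
    also have "\<dots> = (\<Sum>p'<dim3. ?s \<alpha>' (ty 0 (dig3 dims p' 0)) * ?s \<beta>' (ty 1 (dig3 dims p' 1)) * cnj (?s \<gamma>' (ty 2 (dig3 dims p' 2)))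
       * v (ty 0 (dig3 dims p' 0)) (ty 1 (dig3 dims p' 1)) (ty 2 (dig3 dims p' 2)) j)"
      by (intro sum.cong refl) (simp only: lessThan_iff K V_index[OF _ j])
    also have "\<dots> = (\<Sum>\<alpha>\<in>T 0. \<Sum>\<beta>\<in>T 1. \<Sum>\<gamma>\<in>T 2. ?s \<alpha>' \<alpha> * ?s \<beta>' \<beta> * cnj (?s \<gamma>' \<gamma>) * v \<alpha> \<beta> \<gamma> j)"
      unfolding sum_dig3[of "\<lambda>a b c. ?s \<alpha>' (ty 0 a) * ?s \<beta>' (ty 1 b) * cnj (?s \<gamma>' (ty 2 c)) * v (ty 0 a) (ty 1 b) (ty 2 c) j"]
      unfolding sum_ty[symmetric] ..
    also have "\<dots> = (\<Sum>l<dL. v \<alpha>' \<beta>' \<gamma>' l * U $$ (l,j))" using kernel[OF mem j] by simp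
    also have "\<dots> = (V * U) $$ (p,j)"
      unfolding mat_mult_index[OF Vc Uc p j] \<alpha>'_def \<beta>'_def \<gamma>'_def using p by (simp add: V_index)
    finally show "(V * U) $$ (p,j) = (?K * V) $$ (p,j)" ..
  qed (use Kc Vc Uc in auto)
qed

lemma V_setdig3:
  assumes "i < 3" "p < dim3" "\<kappa> < dims i" "l < dL"
  shows "V $$ (setdig3 dims i p \<kappa>, l) = v (ty 0 (if i = 0 then \<kappa> else dig3 dims p 0))
    (ty 1 (if i = 1 then \<kappa> else dig3 dims p 1)) (ty 2 (if i = 2 then \<kappa> else dig3 dims p 2)) l"
  using assms by (simp add: V_index setdig3_less dig3_setdig3)

text \<open>Inverse of the enumeration, used to read a vector over matrix positions as a vector over
  types.\<close>

definition idx :: "nat \<Rightarrow> nat multiset \<Rightarrow> nat" where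
  "idx i = inv_into {..<dims i} (ty i)"

lemma idx_ty: "\<kappa> < dims i \<Longrightarrow> idx i (ty i \<kappa>) = \<kappa>"
  unfolding idx_def dims_def using type_at_bij[of dL "ns i"] by (intro inv_into_f_f) (auto simp: bij_betw_def)

lemma sum_ty_idx: "(\<Sum>\<kappa><dims i. f (ty i \<kappa>) \<kappa>) = (\<Sum>\<alpha>\<in>T i. f \<alpha> (idx i \<alpha>))"
proof -
  have "(\<Sum>\<kappa><dims i. f (ty i \<kappa>) \<kappa>) = (\<Sum>\<kappa><dims i. f (ty i \<kappa>) (idx i (ty i \<kappa>)))"
    by (intro sum.cong refl) (simp add: idx_ty)
  thus ?thesis unfolding sum_ty[where i = i and f = "\<lambda>\<alpha>. f \<alpha> (idx i \<alpha>)"] .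
qed

lemma marginal_norm:
  shows "(\<Sum>p\<in>rest 0. (cmod (\<Sum>\<kappa><dims 0. \<Sum>l<dL. V $$ (setdig3 dims 0 p \<kappa>, l) * \<xi> \<kappa> l))\<^sup>2)
    = (\<Sum>\<beta>\<in>T 1. \<Sum>\<gamma>\<in>T 2. (cmod (\<Sum>\<alpha>\<in>T 0. \<Sum>l<dL. v \<alpha> \<beta> \<gamma> l * \<xi> (idx 0 \<alpha>) l))\<^sup>2)"
    and "(\<Sum>p\<in>rest 1. (cmod (\<Sum>\<kappa><dims 1. \<Sum>l<dL. V $$ (setdig3 dims 1 p \<kappa>, l) * \<xi> \<kappa> l))\<^sup>2)
    = (\<Sum>\<alpha>\<in>T 0. \<Sum>\<gamma>\<in>T 2. (cmod (\<Sum>\<beta>\<in>T 1. \<Sum>l<dL. v \<alpha> \<beta> \<gamma> l * \<xi> (idx 1 \<beta>) l))\<^sup>2)"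
    and "(\<Sum>p\<in>rest 2. (cmod (\<Sum>\<kappa><dims 2. \<Sum>l<dL. V $$ (setdig3 dims 2 p \<kappa>, l) * \<xi> \<kappa> l))\<^sup>2)
    = (\<Sum>\<alpha>\<in>T 0. \<Sum>\<beta>\<in>T 1. (cmod (\<Sum>\<gamma>\<in>T 2. \<Sum>l<dL. v \<alpha> \<beta> \<gamma> l * \<xi> (idx 2 \<gamma>) l))\<^sup>2)"
proof -
  have inner0: "(\<Sum>\<alpha>\<in>T 0. \<Sum>l<dL. v \<alpha> \<beta> \<gamma> l * \<xi> (idx 0 \<alpha>) l) = (\<Sum>\<kappa><dims 0. \<Sum>l<dL. v (ty 0 \<kappa>) \<beta> \<gamma> l * \<xi> \<kappa> l)" for \<beta> \<gamma>
    by (rule sum_ty_idx[where i = 0 and f = "\<lambda>\<alpha> \<kappa>. \<Sum>l<dL. v \<alpha> \<beta> \<gamma> l * \<xi> \<kappa> l", symmetric])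
  have "(\<Sum>p\<in>rest 0. (cmod (\<Sum>\<kappa><dims 0. \<Sum>l<dL. V $$ (setdig3 dims 0 p \<kappa>, l) * \<xi> \<kappa> l))\<^sup>2)
    = (\<Sum>p\<in>rest 0. (cmod (\<Sum>\<kappa><dims 0. \<Sum>l<dL. v (ty 0 \<kappa>) (ty 1 (dig3 dims p 1)) (ty 2 (dig3 dims p 2)) l * \<xi> \<kappa> l))\<^sup>2)"
    by (intro sum.cong refl arg_cong[of _ _ "\<lambda>z. (cmod z)\<^sup>2"]) (simp add: V_setdig3 rest_def)
  thus "(\<Sum>p\<in>rest 0. (cmod (\<Sum>\<kappa><dims 0. \<Sum>l<dL. V $$ (setdig3 dims 0 p \<kappa>, l) * \<xi> \<kappa> l))\<^sup>2)
    = (\<Sum>\<beta>\<in>T 1. \<Sum>\<gamma>\<in>T 2. (cmod (\<Sum>\<alpha>\<in>T 0. \<Sum>l<dL. v \<alpha> \<beta> \<gamma> l * \<xi> (idx 0 \<alpha>) l))\<^sup>2)"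
    unfolding sum_rest_dig3(1)[of "\<lambda>b c. (cmod (\<Sum>\<kappa><dims 0. \<Sum>l<dL. v (ty 0 \<kappa>) (ty 1 b) (ty 2 c) l * \<xi> \<kappa> l))\<^sup>2"] inner0
      sum_ty[where i = 1, symmetric] sum_ty[where i = 2, symmetric] .
  have inner1: "(\<Sum>\<beta>\<in>T 1. \<Sum>l<dL. v \<alpha> \<beta> \<gamma> l * \<xi> (idx 1 \<beta>) l) = (\<Sum>\<kappa><dims 1. \<Sum>l<dL. v \<alpha> (ty 1 \<kappa>) \<gamma> l * \<xi> \<kappa> l)" for \<alpha> \<gamma>
    by (rule sum_ty_idx[where i = 1 and f = "\<lambda>\<beta> \<kappa>. \<Sum>l<dL. v \<alpha> \<beta> \<gamma> l * \<xi> \<kappa> l", symmetric])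
  have "(\<Sum>p\<in>rest 1. (cmod (\<Sum>\<kappa><dims 1. \<Sum>l<dL. V $$ (setdig3 dims 1 p \<kappa>, l) * \<xi> \<kappa> l))\<^sup>2)
    = (\<Sum>p\<in>rest 1. (cmod (\<Sum>\<kappa><dims 1. \<Sum>l<dL. v (ty 0 (dig3 dims p 0)) (ty 1 \<kappa>) (ty 2 (dig3 dims p 2)) l * \<xi> \<kappa> l))\<^sup>2)"
    by (intro sum.cong refl arg_cong[of _ _ "\<lambda>z. (cmod z)\<^sup>2"]) (simp add: V_setdig3 rest_def)
  thus "(\<Sum>p\<in>rest 1. (cmod (\<Sum>\<kappa><dims 1. \<Sum>l<dL. V $$ (setdig3 dims 1 p \<kappa>, l) * \<xi> \<kappa> l))\<^sup>2)
    = (\<Sum>\<alpha>\<in>T 0. \<Sum>\<gamma>\<in>T 2. (cmod (\<Sum>\<beta>\<in>T 1. \<Sum>l<dL. v \<alpha> \<beta> \<gamma> l * \<xi> (idx 1 \<beta>) l))\<^sup>2)"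
    unfolding sum_rest_dig3(2)[of "\<lambda>a c. (cmod (\<Sum>\<kappa><dims 1. \<Sum>l<dL. v (ty 0 a) (ty 1 \<kappa>) (ty 2 c) l * \<xi> \<kappa> l))\<^sup>2"] inner1
      sum_ty[where i = 0, symmetric] sum_ty[where i = 2, symmetric] .
  have inner2: "(\<Sum>\<gamma>\<in>T 2. \<Sum>l<dL. v \<alpha> \<beta> \<gamma> l * \<xi> (idx 2 \<gamma>) l) = (\<Sum>\<kappa><dims 2. \<Sum>l<dL. v \<alpha> \<beta> (ty 2 \<kappa>) l * \<xi> \<kappa> l)" for \<alpha> \<beta>
    by (rule sum_ty_idx[where i = 2 and f = "\<lambda>\<gamma> \<kappa>. \<Sum>l<dL. v \<alpha> \<beta> \<gamma> l * \<xi> \<kappa> l", symmetric])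
  have "(\<Sum>p\<in>rest 2. (cmod (\<Sum>\<kappa><dims 2. \<Sum>l<dL. V $$ (setdig3 dims 2 p \<kappa>, l) * \<xi> \<kappa> l))\<^sup>2)
    = (\<Sum>p\<in>rest 2. (cmod (\<Sum>\<kappa><dims 2. \<Sum>l<dL. v (ty 0 (dig3 dims p 0)) (ty 1 (dig3 dims p 1)) (ty 2 \<kappa>) l * \<xi> \<kappa> l))\<^sup>2)"
    by (intro sum.cong refl arg_cong[of _ _ "\<lambda>z. (cmod z)\<^sup>2"]) (simp add: V_setdig3 rest_def)
  thus "(\<Sum>p\<in>rest 2. (cmod (\<Sum>\<kappa><dims 2. \<Sum>l<dL. V $$ (setdig3 dims 2 p \<kappa>, l) * \<xi> \<kappa> l))\<^sup>2)
    = (\<Sum>\<alpha>\<in>T 0. \<Sum>\<beta>\<in>T 1. (cmod (\<Sum>\<gamma>\<in>T 2. \<Sum>l<dL. v \<alpha> \<beta> \<gamma> l * \<xi> (idx 2 \<gamma>) l))\<^sup>2)"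
    unfolding sum_rest_dig3(3)[of "\<lambda>a b. (cmod (\<Sum>\<kappa><dims 2. \<Sum>l<dL. v (ty 0 a) (ty 1 b) (ty 2 \<kappa>) l * \<xi> \<kappa> l))\<^sup>2"] inner2
      sum_ty[where i = 0, symmetric] sum_ty[where i = 1, symmetric] .
qed

lemma norm_idx: "(\<Sum>\<kappa><dims i. \<Sum>l<dL. (cmod (\<xi> \<kappa> l))\<^sup>2) = (\<Sum>\<alpha>\<in>T i. \<Sum>l<dL. (cmod (\<xi> (idx i \<alpha>) l))\<^sup>2)"
  using sum_ty_idx[of "\<lambda>_ \<kappa>. \<Sum>l<dL. (cmod (\<xi> \<kappa> l))\<^sup>2"] by simp

lemma marginal_bound:
  assumes "\<And>x. (\<Sum>\<beta>\<in>T 1. \<Sum>\<gamma>\<in>T 2. (cmod (\<Sum>\<alpha>\<in>T 0. \<Sum>l<dL. v \<alpha> \<beta> \<gamma> l * x \<alpha> l))\<^sup>2) \<le> t 0 * (\<Sum>\<alpha>\<in>T 0. \<Sum>l<dL. (cmod (x \<alpha> l))\<^sup>2)"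
    and "\<And>x. (\<Sum>\<alpha>\<in>T 0. \<Sum>\<gamma>\<in>T 2. (cmod (\<Sum>\<beta>\<in>T 1. \<Sum>l<dL. v \<alpha> \<beta> \<gamma> l * x \<beta> l))\<^sup>2) \<le> t 1 * (\<Sum>\<beta>\<in>T 1. \<Sum>l<dL. (cmod (x \<beta> l))\<^sup>2)"
    and "\<And>x. (\<Sum>\<alpha>\<in>T 0. \<Sum>\<beta>\<in>T 1. (cmod (\<Sum>\<gamma>\<in>T 2. \<Sum>l<dL. v \<alpha> \<beta> \<gamma> l * x \<gamma> l))\<^sup>2) \<le> t 2 * (\<Sum>\<gamma>\<in>T 2. \<Sum>l<dL. (cmod (x \<gamma> l))\<^sup>2)"
    and i: "i < 3"
  shows "(\<Sum>p\<in>rest i. (cmod (\<Sum>\<kappa><dims i. \<Sum>l<dL. V $$ (setdig3 dims i p \<kappa>, l) * \<xi> \<kappa> l))\<^sup>2)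
      \<le> t i * (\<Sum>\<kappa><dims i. \<Sum>l<dL. (cmod (\<xi> \<kappa> l))\<^sup>2)"
proof -
  have "i = 0 \<or> i = 1 \<or> i = 2" using i by auto
  thus ?thesis unfolding norm_idx
  proof (elim disjE)
    assume "i = 0"
    thus "(\<Sum>p\<in>rest i. (cmod (\<Sum>\<kappa><dims i. \<Sum>l<dL. V $$ (setdig3 dims i p \<kappa>, l) * \<xi> \<kappa> l))\<^sup>2) \<le> t i * (\<Sum>\<alpha>\<in>T i. \<Sum>l<dL. (cmod (\<xi> (idx i \<alpha>) l))\<^sup>2)"
      using assms(1)[of "\<lambda>\<alpha>. \<xi> (idx 0 \<alpha>)"] by (simp only: marginal_norm)
  next
    assume "i = 1"
    thus "(\<Sum>p\<in>rest i. (cmod (\<Sum>\<kappa><dims i. \<Sum>l<dL. V $$ (setdig3 dims i p \<kappa>, l) * \<xi> \<kappa> l))\<^sup>2) \<le> t i * (\<Sum>\<alpha>\<in>T i. \<Sum>l<dL. (cmod (\<xi> (idx i \<alpha>) l))\<^sup>2)"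
      using assms(2)[of "\<lambda>\<alpha>. \<xi> (idx 1 \<alpha>)"] by (simp only: marginal_norm)
  next
    assume "i = 2"
    thus "(\<Sum>p\<in>rest i. (cmod (\<Sum>\<kappa><dims i. \<Sum>l<dL. V $$ (setdig3 dims i p \<kappa>, l) * \<xi> \<kappa> l))\<^sup>2) \<le> t i * (\<Sum>\<alpha>\<in>T i. \<Sum>l<dL. (cmod (\<xi> (idx i \<alpha>) l))\<^sup>2)"
      using assms(3)[of "\<lambda>\<alpha>. \<xi> (idx 2 \<alpha>)"] by (simp only: marginal_norm)
  qed
qed

lemma marginal_entry:
  assumes "\<kappa> < dims 0" "\<kappa>' < dims 0" "l < dL" "l' < dL"
  shows "(\<Sum>p\<in>rest 0. cnj (V $$ (setdig3 dims 0 p \<kappa>', l')) * V $$ (setdig3 dims 0 p \<kappa>, l))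
    = (\<Sum>\<beta>\<in>T 1. \<Sum>\<gamma>\<in>T 2. v (ty 0 \<kappa>) \<beta> \<gamma> l * cnj (v (ty 0 \<kappa>') \<beta> \<gamma> l'))"
proof -
  have "(\<Sum>p\<in>rest 0. cnj (V $$ (setdig3 dims 0 p \<kappa>', l')) * V $$ (setdig3 dims 0 p \<kappa>, l))
    = (\<Sum>p\<in>rest 0. v (ty 0 \<kappa>) (ty 1 (dig3 dims p 1)) (ty 2 (dig3 dims p 2)) l * cnj (v (ty 0 \<kappa>') (ty 1 (dig3 dims p 1)) (ty 2 (dig3 dims p 2)) l'))"
    using assms by (intro sum.cong refl) (simp add: V_setdig3 rest_def mult.commute)
  thus ?thesis unfolding sum_rest_dig3(1)[of "\<lambda>b c. v (ty 0 \<kappa>) (ty 1 b) (ty 2 c) l * cnj (v (ty 0 \<kappa>') (ty 1 b) (ty 2 c) l')"]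
    sum_ty[symmetric] .
qed

end

section \<open>Norm bounds for the three marginals\<close>

context phase
begin

text \<open>The left side is the quadratic form of the Gram matrix in \<open>gram_1\<close>. As
  \<open>gram_link\<close> is nonnegative, the coupling part may be estimated from above by
  \<open>linked_form_le\<close>.\<close>

lemma marginal_1:
  assumes d: "0 < d"
  shows "(\<Sum>\<beta>\<in>types d (t + 2). \<Sum>\<gamma>\<in>types d (2 * t + 3). (cmod (\<Sum>\<alpha>\<in>types d (t + 2). \<Sum>l<d. code_amp \<omega> \<alpha> \<beta> \<gamma> l * x \<alpha> l))\<^sup>2)
    \<le> (gram_diag d + gram_link d * (real t + 1 + real d)) * (\<Sum>\<alpha>\<in>types d (t + 2). \<Sum>l<d. (cmod (x \<alpha> l))\<^sup>2)"
proof -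
  let ?T = "types d (t + 2)" and ?K = "types d (2 * t + 3)"
  let ?I = "?T \<times> {..<d}"
  let ?c = "\<lambda>\<beta> \<gamma> a. code_amp \<omega> (fst a) \<beta> \<gamma> (snd a)" and ?x = "\<lambda>a. x (fst a) (snd a)"
  let ?l = "\<lambda>a b. linked (fst a) (snd a) (fst b) (snd b)"
  have "complex_of_real (\<Sum>\<beta>\<in>?T. \<Sum>\<gamma>\<in>?K. (cmod (\<Sum>\<alpha>\<in>?T. \<Sum>l<d. code_amp \<omega> \<alpha> \<beta> \<gamma> l * x \<alpha> l))\<^sup>2)
    = (\<Sum>\<beta>\<in>?T. \<Sum>\<gamma>\<in>?K. (\<Sum>a\<in>?I. ?c \<beta> \<gamma> a * ?x a) * cnj (\<Sum>a\<in>?I. ?c \<beta> \<gamma> a * ?x a))"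
    unfolding of_real_sum complex_norm_square by (simp add: sum.cartesian_product case_prod_unfold)
  also have "\<dots> = (\<Sum>\<beta>\<in>?T. \<Sum>\<gamma>\<in>?K. \<Sum>a\<in>?I. \<Sum>b\<in>?I. (?x a * cnj (?x b)) * (?c \<beta> \<gamma> a * cnj (?c \<beta> \<gamma> b)))"
    unfolding cnj_sum sum_product by (intro sum.cong refl) simp
  also have "\<dots> = (\<Sum>a\<in>?I. \<Sum>\<beta>\<in>?T. \<Sum>\<gamma>\<in>?K. \<Sum>b\<in>?I. (?x a * cnj (?x b)) * (?c \<beta> \<gamma> a * cnj (?c \<beta> \<gamma> b)))"
    by (rule trans[OF sum.cong[OF refl sum.swap] sum.swap])
  also have "\<dots> = (\<Sum>a\<in>?I. \<Sum>b\<in>?I. \<Sum>\<beta>\<in>?T. \<Sum>\<gamma>\<in>?K. (?x a * cnj (?x b)) * (?c \<beta> \<gamma> a * cnj (?c \<beta> \<gamma> b)))"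
    by (rule sum.cong[OF refl], rule trans[OF sum.cong[OF refl sum.swap] sum.swap])
  also have "\<dots> = (\<Sum>a\<in>?I. \<Sum>b\<in>?I. (?x a * cnj (?x b)) * of_real ((if a = b then gram_diag d else 0) + gram_link d * ?l a b))"
    unfolding sum_distrib_left[symmetric]
  proof (intro sum.cong refl arg_cong2[of _ _ _ _ "(*)"])
    fix a b assume "a \<in> ?I" "b \<in> ?I"
    thus "(\<Sum>\<beta>\<in>?T. \<Sum>\<gamma>\<in>?K. ?c \<beta> \<gamma> a * cnj (?c \<beta> \<gamma> b)) = of_real ((if a = b then gram_diag d else 0) + gram_link d * ?l a b)"
      using gram_1[of "snd a" d "snd b" "fst a" "fst b"] by (auto simp: prod_eq_iff)
  qed
  also have "\<dots> = (\<Sum>a\<in>?I. (\<Sum>b\<in>?I. if a = b then of_real (gram_diag d) * (?x a * cnj (?x a)) else 0)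
      + of_real (gram_link d) * (\<Sum>b\<in>?I. of_real (?l a b) * (?x a * cnj (?x b))))"
    unfolding sum_distrib_left sum.distrib[symmetric] by (intro sum.cong refl) (simp add: algebra_simps)
  also have "\<dots> = of_real (gram_diag d) * (\<Sum>a\<in>?I. of_real ((cmod (?x a))\<^sup>2))
      + of_real (gram_link d) * (\<Sum>a\<in>?I. \<Sum>b\<in>?I. of_real (?l a b) * (?x a * cnj (?x b)))"
    unfolding sum.distrib sum_distrib_left complex_norm_square by (intro arg_cong2[of _ _ _ _ "(+)"] sum.cong refl) simp
  finally have "Re (complex_of_real (\<Sum>\<beta>\<in>?T. \<Sum>\<gamma>\<in>?K. (cmod (\<Sum>\<alpha>\<in>?T. \<Sum>l<d. code_amp \<omega> \<alpha> \<beta> \<gamma> l * x \<alpha> l))\<^sup>2))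
    = Re (of_real (gram_diag d) * (\<Sum>a\<in>?I. of_real ((cmod (?x a))\<^sup>2))
      + of_real (gram_link d) * (\<Sum>a\<in>?I. \<Sum>b\<in>?I. of_real (?l a b) * (?x a * cnj (?x b))))"
    by (rule arg_cong)
  hence "(\<Sum>\<beta>\<in>?T. \<Sum>\<gamma>\<in>?K. (cmod (\<Sum>\<alpha>\<in>?T. \<Sum>l<d. code_amp \<omega> \<alpha> \<beta> \<gamma> l * x \<alpha> l))\<^sup>2)
    = Re (of_real (gram_diag d) * (\<Sum>a\<in>?I. of_real ((cmod (?x a))\<^sup>2))
      + of_real (gram_link d) * (\<Sum>a\<in>?I. \<Sum>b\<in>?I. of_real (?l a b) * (?x a * cnj (?x b))))"
    unfolding Re_complex_of_real .
  also have "\<dots> = gram_diag d * (\<Sum>a\<in>?I. (cmod (?x a))\<^sup>2) + gram_link d * Re (\<Sum>a\<in>?I. \<Sum>b\<in>?I. of_real (?l a b) * (?x a * cnj (?x b)))"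
    by simp
  also have "\<dots> \<le> gram_diag d * (\<Sum>a\<in>?I. (cmod (?x a))\<^sup>2) + gram_link d * ((real t + 1 + real d) * (\<Sum>a\<in>?I. (cmod (?x a))\<^sup>2))"
  proof (intro add_left_mono mult_left_mono gram_link_nonneg)
    show "Re (\<Sum>a\<in>?I. \<Sum>b\<in>?I. of_real (?l a b) * (?x a * cnj (?x b))) \<le> (real t + 1 + real d) * (\<Sum>a\<in>?I. (cmod (?x a))\<^sup>2)"
      using linked_form_le[where n = "t + 1" and \<xi> = x, OF d]
      by (simp only: sum.cartesian_product case_prod_unfold Suc_eq_plus1 of_nat_add of_nat_1 add.assoc one_add_one)
  qed
  also have "\<dots> = (gram_diag d + gram_link d * (real t + 1 + real d)) * (\<Sum>a\<in>?I. (cmod (?x a))\<^sup>2)"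
    by (simp add: algebra_simps)
  finally show ?thesis by (simp add: sum.cartesian_product case_prod_unfold)
qed

text \<open>Exchanging A_1 and A_2 conjugates \<omega>, up to an overall phase. The conjugate has
  the same modulus and real part, so the bound for A_2 is the bound for A_1 at
  \<open>cnj \<omega>\<close>.\<close>

lemma code_amp_swap: "code_amp \<omega> \<alpha> \<beta> \<gamma> j = \<omega> * code_amp (cnj \<omega>) \<beta> \<alpha> \<gamma> j"
proof -
  have "\<omega> * cnj \<omega> = 1" using \<omega>_unit by (simp add: complex_norm_square[symmetric])
  thus ?thesis unfolding code_amp_def by (simp add: distrib_left mult.assoc[symmetric])
qed

lemma marginal_2:
  assumes d: "0 < d"
  shows "(\<Sum>\<alpha>\<in>types d (t + 2). \<Sum>\<gamma>\<in>types d (2 * t + 3). (cmod (\<Sum>\<beta>\<in>types d (t + 2). \<Sum>l<d. code_amp \<omega> \<alpha> \<beta> \<gamma> l * x \<beta> l))\<^sup>2)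
    \<le> (gram_diag d + gram_link d * (real t + 1 + real d)) * (\<Sum>\<beta>\<in>types d (t + 2). \<Sum>l<d. (cmod (x \<beta> l))\<^sup>2)"
proof -
  interpret c: phase t "cnj \<omega>" by (rule phase_cnj)
  have "(\<Sum>\<beta>\<in>types d (t + 2). \<Sum>l<d. code_amp \<omega> \<alpha> \<beta> \<gamma> l * x \<beta> l) = \<omega> * (\<Sum>\<beta>\<in>types d (t + 2). \<Sum>l<d. code_amp (cnj \<omega>) \<beta> \<alpha> \<gamma> l * x \<beta> l)" for \<alpha> \<gamma>
    unfolding code_amp_swap[of \<alpha>] by (simp add: sum_distrib_left mult.assoc)
  hence "cmod (\<Sum>\<beta>\<in>types d (t + 2). \<Sum>l<d. code_amp \<omega> \<alpha> \<beta> \<gamma> l * x \<beta> l) = cmod (\<Sum>\<beta>\<in>types d (t + 2). \<Sum>l<d. code_amp (cnj \<omega>) \<beta> \<alpha> \<gamma> l * x \<beta> l)" for \<alpha> \<gamma>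
    using \<omega>_unit by (simp add: norm_mult)
  moreover have "c.gram_diag d = gram_diag d" "c.gram_link d = gram_link d"
    unfolding gram_diag_def c.gram_diag_def gram_link_def c.gram_link_def by simp_all
  ultimately show ?thesis using c.marginal_1[OF d, of x] by simp
qed

text \<open>An equality and not just a bound, because the Gram matrix in \<open>gram_3\<close> is
  scalar.\<close>

lemma marginal_3:
  "(\<Sum>\<alpha>\<in>types d (t + 2). \<Sum>\<beta>\<in>types d (t + 2). (cmod (\<Sum>\<gamma>\<in>types d (2 * t + 3). \<Sum>l<d. code_amp \<omega> \<alpha> \<beta> \<gamma> l * x \<gamma> l))\<^sup>2)
    = 2 * ((2 * t + 3) choose (t + 1)) * (\<Sum>\<gamma>\<in>types d (2 * t + 3). \<Sum>l<d. (cmod (x \<gamma> l))\<^sup>2)"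
proof -
  let ?T = "types d (t + 2)" and ?K = "types d (2 * t + 3)"
  let ?I = "?K \<times> {..<d}"
  let ?c = "\<lambda>\<alpha> \<beta> a. code_amp \<omega> \<alpha> \<beta> (fst a) (snd a)" and ?x = "\<lambda>a. x (fst a) (snd a)"
  define Z where "Z = (2 * of_nat ((2 * t + 3) choose (t + 1)) :: complex)"
  have "complex_of_real (\<Sum>\<alpha>\<in>?T. \<Sum>\<beta>\<in>?T. (cmod (\<Sum>\<gamma>\<in>?K. \<Sum>l<d. code_amp \<omega> \<alpha> \<beta> \<gamma> l * x \<gamma> l))\<^sup>2)
    = (\<Sum>\<alpha>\<in>?T. \<Sum>\<beta>\<in>?T. (\<Sum>a\<in>?I. ?c \<alpha> \<beta> a * ?x a) * cnj (\<Sum>a\<in>?I. ?c \<alpha> \<beta> a * ?x a))"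
    unfolding of_real_sum complex_norm_square by (simp add: sum.cartesian_product case_prod_unfold)
  also have "\<dots> = (\<Sum>\<alpha>\<in>?T. \<Sum>\<beta>\<in>?T. \<Sum>a\<in>?I. \<Sum>b\<in>?I. (?x a * cnj (?x b)) * (?c \<alpha> \<beta> a * cnj (?c \<alpha> \<beta> b)))"
    unfolding cnj_sum sum_product by (intro sum.cong refl) simp
  also have "\<dots> = (\<Sum>a\<in>?I. \<Sum>\<alpha>\<in>?T. \<Sum>\<beta>\<in>?T. \<Sum>b\<in>?I. (?x a * cnj (?x b)) * (?c \<alpha> \<beta> a * cnj (?c \<alpha> \<beta> b)))"
    by (rule trans[OF sum.cong[OF refl sum.swap] sum.swap])
  also have "\<dots> = (\<Sum>a\<in>?I. \<Sum>b\<in>?I. \<Sum>\<alpha>\<in>?T. \<Sum>\<beta>\<in>?T. (?x a * cnj (?x b)) * (?c \<alpha> \<beta> a * cnj (?c \<alpha> \<beta> b)))"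
    by (rule sum.cong[OF refl], rule trans[OF sum.cong[OF refl sum.swap] sum.swap])
  also have "\<dots> = (\<Sum>a\<in>?I. \<Sum>b\<in>?I. (?x a * cnj (?x b)) * (if a = b then Z else 0))"
    unfolding sum_distrib_left[symmetric]
  proof (intro sum.cong refl arg_cong2[of _ _ _ _ "(*)"])
    fix a b assume "a \<in> ?I" "b \<in> ?I"
    thus "(\<Sum>\<alpha>\<in>?T. \<Sum>\<beta>\<in>?T. ?c \<alpha> \<beta> a * cnj (?c \<alpha> \<beta> b)) = (if a = b then Z else 0)"
      using gram_3[of "snd a" d "snd b" "fst a" "fst b"] unfolding Z_def by (auto simp: prod_eq_iff)
  qed
  also have "\<dots> = (\<Sum>a\<in>?I. \<Sum>b\<in>?I. if a = b then Z * (?x a * cnj (?x a)) else 0)"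
    by (intro sum.cong refl) auto
  also have "\<dots> = Z * (\<Sum>a\<in>?I. of_real ((cmod (?x a))\<^sup>2))"
    unfolding sum_distrib_left complex_norm_square by (intro sum.cong refl) simp
  also have "\<dots> = of_real (2 * ((2 * t + 3) choose (t + 1)) * (\<Sum>a\<in>?I. (cmod (?x a))\<^sup>2))"
    unfolding Z_def by simp
  finally have "(\<Sum>\<alpha>\<in>?T. \<Sum>\<beta>\<in>?T. (cmod (\<Sum>\<gamma>\<in>?K. \<Sum>l<d. code_amp \<omega> \<alpha> \<beta> \<gamma> l * x \<gamma> l))\<^sup>2)
    = 2 * ((2 * t + 3) choose (t + 1)) * (\<Sum>a\<in>?I. (cmod (?x a))\<^sup>2)" unfolding of_real_eq_iff .
  thus ?thesis by (simp only: sum.cartesian_product case_prod_unfold)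
qed

text \<open>The squared norm of each unnormalized code vector: the scalar of \<open>gram_3\<close>
  times the dimension of A_3.\<close>

definition total :: "nat \<Rightarrow> real" where
  "total d = 2 * ((2 * t + 3) choose (t + 1)) * num_types d (2 * t + 3)"

lemma total_pos:
  assumes "0 < d"
  shows "0 < total d"
proof -
  have "0 < (2 * t + 3) choose (t + 1)" by (simp only: zero_less_binomial_iff)
  thus ?thesis unfolding total_def of_nat_0_less_iff using num_types_pos[OF assms, of "2 * t + 3"]
    by (intro mult_pos_pos) simp_all
qed

lemma code_amp_total:
  assumes "l < d" "l' < d"
  shows "(\<Sum>\<alpha>\<in>types d (t + 2). \<Sum>\<beta>\<in>types d (t + 2). \<Sum>\<gamma>\<in>types d (2 * t + 3). cnj (code_amp \<omega> \<alpha> \<beta> \<gamma> l) * code_amp \<omega> \<alpha> \<beta> \<gamma> l')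
    = (if l = l' then of_real (total d) else 0)"
proof -
  have "(\<Sum>\<alpha>\<in>types d (t + 2). \<Sum>\<beta>\<in>types d (t + 2). \<Sum>\<gamma>\<in>types d (2 * t + 3). cnj (code_amp \<omega> \<alpha> \<beta> \<gamma> l) * code_amp \<omega> \<alpha> \<beta> \<gamma> l')
    = (\<Sum>\<gamma>\<in>types d (2 * t + 3). \<Sum>\<alpha>\<in>types d (t + 2). \<Sum>\<beta>\<in>types d (t + 2). code_amp \<omega> \<alpha> \<beta> \<gamma> l' * cnj (code_amp \<omega> \<alpha> \<beta> \<gamma> l))"
    by (rule trans[OF trans[OF sum.cong[OF refl sum.swap] sum.swap]]) (simp only: mult.commute)
  also have "\<dots> = (\<Sum>\<gamma>\<in>types d (2 * t + 3). if l = l' then 2 * of_nat ((2 * t + 3) choose (t + 1)) else 0)"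
  proof (rule sum.cong[OF refl])
    fix \<gamma> assume \<gamma>: "\<gamma> \<in> types d (2 * t + 3)"
    show "(\<Sum>\<alpha>\<in>types d (t + 2). \<Sum>\<beta>\<in>types d (t + 2). code_amp \<omega> \<alpha> \<beta> \<gamma> l' * cnj (code_amp \<omega> \<alpha> \<beta> \<gamma> l))
      = (if l = l' then 2 * of_nat ((2 * t + 3) choose (t + 1)) else 0)"
      unfolding gram_3[OF assms(2,1) \<gamma> \<gamma>] by auto
  qed
  finally show ?thesis unfolding total_def num_types_def by (auto simp: mult.commute)
qed

text \<open>Evaluate the squared norm of the code vector 0 through \<open>gram_1\<close> and drop
  the nonnegative coupling. This relates the normalization to the dimension of A_1 without any
  identity between binomial coefficients.\<close>

lemma gram_diag_le_total:
  assumes d: "0 < d"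
  shows "gram_diag d * num_types d (t + 2) \<le> total d"
proof -
  let ?T = "types d (t + 2)" and ?K = "types d (2 * t + 3)"
  have "(\<Sum>\<alpha>\<in>?T. \<Sum>\<beta>\<in>?T. \<Sum>\<gamma>\<in>?K. code_amp \<omega> \<alpha> \<beta> \<gamma> 0 * cnj (code_amp \<omega> \<alpha> \<beta> \<gamma> 0)) = of_real (total d)"
    using code_amp_total[of 0 d 0] d by (simp add: mult.commute)
  moreover have "(\<Sum>\<beta>\<in>?T. \<Sum>\<gamma>\<in>?K. code_amp \<omega> \<alpha> \<beta> \<gamma> 0 * cnj (code_amp \<omega> \<alpha> \<beta> \<gamma> 0)) = of_real (gram_diag d + gram_link d * linked \<alpha> 0 \<alpha> 0)"
    if "\<alpha> \<in> ?T" for \<alpha> using gram_1[of 0 d 0 \<alpha> \<alpha>] d that by simp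
  ultimately have "complex_of_real (\<Sum>\<alpha>\<in>?T. gram_diag d + gram_link d * linked \<alpha> 0 \<alpha> 0) = of_real (total d)" by simp
  hence "total d = (\<Sum>\<alpha>\<in>?T. gram_diag d + gram_link d * linked \<alpha> 0 \<alpha> 0)" unfolding of_real_eq_iff ..
  also have "\<dots> \<ge> (\<Sum>\<alpha>\<in>?T. gram_diag d)"
    using gram_link_nonneg[of d] by (intro sum_mono) (simp add: linked_def)
  finally show ?thesis unfolding num_types_def by (simp add: mult.commute)
qed

end

section \<open>Error and dimension of the code\<close>

lemma sum_lessThan_3: "(\<Sum>i<3. f i) = f 0 + f 1 + f (2 :: nat)"
  by (simp add: eval_nat_numeral)

context type_code
begin

lemma error_bounds:
  assumes iso: "isometry_mat dim3 dL V" and q: "\<forall>i<3. 0 \<le> q i" "q 0 + q 1 + q 2 = 1"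
    and \<phi>: "\<forall>i<3. unit_vector (dims i) (\<phi> i)" and t: "\<And>i. i < 3 \<Longrightarrow> 0 < t i"
    and bounds: "\<And>x. (\<Sum>\<beta>\<in>T 1. \<Sum>\<gamma>\<in>T 2. (cmod (\<Sum>\<alpha>\<in>T 0. \<Sum>l<dL. v \<alpha> \<beta> \<gamma> l * x \<alpha> l))\<^sup>2) \<le> t 0 * (\<Sum>\<alpha>\<in>T 0. \<Sum>l<dL. (cmod (x \<alpha> l))\<^sup>2)"
      "\<And>x. (\<Sum>\<alpha>\<in>T 0. \<Sum>\<gamma>\<in>T 2. (cmod (\<Sum>\<beta>\<in>T 1. \<Sum>l<dL. v \<alpha> \<beta> \<gamma> l * x \<beta> l))\<^sup>2) \<le> t 1 * (\<Sum>\<beta>\<in>T 1. \<Sum>l<dL. (cmod (x \<beta> l))\<^sup>2)"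
      "\<And>x. (\<Sum>\<alpha>\<in>T 0. \<Sum>\<beta>\<in>T 1. (cmod (\<Sum>\<gamma>\<in>T 2. \<Sum>l<dL. v \<alpha> \<beta> \<gamma> l * x \<gamma> l))\<^sup>2) \<le> t 2 * (\<Sum>\<gamma>\<in>T 2. \<Sum>l<dL. (cmod (x \<gamma> l))\<^sup>2)"
    and \<alpha>: "\<alpha> \<in> T 0" "\<alpha>' \<in> T 0" and l: "l < dL" "l' < dL" "l \<noteq> l'"
  defines "err \<equiv> ent_error dL (3 * (dims 0 * dims 1 * dims 2)) (erasure_noise q dims \<phi> \<circ> (\<lambda>\<rho>. V * \<rho> * mat_adjoint V))"
  shows "err \<le> sqrt (1 - (\<Sum>i<3. q i / (t i * dims i)))"
    and "q 0 * cmod (\<Sum>\<beta>\<in>T 1. \<Sum>\<gamma>\<in>T 2. v \<alpha> \<beta> \<gamma> l * cnj (v \<alpha>' \<beta> \<gamma> l')) / (2 * dL) \<le> err"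
proof -
  interpret e: erasure_code dims dL q \<phi> V
    using dL_pos iso q \<phi> by unfold_locales auto
  obtain \<kappa> \<kappa>' where \<kappa>: "\<kappa> < dims 0" "ty 0 \<kappa> = \<alpha>" "\<kappa>' < dims 0" "ty 0 \<kappa>' = \<alpha>'"
    using \<alpha> type_at_surj unfolding dims_def by meson
  note bound = marginal_bound[OF bounds]
  have 0: "0 < (3 :: nat)" by simp
  note * = e.ent_error_bounds[OF t bound 0 \<kappa>(1,3) l]
  show "err \<le> sqrt (1 - (\<Sum>i<3. q i / (t i * dims i)))" unfolding err_def by (rule *(1))
  show "q 0 * cmod (\<Sum>\<beta>\<in>T 1. \<Sum>\<gamma>\<in>T 2. v \<alpha> \<beta> \<gamma> l * cnj (v \<alpha>' \<beta> \<gamma> l')) / (2 * dL) \<le> err"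
    using *(2) unfolding err_def marginal_entry[OF \<kappa>(1,3) l(1,2)] \<kappa> .
qed

text \<open>Collects what both cases of the theorem share. Each case then supplies the isometry, the
  intertwining relation over types and the estimates, the latter for each dimension separately in
  place of the maximum.\<close>

lemma code_exists:
  assumes dL: "3 \<le> dL" and iso: "isometry_mat dim3 dL V"
    and kernel: "\<And>U \<alpha>' \<beta>' \<gamma>' j. (\<And>i i'. i < dL \<Longrightarrow> i' < dL \<Longrightarrow> (\<Sum>k<dL. U i k * cnj (U i' k)) = (if i = i' then 1 else 0)) \<Longrightarrow>
      \<alpha>' \<in> T 0 \<Longrightarrow> \<beta>' \<in> T 1 \<Longrightarrow> \<gamma>' \<in> T 2 \<Longrightarrow> j < dL \<Longrightarrow>
      (\<Sum>l<dL. v \<alpha>' \<beta>' \<gamma>' l * U l j) = (\<Sum>\<alpha>\<in>T 0. \<Sum>\<beta>\<in>T 1. \<Sum>\<gamma>\<in>T 2.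
       symk U \<alpha>' \<alpha> * symk U \<beta>' \<beta> * cnj (symk U \<gamma>' \<gamma>) * v \<alpha> \<beta> \<gamma> j)"
    and err: "\<And>\<phi> err. (\<forall>i<3. unit_vector (dims i) (\<phi> i)) \<Longrightarrow>
      err = ent_error dL (3 * (dims 0 * dims 1 * dims 2)) (erasure_noise q dims \<phi> \<circ> (\<lambda>\<rho>. V * \<rho> * mat_adjoint V)) \<Longrightarrow>
      err \<le> \<epsilon> \<and> (\<forall>i<3. ln (dims i) \<le> c * ln (1 / err) + C)"
  shows "\<exists>(d :: nat \<Rightarrow> nat) (r :: nat \<Rightarrow> complex mat \<Rightarrow> complex mat) (V :: complex mat).
      (\<forall>i<3. irred_unitary_rep dL (d i) (r i)) \<and>
      isometry_mat (d 0 * d 1 * d 2) dL V \<and>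
      (\<forall>U \<in> unitary_group dL. V * U = kron (kron (r 0 U) (r 1 U)) (r 2 U) * V) \<and>
      (\<forall>\<phi> :: nat \<Rightarrow> complex vec. (\<forall>i<3. unit_vector (d i) (\<phi> i)) \<longrightarrow>
         (let \<epsilon>e = ent_error dL (3 * (d 0 * d 1 * d 2))
                       (erasure_noise q d \<phi> \<circ> (\<lambda>\<rho>. V * \<rho> * mat_adjoint V))
          in \<epsilon>e \<le> \<epsilon> \<and> (MAX i\<in>{0,1,2::nat}. ln (real (d i))) \<le> c * ln (1 / \<epsilon>e) + C))"
proof (intro exI conjI)
  let ?r = "\<lambda>i. if i = 2 then (\<lambda>U. sym_rep dL (ns 2) (map_mat cnj U)) else sym_rep dL (ns i)"
  show "\<forall>i<3. irred_unitary_rep dL (dims i) (?r i)"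
    unfolding dims_def using irred_sym_rep[OF dL] irred_conj_rep[OF irred_sym_rep[OF dL]] by auto
  show "isometry_mat (dims 0 * dims 1 * dims 2) dL V" using iso unfolding dim3_def .
  show "\<forall>U\<in>unitary_group dL. V * U = kron (kron (?r 0 U) (?r 1 U)) (?r 2 U) * V"
  proof
    fix U assume U: "U \<in> unitary_group dL"
    hence Uc: "U \<in> carrier_mat dL dL" and UU: "U * mat_adjoint U = 1\<^sub>m dL"
      unfolding unitary_group_def unitary_mat_def by auto
    have "(\<Sum>k<dL. U $$ (i,k) * cnj (U $$ (i',k))) = (if i = i' then 1 else 0)" if i: "i < dL" "i' < dL" for i i'
    proof -
      have "(U * mat_adjoint U) $$ (i,i') = (\<Sum>k<dL. U $$ (i,k) * cnj (U $$ (i',k)))"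
        using i Uc by (subst mat_mult_index[of _ dL dL _ dL]) auto
      thus ?thesis unfolding UU using i by simp
    qed
    from covariant[OF U kernel[OF this]]
    show "V * U = kron (kron (?r 0 U) (?r 1 U)) (?r 2 U) * V" by simp
  qed
  show "\<forall>\<phi>. (\<forall>i<3. unit_vector (dims i) (\<phi> i)) \<longrightarrow>
      (let \<epsilon>e = ent_error dL (3 * (dims 0 * dims 1 * dims 2)) (erasure_noise q dims \<phi> \<circ> (\<lambda>\<rho>. V * \<rho> * mat_adjoint V))
       in \<epsilon>e \<le> \<epsilon> \<and> (MAX i\<in>{0,1,2::nat}. ln (real (dims i))) \<le> c * ln (1 / \<epsilon>e) + C)"
  proof (intro allI impI)
    fix \<phi> :: "nat \<Rightarrow> complex vec" assume "\<forall>i<3. unit_vector (dims i) (\<phi> i)"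
    from err[OF this refl]
    show "let \<epsilon>e = ent_error dL (3 * (dims 0 * dims 1 * dims 2)) (erasure_noise q dims \<phi> \<circ> (\<lambda>\<rho>. V * \<rho> * mat_adjoint V))
       in \<epsilon>e \<le> \<epsilon> \<and> (MAX i\<in>{0,1,2::nat}. ln (real (dims i))) \<le> c * ln (1 / \<epsilon>e) + C"
      unfolding Let_def by (subst Max_le_iff) auto
  qed
qed

end

text \<open>The dimension is a binomial coefficient with lower index d - 1, hence at most the power
  d - 1 of d + n - 1. The bound d + n - 1 \<le> d (t + 2) covers both degrees t + 2 and 2t +
  3.\<close>

lemma ln_num_types_le:
  assumes d: "2 \<le> d" and n: "n \<le> 2 * t + 3"
  shows "ln (num_types d n) \<le> (real d - 1) * (ln d + ln (real t + 2))"
proof -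
  have "num_types d n = (d + n - 1) choose (d - 1)"
    using d binomial_symmetric[of n "d + n - 1"] by (simp add: card_types)
  also have "\<dots> \<le> (d + n - 1) ^ (d - 1)" by (rule binomial_le_pow) simp
  also have "\<dots> \<le> (d * (t + 2)) ^ (d - 1)"
  proof (rule power_mono)
    have "2 * t \<le> d * t" using d by simp
    thus "d + n - 1 \<le> d * (t + 2)" using d n unfolding distrib_left by linarith
  qed simp
  finally have "real (num_types d n) \<le> real ((d * (t + 2)) ^ (d - 1))" by (simp only: of_nat_le_iff)
  also have "real ((d * (t + 2)) ^ (d - 1)) = (real d * (real t + 2)) ^ (d - 1)"
    by (simp only: of_nat_power of_nat_mult of_nat_add of_nat_numeral)
  finally have "ln (num_types d n) \<le> ln ((real d * (real t + 2)) ^ (d - 1))"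
    using num_types_pos[of d n] d by (subst ln_le_cancel_iff) auto
  also have "\<dots> = real (d - 1) * (ln d + ln (real t + 2))"
    using d by (simp add: ln_realpow ln_mult)
  finally show ?thesis using d by (simp add: of_nat_diff)
qed

lemma phase_exists: "\<exists>\<omega>. phase t \<omega>"
proof
  let ?r = "(real t + 1) / (real t + 2)"
  have "?r\<^sup>2 \<le> 1" by (simp add: power_le_one)
  hence "cmod (Complex (- ?r) (sqrt (1 - ?r\<^sup>2))) = 1" by (simp add: cmod_def)
  thus "phase t (Complex (- ?r) (sqrt (1 - ?r\<^sup>2)))" by unfold_locales (simp_all add: minus_divide_left)
qed

section \<open>The normalized code and its error\<close>

context phase
begin

lemma code_amp_covariant:
  assumes U: "\<And>i i'. i < d \<Longrightarrow> i' < d \<Longrightarrow> (\<Sum>k<d. U i k * cnj (U i' k)) = (if i = i' then 1 else 0)"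
    and \<alpha>': "\<alpha>' \<in> types d (t + 2)" and \<beta>': "\<beta>' \<in> types d (t + 2)" and \<gamma>': "\<gamma>' \<in> types d (2 * t + 3)" and j: "j < d"
  shows "(\<Sum>l<d. code_amp \<omega> \<alpha>' \<beta>' \<gamma>' l * U l j) = (\<Sum>\<alpha>\<in>types d (t + 2). \<Sum>\<beta>\<in>types d (t + 2). \<Sum>\<gamma>\<in>types d (2 * t + 3).
     symk U \<alpha>' \<alpha> * symk U \<beta>' \<beta> * cnj (symk U \<gamma>' \<gamma>) * code_amp \<omega> \<alpha> \<beta> \<gamma> j)"
proof -
  let ?T = "types d (t + 2)" and ?K = "types d (2 * t + 3)"
  have idx: "Suc (t + 1) = t + 2" "t + 1 + (t + 2) = 2 * t + 3" by simp_all
  note cov = amp_covariant[where d = d and U = U and a = "t + 1" and b = "t + 2", unfolded idx, OF U]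
  have 1: "(\<Sum>l<d. of_real (amp \<alpha>' \<beta>' \<gamma>' l) * U l j) = (\<Sum>\<alpha>\<in>?T. \<Sum>\<beta>\<in>?T. \<Sum>\<gamma>\<in>?K.
     symk U \<alpha>' \<alpha> * symk U \<beta>' \<beta> * cnj (symk U \<gamma>' \<gamma>) * of_real (amp \<alpha> \<beta> \<gamma> j))"
    by (rule cov[OF _ _ \<alpha>' \<beta>' \<gamma>' j])
  have "(\<Sum>l<d. of_real (amp \<beta>' \<alpha>' \<gamma>' l) * U l j) = (\<Sum>\<beta>\<in>?T. \<Sum>\<alpha>\<in>?T. \<Sum>\<gamma>\<in>?K.
     symk U \<beta>' \<beta> * symk U \<alpha>' \<alpha> * cnj (symk U \<gamma>' \<gamma>) * of_real (amp \<beta> \<alpha> \<gamma> j))"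
    by (rule cov[OF _ _ \<beta>' \<alpha>' \<gamma>' j])
  also have "\<dots> = (\<Sum>\<alpha>\<in>?T. \<Sum>\<beta>\<in>?T. \<Sum>\<gamma>\<in>?K.
     symk U \<beta>' \<beta> * symk U \<alpha>' \<alpha> * cnj (symk U \<gamma>' \<gamma>) * of_real (amp \<beta> \<alpha> \<gamma> j))"
    by (rule sum.swap)
  finally have 2: "(\<Sum>l<d. of_real (amp \<beta>' \<alpha>' \<gamma>' l) * U l j) = (\<Sum>\<alpha>\<in>?T. \<Sum>\<beta>\<in>?T. \<Sum>\<gamma>\<in>?K.
     symk U \<beta>' \<beta> * symk U \<alpha>' \<alpha> * cnj (symk U \<gamma>' \<gamma>) * of_real (amp \<beta> \<alpha> \<gamma> j))" .
  have "(\<Sum>l<d. code_amp \<omega> \<alpha>' \<beta>' \<gamma>' l * U l j)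
    = (\<Sum>l<d. of_real (amp \<alpha>' \<beta>' \<gamma>' l) * U l j) + \<omega> * (\<Sum>l<d. of_real (amp \<beta>' \<alpha>' \<gamma>' l) * U l j)"
    unfolding sum_distrib_left sum.distrib[symmetric] by (rule sum.cong[OF refl]) (simp only: code_amp_def distrib_right mult.assoc)
  also have "\<dots> = (\<Sum>\<alpha>\<in>?T. \<Sum>\<beta>\<in>?T. \<Sum>\<gamma>\<in>?K.
     symk U \<alpha>' \<alpha> * symk U \<beta>' \<beta> * cnj (symk U \<gamma>' \<gamma>) * of_real (amp \<alpha> \<beta> \<gamma> j)
     + \<omega> * (symk U \<beta>' \<beta> * symk U \<alpha>' \<alpha> * cnj (symk U \<gamma>' \<gamma>) * of_real (amp \<beta> \<alpha> \<gamma> j)))"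
    unfolding 1 2 sum_distrib_left sum.distrib ..
  finally show ?thesis by (simp only: code_amp_def distrib_left mult_ac)
qed

text \<open>The degrees n, n and 2n - 1 for n = t + 2.\<close>

definition sizes :: "nat \<Rightarrow> nat" where
  "sizes i = (if i = 2 then 2 * t + 3 else t + 2)"

lemma sizes_simps: "sizes 0 = t + 2" "sizes 1 = t + 2" "sizes 2 = 2 * t + 3"
  unfolding sizes_def by simp_all

definition code_kernel :: "nat \<Rightarrow> nat multiset \<Rightarrow> nat multiset \<Rightarrow> nat multiset \<Rightarrow> nat \<Rightarrow> complex" where
  "code_kernel d \<alpha> \<beta> \<gamma> l = of_real (1 / sqrt (total d)) * code_amp \<omega> \<alpha> \<beta> \<gamma> l"

lemma inverse_sqrt_total_sqr: "0 < d \<Longrightarrow> (1 / sqrt (total d)) * (1 / sqrt (total d)) = 1 / total d"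
  using total_pos[of d] by simp

lemma norm_code_kernel_sum:
  assumes "0 < d"
  shows "(cmod (\<Sum>\<alpha>\<in>X. \<Sum>l<d. of_real (1 / sqrt (total d)) * g \<alpha> l * x \<alpha> l))\<^sup>2 = (1 / total d) * (cmod (\<Sum>\<alpha>\<in>X. \<Sum>l<d. g \<alpha> l * x \<alpha> l))\<^sup>2"
  unfolding mult.assoc sum_distrib_left[symmetric] norm_mult norm_of_real power_mult_distrib power2_abs
  by (simp only: power2_eq_square inverse_sqrt_total_sqr[OF assms])

lemma code_kernel_isometry:
  assumes "l < d" "l' < d"
  shows "(\<Sum>\<alpha>\<in>types d (t + 2). \<Sum>\<beta>\<in>types d (t + 2). \<Sum>\<gamma>\<in>types d (2 * t + 3). cnj (code_kernel d \<alpha> \<beta> \<gamma> l) * code_kernel d \<alpha> \<beta> \<gamma> l')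
    = (if l = l' then 1 else 0)"
proof -
  have d: "0 < d" using assms by simp
  have "cnj (code_kernel d \<alpha> \<beta> \<gamma> l) * code_kernel d \<alpha> \<beta> \<gamma> l'
    = of_real (1 / sqrt (total d) * (1 / sqrt (total d))) * (cnj (code_amp \<omega> \<alpha> \<beta> \<gamma> l) * code_amp \<omega> \<alpha> \<beta> \<gamma> l')" for \<alpha> \<beta> \<gamma>
    unfolding code_kernel_def complex_cnj_mult complex_cnj_complex_of_real of_real_mult by (simp only: mult_ac)
  note product = this[unfolded inverse_sqrt_total_sqr[OF d]]
  show ?thesis
    unfolding product sum_distrib_left[symmetric] code_amp_total[OF assms]
    using total_pos[OF d] by simp
qed

lemma code_error:
  assumes d: "2 \<le> d" and q: "\<forall>i<3. 0 \<le> q i" "q 0 + q 1 + q 2 = 1" and q0: "0 < q 0"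
    and \<phi>: "\<forall>i<3. unit_vector (type_code.dims d sizes i) (\<phi> i)"
  defines "err \<equiv> ent_error d (3 * (type_code.dims d sizes 0 * type_code.dims d sizes 1 * type_code.dims d sizes 2))
     (erasure_noise q (type_code.dims d sizes) \<phi> \<circ> (\<lambda>\<rho>. type_code.V d sizes (code_kernel d) * \<rho> * mat_adjoint (type_code.V d sizes (code_kernel d))))"
  shows "0 < err" and "err \<le> sqrt (real d * (real d + 1) / (real t + 2))"
proof -
  have d0: "0 < d" using d by simp
  interpret c: type_code d sizes "code_kernel d" using d by unfold_locales simp
  note [simp] = total_pos[OF d0] less_imp_le[OF total_pos[OF d0]]
  define \<delta> where "\<delta> = real d * (real d + 1) / (real t + 2)"
  have \<delta>: "0 \<le> \<delta>" unfolding \<delta>_def by simp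
  define g where "g = gram_diag d + gram_link d * (real t + 1 + real d)"
  define b where "b = real (2 * ((2 * t + 3) choose (t + 1)))"
  \<comment> \<open>The norm bounds of the three marginals after normalization of the code
    vectors.\<close>
  define s where "s i = (if i = 2 then b else g) / total d" for i :: nat
  have diag: "0 < gram_diag d" using gram_diag_ge[of d] binom_mid_pos[of d] by linarith
  have g: "0 < g" unfolding g_def using diag gram_link_nonneg[of d] by (simp add: add_pos_nonneg)
  have b: "0 < b" unfolding b_def by (simp add: zero_less_binomial_iff)
  have "isometry_mat c.dim3 d c.V"
    by (rule c.isometry) (simp only: sizes_simps code_kernel_isometry)
  note iso = this
  have s_pos: "0 < s i" for i unfolding s_def using g b by simp
  have b0: "(\<Sum>\<beta>\<in>types d (sizes 1). \<Sum>\<gamma>\<in>types d (sizes 2). (cmod (\<Sum>\<alpha>\<in>types d (sizes 0). \<Sum>l<d. code_kernel d \<alpha> \<beta> \<gamma> l * x \<alpha> l))\<^sup>2)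
      \<le> s 0 * (\<Sum>\<alpha>\<in>types d (sizes 0). \<Sum>l<d. (cmod (x \<alpha> l))\<^sup>2)" for x
  proof -
    have "1 / total d * (\<Sum>\<beta>\<in>types d (t + 2). \<Sum>\<gamma>\<in>types d (2 * t + 3). (cmod (\<Sum>\<alpha>\<in>types d (t + 2). \<Sum>l<d. code_amp \<omega> \<alpha> \<beta> \<gamma> l * x \<alpha> l))\<^sup>2)
      \<le> 1 / total d * (g * (\<Sum>\<alpha>\<in>types d (t + 2). \<Sum>l<d. (cmod (x \<alpha> l))\<^sup>2))"
      unfolding g_def by (intro mult_left_mono marginal_1[OF d0]) simp
    thus ?thesis unfolding sizes_simps code_kernel_def norm_code_kernel_sum[OF d0] sum_distrib_left[symmetric] s_def by simp
  qed
  have b1: "(\<Sum>\<alpha>\<in>types d (sizes 0). \<Sum>\<gamma>\<in>types d (sizes 2). (cmod (\<Sum>\<beta>\<in>types d (sizes 1). \<Sum>l<d. code_kernel d \<alpha> \<beta> \<gamma> l * x \<beta> l))\<^sup>2)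
      \<le> s 1 * (\<Sum>\<beta>\<in>types d (sizes 1). \<Sum>l<d. (cmod (x \<beta> l))\<^sup>2)" for x
  proof -
    have "1 / total d * (\<Sum>\<alpha>\<in>types d (t + 2). \<Sum>\<gamma>\<in>types d (2 * t + 3). (cmod (\<Sum>\<beta>\<in>types d (t + 2). \<Sum>l<d. code_amp \<omega> \<alpha> \<beta> \<gamma> l * x \<beta> l))\<^sup>2)
      \<le> 1 / total d * (g * (\<Sum>\<alpha>\<in>types d (t + 2). \<Sum>l<d. (cmod (x \<alpha> l))\<^sup>2))"
      unfolding g_def by (intro mult_left_mono marginal_2[OF d0]) simp
    thus ?thesis unfolding sizes_simps code_kernel_def norm_code_kernel_sum[OF d0] sum_distrib_left[symmetric] s_def by simp
  qed
  have b2: "(\<Sum>\<alpha>\<in>types d (sizes 0). \<Sum>\<beta>\<in>types d (sizes 1). (cmod (\<Sum>\<gamma>\<in>types d (sizes 2). \<Sum>l<d. code_kernel d \<alpha> \<beta> \<gamma> l * x \<gamma> l))\<^sup>2)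
      \<le> s 2 * (\<Sum>\<gamma>\<in>types d (sizes 2). \<Sum>l<d. (cmod (x \<gamma> l))\<^sup>2)" for x
    unfolding sizes_simps code_kernel_def norm_code_kernel_sum[OF d0] sum_distrib_left[symmetric] marginal_3 s_def b_def by simp
  \<comment> \<open>Adding the letter 0 or 1 to one \<sigma> gives two linked types, and with the
    logical indices 0 and 1 a strictly positive off-diagonal entry. Any \<sigma> of size t + 1 would
    serve.\<close>
  define \<sigma> where "\<sigma> = replicate_mset (t + 1) (0 :: nat)"
  have \<sigma>: "\<sigma> \<in> types d (t + 1)" unfolding \<sigma>_def by (rule replicate_mset_in_types[OF d0])
  have \<alpha>: "add_mset 0 \<sigma> \<in> types d (t + 2)" "add_mset 1 \<sigma> \<in> types d (t + 2)" using \<sigma> d by simp_all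
  have \<alpha>s: "add_mset 0 \<sigma> \<in> types d (sizes 0)" "add_mset 1 \<sigma> \<in> types d (sizes 0)" unfolding sizes_simps by (fact \<alpha>)+
  have l: "0 < d" "1 < d" "(0 :: nat) \<noteq> 1" using d by simp_all
  note bounds = c.error_bounds[OF iso q \<phi> s_pos b0 b1 b2 \<alpha>s l, folded err_def]
  have "(\<Sum>\<beta>\<in>types d (sizes 1). \<Sum>\<gamma>\<in>types d (sizes 2). code_kernel d (add_mset 0 \<sigma>) \<beta> \<gamma> 0 * cnj (code_kernel d (add_mset 1 \<sigma>) \<beta> \<gamma> 1))
    = of_real (1 / total d) * (\<Sum>\<beta>\<in>types d (t + 2). \<Sum>\<gamma>\<in>types d (2 * t + 3). code_amp \<omega> (add_mset 0 \<sigma>) \<beta> \<gamma> 0 * cnj (code_amp \<omega> (add_mset 1 \<sigma>) \<beta> \<gamma> 1))"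
    unfolding inverse_sqrt_total_sqr[OF d0, symmetric] sizes_simps code_kernel_def sum_distrib_left
      complex_cnj_mult complex_cnj_complex_of_real of_real_mult by (simp only: mult_ac)
  also have "\<dots> = of_real (1 / total d * (gram_link d * linked (add_mset 0 \<sigma>) 0 (add_mset 1 \<sigma>) 1))"
    using gram_1[OF l(1,2) \<alpha>] by simp
  finally have entry: "(\<Sum>\<beta>\<in>types d (sizes 1). \<Sum>\<gamma>\<in>types d (sizes 2). code_kernel d (add_mset 0 \<sigma>) \<beta> \<gamma> 0 * cnj (code_kernel d (add_mset 1 \<sigma>) \<beta> \<gamma> 1))
    = of_real (1 / total d * (gram_link d * linked (add_mset 0 \<sigma>) 0 (add_mset 1 \<sigma>) 1))" .
  have "0 < linked (add_mset 0 \<sigma>) 0 (add_mset 1 \<sigma>) 1"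
    unfolding linked_def by (simp add: add_mset_commute add_pos_nonneg)
  hence "0 < 1 / total d * (gram_link d * linked (add_mset 0 \<sigma>) 0 (add_mset 1 \<sigma>) 1)"
    using gram_link_pos[OF d0] by simp
  moreover have "cmod (of_real x) = x" if "0 < x" for x using that by simp
  ultimately have "0 < q 0 * cmod (of_real (1 / total d * (gram_link d * linked (add_mset 0 \<sigma>) 0 (add_mset 1 \<sigma>) 1))) / (2 * real d)"
    using q0 d0 by (intro divide_pos_pos mult_pos_pos) (simp_all only: of_nat_0_less_iff zero_less_numeral)
  thus "0 < err" using bounds(2) unfolding entry by linarith
  \<comment> \<open>For A_3 the product is exactly 1. For the others the dimension is at most
    \<open>total d / gram_diag d\<close>, so the product is at most the ratio estimated in
    \<open>gram_ratio\<close>.\<close>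
  have le: "s i * c.dims i \<le> 1 + \<delta>" if "i < 3" for i
  proof (cases "i = 2")
    case True
    have "s 2 * c.dims 2 = 1"
      unfolding s_def c.dims_def sizes_simps b_def total_def
      using num_types_pos[OF d0, of "2 * t + 3"] binomial_eq_0_iff[of "2 * t + 3" "t + 1"] by simp
    thus ?thesis using True \<delta> by simp
  next
    case False
    hence "sizes i = t + 2" "s i = g / total d" unfolding sizes_def s_def by simp_all
    moreover have "gram_diag d * (s i * num_types d (t + 2)) \<le> g"
      unfolding \<open>s i = g / total d\<close> using mult_left_mono[OF gram_diag_le_total[OF d0], of g] g
      by (simp add: field_simps)
    hence "s i * num_types d (t + 2) \<le> g / gram_diag d" using diag by (simp add: field_simps)
    moreover have "g / gram_diag d \<le> 1 + \<delta>" unfolding g_def \<delta>_def by (rule gram_ratio)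
    ultimately show ?thesis unfolding c.dims_def by simp
  qed
  \<comment> \<open>All three slots obey the same bound and the q i sum to 1, so the error estimate
    does not depend on q.\<close>
  have "1 - \<delta> \<le> 1 / (1 + \<delta>)" using \<delta> by (simp add: field_simps)
  also have "\<dots> = (\<Sum>i<3. q i * (1 / (1 + \<delta>)))"
    unfolding sum_distrib_right[symmetric] sum_lessThan_3 q(2) by simp
  also have "\<dots> \<le> (\<Sum>i<3. q i * (1 / (s i * c.dims i)))"
  proof (intro sum_mono mult_left_mono)
    fix i :: nat assume "i \<in> {..<3}"
    hence i: "i < 3" by simp
    show "0 \<le> q i" using q i by blast
    have "0 < s i * c.dims i" using s_pos[of i] num_types_pos[OF d0] unfolding c.dims_def by simp
    thus "1 / (1 + \<delta>) \<le> 1 / (s i * c.dims i)" using le[OF i] by (intro divide_left_mono) auto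
  qed
  finally have "1 - (\<Sum>i<3. q i / (s i * c.dims i)) \<le> \<delta>" by simp
  hence "sqrt (1 - (\<Sum>i<3. q i / (s i * c.dims i))) \<le> sqrt \<delta>" by simp
  with bounds(1) show "err \<le> sqrt (real d * (real d + 1) / (real t + 2))" unfolding \<delta>_def by linarith
qed

end

section \<open>The code for \<open>q 0 = 0\<close>\<close>

lemma sum_types_1: "(\<Sum>\<alpha>\<in>types d (Suc 0). f \<alpha>) = (\<Sum>i<d. f {#i#})"
proof -
  have "types d (Suc 0) = (\<lambda>i. {#i#}) ` {..<d}"
    unfolding types_def by (auto dest!: size_1_singleton_mset[unfolded One_nat_def])
  thus ?thesis by (simp add: sum.reindex inj_on_def)
qed

definition single_sizes :: "nat \<Rightarrow> nat" where
  "single_sizes i = (if i = 0 then Suc 0 else 0)"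

lemma single_sizes_simps: "single_sizes 0 = Suc 0" "single_sizes 1 = 0" "single_sizes 2 = 0"
  unfolding single_sizes_def by simp_all

text \<open>In degrees 1, 0, 0 the first factor is L and the others are one-dimensional. Reusing
  \<open>amp\<close> makes covariance the instance a = b = 0 of
  \<open>amp_covariant\<close>.\<close>

definition single_kernel :: "nat multiset \<Rightarrow> nat multiset \<Rightarrow> nat multiset \<Rightarrow> nat \<Rightarrow> complex" where
  "single_kernel \<alpha> \<beta> \<gamma> l = of_real (amp \<alpha> \<beta> \<gamma> l)"

lemma single_kernel: "single_kernel {#i#} {#} {#} l = (if i = l then 1 else 0)"
  unfolding single_kernel_def amp_def by simp

lemma single_kernel_isometry:
  assumes "0 < d"
  shows "isometry_mat (three_digits.dim3 (type_code.dims d single_sizes)) d (type_code.V d single_sizes single_kernel)"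
proof -
  interpret type_code d single_sizes single_kernel using assms by unfold_locales
  show ?thesis
  proof (rule isometry)
    fix l l' assume "l < d" "l' < d"
    have "(\<Sum>i<d. cnj (if i = l then 1 else 0) * (if i = l' then 1 else 0)) = (\<Sum>i<d. if i = l then if l = l' then 1 else 0 else 0 :: complex)"
      by (intro sum.cong refl) auto
    thus "(\<Sum>\<alpha>\<in>types d (single_sizes 0). \<Sum>\<beta>\<in>types d (single_sizes 1). \<Sum>\<gamma>\<in>types d (single_sizes 2).
      cnj (single_kernel \<alpha> \<beta> \<gamma> l) * single_kernel \<alpha> \<beta> \<gamma> l') = (if l = l' then 1 else 0)"
      unfolding single_sizes_simps sum_types_1 using \<open>l < d\<close> by (simp add: single_kernel)
  qed
qed

lemma single_error:
  assumes d: "2 \<le> d" and q: "\<forall>i<3. 0 \<le> q i" "q 0 + q 1 + q 2 = 1" and q0: "q 0 = 0"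
    and \<phi>: "\<forall>i<3. unit_vector (type_code.dims d single_sizes i) (\<phi> i)"
  shows "ent_error d (3 * (type_code.dims d single_sizes 0 * type_code.dims d single_sizes 1 * type_code.dims d single_sizes 2))
     (erasure_noise q (type_code.dims d single_sizes) \<phi> \<circ> (\<lambda>\<rho>. type_code.V d single_sizes single_kernel * \<rho> * mat_adjoint (type_code.V d single_sizes single_kernel))) = 0"
    (is "?err = 0")
proof -
  have d0: "0 < d" using d by simp
  interpret c: type_code d single_sizes single_kernel using d by unfold_locales simp
  \<comment> \<open>Slot 0 only needs some finite bound, here from Cauchy-Schwarz, since its term
    has the weight q 0 = 0. In the other slots s times the dimension is 1, so the lower bound for
    the squared fidelity is 1.\<close>
  define s where "s i = (if i = 0 then real d else 1)" for i :: nat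
  have s_pos: "0 < s i" for i unfolding s_def using d by simp
  have delta: "(\<Sum>l<d. (if i = l then 1 else 0) * y l) = y i" if "i < d" for i and y :: "nat \<Rightarrow> complex"
    using that by (simp add: if_distrib[of "\<lambda>x. x * _"] cong: if_cong)
  have b0: "(\<Sum>\<beta>\<in>types d (single_sizes 1). \<Sum>\<gamma>\<in>types d (single_sizes 2). (cmod (\<Sum>\<alpha>\<in>types d (single_sizes 0). \<Sum>l<d. single_kernel \<alpha> \<beta> \<gamma> l * x \<alpha> l))\<^sup>2)
      \<le> s 0 * (\<Sum>\<alpha>\<in>types d (single_sizes 0). \<Sum>l<d. (cmod (x \<alpha> l))\<^sup>2)" for x
  proof -
    have "(cmod (\<Sum>i<d. x {#i#} i))\<^sup>2 \<le> (\<Sum>i<d. 1 * cmod (x {#i#} i))\<^sup>2"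
      by (intro power_mono) (simp_all add: norm_sum)
    also have "\<dots> \<le> (\<Sum>i<d. 1\<^sup>2) * (\<Sum>i<d. (cmod (x {#i#} i))\<^sup>2)" by (rule Cauchy_Schwarz_ineq_sum)
    also have "\<dots> = real d * (\<Sum>i<d. (cmod (x {#i#} i))\<^sup>2)" by simp
    also have "\<dots> \<le> real d * (\<Sum>i<d. \<Sum>l<d. (cmod (x {#i#} l))\<^sup>2)"
      by (intro mult_left_mono sum_mono member_le_sum[of _ _ "\<lambda>l. (cmod (x _ l))\<^sup>2"]) auto
    finally show ?thesis unfolding single_sizes_simps sum_types_1 s_def by (simp add: single_kernel delta cong: sum.cong_simp)
  qed
  have b1: "(\<Sum>\<alpha>\<in>types d (single_sizes 0). \<Sum>\<gamma>\<in>types d (single_sizes 2). (cmod (\<Sum>\<beta>\<in>types d (single_sizes 1). \<Sum>l<d. single_kernel \<alpha> \<beta> \<gamma> l * x \<beta> l))\<^sup>2)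
      \<le> s 1 * (\<Sum>\<beta>\<in>types d (single_sizes 1). \<Sum>l<d. (cmod (x \<beta> l))\<^sup>2)" for x
    unfolding single_sizes_simps sum_types_1 s_def by (simp add: single_kernel delta cong: sum.cong_simp)
  have b2: "(\<Sum>\<alpha>\<in>types d (single_sizes 0). \<Sum>\<beta>\<in>types d (single_sizes 1). (cmod (\<Sum>\<gamma>\<in>types d (single_sizes 2). \<Sum>l<d. single_kernel \<alpha> \<beta> \<gamma> l * x \<gamma> l))\<^sup>2)
      \<le> s 2 * (\<Sum>\<gamma>\<in>types d (single_sizes 2). \<Sum>l<d. (cmod (x \<gamma> l))\<^sup>2)" for x
    unfolding single_sizes_simps sum_types_1 s_def by (simp add: single_kernel delta cong: sum.cong_simp)
  have \<alpha>: "{#0#} \<in> types d (single_sizes 0)" unfolding single_sizes_simps using d0 by simp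
  have l: "0 < d" "1 < d" "(0 :: nat) \<noteq> 1" using d by simp_all
  note bounds = c.error_bounds[OF single_kernel_isometry[OF d0] q \<phi> s_pos b0 b1 b2 \<alpha> \<alpha> l]
  have "c.dims 1 = 1" "c.dims 2 = 1"
    unfolding c.dims_def single_sizes_simps num_types_def by simp_all
  hence "(\<Sum>i<3. q i / (s i * c.dims i)) = 1" using q(2) unfolding sum_lessThan_3 s_def q0 by simp
  with bounds(1) have "?err \<le> 0" by simp
  moreover have "0 \<le> ?err" using bounds(2) unfolding q0 by simp
  ultimately show ?thesis by simp
qed

text \<open>The code depends on q only through the distinction whether \<open>q 0 = 0\<close>, and
  on \<epsilon> only through t; the same code serves every choice of \<open>\<phi>\<close>. Both
  cases meet the bound with one constant built from dL.\<close>

theorem theorem5: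
  fixes dL :: nat
  assumes "4 \<le> dL"
  shows "\<exists>C2 :: real. \<forall>q :: nat \<Rightarrow> real.
           (\<forall>i<3. 0 \<le> q i) \<longrightarrow> q 0 + q 1 + q 2 = 1 \<longrightarrow>
           (\<forall>\<epsilon> :: real. \<epsilon> > 0 \<longrightarrow>
             (\<exists>(d :: nat \<Rightarrow> nat) (r :: nat \<Rightarrow> complex mat \<Rightarrow> complex mat) (V :: complex mat).
                (\<forall>i<3. irred_unitary_rep dL (d i) (r i)) \<and>
                isometry_mat (d 0 * d 1 * d 2) dL V \<and>
                (\<forall>U \<in> unitary_group dL. V * U = kron (kron (r 0 U) (r 1 U)) (r 2 U) * V) \<and>
                (\<forall>\<phi> :: nat \<Rightarrow> complex vec. (\<forall>i<3. unit_vector (d i) (\<phi> i)) \<longrightarrow>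
                   (let \<epsilon>e = ent_error dL (3 * (d 0 * d 1 * d 2))
                                 (erasure_noise q d \<phi> \<circ> (\<lambda>\<rho>. V * \<rho> * mat_adjoint V))
                    in \<epsilon>e \<le> \<epsilon> \<and>
                       (MAX i\<in>{0,1,2::nat}. ln (real (d i)))
                         \<le> real (dL * (dL - 1)) * ln (1 / \<epsilon>e) + C2))))"
proof -
  have dL: "3 \<le> dL" "2 \<le> dL" "0 < dL" using assms by simp_all
  define K where "K = real dL * (real dL + 1)"
  \<comment> \<open>From err^2 \<le> K / (t + 2) follows ln (t + 2) \<le> ln K + 2 ln (1 / err).
    Inserted into \<open>ln_num_types_le\<close>, this leaves C as the part without err.\<close>
  define C where "C = (real dL - 1) * (ln dL + ln K)"
  have K: "real dL \<le> K" "1 \<le> K" unfolding K_def using dL by (auto intro: mult_ge1_I simp: mult_le_cancel_left1)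
  have lnd: "0 \<le> ln dL" "0 \<le> ln K" using dL K by simp_all
  show ?thesis
  proof (intro exI[of _ C] allI impI)
    fix q :: "nat \<Rightarrow> real" and \<epsilon> :: real
    assume q: "\<forall>i<3. 0 \<le> q i" "q 0 + q 1 + q 2 = 1" and \<epsilon>: "0 < \<epsilon>"
    show "\<exists>(d :: nat \<Rightarrow> nat) (r :: nat \<Rightarrow> complex mat \<Rightarrow> complex mat) (V :: complex mat).
                (\<forall>i<3. irred_unitary_rep dL (d i) (r i)) \<and>
                isometry_mat (d 0 * d 1 * d 2) dL V \<and>
                (\<forall>U \<in> unitary_group dL. V * U = kron (kron (r 0 U) (r 1 U)) (r 2 U) * V) \<and>
                (\<forall>\<phi> :: nat \<Rightarrow> complex vec. (\<forall>i<3. unit_vector (d i) (\<phi> i)) \<longrightarrow>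
                   (let \<epsilon>e = ent_error dL (3 * (d 0 * d 1 * d 2))
                                 (erasure_noise q d \<phi> \<circ> (\<lambda>\<rho>. V * \<rho> * mat_adjoint V))
                    in \<epsilon>e \<le> \<epsilon> \<and>
                       (MAX i\<in>{0,1,2::nat}. ln (real (d i)))
                         \<le> real (dL * (dL - 1)) * ln (1 / \<epsilon>e) + C))"
    proof (cases "q 0 = 0")
      case True
      interpret type_code dL single_sizes single_kernel using dL by unfold_locales simp
      have dims: "ln (dims i) \<le> C" for i
      proof (cases "i = 0")
        case True
        have "ln dL * 1 \<le> (ln dL + ln K) * (real dL - 1)" using dL lnd by (intro mult_mono) auto
        moreover have "dims i = dL" unfolding dims_def single_sizes_def card_types[OF dL(3)] using True by simp
        ultimately show ?thesis unfolding C_def by (simp add: mult.commute)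
      next
        case False
        hence "dims i = 1" unfolding dims_def single_sizes_def num_types_def by simp
        thus ?thesis unfolding C_def using dL lnd by simp
      qed
      show ?thesis
      proof (rule code_exists[OF dL(1) single_kernel_isometry[OF dL(3)]])
        fix U \<alpha>' \<beta>' \<gamma>' j
        assume U: "\<And>i i'. i < dL \<Longrightarrow> i' < dL \<Longrightarrow> (\<Sum>k<dL. U i k * cnj (U i' k)) = (if i = i' then 1 else 0)"
          and "\<alpha>' \<in> T 0" "\<beta>' \<in> T 1" "\<gamma>' \<in> T 2" "j < dL"
        thus "(\<Sum>l<dL. single_kernel \<alpha>' \<beta>' \<gamma>' l * U l j) = (\<Sum>\<alpha>\<in>T 0. \<Sum>\<beta>\<in>T 1. \<Sum>\<gamma>\<in>T 2.
          symk U \<alpha>' \<alpha> * symk U \<beta>' \<beta> * cnj (symk U \<gamma>' \<gamma>) * single_kernel \<alpha> \<beta> \<gamma> j)"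
          using amp_covariant[where a = 0 and b = 0, OF U] unfolding single_sizes_simps single_kernel_def add_0 by blast
      next
        fix \<phi> err assume \<phi>: "\<forall>i<3. unit_vector (dims i) (\<phi> i)"
          and "err = ent_error dL (3 * (dims 0 * dims 1 * dims 2)) (erasure_noise q dims \<phi> \<circ> (\<lambda>\<rho>. V * \<rho> * mat_adjoint V))"
        hence "err = 0" using single_error[OF dL(2) q True \<phi>] by (simp only:)
        thus "err \<le> \<epsilon> \<and> (\<forall>i<3. ln (dims i) \<le> real (dL * (dL - 1)) * ln (1 / err) + C)"
          using \<epsilon> dims by simp
      qed
    next
      case False
      with q(1) have q0: "0 < q 0" by (simp add: order_less_le)
      \<comment> \<open>Capping at 1 makes ln (1 / err) nonnegative, as is required when its
        coefficient is enlarged below.\<close>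
      define \<eta> where "\<eta> = min \<epsilon> 1"
      have \<eta>: "0 < \<eta>" "\<eta> \<le> \<epsilon>" "\<eta> \<le> 1" unfolding \<eta>_def using \<epsilon> by simp_all
      \<comment> \<open>t depends on \<epsilon> and dL alone. The dimension bound is nevertheless in
        terms of err itself, since err^2 \<le> K / (t + 2) holds however far err falls below
        \<epsilon>.\<close>
      obtain t :: nat where t: "K / \<eta>\<^sup>2 \<le> real t" using real_arch_simple by blast
      obtain \<omega> where "phase t \<omega>" using phase_exists by blast
      then interpret phase t \<omega> .
      interpret type_code dL sizes "code_kernel dL" using dL by unfold_locales simp
      have "K / \<eta>\<^sup>2 \<le> real t + 2" using t by simp
      hence "K / (real t + 2) \<le> \<eta>\<^sup>2" using \<eta> by (simp add: field_simps)
      hence small: "sqrt (K / (real t + 2)) \<le> \<eta>" using \<eta> real_le_lsqrt by auto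
      show ?thesis
      proof (rule code_exists[OF dL(1)])
        show "isometry_mat dim3 dL V" by (rule isometry) (simp only: sizes_simps code_kernel_isometry)
      next
        fix U \<alpha>' \<beta>' \<gamma>' j
        assume U: "\<And>i i'. i < dL \<Longrightarrow> i' < dL \<Longrightarrow> (\<Sum>k<dL. U i k * cnj (U i' k)) = (if i = i' then 1 else 0)"
          and mem: "\<alpha>' \<in> T 0" "\<beta>' \<in> T 1" "\<gamma>' \<in> T 2" "j < dL"
        show "(\<Sum>l<dL. code_kernel dL \<alpha>' \<beta>' \<gamma>' l * U l j) = (\<Sum>\<alpha>\<in>T 0. \<Sum>\<beta>\<in>T 1. \<Sum>\<gamma>\<in>T 2.
          symk U \<alpha>' \<alpha> * symk U \<beta>' \<beta> * cnj (symk U \<gamma>' \<gamma>) * code_kernel dL \<alpha> \<beta> \<gamma> j)"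
          using code_amp_covariant[OF U mem[unfolded sizes_simps]]
          unfolding sizes_simps code_kernel_def mult.assoc mult.left_commute[of _ "of_real _"] sum_distrib_left[symmetric] by simp
      next
        fix \<phi> err assume \<phi>: "\<forall>i<3. unit_vector (dims i) (\<phi> i)"
          and err: "err = ent_error dL (3 * (dims 0 * dims 1 * dims 2)) (erasure_noise q dims \<phi> \<circ> (\<lambda>\<rho>. V * \<rho> * mat_adjoint V))"
        have pos: "0 < err" and le: "err \<le> sqrt (K / (real t + 2))"
          using code_error[OF dL(2) q q0 \<phi>] unfolding err K_def by simp_all
        have "err \<le> \<epsilon>" "err \<le> 1" using le small \<eta> by linarith+
        have ln_err: "ln (1 / err) = - ln err" using pos by (simp add: ln_div)
        have "err\<^sup>2 \<le> K / (real t + 2)" using power_mono[OF le, of 2] pos K by simp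
        hence "ln (err\<^sup>2) \<le> ln (K / (real t + 2))" using pos by (intro ln_mono) auto
        hence lnt: "ln (real t + 2) \<le> ln K + 2 * ln (1 / err)"
          unfolding ln_err using K pos by (simp add: ln_div ln_realpow)
        have "ln (dims i) \<le> real (dL * (dL - 1)) * ln (1 / err) + C" for i
        proof -
          have "ln (dims i) \<le> (real dL - 1) * (ln dL + ln (real t + 2))"
            unfolding dims_def by (rule ln_num_types_le[OF dL(2)]) (simp add: sizes_def)
          also have "\<dots> \<le> (real dL - 1) * (ln dL + (ln K + 2 * ln (1 / err)))"
            using lnt dL by (intro mult_left_mono add_left_mono) auto
          also have "\<dots> = 2 * ((real dL - 1) * ln (1 / err)) + C" unfolding C_def by (simp only: algebra_simps)
          \<comment> \<open>The dimension count gives the coefficient 2 (dL - 1): one factor from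
            the degree of the polynomial growth, the 2 from the square of the error. It is enlarged
            to dL (dL - 1) because ln (1 / err) \<ge> 0.\<close>
          also have "\<dots> \<le> dL * ((real dL - 1) * ln (1 / err)) + C"
            using dL pos \<open>err \<le> 1\<close> by (intro add_right_mono mult_right_mono mult_nonneg_nonneg) auto
          also have "\<dots> = real (dL * (dL - 1)) * ln (1 / err) + C" using dL by (simp add: of_nat_diff)
          finally show ?thesis .
        qed
        with \<open>err \<le> \<epsilon>\<close> show "err \<le> \<epsilon> \<and> (\<forall>i<3. ln (dims i) \<le> real (dL * (dL - 1)) * ln (1 / err) + C)" by blast
      qed
    qed
  qed
qed

end
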